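(* Let $(a_n)$ and $(b_n)$ be sequences of positive integers with $\limsup_n a_n=\limsup_n b_n=\infty$. Then the spaces $\big(\bigoplus_n H^1_{a_n}(\mathbb{T})\big)_{\mathrm{ind}}$ and $\big(\bigoplus_n \iota(H^1_{b_n}(\delta))\big)_{\mathrm{ind}}$ are isomorphic.
   Context: $\mathbb{T}=\mathbb{R}/2\pi\mathbb{Z}$ with normalized Lebesgue measure; $H^1_a(\mathbb{T})$ is the space of trigonometric polynomials $\sum_{j=0}^a c_je^{ijt}$ with the $L^1(\mathbb{T})$ norm. On $[0,1]$ with Lebesgue measure, $\mathcal{F}_n$ is the $\sigma$-algebra generated by dyadic intervals of length $2^{-n}$, $\mathbb{E}_n$ the conditional expectation onto it, $\Delta_0=\mathbb{E}_0$, $\Delta_n=\mathbb{E}_n-\mathbb{E}_{n-1}$ for $n\ge1$. The dyadic Hardy space $H^1(\delta)$ consists of integrable $f$ with $\|f\|_{H^1(\delta)}=\mathbb{E}(\sum_{n\ge0}|\Delta_nf|^2)^{1/2}<\infty$; $H^1_b(\delta)$ is its subspace of $\mathcal{F}_b$-measurable functions. $\iota:H^1(\delta)\to L^1([0,1],\ell^2)$, $\iota(f)=(\Delta_nf)_{n\ge0}$, is an isometric embedding, and $\iota(H^1_b(\delta))$ carries the $L^1(\ell^2)$ norm. For subspaces $X_n\subset L^1(\Omega,\mu,B)$ ($\mu$ a probability measure, $B$ a Banach space) the independent sum $(\bigoplus_nX_n)_{\mathrm{ind}}$ is the space of sequences $(f_n)$, $f_n\in X_n$, with finite norm $\|(f_n)\|_{\mathrm{ind}}=\int_{\Omega^\infty}(\sum_n\|f_n(\omega_n)\|_B^2)^{1/2}\,d(\mu\otimes\mu\otimes\cdots)$.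 *)

theory Defs
  imports "HOL-Probability.Probability"
begin

definition torus_measure :: "real measure" where
  "torus_measure = uniform_measure lborel {0..2*pi}"

definition unit_measure :: "real measure" where
  "unit_measure = uniform_measure lborel {0..1}"

definition trig_poly :: "nat \<Rightarrow> (real \<Rightarrow> complex) \<Rightarrow> bool" where
  "trig_poly a f \<longleftrightarrow>
     (\<exists>c :: nat \<Rightarrow> complex. f = (\<lambda>t. \<Sum>j\<le>a. c j * exp (\<i> * of_nat j * of_real t)))"

definition dyad_int :: "nat \<Rightarrow> nat \<Rightarrow> real set" where
  "dyad_int n k = {real k / 2^n ..< (real k + 1) / 2^n}"

text \<open>F_b-measurable functions on [0,1]: step functions on the dyadic intervals of length 2^-b.\<close>
definition dyadic_step :: "nat \<Rightarrow> (real \<Rightarrow> complex) \<Rightarrow> bool" where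
  "dyadic_step b f \<longleftrightarrow>
     (\<exists>v :: nat \<Rightarrow> complex. f = (\<lambda>x. \<Sum>k<2^b. v k * indicator (dyad_int b k) x))"

text \<open>Conditional expectation E_n onto the dyadic sigma-algebra F_n (average over the
  dyadic interval of length 2^-n containing x).\<close>
definition dyad_E :: "nat \<Rightarrow> (real \<Rightarrow> complex) \<Rightarrow> real \<Rightarrow> complex" where
  "dyad_E n f x = of_real (2^n) *
     (LINT y : dyad_int n (nat \<lfloor>2^n * x\<rfloor>) | lborel. f y)"

fun dyad_Delta :: "nat \<Rightarrow> (real \<Rightarrow> complex) \<Rightarrow> real \<Rightarrow> complex" where
  "dyad_Delta 0 f x = dyad_E 0 f x"
| "dyad_Delta (Suc n) f x = dyad_E (Suc n) f x - dyad_E n f x"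

definition iota :: "(real \<Rightarrow> complex) \<Rightarrow> real \<Rightarrow> (nat \<Rightarrow> complex)" where
  "iota f x = (\<lambda>n. dyad_Delta n f x)"

definition l2_sq :: "(nat \<Rightarrow> complex) \<Rightarrow> ennreal" where
  "l2_sq v = (\<Sum>k. ennreal ((cmod (v k))\<^sup>2))"

definition enn_sqrt :: "ennreal \<Rightarrow> ennreal" where
  "enn_sqrt x = (if x = \<infinity> then \<infinity> else ennreal (sqrt (enn2real x)))"

text \<open>Norm of the independent sum: integral over the infinite product
  of (sum_n ||f_n(omega_n)||^2)^(1/2); sqn gives the squared norm in B.\<close>
definition ind_norm :: "'a measure \<Rightarrow> ('b \<Rightarrow> ennreal) \<Rightarrow> (nat \<Rightarrow> 'a \<Rightarrow> 'b) \<Rightarrow> ennreal" where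
  "ind_norm M sqn F =
     (\<integral>\<^sup>+ \<omega>. enn_sqrt (\<Sum>n. sqn (F n (\<omega> n))) \<partial>(PiM UNIV (\<lambda>_. M)))"

definition ind_trig :: "(nat \<Rightarrow> nat) \<Rightarrow> (nat \<Rightarrow> real \<Rightarrow> complex) set" where
  "ind_trig a = {F. (\<forall>n. trig_poly (a n) (F n)) \<and>
                    ind_norm torus_measure (\<lambda>z. ennreal ((cmod z)\<^sup>2)) F < \<infinity>}"

definition norm_trig :: "(nat \<Rightarrow> real \<Rightarrow> complex) \<Rightarrow> ennreal" where
  "norm_trig F = ind_norm torus_measure (\<lambda>z. ennreal ((cmod z)\<^sup>2)) F"

definition ind_dyad :: "(nat \<Rightarrow> nat) \<Rightarrow> (nat \<Rightarrow> real \<Rightarrow> (nat \<Rightarrow> complex)) set" where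
  "ind_dyad b = {G. (\<forall>n. \<exists>f. dyadic_step (b n) f \<and> G n = iota f) \<and>
                    ind_norm unit_measure l2_sq G < \<infinity>}"

definition norm_dyad :: "(nat \<Rightarrow> real \<Rightarrow> (nat \<Rightarrow> complex)) \<Rightarrow> ennreal" where
  "norm_dyad G = ind_norm unit_measure l2_sq G"

definition ind_isomorphic ::
  "(nat \<Rightarrow> real \<Rightarrow> complex) set \<Rightarrow> ((nat \<Rightarrow> real \<Rightarrow> complex) \<Rightarrow> ennreal) \<Rightarrow>
   (nat \<Rightarrow> real \<Rightarrow> (nat \<Rightarrow> complex)) set \<Rightarrow> ((nat \<Rightarrow> real \<Rightarrow> (nat \<Rightarrow> complex)) \<Rightarrow> ennreal) \<Rightarrow> bool" where
  "ind_isomorphic V nV W nW \<longleftrightarrow>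
     (\<exists>T. bij_betw T V W \<and>
          (\<forall>F\<in>V. \<forall>G\<in>V. T (\<lambda>n t. F n t + G n t) = (\<lambda>n x k. T F n x k + T G n x k)) \<and>
          (\<forall>F\<in>V. \<forall>c::complex. T (\<lambda>n t. c * F n t) = (\<lambda>n x k. c * T F n x k)) \<and>
          (\<exists>C::real. C > 0 \<and> (\<forall>F\<in>V. nW (T F) \<le> ennreal C * nV F \<and> nV F \<le> ennreal C * nW (T F))))"

end

theory Submission
  imports Defs "HOL-Probability.Probability" "HOL-Library.Function_Algebras"
    "HOL-Computational_Algebra.Fundamental_Theorem_Algebra" "HOL-Complex_Analysis.Conformal_Mappings"
begin

text \<open>
  Put \<open>phi t = sqrt (1 + t\<^sup>2) - 1\<close>. By independence the norm of an independent sum is equivalent to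
  the Luxemburg norm of the modular \<open>\<Sum>n. \<integral> phi (norm (f n))\<close>, so the isomorphism may be assembled
  from linear maps between the finite-dimensional blocks that are bounded for the modulars with a
  constant independent of the block. If every block of one family factors uniformly through the
  blocks of the other family, infinitely often, Pelczynski's decomposition argument applies.

  Dyadic trees factor through trigonometric polynomials: a Riesz product of dilates of a function
  \<open>tau\<close> close to a sign function turns the dyadic cells into densities on the circle, and the tree
  coefficients are carried by a lacunary analytic polynomial. The lower square function estimate is a
  Bellman function argument resting on the subharmonicity of \<open>sqrt (1 + |f|\<^sup>2)\<close>.

  Trigonometric polynomials factor through dyadic trees: a random walk in the unit disc with small
  steps in the directions of roots of unity, stopped near the circle, carries an analytic polynomial
  \<open>f\<close> to a martingale close to \<open>f\<close> along the walk, and conditional expectation against the Poisson-like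
  de la Vallee Poussin kernel leads back. The kernel does not reach the top frequencies; they are
  handled by a second copy for the reflected polynomial.
\<close>

text \<open>L1 bounds on single blocks do not assemble: the independent norm depends on the
  distributions of the component norms, not only on their means. Hence every block estimate is
  proved for the modular of \<open>phi\<close>, which is convex but not homogeneous. Two mechanisms
  give such estimates: domination by a positive kernel with both marginals bounded, where Jensen's
  inequality applies, and Bellman functions built from \<open>sqrt (1 + s + |u|^2)\<close>. Signed
  kernels are therefore always accompanied by a positive majorant (\<open>kbar\<close>,
  \<open>hb\<close>). A product of \<open>b\<close> majorants would normally have mass exponential
  in \<open>b\<close>; this is why \<open>tau\<close> is chosen after \<open>b\<close>, so close to
  a sign that the mass stays below 2. In the other direction a sharp cut at degree \<open>k\<close>
  costs a factor of order \<open>log k\<close>, so the frequencies are split by a trapezoidal window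
  whose reflection under \<open>p -> k - p\<close> is its complement; each half then leaves room for
  a kernel of bounded mass to decay. The numbers 288 and 400 are collected from local constants;
  what matters is that they do not depend on the size of the block.\<close>

abbreviation tor :: "real measure" where "tor \<equiv> torus_measure"
abbreviation cplx :: "real \<Rightarrow> complex" where "cplx \<equiv> of_real"

section \<open>The convex function \<open>phi\<close> and square root inequalities\<close>

definition phi :: "real \<Rightarrow> real" where "phi t = sqrt (1 + t\<^sup>2) - 1"

lemma phi_0 [simp]: "phi 0 = 0" by (simp add: phi_def)

lemma phi_nonneg [simp]: "0 \<le> phi t" by (simp add: phi_def)

lemma phi_mono: "0 \<le> s \<Longrightarrow> s \<le> t \<Longrightarrow> phi s \<le> phi t"
  by (simp add: phi_def power_mono)

lemma phi_abs [simp]: "phi \<bar>t\<bar> = phi t" by (simp add: phi_def)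

text \<open>\<open>phi t\<close> is the nonnegative root \<open>w\<close> of
  \<open>w^2 + 2 w = t^2\<close>, so upper bounds for \<open>phi\<close> can be checked on this
  quadratic without handling roots.\<close>

lemma phi_sq: "(phi t)\<^sup>2 + 2 * phi t = t\<^sup>2"
proof -
  have "(phi t + 1)\<^sup>2 = 1 + t\<^sup>2" by (simp add: phi_def)
  then show ?thesis by (simp add: power2_eq_square algebra_simps)
qed

lemma phi_unique_le:
  assumes "0 \<le> w" "t\<^sup>2 \<le> w\<^sup>2 + 2 * w"
  shows "phi t \<le> w"
proof -
  have "1 + t\<^sup>2 \<le> (1 + w)\<^sup>2" using assms(2) by (simp add: power2_eq_square algebra_simps)
  then have "sqrt (1 + t\<^sup>2) \<le> 1 + w" using assms(1) by (intro real_le_lsqrt) auto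
  then show ?thesis by (simp add: phi_def)
qed

text \<open>Doubling condition: \<open>phi\<close> behaves like \<open>t^2 / 2\<close> near 0 and
  like \<open>t\<close> at infinity, so its growth under dilation is at most quadratic.\<close>

lemma phi_scale_le:
  assumes "1 \<le> r"
  shows "phi (r * t) \<le> r\<^sup>2 * phi t"
proof (rule phi_unique_le)
  have "1 \<le> r\<^sup>2" using assms by (simp add: one_le_power)
  then have "r\<^sup>2 * (phi t)\<^sup>2 * 1 \<le> r\<^sup>2 * (phi t)\<^sup>2 * r\<^sup>2"
    by (intro mult_left_mono) auto
  moreover have "(r * t)\<^sup>2 = r\<^sup>2 * (phi t)\<^sup>2 + 2 * (r\<^sup>2 * phi t)"
    using phi_sq[of t] by (simp add: power_mult_distrib algebra_simps flip: phi_sq[of t])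
  ultimately show "(r * t)\<^sup>2 \<le> (r\<^sup>2 * phi t)\<^sup>2 + 2 * (r\<^sup>2 * phi t)"
    by (simp add: power2_eq_square algebra_simps)
qed auto

lemma phi_shrink:
  assumes "0 \<le> r" "r \<le> 1"
  shows "phi (r * t) \<le> r * phi t"
proof (rule phi_unique_le)
  have l: "r\<^sup>2 \<le> r" using assms by (simp add: power2_eq_square mult_left_le_one_le)
  then have "r\<^sup>2 * (2 * phi t) \<le> r * (2 * phi t)" by (intro mult_right_mono) auto
  moreover have "(r * t)\<^sup>2 = r\<^sup>2 * (phi t)\<^sup>2 + r\<^sup>2 * (2 * phi t)"
    by (simp add: power_mult_distrib algebra_simps flip: phi_sq[of t])
  ultimately show "(r * t)\<^sup>2 \<le> (r * phi t)\<^sup>2 + 2 * (r * phi t)"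
    by (simp add: power_mult_distrib)
qed (use assms in auto)

text \<open>Convexity in supporting line form; it is the Cauchy-Schwarz inequality for the vectors
  \<open>(1, x)\<close> and \<open>(1, x0)\<close>.\<close>

lemma phi_tangent: "phi x \<ge> phi x0 + x0 / sqrt (1 + x0\<^sup>2) * (x - x0)"
proof -
  let ?r = "sqrt (1 + x0\<^sup>2)"
  have r: "?r > 0" "?r * ?r = 1 + x0\<^sup>2" by (auto simp: add_pos_nonneg simp flip: power2_eq_square)
  have "(1 + x * x0)\<^sup>2 \<le> (1 + x\<^sup>2) * (1 + x0\<^sup>2)"
    using zero_le_power2[of "x - x0"] by (simp add: power2_eq_square algebra_simps)
  then have "1 + x * x0 \<le> sqrt ((1 + x\<^sup>2) * (1 + x0\<^sup>2))" by (rule real_le_rsqrt)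
  then have "1 + x * x0 \<le> sqrt (1 + x\<^sup>2) * ?r" by (simp add: real_sqrt_mult)
  then have "(1 + x * x0) / ?r \<le> sqrt (1 + x\<^sup>2)" using r by (simp add: pos_divide_le_eq)
  moreover have "?r + x0 / ?r * (x - x0) = (1 + x * x0) / ?r"
    using r by (simp add: field_simps) (simp add: power2_eq_square algebra_simps)
  ultimately show ?thesis by (simp add: phi_def)
qed

text \<open>Convexity at the midpoint followed by doubling. The constant 2 here is the
  quasi-triangle constant of all modulars below.\<close>

lemma phi_add_le:
  assumes "0 \<le> s" "0 \<le> t"
  shows "phi (s + t) \<le> 2 * phi s + 2 * phi t"
proof -
  let ?m = "(s + t) / 2"
  have a: "phi s \<ge> phi ?m + ?m / sqrt (1 + ?m\<^sup>2) * (s - ?m)" by (rule phi_tangent)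
  have b: "phi t \<ge> phi ?m + ?m / sqrt (1 + ?m\<^sup>2) * (t - ?m)" by (rule phi_tangent)
  have "?m / sqrt (1 + ?m\<^sup>2) * (s - ?m) + ?m / sqrt (1 + ?m\<^sup>2) * (t - ?m) = ?m / sqrt (1 + ?m\<^sup>2) * 0"
    unfolding distrib_left[symmetric] by (rule arg_cong) (simp add: field_simps)
  then have "2 * phi ?m \<le> phi s + phi t" using a b by simp
  moreover have "phi (s + t) \<le> 2\<^sup>2 * phi ?m"
  proof -
    obtain m where "s + t = 2 * m" by (metis field_sum_of_halves mult_2)
    then show ?thesis using phi_scale_le[of 2 m] by simp
  qed
  ultimately show ?thesis by simp
qed

text \<open>Concavity of the square root, in the form that lets a large base point be traded for a
  smaller one.\<close>

lemma sqrt_diff_antimono: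
  assumes "0 \<le> a" "a \<le> b" "0 \<le> y"
  shows "sqrt (b + y) - sqrt b \<le> sqrt (a + y) - sqrt a"
proof (cases "y = 0")
  case False
  then have y: "y > 0" using assms by simp
  have e: "sqrt (c + y) - sqrt c = y / (sqrt (c + y) + sqrt c)" if "c \<ge> 0" for c
  proof -
    have p: "sqrt (c + y) + sqrt c > 0" using that y by (intro add_pos_nonneg) auto
    have "(sqrt (c + y) - sqrt c) * (sqrt (c + y) + sqrt c) = y"
      using that y by (simp add: algebra_simps flip: power2_eq_square)
    then show ?thesis using p by (simp add: field_simps)
  qed
  show ?thesis unfolding e[OF assms(1)] e[OF order_trans[OF assms(1,2)]]
    using assms y by (intro divide_left_mono add_mono mult_pos_pos add_pos_nonneg) auto
qed simp

text \<open>Enlarging the radicand from a base \<open>q >= 1\<close> by \<open>t^2\<close> gains at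
  most \<open>phi t\<close>, and by the companion bound at least \<open>phi t / sqrt q\<close>.
  These two facts tie the independent norm to the modular.\<close>

lemma phi_q_upper: "1 \<le> q \<Longrightarrow> sqrt (q + t\<^sup>2) \<le> sqrt q + phi t"
  using sqrt_diff_antimono[of 1 q "t\<^sup>2"] by (simp add: phi_def)

lemma phi_q_lower:
  assumes "1 \<le> q"
  shows "sqrt q + phi t / sqrt q \<le> sqrt (q + t\<^sup>2)"
proof (rule real_le_rsqrt)
  have q: "sqrt q > 0" using assms by simp
  have "(sqrt q + phi t / sqrt q)\<^sup>2 = q + 2 * phi t + (phi t)\<^sup>2 / q"
    using assms q by (simp add: power2_sum power_divide)
  also have "(phi t)\<^sup>2 / q \<le> (phi t)\<^sup>2" using assms mult_left_mono[of 1 q "(phi t)\<^sup>2"] by (simp add: divide_le_eq)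
  finally show "(sqrt q + phi t / sqrt q)\<^sup>2 \<le> q + t\<^sup>2" using phi_sq[of t] by linarith
qed

section \<open>Independent sums compared with the modular\<close>

lemma (in prob_space) prod_peel:
  assumes [measurable]: "f \<in> borel_measurable (PiM UNIV (\<lambda>_ :: nat. M))"
  shows "(\<integral>\<^sup>+ \<omega>. f \<omega> \<partial>PiM UNIV (\<lambda>_ :: nat. M)) = (\<integral>\<^sup>+ s. \<integral>\<^sup>+ \<omega>. f (case_nat s \<omega>) \<partial>PiM UNIV (\<lambda>_. M) \<partial>M)"
proof -
  interpret sequence_space M by unfold_locales
  have "(\<integral>\<^sup>+ \<omega>. f \<omega> \<partial>S) = (\<integral>\<^sup>+ \<omega>. f \<omega> \<partial>(distr (M \<Otimes>\<^sub>M S) S (\<lambda>(s, \<omega>). case_nat s \<omega>)))"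
    by (simp only: PiM_iter)
  also have "\<dots> = (\<integral>\<^sup>+ x. f ((\<lambda>(s, \<omega>). case_nat s \<omega>) x) \<partial>(M \<Otimes>\<^sub>M S))"
    by (rule nn_integral_distr) measurable
  also have "\<dots> = (\<integral>\<^sup>+ s. \<integral>\<^sup>+ \<omega>. f (case_nat s \<omega>) \<partial>S \<partial>M)"
    by (subst P.nn_integral_fst[symmetric]) (auto simp: split_beta')
  finally show ?thesis .
qed

text \<open>One coordinate is integrated out at a time. The base \<open>q\<close> has to be general
  because the square of the peeled coordinate moves into it.\<close>

lemma (in prob_space) ind_upper_finite:
  fixes h :: "nat \<Rightarrow> 'a \<Rightarrow> real"
  assumes "\<And>n. h n \<in> borel_measurable M" "1 \<le> q"
  shows "(\<integral>\<^sup>+ \<omega>. ennreal (sqrt (q + (\<Sum>n<N. (h n (\<omega> n))\<^sup>2))) \<partial>PiM UNIV (\<lambda>_. M))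
    \<le> ennreal (sqrt q) + (\<Sum>n<N. \<integral>\<^sup>+ x. ennreal (phi (h n x)) \<partial>M)"
  using assms
proof (induction N arbitrary: h q)
  case 0
  interpret P: prob_space "PiM UNIV (\<lambda>_ :: nat. M)" by (rule prob_space_PiM) unfold_locales
  show ?case using P.emeasure_space_1 by simp
next
  case (Suc N)
  interpret P: prob_space "PiM UNIV (\<lambda>_ :: nat. M)" by (rule prob_space_PiM) unfold_locales
  note [measurable] = Suc.prems(1)
  have phm: "(\<lambda>x. ennreal (phi (h n x))) \<in> borel_measurable M" for n unfolding phi_def by measurable
  have "(\<integral>\<^sup>+ \<omega>. ennreal (sqrt (q + (\<Sum>n<Suc N. (h n (\<omega> n))\<^sup>2))) \<partial>PiM UNIV (\<lambda>_. M))
     = (\<integral>\<^sup>+ s. \<integral>\<^sup>+ \<omega>. ennreal (sqrt (q + (h 0 s)\<^sup>2 + (\<Sum>n<N. (h (Suc n) (\<omega> n))\<^sup>2))) \<partial>PiM UNIV (\<lambda>_. M) \<partial>M)"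
    by (subst prod_peel) (simp_all add: sum.lessThan_Suc_shift add.assoc del: sum.lessThan_Suc)
  also have "\<dots> \<le> (\<integral>\<^sup>+ s. ennreal (sqrt (q + (h 0 s)\<^sup>2)) + (\<Sum>n<N. \<integral>\<^sup>+ x. ennreal (phi (h (Suc n) x)) \<partial>M) \<partial>M)"
    using Suc.prems by (intro nn_integral_mono Suc.IH) (auto intro: add_increasing2)
  also have "\<dots> \<le> (\<integral>\<^sup>+ s. (ennreal (sqrt q) + ennreal (phi (h 0 s))) + (\<Sum>n<N. \<integral>\<^sup>+ x. ennreal (phi (h (Suc n) x)) \<partial>M) \<partial>M)"
    using phi_q_upper[OF Suc.prems(2)] Suc.prems(2)
    by (intro nn_integral_mono add_right_mono) (simp add: ennreal_plus[symmetric] ennreal_leI del: ennreal_plus)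
  also have "\<dots> = ennreal (sqrt q) + (\<Sum>n<Suc N. \<integral>\<^sup>+ x. ennreal (phi (h n x)) \<partial>M)"
    using phm by (simp add: nn_integral_add emeasure_space_1 sum.lessThan_Suc_shift add.assoc del: sum.lessThan_Suc)
  finally show ?case .
qed

text \<open>The gain \<open>phi / sqrt q\<close> shrinks as the base grows, so the modular does not
  simply add up; \<open>sqrt (q + 2 * sum)\<close> is the shape of bound that is stable under
  peeling one coordinate.\<close>

lemma (in prob_space) ind_lower_finite:
  fixes h :: "nat \<Rightarrow> 'a \<Rightarrow> real"
  assumes "\<And>n. h n \<in> borel_measurable M" "\<And>n. (\<integral>\<^sup>+ x. ennreal (phi (h n x)) \<partial>M) = ennreal (a n)" "\<And>n. 0 \<le> a n" "1 \<le> q"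
  shows "ennreal (sqrt (q + 2 * (\<Sum>n<N. a n))) \<le> (\<integral>\<^sup>+ \<omega>. ennreal (sqrt (q + (\<Sum>n<N. (h n (\<omega> n))\<^sup>2))) \<partial>PiM UNIV (\<lambda>_. M))"
  using assms
proof (induction N arbitrary: h q a)
  case 0
  interpret P: prob_space "PiM UNIV (\<lambda>_ :: nat. M)" by (rule prob_space_PiM) unfold_locales
  show ?case using P.emeasure_space_1 by simp
next
  case (Suc N)
  note [measurable] = Suc.prems(1)
  have phm: "(\<lambda>x. ennreal (phi (h n x))) \<in> borel_measurable M" for n unfolding phi_def by measurable
  \<comment> \<open>The base after the later coordinates have been replaced by the gain that the
    induction hypothesis guarantees.\<close>
  define q' where "q' = q + 2 * (\<Sum>n<N. a (Suc n))"
  have q': "1 \<le> q'" unfolding q'_def using Suc.prems(3,4) by (intro add_increasing2) (auto intro: sum_nonneg)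
  have q'0: "sqrt q' > 0" using q' by simp
  have "ennreal (sqrt (q + 2 * (\<Sum>n<Suc N. a n))) = ennreal (sqrt (q' + 2 * a 0))"
    unfolding q'_def by (simp add: sum.lessThan_Suc_shift algebra_simps del: sum.lessThan_Suc)
  \<comment> \<open>Tangent bound for the concave square root at \<open>q'\<close>.\<close>
  also have "\<dots> \<le> ennreal (sqrt q' + a 0 / sqrt q')"
  proof (rule ennreal_leI, rule real_le_lsqrt)
    show "0 \<le> sqrt q' + a 0 / sqrt q'" using q' Suc.prems(3) by auto
    have "(sqrt q' + a 0 / sqrt q')\<^sup>2 = q' + 2 * a 0 + (a 0)\<^sup>2 / q'"
      using q' q'0 by (simp add: power2_sum power_divide)
    then show "q' + 2 * a 0 \<le> (sqrt q' + a 0 / sqrt q')\<^sup>2" using q' by simp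
  qed
  also have "\<dots> = ennreal (sqrt q') + ennreal (1 / sqrt q') * ennreal (a 0)"
    using q'0 Suc.prems(3)[of 0] by (simp flip: ennreal_mult ennreal_plus)
  also have "\<dots> = (\<integral>\<^sup>+ s. ennreal (sqrt q') + ennreal (1 / sqrt q') * ennreal (phi (h 0 s)) \<partial>M)"
    using phm by (simp add: nn_integral_add nn_integral_cmult emeasure_space_1 Suc.prems(2))
  also have "\<dots> \<le> (\<integral>\<^sup>+ s. ennreal (sqrt (q + (h 0 s)\<^sup>2 + 2 * (\<Sum>n<N. a (Suc n)))) \<partial>M)"
  proof (rule nn_integral_mono)
    fix s
    have "ennreal (sqrt q') + ennreal (1 / sqrt q') * ennreal (phi (h 0 s)) = ennreal (sqrt q' + phi (h 0 s) / sqrt q')"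
      using q'0 by (simp flip: ennreal_mult ennreal_plus)
    also have "\<dots> \<le> ennreal (sqrt (q' + (h 0 s)\<^sup>2))" by (intro ennreal_leI phi_q_lower q')
    finally show "ennreal (sqrt q') + ennreal (1 / sqrt q') * ennreal (phi (h 0 s)) \<le> ennreal (sqrt (q + (h 0 s)\<^sup>2 + 2 * (\<Sum>n<N. a (Suc n))))"
      by (simp add: q'_def algebra_simps)
  qed
  also have "\<dots> \<le> (\<integral>\<^sup>+ s. \<integral>\<^sup>+ \<omega>. ennreal (sqrt (q + (h 0 s)\<^sup>2 + (\<Sum>n<N. (h (Suc n) (\<omega> n))\<^sup>2))) \<partial>PiM UNIV (\<lambda>_. M) \<partial>M)"
    using Suc.prems by (intro nn_integral_mono Suc.IH) (auto intro: add_increasing2)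
  also have "\<dots> = (\<integral>\<^sup>+ \<omega>. ennreal (sqrt (q + (\<Sum>n<Suc N. (h n (\<omega> n))\<^sup>2))) \<partial>PiM UNIV (\<lambda>_. M))"
    by (subst prod_peel) (simp_all add: sum.lessThan_Suc_shift add.assoc del: sum.lessThan_Suc)
  finally show ?case .
qed

lemma enn_sqrt_measurable [measurable]: "enn_sqrt \<in> borel_measurable borel"
  unfolding enn_sqrt_def[abs_def] by measurable

lemma enn_sqrt_mult: "0 < c \<Longrightarrow> enn_sqrt (ennreal (c\<^sup>2) * x) = ennreal c * enn_sqrt x"
  by (cases x) (auto simp: enn_sqrt_def ennreal_mult_top real_sqrt_mult simp flip: ennreal_mult)

lemma enn_sqrt_le_iff: "0 \<le> s \<Longrightarrow> enn_sqrt x \<le> ennreal s \<longleftrightarrow> x \<le> ennreal (s\<^sup>2)"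
  by (cases x) (auto simp: enn_sqrt_def ennreal_le_iff real_sqrt_le_iff top_unique sqrt_le_D real_le_lsqrt)

lemma enn_sqrt_mono: "x \<le> y \<Longrightarrow> enn_sqrt x \<le> enn_sqrt y"
  by (cases x; cases y) (auto simp: enn_sqrt_def ennreal_le_iff top_unique)

text \<open>The independent norm of real profiles. Both families of the theorem are reduced to it by
  taking the pointwise norm of each component.\<close>

definition ind_int :: "'a measure \<Rightarrow> (nat \<Rightarrow> 'a \<Rightarrow> real) \<Rightarrow> ennreal" where
  "ind_int M h = (\<integral>\<^sup>+ \<omega>. enn_sqrt (\<Sum>n. ennreal ((h n (\<omega> n))\<^sup>2)) \<partial>PiM UNIV (\<lambda>_. M))"

definition ind_mod :: "'a measure \<Rightarrow> (nat \<Rightarrow> 'a \<Rightarrow> real) \<Rightarrow> ennreal" where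
  "ind_mod M h = (\<Sum>n. \<integral>\<^sup>+ x. ennreal (phi (h n x)) \<partial>M)"

context prob_space
begin

text \<open>Adding 1 under the root allows the finite estimate to start at \<open>q = 1\<close>;
  monotone convergence then removes the truncation.\<close>

lemma ind_int_le:
  fixes h :: "nat \<Rightarrow> 'a \<Rightarrow> real"
  assumes [measurable]: "\<And>n. h n \<in> borel_measurable M"
  shows "ind_int M h \<le> 1 + ind_mod M h"
proof -
  let ?Z = "\<lambda>N \<omega>. ennreal (sqrt (1 + (\<Sum>n<N. (h n (\<omega> n))\<^sup>2)))"
  have le: "enn_sqrt (\<Sum>n. ennreal ((h n (\<omega> n))\<^sup>2)) \<le> (SUP N. ?Z N \<omega>)" for \<omega>
  proof (cases "(SUP N. ?Z N \<omega>)")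
    case (real r)
    have "(\<Sum>n<N. ennreal ((h n (\<omega> n))\<^sup>2)) \<le> ennreal (r\<^sup>2)" for N
    proof -
      have "?Z N \<omega> \<le> ennreal r" unfolding real(2)[symmetric] by (rule SUP_upper) simp
      then have "sqrt (1 + (\<Sum>n<N. (h n (\<omega> n))\<^sup>2)) \<le> r" using real(1) by (simp add: ennreal_le_iff)
      then have "1 + (\<Sum>n<N. (h n (\<omega> n))\<^sup>2) \<le> r\<^sup>2" by (rule sqrt_le_D)
      then show ?thesis by (simp add: ennreal_leI)
    qed
    then have "(\<Sum>n. ennreal ((h n (\<omega> n))\<^sup>2)) \<le> ennreal (r\<^sup>2)" by (intro suminf_le_const) auto
    then show ?thesis using real by (simp add: enn_sqrt_le_iff)
  next
    case top
    show ?thesis unfolding top by simp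
  qed
  have "ind_int M h \<le> (\<integral>\<^sup>+ \<omega>. (SUP N. ?Z N \<omega>) \<partial>PiM UNIV (\<lambda>_. M))"
    unfolding ind_int_def by (rule nn_integral_mono) (rule le)
  also have "\<dots> = (SUP N. \<integral>\<^sup>+ \<omega>. ?Z N \<omega> \<partial>PiM UNIV (\<lambda>_. M))"
  proof (rule nn_integral_monotone_convergence_SUP)
    show "incseq (\<lambda>N \<omega>. ?Z N \<omega>)"
      by (auto simp: incseq_def le_fun_def intro!: ennreal_leI sum_mono2)
  qed measurable
  also have "\<dots> \<le> 1 + ind_mod M h"
  proof (rule SUP_least)
    fix N
    have "(\<integral>\<^sup>+ \<omega>. ?Z N \<omega> \<partial>PiM UNIV (\<lambda>_. M)) \<le> ennreal (sqrt 1) + (\<Sum>n<N. \<integral>\<^sup>+ x. ennreal (phi (h n x)) \<partial>M)"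
      by (rule ind_upper_finite) auto
    also have "\<dots> \<le> 1 + ind_mod M h"
      unfolding ind_mod_def by (intro add_mono sum_le_suminf) auto
    finally show "(\<integral>\<^sup>+ \<omega>. ?Z N \<omega> \<partial>PiM UNIV (\<lambda>_. M)) \<le> 1 + ind_mod M h" .
  qed
  finally show ?thesis .
qed

text \<open>For a partial sum \<open>S\<close> of the modular the lower estimate gives
  \<open>sqrt (1 + 2 S) <= 1 + 1\<close>, hence \<open>S <= 3 / 2\<close>. Finiteness of the single
  terms is what allows \<open>S\<close> to be treated as a real number.\<close>

lemma ind_mod_le:
  fixes h :: "nat \<Rightarrow> 'a \<Rightarrow> real"
  assumes [measurable]: "\<And>n. h n \<in> borel_measurable M"
    and fin: "\<And>n. (\<integral>\<^sup>+ x. ennreal (phi (h n x)) \<partial>M) < \<infinity>" and 1: "ind_int M h \<le> 1"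
  shows "ind_mod M h \<le> 2"
proof -
  interpret P: prob_space "PiM UNIV (\<lambda>_ :: nat. M)" by (rule prob_space_PiM) unfold_locales
  define a where "a n = enn2real (\<integral>\<^sup>+ x. ennreal (phi (h n x)) \<partial>M)" for n
  have a: "(\<integral>\<^sup>+ x. ennreal (phi (h n x)) \<partial>M) = ennreal (a n)" "0 \<le> a n" for n
    using fin[of n] by (auto simp: a_def)
  have "(\<Sum>n<N. a n) \<le> 2" for N
  proof -
    let ?Z = "\<lambda>\<omega>. \<Sum>n<N. (h n (\<omega> n))\<^sup>2"
    have "ennreal (sqrt (1 + 2 * (\<Sum>n<N. a n))) \<le> (\<integral>\<^sup>+ \<omega>. ennreal (sqrt (1 + ?Z \<omega>)) \<partial>PiM UNIV (\<lambda>_. M))"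
      by (rule ind_lower_finite) (auto simp: a)
    also have "\<dots> \<le> (\<integral>\<^sup>+ \<omega>. 1 + ennreal (sqrt (?Z \<omega>)) \<partial>PiM UNIV (\<lambda>_. M))"
    proof (rule nn_integral_mono)
      fix \<omega>
      have "sqrt (1 + ?Z \<omega>) \<le> sqrt 1 + sqrt (?Z \<omega>)" by (rule sqrt_add_le_add_sqrt) (auto intro: sum_nonneg)
      then have "ennreal (sqrt (1 + ?Z \<omega>)) \<le> ennreal (1 + sqrt (?Z \<omega>))" by (intro ennreal_leI) simp
      also have "\<dots> = 1 + ennreal (sqrt (?Z \<omega>))" by (subst ennreal_plus) (auto intro: sum_nonneg)
      finally show "ennreal (sqrt (1 + ?Z \<omega>)) \<le> 1 + ennreal (sqrt (?Z \<omega>))" .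
    qed
    also have "\<dots> = 1 + (\<integral>\<^sup>+ \<omega>. ennreal (sqrt (?Z \<omega>)) \<partial>PiM UNIV (\<lambda>_. M))"
      by (subst nn_integral_add) (auto simp: P.emeasure_space_1)
    also have "\<dots> \<le> 1 + ind_int M h"
      unfolding ind_int_def
    proof (intro add_left_mono nn_integral_mono)
      fix \<omega>
      have "ennreal (sqrt (?Z \<omega>)) = enn_sqrt (\<Sum>n<N. ennreal ((h n (\<omega> n))\<^sup>2))"
        by (auto simp: enn_sqrt_def sum_nonneg)
      also have "\<dots> \<le> enn_sqrt (\<Sum>n. ennreal ((h n (\<omega> n))\<^sup>2))"
        by (intro enn_sqrt_mono sum_le_suminf) auto
      finally show "ennreal (sqrt (?Z \<omega>)) \<le> enn_sqrt (\<Sum>n. ennreal ((h n (\<omega> n))\<^sup>2))" .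
    qed
    also have "\<dots> \<le> 1 + 1" using 1 by (intro add_left_mono)
    finally have "ennreal (sqrt (1 + 2 * (\<Sum>n<N. a n))) \<le> ennreal 2" by simp
    then have "sqrt (1 + 2 * (\<Sum>n<N. a n)) \<le> 2" by (subst (asm) ennreal_le_iff) auto
    then have "1 + 2 * (\<Sum>n<N. a n) \<le> 2\<^sup>2" by (rule sqrt_le_D)
    then show ?thesis by simp
  qed
  then have "(\<Sum>n<N. ennreal (a n)) \<le> ennreal 2" for N
    using a(2) by (subst sum_ennreal) (auto intro!: ennreal_leI simp del: ennreal_numeral)
  then show ?thesis unfolding ind_mod_def a(1) by (intro suminf_le_const) auto
qed

lemma ind_int_scale:
  fixes h :: "nat \<Rightarrow> 'a \<Rightarrow> real"
  assumes [measurable]: "\<And>n. h n \<in> borel_measurable M" and "0 < c"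
  shows "ind_int M (\<lambda>n x. c * h n x) = ennreal c * ind_int M h"
proof -
  have "(\<Sum>n. ennreal ((c * h n (\<omega> n))\<^sup>2)) = ennreal (c\<^sup>2) * (\<Sum>n. ennreal ((h n (\<omega> n))\<^sup>2))" for \<omega>
    by (simp add: power_mult_distrib ennreal_mult)
  then have "ind_int M (\<lambda>n x. c * h n x) = (\<integral>\<^sup>+ \<omega>. ennreal c * enn_sqrt (\<Sum>n. ennreal ((h n (\<omega> n))\<^sup>2)) \<partial>PiM UNIV (\<lambda>_. M))"
    unfolding ind_int_def using assms(2) by (simp add: enn_sqrt_mult)
  also have "\<dots> = ennreal c * ind_int M h"
    unfolding ind_int_def by (rule nn_integral_cmult) measurable
  finally show ?thesis .
qed

lemma ind_mod_scale_le:
  fixes h :: "nat \<Rightarrow> 'a \<Rightarrow> real"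
  assumes [measurable]: "\<And>n. h n \<in> borel_measurable M" and "1 \<le> c"
  shows "ind_mod M (\<lambda>n x. c * h n x) \<le> ennreal (c\<^sup>2) * ind_mod M h"
proof -
  have m: "(\<lambda>x. ennreal (phi (h n x))) \<in> borel_measurable M" for n unfolding phi_def by measurable
  have "ind_mod M (\<lambda>n x. c * h n x) \<le> (\<Sum>n. \<integral>\<^sup>+ x. ennreal (c\<^sup>2) * ennreal (phi (h n x)) \<partial>M)"
    unfolding ind_mod_def using assms(2)
    by (intro suminf_le nn_integral_mono) (auto simp: phi_scale_le ennreal_leI simp flip: ennreal_mult)
  also have "\<dots> = ennreal (c\<^sup>2) * ind_mod M h"
    unfolding ind_mod_def using m by (simp add: nn_integral_cmult)
  finally show ?thesis .
qed

lemma ind_mod_shrink_le: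
  fixes h :: "nat \<Rightarrow> 'a \<Rightarrow> real"
  assumes [measurable]: "\<And>n. h n \<in> borel_measurable M" and "0 \<le> c" "c \<le> 1"
  shows "ind_mod M (\<lambda>n x. c * h n x) \<le> ennreal c * ind_mod M h"
proof -
  have m: "(\<lambda>x. ennreal (phi (h n x))) \<in> borel_measurable M" for n unfolding phi_def by measurable
  have "ind_mod M (\<lambda>n x. c * h n x) \<le> (\<Sum>n. \<integral>\<^sup>+ x. ennreal c * ennreal (phi (h n x)) \<partial>M)"
    unfolding ind_mod_def using assms(2,3)
    by (intro suminf_le nn_integral_mono) (auto simp: phi_shrink ennreal_leI simp flip: ennreal_mult)
  also have "\<dots> = ennreal c * ind_mod M h"
    unfolding ind_mod_def using m by (simp add: nn_integral_cmult)
  finally show ?thesis .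
qed

text \<open>By doubling, a finite modular at some small scale is finite at scale 1, so the space is
  described by the modular without a scaling parameter.\<close>

lemma ind_int_finite_iff:
  fixes h :: "nat \<Rightarrow> 'a \<Rightarrow> real"
  assumes [measurable]: "\<And>n. h n \<in> borel_measurable M"
    and fin: "\<And>n c. (\<integral>\<^sup>+ x. ennreal (phi (c * h n x)) \<partial>M) < \<infinity>"
  shows "ind_int M h < \<infinity> \<longleftrightarrow> ind_mod M h < \<infinity>"
proof
  assume "ind_mod M h < \<infinity>"
  then have "1 + ind_mod M h < \<infinity>" by simp
  then show "ind_int M h < \<infinity>" using ind_int_le[OF assms(1)] by (rule le_less_trans[rotated])
next
  assume "ind_int M h < \<infinity>"
  then obtain x where x: "ind_int M h = ennreal x" "x \<ge> 0" by (cases "ind_int M h") auto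
  define r where "r = 1 / (x + 1)"
  have r: "0 < r" "1 \<le> 1 / r" "r * x \<le> 1" using x by (auto simp: r_def field_simps)
  have "ind_int M (\<lambda>n x. r * h n x) \<le> 1"
    using x r by (simp add: ind_int_scale flip: ennreal_mult)
  then have "ind_mod M (\<lambda>n x. r * h n x) \<le> 2" using fin by (intro ind_mod_le) auto
  moreover have "ind_mod M (\<lambda>n x. (1 / r) * (r * h n x)) \<le> ennreal ((1 / r)\<^sup>2) * ind_mod M (\<lambda>n x. r * h n x)"
    by (rule ind_mod_scale_le) (use r in auto)
  moreover have "(\<lambda>n x. (1 / r) * (r * h n x)) = h" using r by auto
  ultimately have "ind_mod M h \<le> ennreal ((1 / r)\<^sup>2) * ind_mod M (\<lambda>n x. r * h n x)"
    and "ind_mod M (\<lambda>n x. r * h n x) \<le> 2" by simp_all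
  then have "ind_mod M h \<le> ennreal ((1 / r)\<^sup>2) * 2" by (meson mult_left_mono order_trans zero_le)
  also have "\<dots> < \<infinity>" by (simp add: ennreal_mult_less_top)
  finally show "ind_mod M h < \<infinity>" .
qed

end

text \<open>Since the modular is not homogeneous, the comparison is required at every scale
  \<open>r\<close>. Normalising the norm of \<open>h\<close> to 1 makes its modular at most 2 and
  that of \<open>h'\<close> at most \<open>2 C\<close>; shrinking by \<open>1 / (2 C)\<close> brings
  the latter to 1 and the norm to at most 2. This gives the factor \<open>4 C\<close>.\<close>

lemma ind_int_transfer:
  fixes h :: "nat \<Rightarrow> 'a \<Rightarrow> real" and h' :: "nat \<Rightarrow> 'b \<Rightarrow> real"
  assumes "prob_space M" "prob_space M'" and h: "\<And>n. h n \<in> borel_measurable M" and h': "\<And>n. h' n \<in> borel_measurable M'"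
    and fin: "\<And>n c. (\<integral>\<^sup>+ x. ennreal (phi (c * h n x)) \<partial>M) < \<infinity>"
    and le: "\<And>r. 0 < r \<Longrightarrow> ind_mod M' (\<lambda>n x. r * h' n x) \<le> ennreal C * ind_mod M (\<lambda>n x. r * h n x)" and C: "C \<ge> 1"
  shows "ind_int M' h' \<le> ennreal (4 * C) * ind_int M h"
proof -
  interpret M: prob_space M by fact
  interpret M': prob_space M' by fact
  note [measurable] = h h'
  \<comment> \<open>Any positive upper bound \<open>l\<close> replaces the norm itself, so that norm
    zero is reached as a limit.\<close>
  have key: "ind_int M' h' \<le> ennreal (4 * C * l)" if l: "0 < l" "ind_int M h \<le> ennreal l" for l
  proof -
    define r where "r = 1 / l"
    have r: "0 < r" "r * l = 1" using l by (auto simp: r_def)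
    have "ind_int M (\<lambda>n x. r * h n x) = ennreal r * ind_int M h" using r by (intro M.ind_int_scale) auto
    also have "\<dots> \<le> ennreal r * ennreal l" by (intro mult_left_mono l) auto
    also have "\<dots> = 1" using r l by (simp flip: ennreal_mult)
    finally have "ind_mod M (\<lambda>n x. r * h n x) \<le> 2" using fin by (intro M.ind_mod_le) auto
    then have "ind_mod M' (\<lambda>n x. r * h' n x) \<le> ennreal C * 2"
      using le[OF r(1)] by (meson mult_left_mono order_trans zero_le)
    then have "ennreal (1 / (2 * C)) * ind_mod M' (\<lambda>n x. r * h' n x) \<le> ennreal (1 / (2 * C)) * (ennreal C * 2)"
      by (intro mult_left_mono) auto
    also have "\<dots> = ennreal (1 / (2 * C) * (C * 2))" using C by (subst ennreal_mult) (auto simp: ennreal_mult)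
    also have "\<dots> = 1" using C by simp
    finally have 1: "ennreal (1 / (2 * C)) * ind_mod M' (\<lambda>n x. r * h' n x) \<le> 1" .
    have "ind_mod M' (\<lambda>n x. 1 / (2 * C) * (r * h' n x)) \<le> ennreal (1 / (2 * C)) * ind_mod M' (\<lambda>n x. r * h' n x)"
      using C by (intro M'.ind_mod_shrink_le) auto
    with 1 have "ind_mod M' (\<lambda>n x. 1 / (2 * C) * (r * h' n x)) \<le> 1" by (rule order_trans[rotated])
    moreover have "ind_int M' (\<lambda>n x. 1 / (2 * C) * (r * h' n x)) \<le> 1 + ind_mod M' (\<lambda>n x. 1 / (2 * C) * (r * h' n x))"
      by (intro M'.ind_int_le) auto
    ultimately have 2: "ind_int M' (\<lambda>n x. 1 / (2 * C) * (r * h' n x)) \<le> 1 + 1" by (meson add_left_mono order_trans)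
    define d where "d = 1 / (2 * C) * r"
    have d: "0 < d" "1 / d = 2 * C * l" using C l by (auto simp: d_def r_def)
    have "ind_int M' (\<lambda>n x. d * h' n x) \<le> 2" using 2 by (simp add: d_def mult.assoc one_add_one)
    then have "ennreal d * ind_int M' h' \<le> 2" using d by (simp add: M'.ind_int_scale)
    then have "ennreal (1 / d) * (ennreal d * ind_int M' h') \<le> ennreal (1 / d) * 2" by (intro mult_left_mono) auto
    moreover have "ennreal (1 / d) * (ennreal d * ind_int M' h') = ind_int M' h'"
    proof -
      have "ennreal (1 / d) * ennreal d = 1" using d(1) by (subst ennreal_mult[symmetric]) auto
      then show ?thesis by (simp flip: mult.assoc)
    qed
    moreover have "ennreal (1 / d) * 2 = ennreal (4 * C * l)"
    proof -
      have "ennreal (1 / d) * 2 = ennreal ((1 / d) * 2)" using d(1) by (subst ennreal_mult) auto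
      then show ?thesis unfolding d(2) by (simp add: mult.commute mult.left_commute)
    qed
    ultimately show ?thesis by simp
  qed
  show ?thesis
  proof (cases "ind_int M h")
    case (real x)
    show ?thesis
    proof (cases "x > 0")
      case True
      then show ?thesis using key[of x] real C by (simp add: ennreal_mult)
    next
      case False
      then have "x = 0" using real by simp
      have "ind_int M' h' \<le> 0 + ennreal e" if "0 < e" for e
        using key[of "e / (4 * C)"] that C real \<open>x = 0\<close> by simp
      then have "ind_int M' h' \<le> 0" by (rule ennreal_le_epsilon) 
      then show ?thesis by simp
    qed
  next
    case top
    then show ?thesis using C by (simp add: ennreal_mult_top)
  qed
qed

subsection \<open>Trigonometric polynomials on the circle\<close>

lemma prob_space_torus: "prob_space tor"
  unfolding torus_measure_def by (rule prob_space_uniform_measure) auto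

interpretation torus: prob_space tor by (rule prob_space_torus)

lemma space_torus [simp]: "space tor = UNIV"
  by (simp add: torus_measure_def)

lemma sets_torus [simp, measurable_cong]: "sets tor = sets borel"
  by (simp add: torus_measure_def)

lemma torus_integrable:
  fixes f :: "real \<Rightarrow> 'a::{banach, second_countable_topology}"
  assumes "f \<in> borel_measurable borel" "\<And>t. norm (f t) \<le> B"
  shows "integrable tor f"
  by (rule torus.integrable_const_bound[of _ B]) (use assms in \<open>auto simp: measurable_def\<close>)

lemma torus_integral_eq:
  fixes f :: "real \<Rightarrow> 'a::{banach, second_countable_topology}"
  assumes [measurable]: "f \<in> borel_measurable borel"
  shows "(LINT t|tor. f t) = (LINT t:{0..2*pi}|lborel. f t) /\<^sub>R (2 * pi)"
proof -
  have e: "tor = density lborel (\<lambda>t. ennreal (indicator {0..2*pi} t / (2 * pi)))"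
    unfolding torus_measure_def uniform_measure_def
    using divide_ennreal[of 1 "2 * pi"]
    by (intro density_cong) (auto simp: indicator_def)
  have "(LINT t|tor. f t) = (LINT t|lborel. (indicator {0..2*pi} t / (2 * pi)) *\<^sub>R f t)"
    unfolding e by (rule integral_density) auto
  also have "\<dots> = (LINT t|lborel. (indicator {0..2*pi} t *\<^sub>R f t) /\<^sub>R (2 * pi))"
    by (rule Bochner_Integration.integral_cong) (auto simp: field_simps)
  also have "\<dots> = (LINT t:{0..2*pi}|lborel. f t) /\<^sub>R (2 * pi)"
    unfolding set_lebesgue_integral_def by (rule integral_scaleR_right)
  finally show ?thesis .
qed

lemma torus_integral_cis:
  fixes n :: int
  shows "(LINT t|tor. cis (of_int n * t)) = (if n = 0 then 1 else 0)"
proof (cases "n = 0")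
  case True
  then show ?thesis using torus.prob_space by simp
next
  case False
  have "((\<lambda>t. cis (of_int n * t) / (\<i> * of_int n)) has_vector_derivative cis (of_int n * t)) (at t within A)" for t A
  proof -
    have "((\<lambda>z. exp (\<i> * of_int n * z) / (\<i> * of_int n)) has_field_derivative exp (\<i> * of_int n * of_real t)) (at (of_real t))"
      using False by (auto intro!: derivative_eq_intros)
    from has_vector_derivative_real_field[OF this] show ?thesis
      by (simp add: cis_conv_exp mult.assoc)
  qed
  then have "((\<lambda>t. cis (of_int n * t)) has_integral
      (cis (of_int n * (2 * pi)) / (\<i> * of_int n) - cis (of_int n * 0) / (\<i> * of_int n))) {0..2*pi}"
    by (intro fundamental_theorem_of_calculus) auto
  moreover have "cis (of_int n * (2 * pi)) = 1"
    using cis_multiple_2pi[of "of_int n"] by (simp add: algebra_simps)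
  ultimately have hi: "((\<lambda>t. cis (of_int n * t)) has_integral 0) {0..2*pi}" by simp
  have "set_integrable lborel {0..2*pi} (\<lambda>t. cis (of_int n * t))"
    by (rule borel_integrable_atLeastAtMost') (intro continuous_intros)
  then have "(LINT t:{0..2*pi}|lborel. cis (of_int n * t)) = integral {0..2*pi} (\<lambda>t. cis (of_int n * t))"
    by (rule set_borel_integral_eq_integral)
  also have "\<dots> = 0" using hi by (rule integral_unique)
  finally show ?thesis using False
    by (subst torus_integral_eq) (auto intro!: borel_measurable_continuous_onI continuous_intros)
qed

text \<open>The lacunarity arguments need only a window containing the spectrum, and such windows
  are easy to follow through sums, products, conjugation and dilation.\<close>

definition tp :: "int \<Rightarrow> int \<Rightarrow> (real \<Rightarrow> complex) \<Rightarrow> bool" where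
  "tp lo hi f \<longleftrightarrow> (\<exists>c. f = (\<lambda>t. \<Sum>n\<in>{lo..hi}. c n * cis (of_int n * t)))"

lemma tp_zero: "tp lo hi (\<lambda>t. 0)"
  unfolding tp_def by (rule exI[of _ "\<lambda>_. 0"]) simp

lemma tp_cis:
  assumes "lo \<le> n" "n \<le> hi"
  shows "tp lo hi (\<lambda>t. c * cis (of_int n * t))"
  unfolding tp_def
proof (intro exI ext)
  fix t
  have "(\<Sum>m\<in>{lo..hi}. (if m = n then c else 0) * cis (of_int m * t)) = (\<Sum>m\<in>{lo..hi}. if m = n then c * cis (of_int m * t) else 0)"
    by (rule sum.cong) auto
  then show "c * cis (of_int n * t) = (\<Sum>m\<in>{lo..hi}. (if m = n then c else 0) * cis (of_int m * t))"
    using assms by simp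
qed

lemma tp_const: "lo \<le> 0 \<Longrightarrow> 0 \<le> hi \<Longrightarrow> tp lo hi (\<lambda>t. c)"
  using tp_cis[of lo 0 hi c] by simp

lemma tp_add:
  assumes "tp lo hi f" "tp lo hi g"
  shows "tp lo hi (\<lambda>t. f t + g t)"
proof -
  obtain c d where "f = (\<lambda>t. \<Sum>n\<in>{lo..hi}. c n * cis (of_int n * t))" "g = (\<lambda>t. \<Sum>n\<in>{lo..hi}. d n * cis (of_int n * t))"
    using assms unfolding tp_def by blast
  then show ?thesis unfolding tp_def
    by (intro exI[of _ "\<lambda>n. c n + d n"]) (simp add: sum.distrib distrib_right)
qed

lemma tp_sum:
  "(\<And>i. i \<in> A \<Longrightarrow> tp lo hi (f i)) \<Longrightarrow> tp lo hi (\<lambda>t. \<Sum>i\<in>A. f i t)"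
  by (induction A rule: infinite_finite_induct) (auto intro: tp_zero tp_add)

lemma tp_mult:
  assumes "tp lo hi f" "tp lo' hi' g"
  shows "tp (lo + lo') (hi + hi') (\<lambda>t. f t * g t)"
proof -
  obtain c d where c: "f = (\<lambda>t. \<Sum>n\<in>{lo..hi}. c n * cis (of_int n * t))" "g = (\<lambda>t. \<Sum>n\<in>{lo'..hi'}. d n * cis (of_int n * t))"
    using assms unfolding tp_def by blast
  have "(\<lambda>t. f t * g t) = (\<lambda>t. \<Sum>n\<in>{lo..hi}. \<Sum>m\<in>{lo'..hi'}. (c n * d m) * cis (of_int (n + m) * t))"
  proof -
    have "cis (of_int (n + m) * t) = cis (of_int n * t) * cis (of_int m * t)" for n m t
      by (simp add: cis_mult distrib_right)
    then show ?thesis unfolding c sum_product by (simp add: mult_ac)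
  qed
  moreover have "tp (lo + lo') (hi + hi') (\<lambda>t. \<Sum>n\<in>{lo..hi}. \<Sum>m\<in>{lo'..hi'}. (c n * d m) * cis (of_int (n + m) * t))"
    by (intro tp_sum tp_cis) auto
  ultimately show ?thesis by simp
qed

lemma tp_scale: "tp lo hi f \<Longrightarrow> tp lo hi (\<lambda>t. c * f t)"
  using tp_mult[OF tp_const[of 0 0 c], of lo hi f] by simp

lemma tp_mono:
  assumes "tp lo hi f" "lo' \<le> lo" "hi \<le> hi'"
  shows "tp lo' hi' f"
proof -
  obtain c where c: "f = (\<lambda>t. \<Sum>n\<in>{lo..hi}. c n * cis (of_int n * t))" using assms unfolding tp_def by blast
  show ?thesis unfolding c by (intro tp_sum tp_cis) (use assms in auto)
qed

lemma tp_cnj: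
  assumes "tp lo hi f"
  shows "tp (-hi) (-lo) (\<lambda>t. cnj (f t))"
proof -
  obtain c where c: "f = (\<lambda>t. \<Sum>n\<in>{lo..hi}. c n * cis (of_int n * t))" using assms unfolding tp_def by blast
  have "(\<lambda>t. cnj (f t)) = (\<lambda>t. \<Sum>n\<in>{lo..hi}. cnj (c n) * cis (of_int (-n) * t))"
    unfolding c by (simp add: cis_cnj)
  moreover have "tp (-hi) (-lo) (\<lambda>t. \<Sum>n\<in>{lo..hi}. cnj (c n) * cis (of_int (-n) * t))"
    by (intro tp_sum tp_cis) auto
  ultimately show ?thesis by simp
qed

lemma tp_dilate:
  assumes "tp lo hi f" "0 \<le> N"
  shows "tp (N * lo) (N * hi) (\<lambda>t. f (of_int N * t))"
proof -
  obtain c where c: "f = (\<lambda>t. \<Sum>n\<in>{lo..hi}. c n * cis (of_int n * t))" using assms unfolding tp_def by blast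
  have "(\<lambda>t. f (of_int N * t)) = (\<lambda>t. \<Sum>n\<in>{lo..hi}. c n * cis (of_int (N * n) * t))"
    unfolding c by (simp add: mult_ac)
  moreover have "tp (N * lo) (N * hi) (\<lambda>t. \<Sum>n\<in>{lo..hi}. c n * cis (of_int (N * n) * t))"
    by (intro tp_sum tp_cis) (use assms in \<open>auto intro: mult_left_mono\<close>)
  ultimately show ?thesis by simp
qed

lemma tp_continuous:
  assumes "tp lo hi f"
  shows "continuous_on A f"
proof -
  obtain c where c: "f = (\<lambda>t. \<Sum>n\<in>{lo..hi}. c n * cis (of_int n * t))" using assms unfolding tp_def by blast
  show ?thesis unfolding c by (intro continuous_intros)
qed

lemma tp_measurable: "tp lo hi f \<Longrightarrow> f \<in> borel_measurable borel"
  by (intro borel_measurable_continuous_onI tp_continuous)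

lemma tp_bounded:
  assumes "tp lo hi f"
  shows "\<exists>B. \<forall>t. cmod (f t) \<le> B"
proof -
  obtain c where c: "f = (\<lambda>t. \<Sum>n\<in>{lo..hi}. c n * cis (of_int n * t))" using assms unfolding tp_def by blast
  have "cmod (f t) \<le> (\<Sum>n\<in>{lo..hi}. cmod (c n))" for t
    unfolding c by (rule order_trans[OF norm_sum]) (simp add: norm_mult)
  then show ?thesis by blast
qed

lemma tp_integrable:
  assumes "tp lo hi f"
  shows "integrable tor f"
  using tp_bounded[OF assms] torus_integrable[OF tp_measurable[OF assms]] by blast

lemma tp_integral:
  "(LINT t|tor. (\<Sum>n\<in>{lo..hi}. c n * cis (of_int n * t))) = (if lo \<le> 0 \<and> 0 \<le> hi then c 0 else 0)"
proof -
  have i: "integrable tor (\<lambda>t. c n * cis (of_int n * t))" for n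
    using tp_integrable[OF tp_cis[of n n n]] by simp
  have "(LINT t|tor. (\<Sum>n\<in>{lo..hi}. c n * cis (of_int n * t))) = (\<Sum>n\<in>{lo..hi}. c n * (if n = 0 then 1 else 0))"
    by (subst Bochner_Integration.integral_sum) (use i in \<open>auto simp: torus_integral_cis\<close>)
  also have "\<dots> = (\<Sum>n\<in>{lo..hi}. if n = 0 then c n else 0)" by (rule sum.cong) auto
  finally show ?thesis by simp
qed

lemma tp_integral_zero:
  assumes "tp lo hi f" "0 < lo \<or> hi < 0"
  shows "(LINT t|tor. f t) = 0"
  using assms tp_integral unfolding tp_def by fastforce

text \<open>The spectrum of \<open>g (N t)\<close> consists of multiples of \<open>N\<close> and
  that of \<open>h\<close> lies strictly between \<open>-N\<close> and \<open>N\<close>, so only the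
  two zero frequencies can meet.\<close>

lemma tp_lacunary:
  assumes h: "tp (-(N - 1)) (N - 1) h" and g: "tp lo hi g" and N: "0 < N"
  shows "(LINT t|tor. h t * g (of_int N * t)) = (LINT t|tor. h t) * (LINT t|tor. g t)"
proof -
  obtain d where d: "g = (\<lambda>t. \<Sum>n\<in>{lo..hi}. d n * cis (of_int n * t))" using g unfolding tp_def by blast
  have tpn: "tp (-(N - 1) + N * n) ((N - 1) + N * n) (\<lambda>t. h t * (d n * cis (of_int (N * n) * t)))" for n
    by (rule tp_mult[OF h tp_cis]) auto
  have z: "(LINT t|tor. h t * (d n * cis (of_int (N * n) * t))) = (if n = 0 then (LINT t|tor. h t) * d 0 else 0)" for n
  proof (cases "n = 0")
    case False
    have "0 < -(N - 1) + N * n \<or> (N - 1) + N * n < 0"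
    proof (cases "n > 0")
      case True
      then have "N * 1 \<le> N * n" using N by (intro mult_left_mono) auto
      then show ?thesis by simp
    next
      case f: False
      then have "N * n \<le> N * (-1)" using N False by (intro mult_left_mono) auto
      then show ?thesis by simp
    qed
    then show ?thesis using False tp_integral_zero[OF tpn] by simp
  qed simp
  have "(LINT t|tor. h t * g (of_int N * t)) = (LINT t|tor. (\<Sum>n\<in>{lo..hi}. h t * (d n * cis (of_int (N * n) * t))))"
    unfolding d by (simp add: sum_distrib_left mult_ac)
  also have "\<dots> = (\<Sum>n\<in>{lo..hi}. if n = 0 then (LINT t|tor. h t) * d 0 else 0)"
    by (subst Bochner_Integration.integral_sum) (use tp_integrable[OF tpn] z in auto)
  also have "\<dots> = (LINT t|tor. h t) * (LINT t|tor. g t)"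
    unfolding d tp_integral by simp
  finally show ?thesis .
qed

section \<open>Jensen's inequality and a Schur test for the modular\<close>

lemma phi_jensen_kernel:
  assumes [measurable]: "f \<in> borel_measurable M" "k \<in> borel_measurable M"
    and k: "\<And>x. 0 \<le> k x" and f: "\<And>x. 0 \<le> f x" and X: "0 \<le> X"
    and w: "(\<integral>\<^sup>+ x. ennreal (k x) \<partial>M) \<le> 1"
    and le: "ennreal X \<le> (\<integral>\<^sup>+ x. ennreal (k x) * ennreal (f x) \<partial>M)"
  shows "ennreal (phi X) \<le> (\<integral>\<^sup>+ x. ennreal (k x) * ennreal (phi (f x)) \<partial>M)"
proof -
  have [measurable]: "(\<lambda>x. ennreal (phi (f x))) \<in> borel_measurable M" unfolding phi_def by measurable
  define d where "d = X / sqrt (1 + X\<^sup>2)"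
  have d: "0 \<le> d" unfolding d_def using X by simp
  \<comment> \<open>The tangent at \<open>X\<close> evaluated at 0. It absorbs the missing mass
    \<open>1 - W\<close> when the kernel has total mass below 1.\<close>
  have dX: "phi X \<le> d * X" using phi_tangent[of X 0] by (simp add: d_def)
  obtain W where W: "(\<integral>\<^sup>+ x. ennreal (k x) \<partial>M) = ennreal W" "0 \<le> W" "W \<le> 1"
    using w by (cases "\<integral>\<^sup>+ x. ennreal (k x) \<partial>M") (auto simp: ennreal_le_1 top_unique)
  have t: "ennreal (phi X) + ennreal d * ennreal (f x) \<le> ennreal (phi (f x)) + ennreal (d * X)" for x
  proof -
    have "phi X + d * (f x - X) \<le> phi (f x)" using phi_tangent[of X "f x"] by (simp add: d_def)
    then have "phi X + d * f x \<le> phi (f x) + d * X" by (simp add: algebra_simps)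
    then show ?thesis using d f X by (simp add: ennreal_leI flip: ennreal_mult ennreal_plus)
  qed
  have "ennreal W * ennreal (phi X) + ennreal d * ennreal X
     \<le> ennreal W * ennreal (phi X) + ennreal d * (\<integral>\<^sup>+ x. ennreal (k x) * ennreal (f x) \<partial>M)"
    by (intro add_left_mono mult_left_mono le) auto
  also have "\<dots> = (\<integral>\<^sup>+ x. ennreal (k x) * (ennreal (phi X) + ennreal d * ennreal (f x)) \<partial>M)"
    unfolding W(1)[symmetric]
    by (simp add: distrib_left nn_integral_add nn_integral_cmult nn_integral_multc mult.left_commute mult.assoc)
  also have "\<dots> \<le> (\<integral>\<^sup>+ x. ennreal (k x) * (ennreal (phi (f x)) + ennreal (d * X)) \<partial>M)"
    by (intro nn_integral_mono mult_left_mono t) auto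
  also have "\<dots> = (\<integral>\<^sup>+ x. ennreal (k x) * ennreal (phi (f x)) \<partial>M) + ennreal W * ennreal (d * X)"
    unfolding W(1)[symmetric] by (simp add: distrib_left nn_integral_add nn_integral_multc)
  finally have main: "ennreal W * ennreal (phi X) + ennreal d * ennreal X
     \<le> (\<integral>\<^sup>+ x. ennreal (k x) * ennreal (phi (f x)) \<partial>M) + ennreal W * ennreal (d * X)" .
  show ?thesis
  proof (cases "\<integral>\<^sup>+ x. ennreal (k x) * ennreal (phi (f x)) \<partial>M")
    case (real p)
    have "W * phi X + d * X \<le> p + W * (d * X)"
      using main W(2) d X real by (simp flip: ennreal_mult ennreal_plus add: ennreal_le_iff)
    moreover have "(1 - W) * phi X \<le> (1 - W) * (d * X)" using W dX by (intro mult_left_mono) auto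
    ultimately have "phi X \<le> p" by (simp add: algebra_simps)
    then show ?thesis using real by (simp add: ennreal_leI)
  qed simp
qed

text \<open>Schur test: dividing the kernel by \<open>A\<close> makes one marginal at most 1, so
  Jensen applies pointwise; Fubini and the other marginal finish. The factor \<open>A\<close> moved
  into \<open>f\<close> costs \<open>A^2\<close> by doubling.\<close>

lemma phi_kernel:
  fixes k :: "'a \<Rightarrow> 'b \<Rightarrow> real"
  assumes "sigma_finite_measure M" "sigma_finite_measure N"
    and [measurable]: "f \<in> borel_measurable M" "case_prod k \<in> borel_measurable (M \<Otimes>\<^sub>M N)"
    and k: "\<And>x y. 0 \<le> k x y" and f: "\<And>x. 0 \<le> f x" and g: "\<And>y. 0 \<le> g y" and A: "1 \<le> A"
    and w1: "\<And>y. y \<in> space N \<Longrightarrow> (\<integral>\<^sup>+ x. ennreal (k x y) \<partial>M) \<le> ennreal A"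
    and w2: "\<And>x. x \<in> space M \<Longrightarrow> (\<integral>\<^sup>+ y. ennreal (k x y) \<partial>N) \<le> ennreal A"
    and le: "\<And>y. y \<in> space N \<Longrightarrow> ennreal (g y) \<le> (\<integral>\<^sup>+ x. ennreal (k x y) * ennreal (f x) \<partial>M)"
  shows "(\<integral>\<^sup>+ y. ennreal (phi (g y)) \<partial>N) \<le> ennreal (A\<^sup>2) * (\<integral>\<^sup>+ x. ennreal (phi (f x)) \<partial>M)"
proof -
  interpret M: sigma_finite_measure M by fact
  interpret N: sigma_finite_measure N by fact
  interpret pair_sigma_finite M N ..
  have [measurable]: "(\<lambda>x. phi (A * f x)) \<in> borel_measurable M" "(\<lambda>x. phi (f x)) \<in> borel_measurable M"
    unfolding phi_def by measurable
  define k' where "k' x y = k x y / A" for x y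
  have [measurable]: "case_prod k' \<in> borel_measurable (M \<Otimes>\<^sub>M N)" unfolding k'_def[abs_def] split_beta' by measurable
  have k'A: "ennreal (k' x y) = ennreal (1 / A) * ennreal (k x y)" for x y
    using A k by (simp add: k'_def flip: ennreal_mult)
  have AA: "ennreal (1 / A) * ennreal A = 1" using A by (simp flip: ennreal_mult)
  have w1': "(\<integral>\<^sup>+ x. ennreal (k' x y) \<partial>M) \<le> 1" if y: "y \<in> space N" for y
  proof -
    have "(\<integral>\<^sup>+ x. ennreal (k' x y) \<partial>M) = ennreal (1 / A) * (\<integral>\<^sup>+ x. ennreal (k x y) \<partial>M)"
      unfolding k'A using y by (intro nn_integral_cmult) measurable
    also have "\<dots> \<le> ennreal (1 / A) * ennreal A" by (intro mult_left_mono w1 y) auto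
    finally show ?thesis using AA by simp
  qed
  have w2': "(\<integral>\<^sup>+ y. ennreal (k' x y) \<partial>N) \<le> 1" if x: "x \<in> space M" for x
  proof -
    have "(\<integral>\<^sup>+ y. ennreal (k' x y) \<partial>N) = ennreal (1 / A) * (\<integral>\<^sup>+ y. ennreal (k x y) \<partial>N)"
      unfolding k'A using x by (intro nn_integral_cmult) measurable
    also have "\<dots> \<le> ennreal (1 / A) * ennreal A" by (intro mult_left_mono w2 x) auto
    finally show ?thesis using AA by simp
  qed
  have "(\<integral>\<^sup>+ y. ennreal (phi (g y)) \<partial>N) \<le> (\<integral>\<^sup>+ y. \<integral>\<^sup>+ x. ennreal (k' x y) * ennreal (phi (A * f x)) \<partial>M \<partial>N)"
  proof (intro nn_integral_mono phi_jensen_kernel)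
    fix y assume y: "y \<in> space N"
    show "(\<lambda>x. k' x y) \<in> borel_measurable M" using y by measurable
    show "(\<integral>\<^sup>+ x. ennreal (k' x y) \<partial>M) \<le> 1" using w1' y .
    have "ennreal (k' x y) * ennreal (A * f x) = ennreal (k x y) * ennreal (f x)" for x
      using A k f by (simp add: k'_def flip: ennreal_mult)
    then show "ennreal (g y) \<le> (\<integral>\<^sup>+ x. ennreal (k' x y) * ennreal (A * f x) \<partial>M)" using le[OF y] by simp
  qed (use A k f g in \<open>auto simp: k'_def\<close>)
  also have "\<dots> = (\<integral>\<^sup>+ x. \<integral>\<^sup>+ y. ennreal (k' x y) * ennreal (phi (A * f x)) \<partial>N \<partial>M)"
    by (rule Fubini') measurable
  also have "\<dots> = (\<integral>\<^sup>+ x. (\<integral>\<^sup>+ y. ennreal (k' x y) \<partial>N) * ennreal (phi (A * f x)) \<partial>M)"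
    by (intro nn_integral_cong nn_integral_multc) measurable
  also have "\<dots> \<le> (\<integral>\<^sup>+ x. 1 * (ennreal (A\<^sup>2) * ennreal (phi (f x))) \<partial>M)"
    using A by (intro nn_integral_mono mult_mono w2') (auto simp: phi_scale_le ennreal_leI simp flip: ennreal_mult)
  also have "\<dots> = ennreal (A\<^sup>2) * (\<integral>\<^sup>+ x. ennreal (phi (f x)) \<partial>M)"
    by (simp add: nn_integral_cmult)
  finally show ?thesis .
qed

subsection \<open>Subharmonicity on the circle\<close>

lemma torus_integral_cont:
  fixes g :: "real \<Rightarrow> real"
  assumes "continuous_on UNIV g"
  shows "(LINT t|tor. g t) = integral {0..2*pi} g / (2 * pi)"
proof -
  have "set_integrable lborel {0..2*pi} g"
    by (rule borel_integrable_atLeastAtMost') (use assms continuous_on_subset in blast)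
  then have "(LINT t:{0..2*pi}|lborel. g t) = integral {0..2*pi} g"
    by (rule set_borel_integral_eq_integral)
  then show ?thesis using assms
    by (subst torus_integral_eq) (auto simp: field_simps borel_measurable_continuous_onI)
qed

lemma torus_shift:
  fixes g :: "real \<Rightarrow> real"
  assumes c: "continuous_on UNIV g" and p: "\<And>t. g (t + 2 * pi) = g t" and s: "0 \<le> s" "s \<le> 2 * pi"
  shows "(LINT t|tor. g (t + s)) = (LINT t|tor. g t)"
proof -
  have ci: "continuous_on A g" for A using c continuous_on_subset by blast
  have i: "g integrable_on {a..b}" for a b by (intro integrable_continuous_real ci)
  have c': "continuous_on UNIV (\<lambda>t. g (t + s))" by (intro continuous_on_compose2[OF c] continuous_intros) auto
  have "integral {0..2*pi} (\<lambda>t. g (t + s)) = integral {0 + s..2*pi + s} g"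
    using integral_shift_Icc_real[of 0 "2*pi" g s] by (simp add: add.commute comp_def)
  also have "\<dots> = integral {s..2*pi} g + integral {2*pi..2*pi + s} g"
    using s by (subst Henstock_Kurzweil_Integration.integral_combine[where c="2*pi"]) (auto intro: i)
  also have "integral {2*pi..2*pi + s} g = integral {0..s} (\<lambda>t. g (t + 2 * pi))"
    using integral_shift_Icc_real[of 0 s g "2*pi"] by (simp add: add.commute comp_def)
  also have "\<dots> = integral {0..s} g" by (simp add: p)
  also have "integral {s..2*pi} g + integral {0..s} g = integral {0..2*pi} g"
    using s Henstock_Kurzweil_Integration.integral_combine[of 0 s "2*pi" g] i by simp
  finally show ?thesis by (simp add: torus_integral_cont c c')
qed

text \<open>Translates have equal means. Passing to grid averages turns an integral inequality into
  a pointwise inequality over finitely many equally spaced points.\<close>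

lemma torus_grid:
  fixes g :: "real \<Rightarrow> real"
  assumes c: "continuous_on UNIV g" and p: "\<And>t. g (t + 2 * pi) = g t" and M: "M > 0"
  shows "(LINT t|tor. (\<Sum>k<M. g (t + 2 * pi * real k / real M)) / real M) = (LINT t|tor. g t)"
proof -
  have per: "g (t + 2 * pi * real k) = g t" for t k
  proof (induction k arbitrary: t)
    case (Suc k)
    have "g (t + 2 * pi * real (Suc k)) = g ((t + 2 * pi * real k) + 2 * pi)" by (simp add: algebra_simps)
    then show ?case using p Suc.IH by metis
  qed simp
  have cont: "continuous_on UNIV (\<lambda>t. g (t + s))" for s
    by (intro continuous_on_compose2[OF c] continuous_intros) auto
  have "bounded (g ` {0..2*pi})"
    by (intro compact_imp_bounded compact_continuous_image continuous_on_subset[OF c]) auto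
  then obtain B where B: "\<And>t. t \<in> {0..2*pi} \<Longrightarrow> \<bar>g t\<bar> \<le> B" unfolding bounded_iff by (metis imageI real_norm_def)
  \<comment> \<open>Integrability is derived from a global bound, which periodicity carries over
    from one period.\<close>
  have Ball: "\<bar>g t\<bar> \<le> B" for t
  proof -
    define n where "n = \<lfloor>t / (2 * pi)\<rfloor>"
    define x where "x = t - 2 * pi * of_int n"
    have x: "0 \<le> x" "x \<le> 2 * pi"
      using floor_divide_lower[of "2*pi" t] floor_divide_upper[of "2*pi" t]
      unfolding x_def n_def by (auto simp: algebra_simps)
    have "g t = g x"
    proof (cases "n \<ge> 0")
      case True
      then have "t = x + 2 * pi * real (nat n)" by (simp add: x_def)
      then show ?thesis using per by metis
    next
      case False
      then have "x = t + 2 * pi * real (nat (- n))" by (simp add: x_def)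
      then show ?thesis using per by metis
    qed
    then show ?thesis using B x by simp
  qed
  have i: "integrable tor (\<lambda>t. g (t + s))" for s
    by (rule torus_integrable[where B=B]) (use Ball borel_measurable_continuous_onI[OF cont] in auto)
  have "(LINT t|tor. (\<Sum>k<M. g (t + 2 * pi * real k / real M)) / real M)
     = (\<Sum>k<M. LINT t|tor. g (t + 2 * pi * real k / real M)) / real M"
    using i by (simp add: Bochner_Integration.integral_sum)
  also have "\<dots> = (\<Sum>k<M. LINT t|tor. g t) / real M"
  proof (intro arg_cong[where f="\<lambda>x. x / real M"] sum.cong refl torus_shift[OF c p])
    fix k assume k: "k \<in> {..<M}"
    then have "pi * real k \<le> pi * real M" by (intro mult_left_mono) auto
    then show "0 \<le> 2 * pi * real k / real M" "2 * pi * real k / real M \<le> 2 * pi"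
      using k M by (auto simp: field_simps)
  qed
  also have "\<dots> = (LINT t|tor. g t)" using M by simp
  finally show ?thesis .
qed

text \<open>Grids of \<open>2^j\<close> points allow an induction by doubling: the points
  \<open>k\<close> and \<open>k + 2^j\<close> of the finer grid are opposite.\<close>

lemma prod_roots_pow2:
  fixes x :: complex
  shows "(\<Prod>k<2^j. x - cis (2 * pi * real k / 2^j)) = x^(2^j) - 1"
proof (induction j arbitrary: x)
  case 0 then show ?case by simp
next
  case (Suc j)
  have s: "{..<2^Suc j} = {..<2^j} \<union> (\<lambda>k. k + 2^j) ` {..<2^j::nat}"
  proof -
    have "k \<in> (\<lambda>k. k + 2^j) ` {..<2^j}" if "k < 2^Suc j" "\<not> k < 2^j" for k :: nat
      using that by (intro image_eqI[of _ _ "k - 2^j"]) auto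
    then show ?thesis by auto
  qed
  have "(\<Prod>k<2^Suc j. x - cis (2 * pi * real k / 2^Suc j)) =
      (\<Prod>k<2^j. x - cis (2 * pi * real k / 2^Suc j)) * (\<Prod>k<2^j. x - cis (2 * pi * real (k + 2^j) / 2^Suc j))"
    unfolding s by (subst prod.union_disjoint) (auto simp: prod.reindex inj_on_def)
  also have "(\<Prod>k<2^j. x - cis (2 * pi * real (k + 2^j) / 2^Suc j)) = (\<Prod>k<2^j. x + cis (2 * pi * real k / 2^Suc j))"
  proof (rule prod.cong[OF refl])
    fix k :: nat
    have "2 * pi * real (k + 2^j) / 2^Suc j = 2 * pi * real k / 2^Suc j + pi"
      by (simp add: field_simps)
    then show "x - cis (2 * pi * real (k + 2^j) / 2^Suc j) = x + cis (2 * pi * real k / 2^Suc j)"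
      by (simp add: cis_mult[symmetric])
  qed
  also have "(\<Prod>k<2^j. x - cis (2 * pi * real k / 2^Suc j)) * (\<Prod>k<2^j. x + cis (2 * pi * real k / 2^Suc j))
     = (\<Prod>k<2^j. x\<^sup>2 - cis (2 * pi * real k / 2^j))"
    unfolding prod.distrib[symmetric]
  proof (rule prod.cong[OF refl])
    fix k :: nat
    have "cis (2 * pi * real k / 2^Suc j) ^ 2 = cis (2 * pi * real k / 2^j)"
    proof -
      have "real 2 * (2 * pi * real k / 2^Suc j) = 2 * pi * real k / 2^j" by (simp add: field_simps)
      then show ?thesis by (simp only: Complex.DeMoivre)
    qed
    then show "(x - cis (2 * pi * real k / 2^Suc j)) * (x + cis (2 * pi * real k / 2^Suc j)) = x\<^sup>2 - cis (2 * pi * real k / 2^j)"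
      by (simp add: algebra_simps power2_eq_square)
  qed
  also have "\<dots> = (x\<^sup>2)^(2^j) - 1" by (rule Suc.IH)
  finally show ?case by (simp add: power_mult[symmetric])
qed

lemma prod_grid_cmod:
  fixes \<zeta> :: complex
  shows "(\<Prod>k<2^j. cmod (cis (t + 2 * pi * real k / 2^j) - \<zeta>)) = cmod (\<zeta>^(2^j) - cis (2^j * t))"
proof -
  have "cmod (cis (t + 2 * pi * real k / 2^j) - \<zeta>) = cmod (\<zeta> * cis (- t) - cis (2 * pi * real k / 2^j))" for k
  proof -
    have "cis (t + 2 * pi * real k / 2^j) - \<zeta> = - cis t * (\<zeta> * cis (- t) - cis (2 * pi * real k / 2^j))"
      by (simp add: algebra_simps cis_mult)
    then show ?thesis by (simp add: norm_mult)
  qed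
  then have "(\<Prod>k<2^j. cmod (cis (t + 2 * pi * real k / 2^j) - \<zeta>)) = cmod (\<Prod>k<2^j. \<zeta> * cis (- t) - cis (2 * pi * real k / 2^j))"
    by (simp add: prod_norm)
  also have "\<dots> = cmod ((\<zeta> * cis (- t))^(2^j) - 1)" by (subst prod_roots_pow2) simp
  also have "(\<zeta> * cis (- t))^(2^j) - 1 = cis (- (2^j * t)) * (\<zeta>^(2^j) - cis (2^j * t))"
  proof -
    have "cis (- t) ^ (2^j) = cis (- (2^j * t))" by (simp add: Complex.DeMoivre)
    then show ?thesis by (simp add: power_mult_distrib algebra_simps cis_mult)
  qed
  finally show ?thesis by (simp add: norm_mult)
qed

text \<open>Discrete form of Jensen's formula. With \<open>N = 2^j\<close> the product equals
  \<open>|\<zeta>^N - w|\<close> for some \<open>w\<close> of modulus 1, which is about 1 inside the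
  disc and about \<open>|\<zeta>|^N\<close> outside; either way it exceeds
  \<open>|\<zeta>|^N\<close> up to the factor \<open>1 - \<delta>\<close>.\<close>

lemma grid_root_lower:
  fixes \<zeta> :: complex
  assumes "cmod \<zeta> \<noteq> 1" "0 < \<delta>"
  shows "\<forall>\<^sub>F j in sequentially. \<forall>t. (1 - \<delta>) * cmod \<zeta> ^ (2^j) \<le> (\<Prod>k<2^j. cmod (cis (t + 2 * pi * real k / 2^j) - \<zeta>))"
proof -
  have fl: "filterlim (\<lambda>j::nat. (2::nat)^j) at_top sequentially"
    by (rule filterlim_at_top_mono[OF filterlim_ident]) (auto intro: eventually_sequentiallyI[of 0] simp: less_imp_le)
  show ?thesis
  proof (cases "cmod \<zeta> < 1")
    case True
    have "(\<lambda>j. cmod \<zeta> ^ (2^j)) \<longlonglongrightarrow> 0"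
      by (rule filterlim_compose[OF LIMSEQ_power_zero fl]) (use True in auto)
    then have "\<forall>\<^sub>F j in sequentially. cmod \<zeta> ^ (2^j) < \<delta>" using assms(2) by (rule order_tendstoD)
    then show ?thesis
    proof eventually_elim
      case (elim j)
      show ?case
      proof
        fix t
        have "cmod (cis (2^j * t)) - cmod (\<zeta>^(2^j)) \<le> cmod (\<zeta>^(2^j) - cis (2^j * t))"
          by (metis norm_minus_commute norm_triangle_ineq2)
        then have a: "1 - cmod \<zeta> ^ (2^j) \<le> cmod (\<zeta>^(2^j) - cis (2^j * t))" by (simp add: norm_power)
        have p: "cmod \<zeta> ^ (2^j) \<le> 1" using True by (simp add: power_le_one)
        have "(1 - \<delta>) * cmod \<zeta> ^ (2^j) \<le> 1 - cmod \<zeta> ^ (2^j)"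
        proof (cases "\<delta> \<le> 1")
          case True
          then have "(1 - \<delta>) * cmod \<zeta> ^ (2^j) \<le> (1 - \<delta>) * 1" using p by (intro mult_left_mono) auto
          also have "\<dots> \<le> 1 - cmod \<zeta> ^ (2^j)" using elim by simp
          finally show ?thesis .
        next
          case False
          then have "(1 - \<delta>) * cmod \<zeta> ^ (2^j) \<le> 0" by (intro mult_nonpos_nonneg) auto
          also have "0 \<le> 1 - cmod \<zeta> ^ (2^j)" using p by simp
          finally show ?thesis .
        qed
        then show "(1 - \<delta>) * cmod \<zeta> ^ (2^j) \<le> (\<Prod>k<2^j. cmod (cis (t + 2 * pi * real k / 2^j) - \<zeta>))"
          unfolding prod_grid_cmod using a by (rule order_trans)
      qed
    qed
  next
    case False
    then have g: "cmod \<zeta> > 1" using assms(1) by simp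
    have "(\<lambda>j. (1 / cmod \<zeta>) ^ (2^j)) \<longlonglongrightarrow> 0"
      by (rule filterlim_compose[OF LIMSEQ_power_zero fl]) (use g in \<open>simp add: divide_less_eq\<close>)
    then have "\<forall>\<^sub>F j in sequentially. (1 / cmod \<zeta>) ^ (2^j) < \<delta>" using assms(2) by (rule order_tendstoD)
    then show ?thesis
    proof eventually_elim
      case (elim j)
      have pz: "0 < cmod \<zeta> ^ (2^j)" using g by (intro zero_less_power) linarith
      have "1 < \<delta> * cmod \<zeta> ^ (2^j)" using elim pz by (simp add: power_divide pos_divide_less_eq)
      moreover have "cmod (\<zeta>^(2^j)) - cmod (cis (2^j * t)) \<le> cmod (\<zeta>^(2^j) - cis (2^j * t))" for t
        by (rule norm_triangle_ineq2)
      then have "cmod \<zeta>^(2^j) - 1 \<le> cmod (\<zeta>^(2^j) - cis (2^j * t))" for t by (simp add: norm_power)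
      moreover have "(1 - \<delta>) * cmod \<zeta> ^ (2^j) = cmod \<zeta> ^ (2^j) - \<delta> * cmod \<zeta> ^ (2^j)" by (simp add: algebra_simps)
      ultimately show ?case unfolding prod_grid_cmod by (smt (verit))
    qed
  qed
qed

text \<open>Chosen so that \<open>hsub Q (exp s)\<close> is increasing and convex in
  \<open>s\<close>, which makes \<open>hsub Q |f|\<close> subharmonic for analytic \<open>f\<close>.
  The weight 2 makes this work for all \<open>Q >= 1\<close> at once.\<close>

definition hsub :: "real \<Rightarrow> real \<Rightarrow> real" where
  "hsub Q x = 2 * sqrt (1 + x\<^sup>2) - sqrt (Q + x\<^sup>2)"

lemma hsub_exp_deriv:
  assumes "Q \<ge> 1"
  shows "((\<lambda>s. hsub Q (exp s)) has_real_derivative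
     (2 * ((exp s)\<^sup>2 / sqrt (1 + (exp s)\<^sup>2)) - (exp s)\<^sup>2 / sqrt (Q + (exp s)\<^sup>2))) (at s)"
proof -
  have "1 + (exp s)\<^sup>2 > 0" "Q + (exp s)\<^sup>2 > 0" using assms by (auto intro: add_pos_nonneg)
  then show ?thesis unfolding hsub_def
    by (auto intro!: derivative_eq_intros simp: power2_eq_square field_simps)
qed

text \<open>At \<open>y = exp (2 s)\<close> the expression is the derivative in \<open>s\<close>.
  Writing \<open>y / sqrt (q + y)\<close> as \<open>sqrt (q + y) - q / sqrt (q + y)\<close>, the
  \<open>Q\<close> term grows by at most twice the increment of \<open>sqrt (Q + y)\<close>, and
  concavity bounds that by twice the increment of \<open>sqrt (1 + y)\<close>.\<close>

lemma hsub_slope_mono: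
  assumes Q: "Q \<ge> 1" and y: "0 \<le> y1" "y1 \<le> y2"
  shows "2 * (y1 / sqrt (1 + y1)) - y1 / sqrt (Q + y1) \<le> 2 * (y2 / sqrt (1 + y2)) - y2 / sqrt (Q + y2)"
proof -
  have e: "y / sqrt (q + y) = sqrt (q + y) - q / sqrt (q + y)" if "q \<ge> 1" "y \<ge> 0" for q y :: real
  proof -
    have "sqrt (q + y) > 0" using that by simp
    moreover have "sqrt (q + y) * sqrt (q + y) = q + y" using that by simp
    ultimately show ?thesis by (simp add: field_simps)
  qed
  let ?a = "sqrt (Q + y1)" and ?b = "sqrt (Q + y2)"
  have ab: "0 < ?a" "?a \<le> ?b" "0 < ?b" using Q y by auto
  have d: "?b - ?a \<le> sqrt (1 + y2) - sqrt (1 + y1)"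
    using sqrt_diff_antimono[of "1 + y1" "Q + y1" "y2 - y1"] Q y by simp
  have "Q \<le> ?a * ?b"
  proof -
    have "Q \<le> ?a * ?a" using Q y by simp
    also have "\<dots> \<le> ?a * ?b" using ab by (intro mult_left_mono) auto
    finally show ?thesis .
  qed
  have "Q / ?a - Q / ?b = (Q / (?a * ?b)) * (?b - ?a)" using ab by (simp add: field_simps)
  also have "\<dots> \<le> 1 * (?b - ?a)" using ab \<open>Q \<le> ?a * ?b\<close> by (intro mult_right_mono) (auto simp: divide_le_eq)
  finally have f: "Q / ?a - Q / ?b \<le> ?b - ?a" by simp
  have g: "1 / sqrt (1 + y2) \<le> 1 / sqrt (1 + y1)" using y by (intro divide_left_mono) auto
  have e1: "y1 / sqrt (1 + y1) = sqrt (1 + y1) - 1 / sqrt (1 + y1)" using e[of 1 y1] y by simp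
  have e2: "y2 / sqrt (1 + y2) = sqrt (1 + y2) - 1 / sqrt (1 + y2)" using e[of 1 y2] y by simp
  have e3: "y1 / ?a = ?a - Q / ?a" using e[of Q y1] Q y by simp
  have e4: "y2 / ?b = ?b - Q / ?b" using e[of Q y2] Q y by simp
  show ?thesis unfolding e1 e2 e3 e4 using d f g by argo
qed

lemma hsub_convex: "Q \<ge> 1 \<Longrightarrow> convex_on UNIV (\<lambda>s. hsub Q (exp s))"
  by (rule convex_on_realI[OF _ hsub_exp_deriv]) (simp_all add: hsub_slope_mono power_mono del: times_divide_eq_right)

lemma hsub_mono:
  assumes "Q \<ge> 1" "0 \<le> x" "x \<le> y"
  shows "hsub Q x \<le> hsub Q y"
proof -
  have xy: "x\<^sup>2 \<le> y\<^sup>2" using assms by (intro power_mono) auto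
  have "sqrt (Q + y\<^sup>2) - sqrt (Q + x\<^sup>2) \<le> sqrt (1 + y\<^sup>2) - sqrt (1 + x\<^sup>2)"
    using sqrt_diff_antimono[of "1 + x\<^sup>2" "Q + x\<^sup>2" "y\<^sup>2 - x\<^sup>2"] assms xy by simp
  moreover have "sqrt (1 + x\<^sup>2) \<le> sqrt (1 + y\<^sup>2)" using xy by simp
  ultimately show ?thesis unfolding hsub_def by linarith
qed

text \<open>Polynomials given by their list of roots, so that the grid estimate can be proved root
  by root.\<close>

definition rootfn :: "complex \<Rightarrow> complex list \<Rightarrow> complex \<Rightarrow> complex" where
  "rootfn c zs z = c * (\<Prod>\<zeta>\<leftarrow>zs. z - \<zeta>)"

lemma rootfn_Cons: "rootfn c (\<zeta> # zs) z = (z - \<zeta>) * rootfn c zs z"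
  by (simp add: rootfn_def)

lemma rootfn_cont: "continuous_on A (\<lambda>t. rootfn c zs (cis t))"
  by (induction zs) (auto simp: rootfn_Cons rootfn_def[of c "[]"] intro!: continuous_intros)

lemma rootfn_grid_lower:
  assumes "\<forall>\<zeta>\<in>set zs. cmod \<zeta> \<noteq> 1" "0 < \<delta>" "\<delta> < 1"
  shows "\<forall>\<^sub>F j in sequentially. \<forall>t. (1 - \<delta>) ^ length zs * cmod (rootfn c zs 0) ^ (2^j)
     \<le> (\<Prod>k<2^j. cmod (rootfn c zs (cis (t + 2 * pi * real k / 2^j))))"
  using assms(1)
proof (induction zs)
  case Nil
  then show ?case by (simp add: rootfn_def)
next
  case (Cons \<zeta> zs)
  have "\<forall>\<^sub>F j in sequentially. \<forall>t. (1 - \<delta>) ^ length zs * cmod (rootfn c zs 0) ^ (2^j)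
     \<le> (\<Prod>k<2^j. cmod (rootfn c zs (cis (t + 2 * pi * real k / 2^j))))" using Cons by simp
  moreover have "\<forall>\<^sub>F j in sequentially. \<forall>t. (1 - \<delta>) * cmod \<zeta> ^ (2^j) \<le> (\<Prod>k<2^j. cmod (cis (t + 2 * pi * real k / 2^j) - \<zeta>))"
    using Cons.prems assms(2) by (intro grid_root_lower) auto
  ultimately show ?case
  proof eventually_elim
    case (elim j)
    show ?case
    proof
      fix t
      have "(1 - \<delta>) ^ length (\<zeta> # zs) * cmod (rootfn c (\<zeta> # zs) 0) ^ (2^j)
         = ((1 - \<delta>) * cmod \<zeta> ^ (2^j)) * ((1 - \<delta>) ^ length zs * cmod (rootfn c zs 0) ^ (2^j))"
        by (simp add: rootfn_Cons norm_mult power_mult_distrib)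
      also have "\<dots> \<le> (\<Prod>k<2^j. cmod (cis (t + 2 * pi * real k / 2^j) - \<zeta>)) * (\<Prod>k<2^j. cmod (rootfn c zs (cis (t + 2 * pi * real k / 2^j))))"
        using elim assms(3) by (intro mult_mono) (auto intro!: mult_nonneg_nonneg prod_nonneg)
      also have "\<dots> = (\<Prod>k<2^j. cmod (rootfn c (\<zeta> # zs) (cis (t + 2 * pi * real k / 2^j))))"
        by (simp add: rootfn_Cons norm_mult prod.distrib)
      finally show "(1 - \<delta>) ^ length (\<zeta> # zs) * cmod (rootfn c (\<zeta> # zs) 0) ^ (2^j)
         \<le> (\<Prod>k<2^j. cmod (rootfn c (\<zeta> # zs) (cis (t + 2 * pi * real k / 2^j))))" .
    qed
  qed
qed

lemma hsub_cont: "Q \<ge> 1 \<Longrightarrow> continuous_on A f \<Longrightarrow> continuous_on A (\<lambda>t. hsub Q (f t))"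
  unfolding hsub_def by (intro continuous_intros)

lemma hsub_bound:
  assumes "Q \<ge> 1" "0 \<le> x" "x \<le> B"
  shows "\<bar>hsub Q x\<bar> \<le> 2 * sqrt (1 + B\<^sup>2) + sqrt (Q + B\<^sup>2)"
proof -
  have "x\<^sup>2 \<le> B\<^sup>2" using assms by (intro power_mono) auto
  then have "sqrt (1 + x\<^sup>2) \<le> sqrt (1 + B\<^sup>2)" "sqrt (Q + x\<^sup>2) \<le> sqrt (Q + B\<^sup>2)" by auto
  moreover have "0 \<le> sqrt (1 + x\<^sup>2)" "0 \<le> sqrt (Q + x\<^sup>2)" using assms by auto
  ultimately show ?thesis unfolding hsub_def by linarith
qed

text \<open>The geometric mean of \<open>|f|\<close> over a rotated grid is almost at least
  \<open>|f 0|\<close>; convexity and monotonicity of \<open>hsub Q (exp s)\<close> turn this into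
  an arithmetic mean, and averaging over rotations yields the integral.\<close>

lemma hsub_mean_rootfn:
  assumes Q: "Q \<ge> 1" and zs: "\<forall>\<zeta>\<in>set zs. cmod \<zeta> \<noteq> 1" and u: "rootfn c zs 0 \<noteq> 0"
  shows "hsub Q (cmod (rootfn c zs 0)) \<le> (LINT t|tor. hsub Q (cmod (rootfn c zs (cis t))))"
proof -
  let ?u = "cmod (rootfn c zs 0)" and ?n = "length zs"
  let ?g = "\<lambda>t. hsub Q (cmod (rootfn c zs (cis t)))"
  have u0: "?u > 0" using u by simp
  have c0: "c \<noteq> 0" using u by (auto simp: rootfn_def)
  have gc: "continuous_on UNIV ?g" using Q by (intro hsub_cont continuous_intros rootfn_cont)
  have gp: "?g (t + 2 * pi) = ?g t" for t by (simp add: cis_mult[symmetric])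
  have nz: "cmod (rootfn c zs (cis t)) > 0" for t
  proof -
    have "rootfn c zs (cis t) \<noteq> 0" using zs c0
    proof (induction zs)
      case (Cons \<zeta> zs) then show ?case by (auto simp: rootfn_Cons)
    qed (simp add: rootfn_def)
    then show ?thesis by simp
  qed
  have gi: "integrable tor h" if "continuous_on UNIV h" "\<And>t. h (t + 2 * pi) = h t" for h :: "real \<Rightarrow> real"
  proof -
    have "bounded (h ` {0..2*pi})"
      by (intro compact_imp_bounded compact_continuous_image continuous_on_subset[OF that(1)]) auto
    then obtain B where B: "\<And>t. t \<in> {0..2*pi} \<Longrightarrow> \<bar>h t\<bar> \<le> B"
      unfolding bounded_iff by (metis imageI real_norm_def)
    show ?thesis
    proof (rule torus.integrable_const_bound[where B=B])
      show "AE x in tor. norm (h x) \<le> B"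
        unfolding torus_measure_def by (rule AE_uniform_measureI) (use B in auto)
      show "h \<in> borel_measurable tor" using borel_measurable_continuous_onI[OF that(1)] by (simp cong: measurable_cong_sets)
    qed
  qed
  have key: "hsub Q (?u * (1 - \<delta>) ^ ?n) \<le> (LINT t|tor. ?g t)" if \<delta>: "0 < \<delta>" "\<delta> < 1" for \<delta>
  proof -
    obtain j where j: "\<And>t. (1 - \<delta>) ^ ?n * ?u ^ (2^j) \<le> (\<Prod>k<2^j. cmod (rootfn c zs (cis (t + 2 * pi * real k / 2^j))))"
      using eventually_happens[OF rootfn_grid_lower[OF zs \<delta>, of c]] by auto
    have M: "real (2^j) \<ge> 1" "real (2^j) > 0" by auto
    have pt: "hsub Q (?u * (1 - \<delta>) ^ ?n) \<le> (\<Sum>k<2^j. ?g (t + 2 * pi * real k / real (2^j))) / real (2^j)" for t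
    proof -
      define x where "x k = cmod (rootfn c zs (cis (t + 2 * pi * real k / real (2^j))))" for k
      have x0: "x k > 0" for k unfolding x_def by (rule nz)
      have px: "(1 - \<delta>) ^ ?n * ?u ^ (2^j) \<le> (\<Prod>k<2^j. x k)" unfolding x_def using j[of t] by simp
      have "ln ((1 - \<delta>) ^ ?n * ?u ^ (2^j)) \<le> ln (\<Prod>k<2^j. x k)"
        using px \<delta> u0 by (intro ln_mono) auto
      also have "ln (\<Prod>k<2^j. x k) = (\<Sum>k<2^j. ln (x k))"
        by (intro ln_prod) (simp_all add: less_imp_neq[OF x0, symmetric])
      also have "ln ((1 - \<delta>) ^ ?n * ?u ^ (2^j)) = ?n * ln (1 - \<delta>) + 2^j * ln ?u"
        using \<delta> u0 by (simp add: ln_mult ln_realpow)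
      finally have a: "?n * ln (1 - \<delta>) + 2^j * ln ?u \<le> (\<Sum>k<2^j. ln (x k))" .
      \<comment> \<open>The \<open>2^j\<close>-th root of \<open>(1 - \<delta>) ^ ?n\<close> is
        weakened to the power itself, since \<open>\<delta>\<close> tends to 0 at the end
        anyway.\<close>
      have "?n * ln (1 - \<delta>) \<le> 0" using \<delta> by (intro mult_nonneg_nonpos) auto
      then have "2^j * (?n * ln (1 - \<delta>)) \<le> 1 * (?n * ln (1 - \<delta>))" using M by (intro mult_right_mono_neg) auto
      then have "2^j * (ln ?u + ?n * ln (1 - \<delta>)) \<le> (\<Sum>k<2^j. ln (x k))" using a by (simp add: algebra_simps)
      then have b: "ln ?u + ?n * ln (1 - \<delta>) \<le> (\<Sum>k<2^j. ln (x k)) / 2^j" by (simp add: pos_le_divide_eq mult.commute)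
      have "?u * (1 - \<delta>) ^ ?n = exp (ln ?u + ?n * ln (1 - \<delta>))"
        using \<delta> u0 by (simp add: exp_add exp_of_nat_mult)
      also have "\<dots> \<le> exp ((\<Sum>k<2^j. ln (x k)) / 2^j)" using b by simp
      finally have "hsub Q (?u * (1 - \<delta>) ^ ?n) \<le> hsub Q (exp ((\<Sum>k<2^j. ln (x k)) / 2^j))"
        using Q \<delta> u0 by (intro hsub_mono) auto
      also have "(\<Sum>k<2^j. ln (x k)) / 2^j = (\<Sum>k\<in>{..<2^j::nat}. (1 / 2^j) *\<^sub>R ln (x k))"
        by (simp add: sum_divide_distrib)
      also have "hsub Q (exp (\<Sum>k\<in>{..<2^j::nat}. (1 / 2^j) *\<^sub>R ln (x k))) \<le> (\<Sum>k\<in>{..<2^j::nat}. (1 / 2^j) * hsub Q (exp (ln (x k))))"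
        by (rule convex_on_sum[OF _ _ hsub_convex[OF Q]]) (auto simp: lessThan_empty_iff)
      also have "\<dots> = (\<Sum>k<2^j. hsub Q (x k)) / real (2^j)" using x0 by (simp add: sum_divide_distrib)
      finally show ?thesis unfolding x_def .
    qed
    have ci: "continuous_on UNIV (\<lambda>t. (\<Sum>k<2^j. ?g (t + 2 * pi * real k / real (2^j))) / real (2^j))"
      by (intro continuous_intros continuous_on_compose2[OF gc]) auto
    have pi': "(\<Sum>k<2^j. ?g ((t + 2 * pi) + 2 * pi * real k / real (2^j))) / real (2^j) = (\<Sum>k<2^j. ?g (t + 2 * pi * real k / real (2^j))) / real (2^j)" for t
    proof -
      have "?g ((t + 2 * pi) + s) = ?g (t + s)" for s using gp[of "t + s"] by (simp add: add_ac)
      then show ?thesis by simp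
    qed
    have "hsub Q (?u * (1 - \<delta>) ^ ?n) = (LINT t|tor. hsub Q (?u * (1 - \<delta>) ^ ?n))"
      using torus.prob_space by simp
    also have "\<dots> \<le> (LINT t|tor. (\<Sum>k<2^j. ?g (t + 2 * pi * real k / real (2^j))) / real (2^j))"
      by (intro integral_mono pt gi ci pi' torus.integrable_const)
    also have "\<dots> = (LINT t|tor. ?g t)" by (rule torus_grid[OF gc gp]) simp
    finally show ?thesis .
  qed
  have "(\<lambda>m. hsub Q (?u * (1 - 1 / real (m + 2)) ^ ?n)) \<longlonglongrightarrow> hsub Q (?u * (1 - 0) ^ ?n)"
  proof -
    have "(\<lambda>m. 1 / real (m + 2)) \<longlonglongrightarrow> 0" using LIMSEQ_ignore_initial_segment[OF lim_1_over_n, of 2] by simp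
    then show ?thesis unfolding hsub_def by (intro tendsto_intros)
  qed
  then show ?thesis
    using LIMSEQ_le_const2[of _ "hsub Q ?u" "LINT t|tor. ?g t"] key by simp
qed

lemma complex_poly_rootfn:
  fixes p :: "complex poly"
  shows "\<exists>zs. \<forall>z. poly p z = rootfn (lead_coeff p) zs z"
proof -
  obtain A where A: "p = smult (lead_coeff p) (\<Prod>x\<in>#A. [:-x, 1:])"
    using complex_poly_decompose_multiset[of p] by metis
  obtain zs where zs: "A = mset zs" using ex_mset by metis
  have "poly (\<Prod>x\<in>#mset zs. [:-x, 1:]) z = (\<Prod>\<zeta>\<leftarrow>zs. z - \<zeta>)" for z :: complex
    by (induction zs) (auto simp: algebra_simps)
  then have "poly p z = rootfn (lead_coeff p) zs z" for z
    unfolding rootfn_def by (subst A) (simp add: zs)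
  then show ?thesis by blast
qed

lemma rootfn_scale:
  assumes "r \<noteq> 0"
  shows "rootfn c zs (of_real r * z) = rootfn (c * of_real r ^ length zs) (map (\<lambda>\<zeta>. \<zeta> / of_real r) zs) z"
  using assms by (induction zs) (auto simp: rootfn_def field_simps)

text \<open>Roots on the circle are avoided by shrinking to radii \<open>r m < 1\<close>, which
  eventually miss the moduli of all roots; dominated convergence leads back to the circle.\<close>

lemma hsub_mean_poly:
  fixes p :: "complex poly"
  assumes Q: "Q \<ge> 1" and u: "poly p 0 \<noteq> 0"
  shows "hsub Q (cmod (poly p 0)) \<le> (LINT t|tor. hsub Q (cmod (poly p (cis t))))"
proof -
  obtain zs where zs: "\<And>z. poly p z = rootfn (lead_coeff p) zs z" using complex_poly_rootfn by blast
  define r where "r m = 1 - 1 / real (m + 2)" for m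
  have r: "r m > 0" "r m < 1" for m by (auto simp: r_def)
  have rl: "r \<longlonglongrightarrow> 1"
    unfolding r_def using tendsto_diff[OF tendsto_const[of 1] LIMSEQ_ignore_initial_segment[OF lim_1_over_n, of 2]] by simp
  have ev: "\<forall>\<^sub>F m in sequentially. \<forall>\<zeta>\<in>set zs. cmod \<zeta> \<noteq> r m"
  proof (rule eventually_ball_finite)
    show "\<forall>\<zeta>\<in>set zs. \<forall>\<^sub>F m in sequentially. cmod \<zeta> \<noteq> r m"
    proof
      fix \<zeta>
      show "\<forall>\<^sub>F m in sequentially. cmod \<zeta> \<noteq> r m"
      proof (cases "cmod \<zeta> = 1")
        case True then show ?thesis using r(2) by (metis (mono_tags, lifting) always_eventually less_irrefl)
      next
        case False
        then show ?thesis using tendsto_imp_eventually_ne[OF rl, of "cmod \<zeta>"] by (auto elim: eventually_mono)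
      qed
    qed
  qed simp
  have le: "\<forall>\<^sub>F m in sequentially. hsub Q (cmod (poly p 0)) \<le> (LINT t|tor. hsub Q (cmod (poly p (of_real (r m) * cis t))))"
    using ev
  proof eventually_elim
    case (elim m)
    let ?c = "lead_coeff p * of_real (r m) ^ length zs" and ?zs = "map (\<lambda>\<zeta>. \<zeta> / of_real (r m)) zs"
    have e: "rootfn ?c ?zs z = poly p (of_real (r m) * z)" for z
      using rootfn_scale[of "r m" "lead_coeff p" zs z] r(1)[of m] by (simp add: zs)
    have "\<forall>\<zeta>\<in>set ?zs. cmod \<zeta> \<noteq> 1" using elim r(1)[of m] by (auto simp: norm_divide)
    from hsub_mean_rootfn[OF Q this, of ?c] show ?case unfolding e using u by simp
  qed
  obtain B where B: "\<And>z. cmod z \<le> 1 \<Longrightarrow> cmod (poly p z) \<le> B"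
  proof -
    have "bounded (poly p ` cball 0 1)"
      by (intro compact_imp_bounded compact_continuous_image continuous_intros) auto
    then show ?thesis using that unfolding bounded_iff by (metis imageI mem_cball_0)
  qed
  have meas: "(\<lambda>t. hsub Q (cmod (poly p (of_real s * cis t)))) \<in> borel_measurable tor" for s
    using borel_measurable_continuous_onI[OF hsub_cont[OF Q, of UNIV "\<lambda>t. cmod (poly p (of_real s * cis t))"]]
    by (simp add: continuous_intros cong: measurable_cong_sets)
  have "(\<lambda>m. LINT t|tor. hsub Q (cmod (poly p (of_real (r m) * cis t)))) \<longlonglongrightarrow> (LINT t|tor. hsub Q (cmod (poly p (of_real 1 * cis t))))"
  proof (rule integral_dominated_convergence[where w="\<lambda>_. 2 * sqrt (1 + B\<^sup>2) + sqrt (Q + B\<^sup>2)"])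
    show "AE t in tor. (\<lambda>m. hsub Q (cmod (poly p (of_real (r m) * cis t)))) \<longlonglongrightarrow> hsub Q (cmod (poly p (of_real 1 * cis t)))"
      unfolding hsub_def by (intro AE_I2 tendsto_intros rl)
    show "AE t in tor. norm (hsub Q (cmod (poly p (of_real (r m) * cis t)))) \<le> 2 * sqrt (1 + B\<^sup>2) + sqrt (Q + B\<^sup>2)" for m
    proof (intro AE_I2)
      fix t
      have "cmod (of_real (r m) * cis t) \<le> 1" using r[of m] by (simp add: norm_mult)
      then show "norm (hsub Q (cmod (poly p (of_real (r m) * cis t)))) \<le> 2 * sqrt (1 + B\<^sup>2) + sqrt (Q + B\<^sup>2)"
        using hsub_bound[OF Q, of "cmod (poly p (of_real (r m) * cis t))" B] B by simp
    qed
  qed (use meas[of 1] meas in auto)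
  from tendsto_lowerbound[OF this le] show ?thesis by simp
qed

text \<open>The sub-mean value property of \<open>hsub\<close>, rearranged. It limits how much
  faster the mean of \<open>sqrt (Q + |f|^2)\<close> can grow than that of
  \<open>sqrt (1 + |f|^2)\<close>. At a zero of \<open>f\<close> in the centre no logarithm exists,
  and the pointwise bound \<open>phi_q_upper\<close> replaces it.\<close>

lemma phi_mean_gap:
  fixes p :: "complex poly"
  assumes Q: "Q \<ge> 1"
  shows "(LINT t|tor. sqrt (Q + (cmod (poly p (cis t)))\<^sup>2)) - sqrt (Q + (cmod (poly p 0))\<^sup>2)
    \<le> 2 * ((LINT t|tor. sqrt (1 + (cmod (poly p (cis t)))\<^sup>2)) - sqrt (1 + (cmod (poly p 0))\<^sup>2))"
proof -
  obtain B where B: "\<And>z. cmod z \<le> 1 \<Longrightarrow> cmod (poly p z) \<le> B"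
  proof -
    have "bounded (poly p ` cball 0 1)"
      by (intro compact_imp_bounded compact_continuous_image continuous_intros) auto
    then show ?thesis using that unfolding bounded_iff by (metis imageI mem_cball_0)
  qed
  have i: "integrable tor (\<lambda>t. sqrt (q + (cmod (poly p (cis t)))\<^sup>2))" if "q \<ge> 1" for q
  proof (rule torus_integrable[where B="sqrt (q + B\<^sup>2)"])
    show "(\<lambda>t. sqrt (q + (cmod (poly p (cis t)))\<^sup>2)) \<in> borel_measurable borel"
      by (intro borel_measurable_continuous_onI continuous_intros)
    show "norm (sqrt (q + (cmod (poly p (cis t)))\<^sup>2)) \<le> sqrt (q + B\<^sup>2)" for t
      using B[of "cis t"] that by (auto intro!: power_mono)
  qed
  show ?thesis
  proof (cases "poly p 0 = 0")
    case True
    have "(LINT t|tor. sqrt (Q + (cmod (poly p (cis t)))\<^sup>2)) \<le> (LINT t|tor. sqrt (1 + (cmod (poly p (cis t)))\<^sup>2) + (sqrt Q - 1))"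
    proof (intro integral_mono i Q Bochner_Integration.integrable_add)
      show "sqrt (Q + (cmod (poly p (cis t)))\<^sup>2) \<le> sqrt (1 + (cmod (poly p (cis t)))\<^sup>2) + (sqrt Q - 1)" for t
        using phi_q_upper[OF Q, of "cmod (poly p (cis t))"] by (simp add: phi_def)
    qed auto
    also have "\<dots> = (LINT t|tor. sqrt (1 + (cmod (poly p (cis t)))\<^sup>2)) + (sqrt Q - 1)"
      using torus.prob_space by (subst Bochner_Integration.integral_add) (auto intro: i)
    finally have "(LINT t|tor. sqrt (Q + (cmod (poly p (cis t)))\<^sup>2)) \<le> (LINT t|tor. sqrt (1 + (cmod (poly p (cis t)))\<^sup>2)) + (sqrt Q - 1)" .
    moreover have "(LINT t|tor. 1) \<le> (LINT t|tor. sqrt (1 + (cmod (poly p (cis t)))\<^sup>2))"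
      by (intro integral_mono i) auto
    ultimately show ?thesis using True torus.prob_space by simp
  next
    case False
    have "hsub Q (cmod (poly p 0)) \<le> (LINT t|tor. hsub Q (cmod (poly p (cis t))))"
      by (rule hsub_mean_poly[OF Q False])
    also have "\<dots> = 2 * (LINT t|tor. sqrt (1 + (cmod (poly p (cis t)))\<^sup>2)) - (LINT t|tor. sqrt (Q + (cmod (poly p (cis t)))\<^sup>2))"
      unfolding hsub_def using i[OF Q] i[of 1] by simp
    finally show ?thesis unfolding hsub_def by simp
  qed
qed

section \<open>Four-point inequalities and the one-step estimate for analytic polynomials\<close>

lemma sqrt_scale_le:
  assumes "0 \<le> x" "0 \<le> y" "1 \<le> k"
  shows "sqrt (x + k * y) - sqrt x \<le> k * (sqrt (x + y) - sqrt x)"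
proof (cases "y = 0")
  case False
  then have y: "y > 0" using assms by simp
  have ky: "y \<le> k * y" using assms by (simp add: mult_le_cancel_right1)
  have e: "sqrt (x + w) - sqrt x = w / (sqrt (x + w) + sqrt x)" if "w > 0" for w
  proof -
    have p: "sqrt (x + w) + sqrt x > 0" using that assms by (intro add_pos_nonneg) auto
    have "(sqrt (x + w) - sqrt x) * (sqrt (x + w) + sqrt x) = w"
      using that assms by (simp add: algebra_simps flip: power2_eq_square)
    then show ?thesis using p by (simp add: field_simps)
  qed
  have "k * y / (sqrt (x + k * y) + sqrt x) \<le> k * y / (sqrt (x + y) + sqrt x)"
    using assms y ky by (intro divide_left_mono add_mono mult_pos_pos add_pos_nonneg) (auto intro!: add_nonneg_pos mult_pos_pos)
  then show ?thesis using e[of "k * y"] e[of y] y assms ky by simp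
qed simp

lemma sqrt_pair_lower:
  assumes "0 \<le> B" "B\<^sup>2 \<le> A\<^sup>2 - x\<^sup>2" "\<bar>x\<bar> \<le> A"
  shows "sqrt (2 * A + 2 * B) \<le> sqrt (A + x) + sqrt (A - x)"
proof (rule real_le_lsqrt)
  have a: "0 \<le> A + x" "0 \<le> A - x" using assms by auto
  then show "0 \<le> sqrt (A + x) + sqrt (A - x)" by simp
  have "B \<le> sqrt ((A + x) * (A - x))"
    using assms by (intro real_le_rsqrt) (simp add: power2_eq_square algebra_simps)
  then have "B \<le> sqrt (A + x) * sqrt (A - x)" by (simp add: real_sqrt_mult)
  moreover have "(sqrt (A + x) + sqrt (A - x))\<^sup>2 = 2 * A + 2 * (sqrt (A + x) * sqrt (A - x))"
    using a by (simp add: power2_sum)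
  ultimately show "2 * A + 2 * B \<le> (sqrt (A + x) + sqrt (A - x))\<^sup>2" by simp
qed

lemma cmod_add_sq: "(cmod (u + c))\<^sup>2 = (cmod u)\<^sup>2 + (cmod c)\<^sup>2 + 2 * Re (cnj u * c)"
  by (simp only: cmod_power2) (simp add: power2_eq_square algebra_simps)

text \<open>With \<open>A = r + |c|^2\<close> and \<open>x = 2 Re (cnj u * c)\<close> the two
  radicands are \<open>A + x\<close> and \<open>A - x\<close>. The first bound always holds; the
  second gains \<open>|c|^2 / 2\<close> when \<open>c\<close> makes an angle of at least 45 degrees
  with the line through \<open>u\<close>.\<close>

lemma sqrt_pair_cmod:
  fixes u c :: complex
  defines "r \<equiv> 1 + (cmod u)\<^sup>2"
  shows "2 * sqrt r \<le> sqrt (1 + (cmod (u + c))\<^sup>2) + sqrt (1 + (cmod (u - c))\<^sup>2)"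
    and "2 * (Re (cnj u * c))\<^sup>2 \<le> (cmod u)\<^sup>2 * (cmod c)\<^sup>2 \<Longrightarrow>
      2 * sqrt (r + (cmod c)\<^sup>2 / 2) \<le> sqrt (1 + (cmod (u + c))\<^sup>2) + sqrt (1 + (cmod (u - c))\<^sup>2)"
proof -
  define A where "A = r + (cmod c)\<^sup>2"
  define x where "x = 2 * Re (cnj u * c)"
  have e: "1 + (cmod (u + c))\<^sup>2 = A + x" "1 + (cmod (u - c))\<^sup>2 = A - x"
    using cmod_add_sq[of u c] cmod_add_sq[of u "-c"] by (auto simp: A_def x_def r_def)
  have "\<bar>Re (cnj u * c)\<bar> \<le> cmod u * cmod c" using abs_Re_le_cmod[of "cnj u * c"] by (simp add: norm_mult)
  then have "\<bar>Re (cnj u * c)\<bar>\<^sup>2 \<le> (cmod u * cmod c)\<^sup>2" by (intro power_mono) auto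
  moreover have xx: "x\<^sup>2 = 4 * (Re (cnj u * c))\<^sup>2" unfolding x_def power_mult_distrib by simp
  ultimately have x2: "x\<^sup>2 \<le> 4 * (cmod u)\<^sup>2 * (cmod c)\<^sup>2" unfolding xx power2_abs power_mult_distrib by simp
  have ur: "(cmod u)\<^sup>2 \<le> r" "0 \<le> r" by (auto simp: r_def)
  have x2r: "x\<^sup>2 \<le> 4 * r * (cmod c)\<^sup>2" using x2 ur by (meson mult_left_mono mult_right_mono order_trans zero_le_numeral zero_le_power2)
  have A0: "0 \<le> A" using ur by (simp add: A_def)
  have xA: "\<bar>x\<bar> \<le> A"
  proof (rule abs_le_square_iff[THEN iffD2, of x A, simplified abs_of_nonneg[OF A0]])
    have "0 \<le> (r - (cmod c)\<^sup>2)\<^sup>2" by simp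
    then show "x\<^sup>2 \<le> A\<^sup>2" using x2r by (simp add: A_def power2_eq_square algebra_simps)
  qed
  have "sqrt (2 * A + 2 * \<bar>r - (cmod c)\<^sup>2\<bar>) \<le> sqrt (A + x) + sqrt (A - x)"
    using x2r xA by (intro sqrt_pair_lower) (auto simp: A_def power2_eq_square algebra_simps)
  moreover have "2 * sqrt r = sqrt (4 * r)" by (simp add: real_sqrt_mult)
  moreover have "sqrt (4 * r) \<le> sqrt (2 * A + 2 * \<bar>r - (cmod c)\<^sup>2\<bar>)"
    using abs_ge_self[of "r - (cmod c)\<^sup>2"] by (simp add: A_def algebra_simps)
  ultimately show "2 * sqrt r \<le> sqrt (1 + (cmod (u + c))\<^sup>2) + sqrt (1 + (cmod (u - c))\<^sup>2)" unfolding e by linarith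
  assume "2 * (Re (cnj u * c))\<^sup>2 \<le> (cmod u)\<^sup>2 * (cmod c)\<^sup>2"
  then have "x\<^sup>2 \<le> 2 * ((cmod u)\<^sup>2 * (cmod c)\<^sup>2)" unfolding xx by linarith
  also have "\<dots> \<le> 2 * (r * (cmod c)\<^sup>2)" using ur by (intro mult_left_mono mult_right_mono) auto
  finally have "r\<^sup>2 \<le> A\<^sup>2 - x\<^sup>2" by (simp add: A_def power2_eq_square algebra_simps add_increasing2)
  then have "sqrt (2 * A + 2 * r) \<le> sqrt (A + x) + sqrt (A - x)" using xA ur by (intro sqrt_pair_lower)
  moreover have "2 * sqrt (r + (cmod c)\<^sup>2 / 2) = sqrt (2 * A + 2 * r)"
  proof -
    have q: "2 * A + 2 * r = 4 * (r + (cmod c)\<^sup>2 / 2)" by (simp add: A_def)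
    show ?thesis unfolding q real_sqrt_mult by simp
  qed
  ultimately show "2 * sqrt (r + (cmod c)\<^sup>2 / 2) \<le> sqrt (1 + (cmod (u + c))\<^sup>2) + sqrt (1 + (cmod (u - c))\<^sup>2)" unfolding e by simp
qed

text \<open>The squares of \<open>Re (cnj u * c)\<close> and \<open>Re (cnj u * (\<i> * c))\<close>
  add up to \<open>|u|^2 |c|^2\<close>, so one of the directions \<open>c\<close> and
  \<open>\<i> * c\<close> always satisfies the condition for the gain.\<close>

lemma four_point:
  fixes u c :: complex
  shows "2 * sqrt (1 + (cmod u)\<^sup>2) + 2 * sqrt (1 + (cmod u)\<^sup>2 + (cmod c)\<^sup>2 / 2)
    \<le> sqrt (1 + (cmod (u + c))\<^sup>2) + sqrt (1 + (cmod (u - c))\<^sup>2) + sqrt (1 + (cmod (u + \<i> * c))\<^sup>2) + sqrt (1 + (cmod (u - \<i> * c))\<^sup>2)"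
proof -
  have n: "cmod (\<i> * c) = cmod c" by (simp add: norm_mult)
  have "(Re (cnj u * c))\<^sup>2 + (Re (cnj u * (\<i> * c)))\<^sup>2 = (cmod (cnj u * c))\<^sup>2"
    unfolding cmod_power2 by (simp add: power2_eq_square algebra_simps)
  then have s: "(Re (cnj u * c))\<^sup>2 + (Re (cnj u * (\<i> * c)))\<^sup>2 = (cmod u)\<^sup>2 * (cmod c)\<^sup>2"
    by (simp add: norm_mult power_mult_distrib)
  show ?thesis
  proof (cases "2 * (Re (cnj u * c))\<^sup>2 \<le> (cmod u)\<^sup>2 * (cmod c)\<^sup>2")
    case True
    then show ?thesis using sqrt_pair_cmod(2)[of u c] sqrt_pair_cmod(1)[of u "\<i> * c"] by linarith
  next
    case False
    then have "2 * (Re (cnj u * (\<i> * c)))\<^sup>2 \<le> (cmod u)\<^sup>2 * (cmod (\<i> * c))\<^sup>2" using s n by simp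
    then show ?thesis using sqrt_pair_cmod(2)[of u "\<i> * c"] sqrt_pair_cmod(1)[of u c] unfolding n by linarith
  qed
qed

lemma torus_coeff:
  fixes a :: "nat \<Rightarrow> complex" and m :: int
  shows "(LINT t|tor. (\<Sum>n<R. a n * cis (real n * t)) * cis (- of_int m * t)) = (if 0 \<le> m \<and> nat m < R then a (nat m) else 0)"
proof -
  have i: "integrable tor (\<lambda>t. a n * cis (of_int (int n - m) * t))" for n
    using tp_integrable[OF tp_cis[of "int n - m" "int n - m" "int n - m"]] by simp
  have e: "(\<Sum>n<R. a n * cis (real n * t)) * cis (- of_int m * t) = (\<Sum>n<R. a n * cis (of_int (int n - m) * t))" for t
    unfolding sum_distrib_right
    by (rule sum.cong) (auto simp: cis_mult algebra_simps)
  have "(LINT t|tor. (\<Sum>n<R. a n * cis (of_int (int n - m) * t))) = (\<Sum>n<R. a n * (LINT t|tor. cis (of_int (int n - m) * t)))"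
    using i by (subst Bochner_Integration.integral_sum) auto
  also have "\<dots> = (\<Sum>n<R. if int n = m then a n else 0)"
    unfolding torus_integral_cis by (rule sum.cong) auto
  also have "\<dots> = (if 0 \<le> m \<and> nat m < R then a (nat m) else 0)"
  proof (cases "0 \<le> m")
    case True
    then have "(\<Sum>n<R. if int n = m then a n else 0) = (\<Sum>n<R. if n = nat m then a n else 0)" by (intro sum.cong) auto
    then show ?thesis using True by simp
  next
    case False
    then have "(\<Sum>n<R. if int n = m then a n else 0) = 0" by (intro sum.neutral) auto
    then show ?thesis using False by simp
  qed
  finally show ?thesis unfolding e .
qed

text \<open>The four-point inequality for \<open>c * cis t\<close>, averaged over \<open>t\<close>:
  by \<open>torus_grid\<close> the four quarter turns have the same mean.\<close>

lemma torus_linear_lower: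
  fixes u c :: complex
  shows "sqrt (1 + (cmod u)\<^sup>2) + sqrt (1 + (cmod u)\<^sup>2 + (cmod c)\<^sup>2 / 2) \<le> 2 * (LINT t|tor. sqrt (1 + (cmod (u + c * cis t))\<^sup>2))"
proof -
  let ?g = "\<lambda>t. sqrt (1 + (cmod (u + c * cis t))\<^sup>2)"
  have c: "continuous_on UNIV ?g" by (intro continuous_intros)
  have p: "?g (t + 2 * pi) = ?g t" for t by (simp add: cis_mult[symmetric])
  have b: "norm (?g t) \<le> sqrt (1 + (cmod u + cmod c)\<^sup>2)" for t
  proof -
    have "cmod (u + c * cis t) \<le> cmod u + cmod c" by (rule order_trans[OF norm_triangle_ineq]) (simp add: norm_mult)
    then show ?thesis by (auto intro!: power_mono)
  qed
  have i: "integrable tor (\<lambda>t. ?g (t + s))" for s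
    by (rule torus_integrable[where B="sqrt (1 + (cmod u + cmod c)\<^sup>2)"]) (use b in \<open>auto intro!: borel_measurable_continuous_onI continuous_intros simp del: real_norm_def\<close>)
  have "sqrt (1 + (cmod u)\<^sup>2) + sqrt (1 + (cmod u)\<^sup>2 + (cmod c)\<^sup>2 / 2) =
    (LINT t|tor. sqrt (1 + (cmod u)\<^sup>2) + sqrt (1 + (cmod u)\<^sup>2 + (cmod c)\<^sup>2 / 2))" using torus.prob_space by simp
  also have "\<dots> \<le> (LINT t|tor. 2 * ((\<Sum>k<4. ?g (t + 2 * pi * real k / real 4)) / real 4))"
  proof (rule integral_mono)
    show "integrable tor (\<lambda>t. 2 * ((\<Sum>k<4. ?g (t + 2 * pi * real k / real 4)) / real 4))"
      using i by (auto intro!: Bochner_Integration.integrable_sum)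
    fix t
    have "cis (pi / 2) = \<i>" by (simp add: complex_eq_iff)
    moreover have "cis (pi * 3 / 2) = - \<i>"
    proof -
      have "cis (pi * 3 / 2) = cis (pi / 2) * cis pi" unfolding cis_mult by (simp add: field_simps)
      then show ?thesis using \<open>cis (pi / 2) = \<i>\<close> by simp
    qed
    ultimately have "(\<Sum>k<4. ?g (t + 2 * pi * real k / real 4)) =
       ?g t + sqrt (1 + (cmod (u + \<i> * (c * cis t)))\<^sup>2) + sqrt (1 + (cmod (u - c * cis t))\<^sup>2) + sqrt (1 + (cmod (u - \<i> * (c * cis t)))\<^sup>2)"
      by (simp add: eval_nat_numeral cis_mult[symmetric] mult_ac)
    then show "sqrt (1 + (cmod u)\<^sup>2) + sqrt (1 + (cmod u)\<^sup>2 + (cmod c)\<^sup>2 / 2) \<le> 2 * ((\<Sum>k<4. ?g (t + 2 * pi * real k / real 4)) / real 4)"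
      using four_point[of u "c * cis t"] by (simp add: norm_mult)
  qed auto
  also have "\<dots> = 2 * (LINT t|tor. ?g t)"
    using torus_grid[OF c p, of 4] by simp
  finally show ?thesis .
qed

lemma norm_lint_le_kernel:
  fixes f K :: "'a \<Rightarrow> complex"
  assumes "integrable M (\<lambda>x. f x * K x)" "\<And>x. cmod (K x) \<le> k x"
  shows "ennreal (cmod (LINT x|M. f x * K x)) \<le> (\<integral>\<^sup>+ x. ennreal (k x) * ennreal (cmod (f x)) \<partial>M)"
proof -
  have k: "0 \<le> k x" for x using assms(2)[of x] norm_ge_zero order_trans by blast
  have "ennreal (cmod (LINT x|M. f x * K x)) \<le> (\<integral>\<^sup>+ x. ennreal (cmod (f x * K x)) \<partial>M)"
    by (rule integral_norm_bound_ennreal) fact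
  also have "\<dots> \<le> (\<integral>\<^sup>+ x. ennreal (k x) * ennreal (cmod (f x)) \<partial>M)"
    using assms(2) k by (intro nn_integral_mono) (simp add: norm_mult mult.commute mult_left_mono mult_right_mono ennreal_leI flip: ennreal_mult)
  finally show ?thesis .
qed

lemma torus_nn_integral:
  assumes "f \<in> borel_measurable borel" "\<And>t. 0 \<le> f t" "\<And>t. f t \<le> B"
  shows "(\<integral>\<^sup>+ t. ennreal (f t) \<partial>tor) = ennreal (LINT t|tor. f t)"
  by (rule nn_integral_eq_integral) (use assms in \<open>auto intro!: torus_integrable[where B=B]\<close>)

lemma sum_cis_bound: "cmod (\<Sum>n<R. a n * cis (real n * t)) \<le> (\<Sum>n<R. cmod (a n))"
  by (rule order_trans[OF norm_sum]) (simp add: norm_mult)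

text \<open>\<open>1 + cos\<close> is the Fejer kernel of order 2: it is positive of mass 1, keeps
  \<open>a 0\<close>, halves \<open>a 1\<close> and removes higher terms, while frequency -1 is
  absent by analyticity. Jensen's inequality does the rest.\<close>

lemma analytic_first_coeff:
  fixes a :: "nat \<Rightarrow> complex"
  assumes R: "R \<ge> 2"
  shows "(LINT t|tor. phi (cmod (a 0 + (a 1 / 2) * cis t))) \<le> (LINT t|tor. phi (cmod (\<Sum>n<R. a n * cis (real n * t))))"
proof -
  define F where "F t = (\<Sum>n<R. a n * cis (real n * t))" for t
  define g where "g t = a 0 + (a 1 / 2) * cis t" for t
  have Fc: "continuous_on UNIV F" "continuous_on UNIV g" unfolding F_def g_def by (intro continuous_intros)+
  have Fm [measurable]: "F \<in> borel_measurable borel" "g \<in> borel_measurable borel" using Fc by (auto intro: borel_measurable_continuous_onI)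
  have gb: "cmod (g t) \<le> cmod (a 0) + cmod (a 1 / 2)" for t
    unfolding g_def by (rule order_trans[OF norm_triangle_ineq]) (simp add: norm_mult)
  have Fb: "cmod (F t) \<le> (\<Sum>n<R. cmod (a n))" for t unfolding F_def by (rule sum_cis_bound)
  have km: "(\<lambda>(x, y). 1 + cos (y - x)) \<in> borel_measurable (tor \<Otimes>\<^sub>M tor)"
    by (subst measurable_cong_sets[OF sets_pair_measure_cong[OF sets_torus sets_torus] refl])
      (auto simp: borel_prod split_beta' intro!: borel_measurable_continuous_onI continuous_intros)
  have K: "1 + cos s \<ge> (0::real)" for s using cos_ge_minus_one[of s] by linarith
  have one: "(\<integral>\<^sup>+ x. ennreal (1 + cos (y - x)) \<partial>tor) = 1" "(\<integral>\<^sup>+ x. ennreal (1 + cos (x - y)) \<partial>tor) = 1" for y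
  proof -
    have i: "integrable tor (\<lambda>x. cis (of_int 1 * x))" using tp_integrable[OF tp_cis[of 1 1 1 1]] by simp
    have ci: "integrable tor (\<lambda>x. cis (x - y))" "(LINT x|tor. cis (x - y)) = 0"
    proof -
      have e: "cis (x - y) = cis (of_int 1 * x) * cis (- y)" for x by (simp add: cis_mult)
      show "integrable tor (\<lambda>x. cis (x - y))" unfolding e by (intro integrable_mult_left i)
      show "(LINT x|tor. cis (x - y)) = 0" unfolding e using torus_integral_cis[of 1] by simp
    qed
    have "(LINT x|tor. cos (x - y)) = Re (LINT x|tor. cis (x - y))"
      using integral_Re[OF ci(1)] by simp
    then have c0: "(LINT x|tor. cos (x - y)) = 0" using ci(2) by simp
    have ic: "integrable tor (\<lambda>x. cos (x - y))"
      by (rule torus_integrable[where B=1]) (auto intro!: borel_measurable_continuous_onI continuous_intros)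
    have "(LINT x|tor. 1 + cos (x - y)) = 1" using c0 ic torus.prob_space by simp
    then show 2: "(\<integral>\<^sup>+ x. ennreal (1 + cos (x - y)) \<partial>tor) = 1"
      using K by (subst torus_nn_integral[where B=2]) (auto intro!: borel_measurable_continuous_onI continuous_intros)
    have "cos (y - x) = cos (x - y)" for x using cos_minus[of "x - y"] by simp
    with 2 show "(\<integral>\<^sup>+ x. ennreal (1 + cos (y - x)) \<partial>tor) = 1" by simp
  qed
  have "(\<integral>\<^sup>+ y. ennreal (phi (cmod (g y))) \<partial>tor) \<le> ennreal (1\<^sup>2) * (\<integral>\<^sup>+ x. ennreal (phi (cmod (F x))) \<partial>tor)"
  proof (rule phi_kernel[where k="\<lambda>x y. 1 + cos (y - x)"])
    fix y
    have Fcis: "integrable tor (\<lambda>x. F x * cis (- of_int m * x))" for m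
      by (rule torus_integrable[where B="\<Sum>n<R. cmod (a n)"])
        (auto simp: norm_mult Fb intro!: borel_measurable_continuous_onI continuous_intros Fc)
    have "F x * of_real (1 + cos (y - x)) = F x * cis (- of_int 0 * x) + (cis y / 2) * (F x * cis (- of_int 1 * x)) + (cis (-y) / 2) * (F x * cis (- of_int (-1) * x))" for x
    proof -
      have "cplx (1 + cos (y - x)) = 1 + (cis (y - x) + cis (- (y - x))) / 2"
        by (simp add: complex_eq_iff cos_diff sin_diff)
      also have "\<dots> = 1 + (cis y * cis (-x) + cis (-y) * cis x) / 2" by (simp add: cis_mult)
      finally have "F x * of_real (1 + cos (y - x)) = F x * (1 + (cis y * cis (-x) + cis (-y) * cis x) / 2)" by (rule arg_cong)
      then show ?thesis by (simp add: distrib_left add_divide_distrib mult_ac del: of_real_add)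
    qed
    then have "(LINT x|tor. F x * of_real (1 + cos (y - x))) =
       (LINT x|tor. F x * cis (- of_int 0 * x)) + (cis y / 2) * (LINT x|tor. F x * cis (- of_int 1 * x)) + (cis (-y) / 2) * (LINT x|tor. F x * cis (- of_int (-1) * x))"
      using Fcis by (simp del: of_int_0 of_int_1 of_int_minus)
    also have "\<dots> = g y" unfolding F_def torus_coeff g_def using R by (simp add: mult.commute)
    finally have e: "g y = (LINT x|tor. F x * of_real (1 + cos (y - x)))" by simp
    show "ennreal (cmod (g y)) \<le> (\<integral>\<^sup>+ x. ennreal (1 + cos (y - x)) * ennreal (cmod (F x)) \<partial>tor)"
      unfolding e
    proof (rule norm_lint_le_kernel)
      show "integrable tor (\<lambda>x. F x * of_real (1 + cos (y - x)))"
      proof (rule torus_integrable[where B="(\<Sum>n<R. cmod (a n)) * 2"])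
        show "(\<lambda>x. F x * of_real (1 + cos (y - x))) \<in> borel_measurable borel"
          by (intro borel_measurable_continuous_onI continuous_intros Fc)
        show "norm (F x * of_real (1 + cos (y - x))) \<le> (\<Sum>n<R. cmod (a n)) * 2" for x
          unfolding norm_mult norm_of_real using K[of "y - x"] cos_le_one[of "y - x"] by (intro mult_mono Fb) (auto intro: sum_nonneg)
      qed
      show "cmod (of_real (1 + cos (y - x))) \<le> 1 + cos (y - x)" for x using K[of "y - x"] by (simp del: of_real_add)
    qed
  qed (use K km one prob_space_imp_sigma_finite[OF prob_space_torus] in auto)
  moreover have L: "(\<integral>\<^sup>+ y. ennreal (phi (cmod (h y))) \<partial>tor) = ennreal (LINT y|tor. phi (cmod (h y)))"
    if "h \<in> borel_measurable borel" "\<And>t. cmod (h t) \<le> B" for h B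
    using that by (intro torus_nn_integral[where B="phi B"]) (auto intro!: phi_mono power_mono simp: phi_def)
  ultimately have "ennreal (LINT y|tor. phi (cmod (g y))) \<le> ennreal (LINT y|tor. phi (cmod (F y)))"
    unfolding L[OF Fm(1) Fb] L[OF Fm(2) gb] by simp
  then show ?thesis unfolding F_def g_def by (simp add: ennreal_le_iff Bochner_Integration.integral_nonneg)
qed

text \<open>One Bellman step; \<open>s\<close> carries the square function so far. Let
  \<open>X\<close> be the increase of the mean of \<open>sqrt (1 + |F|^2)\<close>. Passing from the
  centre to the circle costs \<open>2 X\<close> by \<open>phi_mean_gap\<close>. Inserting
  \<open>|a 1|^2\<close> costs \<open>16 X\<close>: a factor 8 for rescaling
  \<open>|a 1|^2 / 8\<close> and a factor 2 from \<open>torus_linear_lower\<close>. The sum is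
  18.\<close>

lemma analytic_step:
  fixes a :: "nat \<Rightarrow> complex"
  assumes R: "R \<ge> 2" and s: "0 \<le> s"
  defines "F \<equiv> \<lambda>t. \<Sum>n<R. a n * cis (real n * t)"
  shows "(LINT t|tor. sqrt (1 + s + (cmod (a 1))\<^sup>2 + (cmod (F t))\<^sup>2)) + 18 * sqrt (1 + (cmod (a 0))\<^sup>2)
    \<le> sqrt (1 + s + (cmod (a 0))\<^sup>2) + 18 * (LINT t|tor. sqrt (1 + (cmod (F t))\<^sup>2))"
proof -
  define p where "p = (\<Sum>n<R. monom (a n) n)"
  have pz: "poly p z = (\<Sum>n<R. a n * z ^ n)" for z by (simp add: p_def poly_sum poly_monom)
  have pF: "poly p (cis t) = F t" for t by (simp add: pz F_def Complex.DeMoivre)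
  have "(\<Sum>n<R. a n * 0 ^ n) = (\<Sum>n<R. if n = 0 then a n else 0)" by (rule sum.cong) auto
  then have p0: "poly p 0 = a 0" using R by (simp add: pz)
  let ?c = "cmod (a 1)" and ?r = "1 + (cmod (a 0))\<^sup>2"
  define X where "X = (LINT t|tor. sqrt (1 + (cmod (F t))\<^sup>2)) - sqrt ?r"
  have gap: "(LINT t|tor. sqrt (1 + s + ?c\<^sup>2 + (cmod (F t))\<^sup>2)) - sqrt (1 + s + ?c\<^sup>2 + (cmod (a 0))\<^sup>2) \<le> 2 * X"
    using phi_mean_gap[of "1 + s + ?c\<^sup>2" p] s unfolding pF p0 X_def by simp
  have i: "integrable tor (\<lambda>t. sqrt (1 + (cmod (h t))\<^sup>2))" if "continuous_on UNIV h" "\<And>t. cmod (h t) \<le> B" for h :: "real \<Rightarrow> complex" and B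
  proof (rule torus_integrable[where B="sqrt (1 + B\<^sup>2)"])
    show "(\<lambda>t. sqrt (1 + (cmod (h t))\<^sup>2)) \<in> borel_measurable borel"
      by (intro borel_measurable_continuous_onI continuous_intros that)
    show "norm (sqrt (1 + (cmod (h t))\<^sup>2)) \<le> sqrt (1 + B\<^sup>2)" for t using that(2) by (auto intro: power_mono)
  qed
  have F1: "continuous_on UNIV F" "\<And>t. cmod (F t) \<le> (\<Sum>n<R. cmod (a n))"
    unfolding F_def by (auto intro!: continuous_intros sum_cis_bound)
  have g1: "continuous_on UNIV (\<lambda>t. a 0 + (a 1 / 2) * cis t)" "\<And>t. cmod (a 0 + (a 1 / 2) * cis t) \<le> cmod (a 0) + cmod (a 1 / 2)"
    by (auto intro!: continuous_intros order_trans[OF norm_triangle_ineq] simp: norm_mult)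
  have "(LINT t|tor. sqrt (1 + (cmod (a 0 + (a 1 / 2) * cis t))\<^sup>2)) \<le> (LINT t|tor. sqrt (1 + (cmod (F t))\<^sup>2))"
    using analytic_first_coeff[OF R, of a] i[OF g1] i[OF F1] torus.prob_space
    unfolding phi_def F_def by simp
  from order_trans[OF torus_linear_lower[of "a 0" "a 1 / 2"] mult_left_mono[OF this, of 2]]
  have "sqrt ?r + sqrt (?r + (cmod (a 1 / 2))\<^sup>2 / 2) \<le> 2 * (X + sqrt ?r)" by (simp add: X_def)
  then have X: "sqrt (?r + ?c\<^sup>2 / 8) - sqrt ?r \<le> 2 * X" by (simp add: norm_divide power_divide)
  have "sqrt (1 + s + ?c\<^sup>2 + (cmod (a 0))\<^sup>2) - sqrt (1 + s + (cmod (a 0))\<^sup>2) \<le> sqrt (?r + ?c\<^sup>2) - sqrt ?r"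
    using sqrt_diff_antimono[of ?r "1 + s + (cmod (a 0))\<^sup>2" "?c\<^sup>2"] s by (simp add: algebra_simps)
  also have "\<dots> \<le> 8 * (sqrt (?r + ?c\<^sup>2 / 8) - sqrt ?r)"
    using sqrt_scale_le[of ?r "?c\<^sup>2 / 8" 8] by simp
  also have "\<dots> \<le> 8 * (2 * X)" by (rule mult_left_mono[OF X]) simp
  finally show ?thesis using gap unfolding X_def by simp
qed

subsection \<open>Modular sums of blocks\<close>

text \<open>One carrier for trees and polynomials, so that mixed direct sums can be formed and the
  decomposition argument is needed only once.\<close>

type_synonym vec = "nat \<Rightarrow> nat \<Rightarrow> complex"
type_synonym block = "vec set \<times> (vec \<Rightarrow> ennreal)"

definition vsc :: "complex \<Rightarrow> vec \<Rightarrow> vec" where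
  "vsc c x = (\<lambda>j p. c * x j p)"

lemma vsc_diff: "vsc c (x - y) = vsc c x - vsc c y"
  by (simp add: vsc_def fun_eq_iff fun_diff_def algebra_simps)

lemma vsc_minus_one: "vsc (-1) x = - x"
  by (simp add: vsc_def fun_eq_iff fun_Compl_def)

lemma vsc_zero [simp]: "vsc c 0 = 0"
  by (simp add: vsc_def fun_eq_iff zero_fun_def)

text \<open>A complex vector space with a modular that has quasi-triangle constant 2 and at most
  quadratic growth under scalars: the properties inherited from \<open>phi\<close>.\<close>

definition good_block :: "block \<Rightarrow> bool" where
  "good_block A \<longleftrightarrow> 0 \<in> fst A \<and> (\<forall>x\<in>fst A. \<forall>y\<in>fst A. x + y \<in> fst A) \<and>
     (\<forall>c. \<forall>x\<in>fst A. vsc c x \<in> fst A) \<and> snd A 0 = 0 \<and>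
     (\<forall>x\<in>fst A. \<forall>y\<in>fst A. snd A (x + y) \<le> 2 * snd A x + 2 * snd A y) \<and>
     (\<forall>c. \<forall>x\<in>fst A. snd A (vsc c x) \<le> ennreal (max 1 ((cmod c)\<^sup>2)) * snd A x)"

definition lin_on :: "vec set \<Rightarrow> (vec \<Rightarrow> vec) \<Rightarrow> bool" where
  "lin_on S f \<longleftrightarrow> (\<forall>x\<in>S. \<forall>y\<in>S. f (x + y) = f x + f y) \<and> (\<forall>c. \<forall>x\<in>S. f (vsc c x) = vsc c (f x))"

text \<open>Uniform complementation: \<open>J\<close> embeds and \<open>P\<close> is a left inverse.
  The bounds are on modulars because these can be summed over the blocks.\<close>

definition fac :: "real \<Rightarrow> block \<Rightarrow> block \<Rightarrow> bool" where
  "fac C A B \<longleftrightarrow> (\<exists>J P. lin_on (fst A) J \<and> lin_on (fst B) P \<and>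
     (\<forall>x\<in>fst A. J x \<in> fst B \<and> P (J x) = x \<and> snd B (J x) \<le> ennreal C * snd A x) \<and>
     (\<forall>y\<in>fst B. P y \<in> fst A \<and> snd A (P y) \<le> ennreal C * snd B y))"

text \<open>An integral against counting measure rather than a series, so that sums and products of
  index types need no enumeration.\<close>

definition msum :: "('i \<Rightarrow> block) \<Rightarrow> ('i \<Rightarrow> vec) \<Rightarrow> ennreal" where
  "msum X F = (\<integral>\<^sup>+ i. snd (X i) (F i) \<partial>count_space UNIV)"

definition msp :: "('i \<Rightarrow> block) \<Rightarrow> ('i \<Rightarrow> vec) set" where
  "msp X = {F. (\<forall>i. F i \<in> fst (X i)) \<and> msum X F < \<infinity>}"

text \<open>The comparison is stated at scale 1; since \<open>T\<close> commutes with
  \<open>vsc\<close> it then holds at every scale, as \<open>ind_int_transfer\<close>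
  demands.\<close>

definition fiso :: "('i \<Rightarrow> block) \<Rightarrow> ('j \<Rightarrow> block) \<Rightarrow> bool" where
  "fiso X Y \<longleftrightarrow> (\<exists>T C. bij_betw T (msp X) (msp Y) \<and>
     (\<forall>F\<in>msp X. \<forall>G\<in>msp X. T (F + G) = T F + T G) \<and>
     (\<forall>F\<in>msp X. \<forall>c. T (\<lambda>i. vsc c (F i)) = (\<lambda>j. vsc c (T F j))) \<and> C > 0 \<and>
     (\<forall>F\<in>msp X. msum Y (T F) \<le> ennreal C * msum X F \<and> msum X F \<le> ennreal C * msum Y (T F)))"

lemma good_blockD:
  assumes "good_block A"
  shows "0 \<in> fst A" "x \<in> fst A \<Longrightarrow> y \<in> fst A \<Longrightarrow> x + y \<in> fst A"
    "x \<in> fst A \<Longrightarrow> vsc c x \<in> fst A" "snd A 0 = 0"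
    "x \<in> fst A \<Longrightarrow> y \<in> fst A \<Longrightarrow> snd A (x + y) \<le> 2 * snd A x + 2 * snd A y"
    "x \<in> fst A \<Longrightarrow> snd A (vsc c x) \<le> ennreal (max 1 ((cmod c)\<^sup>2)) * snd A x"
  using assms unfolding good_block_def by blast+

lemma good_block_diff:
  assumes "good_block A" "x \<in> fst A" "y \<in> fst A"
  shows "x - y \<in> fst A" "snd A (x - y) \<le> 2 * snd A x + 2 * snd A y"
proof -
  have m: "- y \<in> fst A" using good_blockD(3)[OF assms(1) assms(3), of "-1"] by (simp add: vsc_minus_one)
  have "snd A (- y) \<le> snd A y"
    using good_blockD(6)[OF assms(1) assms(3), of "-1"] by (simp add: vsc_minus_one)
  moreover have "snd A (x + - y) \<le> 2 * snd A x + 2 * snd A (- y)"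
    by (rule good_blockD(5)[OF assms(1,2) m])
  ultimately have "snd A (x + - y) \<le> 2 * snd A x + 2 * snd A y"
    by (meson add_left_mono mult_left_mono order_trans zero_le)
  then show "snd A (x - y) \<le> 2 * snd A x + 2 * snd A y" by (simp add: diff_conv_add_uminus del: add_uminus_conv_diff)
  show "x - y \<in> fst A" using good_blockD(2)[OF assms(1,2) m] by simp
qed

lemma msum_add_le:
  assumes "\<And>i. good_block (X i)" "F \<in> msp X" "G \<in> msp X"
  shows "msum X (F + G) \<le> 2 * msum X F + 2 * msum X G"
proof -
  have "msum X (F + G) \<le> (\<integral>\<^sup>+ i. 2 * snd (X i) (F i) + 2 * snd (X i) (G i) \<partial>count_space UNIV)"
    unfolding msum_def plus_fun_def[of F] using assms
    by (intro nn_integral_mono good_blockD(5)) (auto simp: msp_def)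
  then show ?thesis by (simp add: nn_integral_add nn_integral_cmult msum_def)
qed

lemma msp_add:
  assumes "\<And>i. good_block (X i)" "F \<in> msp X" "G \<in> msp X"
  shows "F + G \<in> msp X"
proof -
  have "2 * msum X F + 2 * msum X G < \<infinity>"
    using assms(2,3) by (auto simp: msp_def ennreal_mult_less_top)
  then have "msum X (F + G) < \<infinity>" using msum_add_le[OF assms] by (rule le_less_trans[rotated])
  then show ?thesis using assms by (auto simp: msp_def intro!: good_blockD(2)[OF assms(1)])
qed

lemma msp_scale:
  assumes "\<And>i. good_block (X i)" "F \<in> msp X"
  shows "(\<lambda>i. vsc c (F i)) \<in> msp X"
proof -
  have "msum X (\<lambda>i. vsc c (F i)) \<le> (\<integral>\<^sup>+ i. ennreal (max 1 ((cmod c)\<^sup>2)) * snd (X i) (F i) \<partial>count_space UNIV)"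
    unfolding msum_def using assms by (intro nn_integral_mono good_blockD(6)) (auto simp: msp_def)
  also have "\<dots> = ennreal (max 1 ((cmod c)\<^sup>2)) * msum X F"
    by (simp add: nn_integral_cmult msum_def)
  also have "\<dots> < \<infinity>" using assms(2) by (auto simp: msp_def ennreal_mult_less_top)
  finally show ?thesis using assms by (auto simp: msp_def intro!: good_blockD(3)[OF assms(1)])
qed

lemma fisoI:
  assumes "\<And>F. F \<in> msp X \<Longrightarrow> (\<forall>j. T F j \<in> fst (Y j)) \<and> T' (T F) = F \<and> msum Y (T F) \<le> ennreal C * msum X F"
    and "\<And>G. G \<in> msp Y \<Longrightarrow> (\<forall>i. T' G i \<in> fst (X i)) \<and> T (T' G) = G \<and> msum X (T' G) \<le> ennreal C * msum Y G"
    and "\<And>F G. F \<in> msp X \<Longrightarrow> G \<in> msp X \<Longrightarrow> T (F + G) = T F + T G"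
    and "\<And>F c. F \<in> msp X \<Longrightarrow> T (\<lambda>i. vsc c (F i)) = (\<lambda>j. vsc c (T F j))"
    and "C > 0"
  shows "fiso X Y"
proof -
  have fin: "a \<le> ennreal C * b \<Longrightarrow> b < \<infinity> \<Longrightarrow> a < \<infinity>" for a b
    by (metis ennreal_less_top ennreal_mult_less_top infinity_ennreal_def le_less_trans)
  have 1: "T F \<in> msp Y" if "F \<in> msp X" for F
    using assms(1)[OF that] that fin[of "msum Y (T F)" "msum X F"] by (auto simp: msp_def)
  have 2: "T' F \<in> msp X" if "F \<in> msp Y" for F
    using assms(2)[OF that] that fin[of "msum X (T' F)" "msum Y F"] by (auto simp: msp_def)
  have b: "bij_betw T (msp X) (msp Y)"
    by (rule bij_betw_byWitness[where f'=T']) (use assms 1 2 in auto)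
  have "msum X F \<le> ennreal C * msum Y (T F)" if "F \<in> msp X" for F
    using assms(2)[OF 1[OF that]] assms(1)[OF that] by auto
  then show ?thesis unfolding fiso_def using assms b by blast
qed

lemma fiso_sym:
  assumes g: "\<And>i. good_block (X i)" and "fiso X Y"
  shows "fiso Y X"
proof -
  obtain T C where T: "bij_betw T (msp X) (msp Y)"
     "\<And>F G. F \<in> msp X \<Longrightarrow> G \<in> msp X \<Longrightarrow> T (F + G) = T F + T G"
     "\<And>F c. F \<in> msp X \<Longrightarrow> T (\<lambda>i. vsc c (F i)) = (\<lambda>j. vsc c (T F j))" "C > 0"
     "\<And>F. F \<in> msp X \<Longrightarrow> msum Y (T F) \<le> ennreal C * msum X F \<and> msum X F \<le> ennreal C * msum Y (T F)"
    using assms(2) unfolding fiso_def by blast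
  define S where "S = inv_into (msp X) T"
  have S: "S G \<in> msp X" "T (S G) = G" if "G \<in> msp Y" for G
    using that T(1) unfolding S_def by (auto simp: bij_betw_def inv_into_into f_inv_into_f)
  have ST: "S (T F) = F" if "F \<in> msp X" for F
    using that T(1) unfolding S_def by (auto simp: bij_betw_def inv_into_f_f)
  have TY: "T F \<in> msp Y" if "F \<in> msp X" for F using that T(1) by (auto simp: bij_betw_def)
  show ?thesis
  proof (rule fisoI[where T=S and T'=T and C=C])
    fix G assume "G \<in> msp Y"
    then show "(\<forall>j. S G j \<in> fst (X j)) \<and> T (S G) = G \<and> msum X (S G) \<le> ennreal C * msum Y G"
      using S[of G] T(5)[of "S G"] by (auto simp: msp_def)
  next
    fix F assume "F \<in> msp X"
    then show "(\<forall>i. T F i \<in> fst (Y i)) \<and> S (T F) = F \<and> msum Y (T F) \<le> ennreal C * msum X F"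
      using TY[of F] T(5)[of F] ST[of F] by (auto simp: msp_def)
  next
    fix F G assume "F \<in> msp Y" "G \<in> msp Y"
    then have FG: "S F \<in> msp X" "S G \<in> msp X" "T (S F) = F" "T (S G) = G" by (simp_all add: S)
    have "T (S F + S G) = F + G" using T(2)[OF FG(1,2)] FG(3,4) by simp
    then show "S (F + G) = S F + S G"
      using ST[OF msp_add[OF g FG(1,2)]] by simp
  next
    fix F c assume "F \<in> msp Y"
    then have SF: "S F \<in> msp X" "T (S F) = F" by (simp_all add: S)
    have "T (\<lambda>i. vsc c (S F i)) = (\<lambda>i. vsc c (F i))" using T(3)[OF SF(1)] SF(2) by simp
    then show "S (\<lambda>i. vsc c (F i)) = (\<lambda>j. vsc c (S F j))"
      using ST[OF msp_scale[OF g SF(1), of c]] by simp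
  qed (use T in auto)
qed

lemma fiso_trans:
  assumes "fiso X Y" "fiso Y Z"
  shows "fiso X Z"
proof -
  obtain T C where T: "bij_betw T (msp X) (msp Y)"
     "\<And>F G. F \<in> msp X \<Longrightarrow> G \<in> msp X \<Longrightarrow> T (F + G) = T F + T G"
     "\<And>F c. F \<in> msp X \<Longrightarrow> T (\<lambda>i. vsc c (F i)) = (\<lambda>j. vsc c (T F j))" "C > 0"
     "\<And>F. F \<in> msp X \<Longrightarrow> msum Y (T F) \<le> ennreal C * msum X F \<and> msum X F \<le> ennreal C * msum Y (T F)"
    using assms(1) unfolding fiso_def by blast
  obtain T' C' where T': "bij_betw T' (msp Y) (msp Z)"
     "\<And>F G. F \<in> msp Y \<Longrightarrow> G \<in> msp Y \<Longrightarrow> T' (F + G) = T' F + T' G"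
     "\<And>F c. F \<in> msp Y \<Longrightarrow> T' (\<lambda>i. vsc c (F i)) = (\<lambda>j. vsc c (T' F j))" "C' > 0"
     "\<And>F. F \<in> msp Y \<Longrightarrow> msum Z (T' F) \<le> ennreal C' * msum Y F \<and> msum Y F \<le> ennreal C' * msum Z (T' F)"
    using assms(2) unfolding fiso_def by blast
  have TY: "T F \<in> msp Y" if "F \<in> msp X" for F using that T(1) by (auto simp: bij_betw_def)
  have c: "a \<le> ennreal D * b \<Longrightarrow> b \<le> ennreal D' * d \<Longrightarrow> a \<le> ennreal (D * D') * d" if "D > 0" "D' > 0" for a b d D D'
  proof -
    assume "a \<le> ennreal D * b" "b \<le> ennreal D' * d"
    then have "a \<le> ennreal D * (ennreal D' * d)" by (meson mult_left_mono order_trans zero_le)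
    then show "a \<le> ennreal (D * D') * d" using that by (simp add: ennreal_mult mult.assoc)
  qed
  show ?thesis unfolding fiso_def
  proof (intro exI[of _ "T' \<circ> T"] exI[of _ "C * C'"] conjI ballI allI)
    show "bij_betw (T' \<circ> T) (msp X) (msp Z)" using T(1) T'(1) by (rule bij_betw_trans)
    fix F assume F: "F \<in> msp X"
    show "msum Z ((T' \<circ> T) F) \<le> ennreal (C * C') * msum X F"
      using c[OF T'(4) T(4) conjunct1[OF T'(5)[OF TY[OF F]]] conjunct1[OF T(5)[OF F]]] by (simp add: mult.commute)
    show "msum X F \<le> ennreal (C * C') * msum Z ((T' \<circ> T) F)"
      using c[OF T(4) T'(4) conjunct2[OF T(5)[OF F]] conjunct2[OF T'(5)[OF TY[OF F]]]] by simp
  next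
    fix F G assume F: "F \<in> msp X" and G: "G \<in> msp X"
    show "(T' \<circ> T) (F + G) = (T' \<circ> T) F + (T' \<circ> T) G"
      unfolding comp_def T(2)[OF F G] by (rule T'(2)[OF TY[OF F] TY[OF G]])
  next
    fix F c assume F: "F \<in> msp X"
    show "(T' \<circ> T) (\<lambda>i. vsc c (F i)) = (\<lambda>j. vsc c ((T' \<circ> T) F j))"
      unfolding comp_def T(3)[OF F] by (rule T'(3)[OF TY[OF F]])
  qed (use T(4) T'(4) in auto)
qed

lemma msum_reindex:
  assumes "inj h" "\<And>i. i \<notin> range h \<Longrightarrow> snd (X i) (F i) = 0"
  shows "msum X F = msum (\<lambda>j. X (h j)) (\<lambda>j. F (h j))"
proof -
  have "msum X F = (\<integral>\<^sup>+ i. snd (X i) (F i) * indicator (range h) i \<partial>count_space UNIV)"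
    unfolding msum_def by (rule nn_integral_cong) (use assms(2) in \<open>auto simp: indicator_def\<close>)
  also have "\<dots> = (\<integral>\<^sup>+ i. snd (X i) (F i) \<partial>count_space (range h))"
    by (subst nn_integral_count_space_indicator) (auto)
  also have "\<dots> = (\<integral>\<^sup>+ j. snd (X (h j)) (F (h j)) \<partial>count_space UNIV)"
    by (rule nn_integral_bij_count_space[symmetric]) (use assms(1) in \<open>simp add: bij_betw_def\<close>)
  finally show ?thesis by (simp add: msum_def)
qed

abbreviation triv_block :: block where "triv_block \<equiv> ({0}, \<lambda>_. 0)"

text \<open>Renaming indices and discarding trivial blocks. Every commutation and absorption of
  summands in the decomposition is an instance.\<close>

lemma fiso_reindex:
  assumes "inj h" "\<And>i. i \<notin> range h \<Longrightarrow> X i = triv_block" "\<And>j. X (h j) = Y j"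
  shows "fiso X Y"
proof -
  define T' where "T' G = (\<lambda>i. if i \<in> range h then G (inv h i) else (0::vec))" for G
  have T'h: "T' G (h j) = G j" for G j using assms(1) by (simp add: T'_def)
  have m: "msum X F = msum Y (\<lambda>j. F (h j))" for F
    using msum_reindex[OF assms(1), of X F] assms(2,3) by auto
  have z: "F i = 0" if "F \<in> msp X" "i \<notin> range h" for F i
    using that assms(2)[OF that(2)] by (auto simp: msp_def) (metis fst_conv singletonD)
  show ?thesis
  proof (rule fisoI[where T="\<lambda>F j. F (h j)" and T'="T'" and C=1])
    fix F assume F: "F \<in> msp X"
    have "T' (\<lambda>j. F (h j)) = F"
    proof
      fix i show "T' (\<lambda>j. F (h j)) i = F i"
        using z[OF F, of i] T'h by (cases "i \<in> range h") (auto simp: T'_def f_inv_into_f)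
    qed
    then show "(\<forall>j. F (h j) \<in> fst (Y j)) \<and> T' (\<lambda>j. F (h j)) = F \<and> msum Y (\<lambda>j. F (h j)) \<le> ennreal 1 * msum X F"
      using F m[of F] assms(3) by (auto simp: msp_def) (metis)
  next
    fix G assume G: "G \<in> msp Y"
    have "T' G i \<in> fst (X i)" for i
      using G assms(2)[of i] assms(3)[of "inv h i"]
      by (cases "i \<in> range h") (auto simp: T'_def msp_def f_inv_into_f)
    then show "(\<forall>i. T' G i \<in> fst (X i)) \<and> (\<lambda>j. T' G (h j)) = G \<and> msum X (T' G) \<le> ennreal 1 * msum Y G"
      using m[of "T' G"] by (simp add: T'h)
  qed (auto simp: plus_fun_def)
qed

lemma msum_case_sum:
  "msum (case_sum X Y) F = msum X (\<lambda>i. F (Inl i)) + msum Y (\<lambda>i. F (Inr i))"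
proof -
  let ?f = "\<lambda>s. snd (case_sum X Y s) (F s)"
  have "msum (case_sum X Y) F = (\<integral>\<^sup>+ s. ?f s * indicator (range Inl) s + ?f s * indicator (range Inr) s \<partial>count_space UNIV)"
    unfolding msum_def by (rule nn_integral_cong) (auto simp: indicator_def split: sum.splits)
  also have "\<dots> = (\<integral>\<^sup>+ s. ?f s * indicator (range Inl) s \<partial>count_space UNIV) + (\<integral>\<^sup>+ s. ?f s * indicator (range Inr) s \<partial>count_space UNIV)"
    by (rule nn_integral_add) auto
  also have "(\<integral>\<^sup>+ s. ?f s * indicator (range Inl) s \<partial>count_space UNIV) = (\<integral>\<^sup>+ s. ?f s \<partial>count_space (range Inl))"
    by (subst nn_integral_count_space_indicator) auto
  also have "\<dots> = msum X (\<lambda>i. F (Inl i))"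
    by (subst nn_integral_bij_count_space[of Inl UNIV "range Inl", symmetric])
      (auto simp: msum_def bij_betw_def)
  also have "(\<integral>\<^sup>+ s. ?f s * indicator (range Inr) s \<partial>count_space UNIV) = (\<integral>\<^sup>+ s. ?f s \<partial>count_space (range Inr))"
    by (subst nn_integral_count_space_indicator) auto
  also have "\<dots> = msum Y (\<lambda>i. F (Inr i))"
    by (subst nn_integral_bij_count_space[of Inr UNIV "range Inr", symmetric])
      (auto simp: msum_def bij_betw_def)
  finally show ?thesis .
qed

lemma msp_case_sum:
  "F \<in> msp (case_sum X Y) \<longleftrightarrow> (\<lambda>i. F (Inl i)) \<in> msp X \<and> (\<lambda>i. F (Inr i)) \<in> msp Y"
  unfolding msp_def msum_case_sum by (auto split: sum.splits)

lemma fiso_cong_right: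
  fixes X :: "'a \<Rightarrow> block" and Y :: "'b \<Rightarrow> block" and Z :: "'c \<Rightarrow> block"
  assumes "fiso X Y"
  shows "fiso (case_sum Z X) (case_sum Z Y)"
proof -
  obtain T C where T: "bij_betw T (msp X) (msp Y)"
     "\<And>F G. F \<in> msp X \<Longrightarrow> G \<in> msp X \<Longrightarrow> T (F + G) = T F + T G"
     "\<And>F c. F \<in> msp X \<Longrightarrow> T (\<lambda>i. vsc c (F i)) = (\<lambda>j. vsc c (T F j))" "C > 0"
     "\<And>F. F \<in> msp X \<Longrightarrow> msum Y (T F) \<le> ennreal C * msum X F \<and> msum X F \<le> ennreal C * msum Y (T F)"
    using assms unfolding fiso_def by blast
  define S where "S = inv_into (msp X) T"
  have S: "S G \<in> msp X" "T (S G) = G" if "G \<in> msp Y" for G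
    using that T(1) unfolding S_def by (auto simp: bij_betw_def inv_into_into f_inv_into_f)
  have ST: "S (T F) = F" if "F \<in> msp X" for F
    using that T(1) unfolding S_def by (auto simp: bij_betw_def inv_into_f_f)
  have TY: "T F \<in> msp Y" if "F \<in> msp X" for F using that T(1) by (auto simp: bij_betw_def)
  have le: "z + a \<le> ennreal (C + 1) * (z + b)" if "a \<le> ennreal C * b" for z a b :: ennreal
  proof -
    have "ennreal (C + 1) = ennreal C + 1" using T(4) by (simp add: ennreal_plus)
    then have "ennreal (C + 1) * (z + b) = (ennreal C * z + z) + (ennreal C * b + b)"
      by (simp add: distrib_left distrib_right)
    moreover have "z + a \<le> (ennreal C * z + z) + (ennreal C * b + b)"
      using that by (intro add_mono) (auto intro: add_increasing add_increasing2)
    ultimately show ?thesis by simp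
  qed
  define TT where "TT F = case_sum (\<lambda>i. F (Inl i)) (T (\<lambda>i. F (Inr i)))" for F :: "'c + 'a \<Rightarrow> vec"
  define SS where "SS F = case_sum (\<lambda>i. F (Inl i)) (S (\<lambda>i. F (Inr i)))" for F :: "'c + 'b \<Rightarrow> vec"
  have eta: "case_sum (\<lambda>i. F (Inl i)) (\<lambda>i. F (Inr i)) = F" for F
    by (rule ext) (auto split: sum.splits)
  show ?thesis
  proof (rule fisoI[where T="TT" and T'="SS" and C="C+1"])
    fix F assume F: "F \<in> msp (case_sum Z X)"
    then have 1: "(\<lambda>i. F (Inl i)) \<in> msp Z" and 2: "(\<lambda>i. F (Inr i)) \<in> msp X" by (auto simp: msp_case_sum)
    have a: "TT F \<in> msp (case_sum Z Y)" using 1 2 TY by (simp add: msp_case_sum TT_def)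
    have b: "SS (TT F) = F" by (simp add: SS_def TT_def ST[OF 2] eta)
    have c: "msum (case_sum Z Y) (TT F) \<le> ennreal (C + 1) * msum (case_sum Z X) F"
      unfolding msum_case_sum TT_def using le T(5)[OF 2] by auto
    from a have a': "\<forall>j. TT F j \<in> fst (case_sum Z Y j)" unfolding msp_def by blast
    from a' b c show "(\<forall>j. TT F j \<in> fst (case_sum Z Y j)) \<and> SS (TT F) = F \<and>
        msum (case_sum Z Y) (TT F) \<le> ennreal (C + 1) * msum (case_sum Z X) F" by blast
  next
    fix F assume F: "F \<in> msp (case_sum Z Y)"
    then have 1: "(\<lambda>i. F (Inl i)) \<in> msp Z" and 2: "(\<lambda>i. F (Inr i)) \<in> msp Y" by (auto simp: msp_case_sum)
    have a: "SS F \<in> msp (case_sum Z X)" using 1 2 S by (simp add: msp_case_sum SS_def)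
    have b: "TT (SS F) = F" by (simp add: SS_def TT_def S(2)[OF 2] eta)
    have c: "msum (case_sum Z X) (SS F) \<le> ennreal (C + 1) * msum (case_sum Z Y) F"
      unfolding msum_case_sum SS_def using le T(5)[OF S(1)[OF 2]] S(2)[OF 2] by auto
    from a have a': "\<forall>j. SS F j \<in> fst (case_sum Z X j)" unfolding msp_def by blast
    from a' b c show "(\<forall>j. SS F j \<in> fst (case_sum Z X j)) \<and> TT (SS F) = F \<and>
        msum (case_sum Z X) (SS F) \<le> ennreal (C + 1) * msum (case_sum Z Y) F" by blast
  next
    fix F G assume "F \<in> msp (case_sum Z X)" "G \<in> msp (case_sum Z X)"
    then have "(\<lambda>i. F (Inr i)) \<in> msp X" "(\<lambda>i. G (Inr i)) \<in> msp X" by (auto simp: msp_case_sum)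
    from T(2)[OF this] show "TT (F + G) = TT F + TT G"
      by (auto simp: TT_def fun_eq_iff plus_fun_def split: sum.splits)
  next
    fix F c assume "F \<in> msp (case_sum Z X)"
    then have "(\<lambda>i. F (Inr i)) \<in> msp X" by (auto simp: msp_case_sum)
    from T(3)[OF this] show "TT (\<lambda>i. vsc c (F i)) = (\<lambda>j. vsc c (TT F j))"
      by (auto simp: TT_def fun_eq_iff split: sum.splits)
  qed (use T in auto)
qed

text \<open>The complement of \<open>Y i\<close> in \<open>X i\<close> is the kernel of
  \<open>P i\<close>. In the constant, \<open>C\<close> comes from \<open>P\<close> and
  \<open>2 * C^2 + 2\<close> from \<open>x - J (P x)\<close>.\<close>

lemma fiso_split:
  fixes X Y :: "'a \<Rightarrow> block"
  assumes gX: "\<And>i. good_block (X i)" and gY: "\<And>i. good_block (Y i)" and f: "\<And>i. fac C (Y i) (X i)" and C: "C \<ge> 1"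
  shows "\<exists>K :: 'a \<Rightarrow> block. (\<forall>i. good_block (K i)) \<and> fiso X (case_sum Y K)"
proof -
  obtain J P where JP: "\<And>i. lin_on (fst (Y i)) (J i)" "\<And>i. lin_on (fst (X i)) (P i)"
     "\<And>i x. x \<in> fst (Y i) \<Longrightarrow> J i x \<in> fst (X i) \<and> P i (J i x) = x \<and> snd (X i) (J i x) \<le> ennreal C * snd (Y i) x"
     "\<And>i y. y \<in> fst (X i) \<Longrightarrow> P i y \<in> fst (Y i) \<and> snd (Y i) (P i y) \<le> ennreal C * snd (X i) y"
    using f unfolding fac_def by metis
  define K where "K i = ({x \<in> fst (X i). P i x = 0}, snd (X i))" for i
  have P0: "P i 0 = 0" for i
    using JP(2)[of i] good_blockD(1)[OF gX, of i] unfolding lin_on_def by (metis add_cancel_right_left)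
  have J0: "J i 0 = 0" for i
    using JP(1)[of i] good_blockD(1)[OF gY, of i] unfolding lin_on_def by (metis add_cancel_right_left)
  have Padd: "P i (x + y) = P i x + P i y" if "x \<in> fst (X i)" "y \<in> fst (X i)" for i x y
    using JP(2)[of i] that unfolding lin_on_def by blast
  have Psc: "P i (vsc c x) = vsc c (P i x)" if "x \<in> fst (X i)" for i x c
    using JP(2)[of i] that unfolding lin_on_def by blast
  have Jadd: "J i (x + y) = J i x + J i y" if "x \<in> fst (Y i)" "y \<in> fst (Y i)" for i x y
    using JP(1)[of i] that unfolding lin_on_def by blast
  have Jsc: "J i (vsc c x) = vsc c (J i x)" if "x \<in> fst (Y i)" for i x c
    using JP(1)[of i] that unfolding lin_on_def by blast
  have Pdiff: "P i (x - y) = P i x - P i y" if "x \<in> fst (X i)" "y \<in> fst (X i)" for i x y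
    using Padd[of "x - y" i y] that good_block_diff[OF gX, of x i y] by (simp add: algebra_simps)
  have gK: "good_block (K i)" for i
    using gX[of i] unfolding good_block_def K_def by (auto simp: P0 Padd Psc)
  define T where "T F = case_sum (\<lambda>i. P i (F i)) (\<lambda>i. F i - J i (P i (F i)))" for F
  define T' where "T' G = (\<lambda>i. J i (G (Inl i)) + G (Inr i))" for G :: "_ \<Rightarrow> vec"
  have "fiso X (case_sum Y K)"
  proof (rule fisoI[where T=T and T'=T' and C="2 * C\<^sup>2 + C + 2"])
    fix F assume F: "F \<in> msp X"
    then have Fi: "F i \<in> fst (X i)" for i by (auto simp: msp_def)
    have Pi: "P i (F i) \<in> fst (Y i)" "snd (Y i) (P i (F i)) \<le> ennreal C * snd (X i) (F i)" for i using JP(4)[OF Fi] by auto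
    have JPi: "J i (P i (F i)) \<in> fst (X i)" "P i (J i (P i (F i))) = P i (F i)"
      "snd (X i) (J i (P i (F i))) \<le> ennreal C * snd (Y i) (P i (F i))" for i using JP(3)[OF Pi(1)] by auto
    have D: "F i - J i (P i (F i)) \<in> fst (K i)" for i
      unfolding K_def using good_block_diff[OF gX Fi JPi(1)] Pdiff[OF Fi JPi(1)] JPi(2) by auto
    have D2: "snd (X i) (F i - J i (P i (F i))) \<le> ennreal (2 * C\<^sup>2 + 2) * snd (X i) (F i)" for i
    proof -
      have "snd (X i) (J i (P i (F i))) \<le> ennreal C * (ennreal C * snd (X i) (F i))"
        using JPi(3)[of i] Pi(2)[of i] by (meson mult_left_mono order_trans zero_le)
      then have "snd (X i) (F i - J i (P i (F i))) \<le> 2 * snd (X i) (F i) + 2 * (ennreal C * (ennreal C * snd (X i) (F i)))"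
        using good_block_diff(2)[OF gX Fi JPi(1), of i] by (meson add_left_mono mult_left_mono order_trans zero_le)
      also have "\<dots> = ennreal (2 * C\<^sup>2 + 2) * snd (X i) (F i)"
      proof -
        have "ennreal (2 * C\<^sup>2 + 2) = 2 * (ennreal C * ennreal C) + 2" using C
          by (simp add: power2_eq_square ennreal_plus ennreal_mult)
        then show ?thesis by (simp add: algebra_simps)
      qed
      finally show ?thesis .
    qed
    have "msum (case_sum Y K) (T F) = msum Y (\<lambda>i. P i (F i)) + msum K (\<lambda>i. F i - J i (P i (F i)))"
      by (simp add: msum_case_sum T_def)
    also have "\<dots> \<le> ennreal C * msum X F + ennreal (2 * C\<^sup>2 + 2) * msum X F"
      unfolding msum_def K_def nn_integral_cmult[symmetric, OF borel_measurable_count_space]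
      by (intro add_mono nn_integral_mono) (use Pi(2) D2 in \<open>simp_all del: ennreal_plus\<close>)
    also have "\<dots> = ennreal (2 * C\<^sup>2 + C + 2) * msum X F"
    proof -
      have "ennreal (2 * C\<^sup>2 + C + 2) = ennreal C + ennreal (2 * C\<^sup>2 + 2)"
        using C by (subst ennreal_plus[symmetric]) (auto simp: algebra_simps)
      then show ?thesis by (simp add: distrib_right)
    qed
    finally have m: "msum (case_sum Y K) (T F) \<le> ennreal (2 * C\<^sup>2 + C + 2) * msum X F" .
    show "(\<forall>j. T F j \<in> fst (case_sum Y K j)) \<and> T' (T F) = F \<and> msum (case_sum Y K) (T F) \<le> ennreal (2 * C\<^sup>2 + C + 2) * msum X F"
      using m Pi D by (auto simp: T_def T'_def split: sum.splits)
  next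
    fix G assume G: "G \<in> msp (case_sum Y K)"
    then have Gl: "G (Inl i) \<in> fst (Y i)" and Gr: "G (Inr i) \<in> fst (X i)" and P0G: "P i (G (Inr i)) = 0" for i
      unfolding msp_case_sum by (auto simp: msp_def K_def)
    have JG: "J i (G (Inl i)) \<in> fst (X i)" "P i (J i (G (Inl i))) = G (Inl i)"
       "snd (X i) (J i (G (Inl i))) \<le> ennreal C * snd (Y i) (G (Inl i))" for i using JP(3)[OF Gl] by auto
    have PT: "P i (T' G i) = G (Inl i)" for i
      unfolding T'_def using Padd[OF JG(1) Gr] JG(2) P0G by simp
    have TT: "T (T' G) = G"
    proof
      fix s show "T (T' G) s = G s"
        by (cases s) (simp_all add: T_def PT, simp add: T'_def)
    qed
    have "msum X (T' G) \<le> (\<integral>\<^sup>+ i. 2 * (ennreal C * snd (Y i) (G (Inl i))) + 2 * snd (X i) (G (Inr i)) \<partial>count_space UNIV)"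
      unfolding msum_def
    proof (rule nn_integral_mono)
      fix i
      have "snd (X i) (T' G i) \<le> 2 * snd (X i) (J i (G (Inl i))) + 2 * snd (X i) (G (Inr i))"
        unfolding T'_def by (rule good_blockD(5)[OF gX JG(1) Gr])
      also have "\<dots> \<le> 2 * (ennreal C * snd (Y i) (G (Inl i))) + 2 * snd (X i) (G (Inr i))"
        by (intro add_right_mono mult_left_mono JG(3)) auto
      finally show "snd (X i) (T' G i) \<le> 2 * (ennreal C * snd (Y i) (G (Inl i))) + 2 * snd (X i) (G (Inr i))" .
    qed
    also have "\<dots> = ennreal (2 * C) * msum Y (\<lambda>i. G (Inl i)) + 2 * msum K (\<lambda>i. G (Inr i))"
      using C by (simp add: nn_integral_add nn_integral_cmult msum_def K_def ennreal_mult mult.assoc)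
    also have "\<dots> \<le> ennreal (2 * C\<^sup>2 + C + 2) * msum Y (\<lambda>i. G (Inl i)) + ennreal (2 * C\<^sup>2 + C + 2) * msum K (\<lambda>i. G (Inr i))"
    proof (intro add_mono mult_right_mono)
      have "C * 1 \<le> C * C" using C by (intro mult_left_mono) auto
      then have "2 * C \<le> 2 * C\<^sup>2 + C + 2" using C unfolding power2_eq_square by linarith
      then show "ennreal (2 * C) \<le> ennreal (2 * C\<^sup>2 + C + 2)" by (rule ennreal_leI)
      have "ennreal 2 \<le> ennreal (2 * C\<^sup>2 + C + 2)" using C by (intro ennreal_leI) (simp add: power2_eq_square)
      then show "2 \<le> ennreal (2 * C\<^sup>2 + C + 2)" by simp
    qed auto
    also have "\<dots> = ennreal (2 * C\<^sup>2 + C + 2) * msum (case_sum Y K) G"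
      by (simp add: msum_case_sum distrib_left)
    finally have m: "msum X (T' G) \<le> ennreal (2 * C\<^sup>2 + C + 2) * msum (case_sum Y K) G" .
    show "(\<forall>i. T' G i \<in> fst (X i)) \<and> T (T' G) = G \<and> msum X (T' G) \<le> ennreal (2 * C\<^sup>2 + C + 2) * msum (case_sum Y K) G"
      using m TT good_blockD(2)[OF gX JG(1) Gr] by (auto simp: T'_def)
  next
    fix F G assume "F \<in> msp X" "G \<in> msp X"
    then have Fi: "F i \<in> fst (X i)" "G i \<in> fst (X i)" for i by (auto simp: msp_def)
    have "P i (F i + G i) = P i (F i) + P i (G i)" "J i (P i (F i) + P i (G i)) = J i (P i (F i)) + J i (P i (G i))" for i
      using Padd Jadd Fi JP(4) by blast+
    then show "T (F + G) = T F + T G"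
      by (intro ext) (auto simp: T_def plus_fun_def[of F] plus_fun_def[of "case_sum _ _"] algebra_simps split: sum.splits)
  next
    fix F c assume "F \<in> msp X"
    then have Fi: "F i \<in> fst (X i)" for i by (auto simp: msp_def)
    have "P i (vsc c (F i)) = vsc c (P i (F i))" "J i (vsc c (P i (F i))) = vsc c (J i (P i (F i)))" for i
      using Psc Jsc Fi JP(4) by blast+
    then show "T (\<lambda>i. vsc c (F i)) = (\<lambda>j. vsc c (T F j))"
      by (intro ext) (auto simp: T_def vsc_diff split: sum.splits)
  qed (use C in \<open>auto simp: add_pos_nonneg\<close>)
  with gK show ?thesis by (intro exI[of _ K]) simp
qed

lemma good_triv: "good_block triv_block"
  by (auto simp: good_block_def)

lemma fac_triv: "good_block A \<Longrightarrow> fac C triv_block A"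
  unfolding fac_def
  by (rule exI[of _ "\<lambda>_. 0"], rule exI[of _ "\<lambda>_. 0"]) (auto simp: lin_on_def good_blockD)

lemma fac_mono:
  assumes "fac C A B" "C \<le> C'"
  shows "fac C' A B"
proof -
  have "ennreal C * x \<le> ennreal C' * x" for x
    using assms(2) by (intro mult_right_mono ennreal_leI) auto
  then have "a \<le> ennreal C * x \<Longrightarrow> a \<le> ennreal C' * x" for a x using order_trans by blast
  then show ?thesis using assms(1) unfolding fac_def by blast
qed

text \<open>When every label occurs countably infinitely often on both sides, the index sets can be
  matched label by label.\<close>

lemma bij_fiberwise:
  fixes f :: "'a \<Rightarrow> 'k" and g :: "'b \<Rightarrow> 'k"
  assumes "\<And>k. countable {x. f x = k}" "\<And>k. infinite {x. f x = k}"
    and "\<And>k. countable {x. g x = k}" "\<And>k. infinite {x. g x = k}"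
  shows "\<exists>h. bij h \<and> (\<forall>x. g (h x) = f x)"
proof -
  have "\<exists>b. bij_betw b {x. f x = k} {x. g x = k}" for k
    using bij_betw_trans[OF to_nat_on_infinite[OF assms(1,2)] bij_betw_from_nat_into[OF assms(3,4)]] by blast
  then obtain b where b: "\<And>k. bij_betw (b k) {x. f x = k} {x. g x = k}" by metis
  define h where "h x = b (f x) x" for x
  have gh: "g (h x) = f x" for x using b[of "f x"] unfolding h_def bij_betw_def by auto
  have "inj h"
  proof (rule injI)
    fix x y assume e: "h x = h y"
    then have "f x = f y" using gh by metis
    then show "x = y" using e b[of "f y"] unfolding h_def bij_betw_def inj_on_def by auto
  qed
  moreover have "surj h"
  proof (rule surjI)
    fix y
    show "h (inv_into {x. f x = g y} (b (g y)) y) = y"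
    proof -
      have y: "y \<in> b (g y) ` {x. f x = g y}" using b[of "g y"] unfolding bij_betw_def by auto
      have "f (inv_into {x. f x = g y} (b (g y)) y) = g y" using inv_into_into[OF y] by simp
      then show ?thesis unfolding h_def using f_inv_into_f[OF y] by simp
    qed
  qed
  ultimately show ?thesis using gh by (auto simp: bij_def)
qed

text \<open>Pelczynski's decomposition. \<open>U\<close> repeats each \<open>D k\<close> infinitely
  often. Since \<open>U\<close> is complemented in \<open>X\<close> and \<open>U + U\<close> is
  \<open>U\<close>, the sum \<open>X\<close> is isomorphic to \<open>U + X\<close>. Since infinitely
  many copies of \<open>X\<close> are complemented in a summand of \<open>U\<close>, also
  \<open>U\<close> is isomorphic to \<open>X + U\<close>. Hence \<open>X\<close> and
  \<open>U\<close> are isomorphic.\<close>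

theorem fiso_universal:
  fixes X D :: "nat \<Rightarrow> block"
  assumes gX: "\<And>n. good_block (X n)" and gD: "\<And>k. good_block (D k)" and C: "C \<ge> 1"
    and XD: "\<And>n. \<exists>m. fac C (X n) (D m)"
    and DX: "\<And>k. infinite {n. fac C (D k) (X n)}"
  shows "fiso X (\<lambda>(k, i :: nat). D k)"
proof -
  define U where "U = (\<lambda>(k, i :: nat). D k)"
  have gU: "good_block (U p)" for p using gD by (auto simp: U_def split: prod.splits)
  \<comment> \<open>Every copy of \<open>D k\<close> needs its own host: the pairs
    \<open>(k, i)\<close> are coded by \<open>l\<close> and the hosts are chosen with increasing
    index.\<close>
  have "\<exists>\<nu> :: nat \<Rightarrow> nat. inj \<nu> \<and> (\<forall>l. fac C (D (fst (prod_decode l))) (X (\<nu> l)))"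
  proof -
    have "\<exists>n. fac C (D (fst (prod_decode l))) (X n) \<and> n > N" for l N
      using DX[of "fst (prod_decode l)"] by (auto simp: infinite_nat_iff_unbounded)
    then obtain \<nu> where \<nu>: "\<And>l. fac C (D (fst (prod_decode l))) (X (\<nu> l)) \<and> \<nu> (Suc l) > \<nu> l"
      using dependent_nat_choice[of "\<lambda>l n. fac C (D (fst (prod_decode l))) (X n)" "\<lambda>l m n. n > m"] by metis
    then have "strict_mono \<nu>" by (simp add: strict_mono_Suc_iff)
    then show ?thesis using \<nu> strict_mono_imp_inj_on by blast
  qed
  then obtain \<nu>' where \<nu>': "inj \<nu>'" "\<And>l. fac C (D (fst (prod_decode l))) (X (\<nu>' l))" by blast
  define \<nu> where "\<nu> p = \<nu>' (prod_encode p)" for p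
  have \<nu>: "inj \<nu>" "fac C (U p) (X (\<nu> p))" for p
    using inj_compose[OF \<nu>'(1) inj_prod_encode[of UNIV]] \<nu>'(2)[of "prod_encode p"]
    by (auto simp: \<nu>_def[abs_def] comp_def U_def split: prod.splits)
  \<comment> \<open>Blocks of \<open>X\<close> that host nothing split off the trivial
    block.\<close>
  define Y where "Y n = (if n \<in> range \<nu> then U (inv \<nu> n) else triv_block)" for n
  have Y\<nu>: "Y (\<nu> p) = U p" for p using \<nu>(1) by (simp add: Y_def)
  have gY: "good_block (Y n)" for n using gU good_triv by (auto simp: Y_def)
  have "fac C (Y n) (X n)" for n
  proof (cases "n \<in> range \<nu>")
    case True then show ?thesis using \<nu>(2) Y\<nu> by auto
  next
    case False then show ?thesis using fac_triv gX by (auto simp: Y_def)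
  qed
  from fiso_split[of X Y C, OF gX gY this C] obtain K :: "nat \<Rightarrow> block"
    where K: "(\<forall>n. good_block (K n)) \<and> fiso X (case_sum Y K)" ..
  have XUK: "fiso X (case_sum U K)"
  proof (rule fiso_trans[OF conjunct2[OF K]], rule fiso_reindex[where h="map_sum \<nu> (\<lambda>i::nat. i)"])
    show "inj (map_sum \<nu> (\<lambda>i::nat. i))" using sum.inj_map[OF \<nu>(1) inj_on_id] by (simp add: id_def)
    show "case_sum Y K i = triv_block" if "i \<notin> range (map_sum \<nu> (\<lambda>i. i))" for i
    proof (cases i)
      case (Inl n)
      then have "n \<notin> range \<nu>" using that by (metis map_sum.simps(1) rangeE rangeI)
      then show ?thesis using Inl by (simp add: Y_def)
    next
      case (Inr n) then show ?thesis using that by (metis map_sum.simps(2) rangeI)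
    qed
    show "case_sum Y K (map_sum \<nu> (\<lambda>i. i) j) = case_sum U K j" for j
      by (cases j) (auto simp: Y\<nu>)
  qed
  \<comment> \<open>Even and odd positions interleave two copies of \<open>U\<close> into
    one.\<close>
  define e where "e = (\<lambda>s :: (nat \<times> nat) + ((nat \<times> nat) + nat). case s of Inl (k, i) \<Rightarrow> Inl (k, 2 * i)
       | Inr (Inl (k, i)) \<Rightarrow> Inl (k, 2 * i + 1) | Inr (Inr n) \<Rightarrow> (Inr n :: (nat \<times> nat) + nat))"
  have "inj e" unfolding e_def by (rule injI) (auto split: sum.splits prod.splits; presburger)
  moreover have "range e = UNIV"
  proof -
    have "s \<in> range e" for s
    proof (cases s)
      case (Inl p)
      obtain k i where p: "p = (k, i)" by force
      show ?thesis
      proof (cases "even i")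
        case True
        then have "s = e (Inl (k, i div 2))" using Inl p by (simp add: e_def)
        then show ?thesis by simp
      next
        case False
        then have "s = e (Inr (Inl (k, i div 2)))" using Inl p by (simp add: e_def)
        then show ?thesis by simp
      qed
    next
      case (Inr n)
      then have "s = e (Inr (Inr n))" by (simp add: e_def)
      then show ?thesis by simp
    qed
    then show ?thesis by auto
  qed
  ultimately have "fiso (case_sum U K) (case_sum U (case_sum U K))"
    by (intro fiso_reindex[of e]) (auto simp: e_def U_def split: sum.splits)
  then have "fiso X (case_sum U (case_sum U K))" using XUK fiso_trans by blast
  moreover have "fiso (case_sum U (case_sum U K)) (case_sum U X)"
    by (intro fiso_cong_right fiso_sym[OF gX XUK])
  ultimately have XUX: "fiso X (case_sum U X)" using fiso_trans by blast

  obtain m where m: "\<And>n. fac C (X n) (D (m n))" using XD by metis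
  \<comment> \<open>Each host \<open>D (m n)\<close> is repeated infinitely often, so the sum
    complemented in it consists of infinitely many copies of \<open>X\<close> and can absorb one
    more.\<close>
  define W where "W = (\<lambda>(n, i :: nat). D (m n))"
  define X' where "X' = (\<lambda>(n, i :: nat). X n)"
  have gW: "good_block (W p)" and gX': "good_block (X' p)" and XW: "fac C (X' p) (W p)" for p
    using gD gX m by (auto simp: W_def X'_def split: prod.splits)
  from fiso_split[of W X' C, OF gW gX' XW C] obtain K' :: "nat \<times> nat \<Rightarrow> block"
    where K': "(\<forall>n. good_block (K' n)) \<and> fiso W (case_sum X' K')" ..
  define f where "f = (\<lambda>s. case s of Inl (k, i :: nat) \<Rightarrow> k | Inr (n, i :: nat) \<Rightarrow> m n)"
  have "\<exists>h. bij h \<and> (\<forall>x. fst (h x :: nat \<times> nat) = f x)"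
  proof (rule bij_fiberwise)
    fix k
    show "countable {x. f x = k}" "countable {x :: nat \<times> nat. fst x = k}" by auto
    have "range (\<lambda>i. Inl (k, i)) \<subseteq> {x. f x = k}" by (auto simp: f_def)
    moreover have "infinite (range (\<lambda>i :: nat. Inl (k, i)))" by (rule range_inj_infinite) (auto simp: inj_def)
    ultimately show "infinite {x. f x = k}" using infinite_super by blast
    have "range (\<lambda>i. (k, i)) \<subseteq> {x :: nat \<times> nat. fst x = k}" by auto
    moreover have "infinite (range (\<lambda>i :: nat. (k, i)))" by (rule range_inj_infinite) (auto simp: inj_def)
    ultimately show "infinite {x :: nat \<times> nat. fst x = k}" using infinite_super by blast
  qed
  then obtain h where h: "bij h" "\<And>x. fst (h x :: nat \<times> nat) = f x" by blast
  have "fiso U (case_sum U W)"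
  proof (rule fiso_reindex[of h])
    show "inj h" using h(1) bij_is_inj by blast
    show "U i = triv_block" if "i \<notin> range h" for i using h(1) that by (auto simp: bij_def)
    show "U (h j) = case_sum U W j" for j
      using h(2)[of j] by (auto simp: U_def W_def f_def split: sum.splits prod.splits)
  qed
  then have UW: "fiso U (case_sum U (case_sum X' K'))"
    using fiso_cong_right[OF conjunct2[OF K']] fiso_trans by blast
  let ?Z = "case_sum U (case_sum X' K')"
  \<comment> \<open>The additional copy of \<open>X\<close> takes position 0 and the others move up
    by one.\<close>
  define c where "c = (\<lambda>s :: nat + ((nat \<times> nat) + ((nat \<times> nat) + (nat \<times> nat))).
     case s of Inl n \<Rightarrow> Inr (Inl (n, 0)) | Inr (Inl p) \<Rightarrow> Inl p
       | Inr (Inr (Inl (n, i))) \<Rightarrow> Inr (Inl (n, Suc i))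
       | Inr (Inr (Inr p)) \<Rightarrow> (Inr (Inr p) :: (nat \<times> nat) + ((nat \<times> nat) + (nat \<times> nat))))"
  have "inj c" unfolding c_def by (rule injI) (auto split: sum.splits prod.splits)
  moreover have "range c = UNIV"
  proof -
    have "s \<in> range c" for s
    proof -
      consider p where "s = Inl p" | n where "s = Inr (Inl (n, 0))" | n i where "s = Inr (Inl (n, Suc i))" | p where "s = Inr (Inr p)"
        by (metis old.sum.exhaust surj_pair not0_implies_Suc)
      then show ?thesis
      proof cases
        case 1 then have "s = c (Inr (Inl p))" by (simp add: c_def) then show ?thesis by simp
      next
        case 2 then have "s = c (Inl n)" by (simp add: c_def) then show ?thesis by simp
      next
        case 3 then have "s = c (Inr (Inr (Inl (n, i))))" by (simp add: c_def) then show ?thesis by simp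
      next
        case 4 then have "s = c (Inr (Inr (Inr p)))" by (simp add: c_def) then show ?thesis by simp
      qed
    qed
    then show ?thesis by auto
  qed
  ultimately have "fiso ?Z (case_sum X ?Z)"
    by (intro fiso_reindex[of c]) (auto simp: c_def X'_def split: sum.splits)
  then have "fiso U (case_sum X ?Z)" using UW fiso_trans by blast
  moreover have "fiso (case_sum X ?Z) (case_sum X U)"
    by (intro fiso_cong_right fiso_sym[OF gU UW])
  ultimately have "fiso U (case_sum X U)" using fiso_trans by blast
  moreover have "fiso (case_sum X U) (case_sum U X)"
  proof (rule fiso_reindex[where h="case_sum Inr Inl :: (nat \<times> nat) + nat \<Rightarrow> nat + (nat \<times> nat)"])
    show "inj (case_sum Inr Inl :: (nat \<times> nat) + nat \<Rightarrow> nat + (nat \<times> nat))" by (auto simp: inj_def split: sum.splits)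
    have "i \<in> range (case_sum Inr Inl)" for i :: "nat + (nat \<times> nat)"
      by (cases i) (metis rangeI sum.case)+
    then show "case_sum X U i = triv_block" if "i \<notin> range (case_sum Inr Inl)" for i using that by blast
    show "case_sum X U (case_sum Inr Inl j) = case_sum U X j" for j by (auto split: sum.splits)
  qed
  ultimately have UUX: "fiso U (case_sum U X)" using fiso_trans by blast
  have "fiso X U" by (rule fiso_trans[OF XUX fiso_sym[OF gU UUX]])
  then show ?thesis by (simp add: U_def)
qed

subsection \<open>Trees and trigonometric polynomials as blocks\<close>

text \<open>The \<open>j\<close>-th martingale difference of a dyadic step function is stored as \<open>y j p\<close> with \<open>p\<close>
  ranging over the cells of level \<open>j - 1\<close> (the mean being \<open>y 0 0\<close>); a polynomial occupies row \<open>0\<close>.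
  \<open>anc m j n\<close> is the cell of level \<open>j - 1\<close> containing the cell \<open>n\<close> of level \<open>m\<close>.\<close>

definition anc :: "nat \<Rightarrow> nat \<Rightarrow> nat \<Rightarrow> nat" where
  "anc m j n = n div 2 ^ (m - (j - 1))"

text \<open>The squared square function on a cell of level \<open>m\<close>. The Haar signs of the
  differences drop out, so moduli of coefficients suffice.\<close>

definition tsq :: "nat \<Rightarrow> vec \<Rightarrow> nat \<Rightarrow> real" where
  "tsq m y n = (\<Sum>j\<le>m. (cmod (y j (anc m j n)))\<^sup>2)"

definition tmod :: "nat \<Rightarrow> vec \<Rightarrow> ennreal" where
  "tmod m y = ennreal ((\<Sum>n<2^m. phi (sqrt (tsq m y n))) / 2^m)"

text \<open>Truncated subtraction leaves one slot in row 0 and one in row 1: the mean and the first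
  Haar coefficient.\<close>

definition tree_block :: "nat \<Rightarrow> block" where
  "tree_block m = ({y. \<forall>j p. \<not> (j \<le> m \<and> p < 2 ^ (j - 1)) \<longrightarrow> y j p = 0}, tmod m)"

definition tpoly :: "nat \<Rightarrow> vec \<Rightarrow> real \<Rightarrow> complex" where
  "tpoly a v t = (\<Sum>p\<le>a. v 0 p * cis (real p * t))"

definition pmod :: "nat \<Rightarrow> vec \<Rightarrow> ennreal" where
  "pmod a v = (\<integral>\<^sup>+ t. ennreal (phi (cmod (tpoly a v t))) \<partial>tor)"

definition trig_block :: "nat \<Rightarrow> block" where
  "trig_block a = ({v. \<forall>j p. \<not> (j = 0 \<and> p \<le> a) \<longrightarrow> v j p = 0}, pmod a)"

lemma tsq_nonneg [simp]: "0 \<le> tsq m y n"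
  by (simp add: tsq_def sum_nonneg)

lemma sqrt_tsq: "sqrt (tsq m y n) = L2_set (\<lambda>j. cmod (y j (anc m j n))) {..m}"
  by (simp add: tsq_def L2_set_def)

lemma phi_cmod_add: "phi (cmod (x + y)) \<le> 2 * phi (cmod x) + 2 * phi (cmod y)"
  using phi_mono[OF _ norm_triangle_ineq[of x y]] phi_add_le[of "cmod x" "cmod y"] by simp

lemma phi_scale_max:
  assumes "0 \<le> c" "0 \<le> x"
  shows "phi (c * x) \<le> max 1 (c\<^sup>2) * phi x"
proof (cases "c \<le> 1")
  case True
  then have "phi (c * x) \<le> phi x" using assms by (intro phi_mono) (auto simp: mult_left_le_one_le)
  moreover have "1 * phi x \<le> max 1 (c\<^sup>2) * phi x" by (intro mult_right_mono) auto
  ultimately show ?thesis by simp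
next
  case False
  then have "phi (c * x) \<le> c\<^sup>2 * phi x" by (intro phi_scale_le) auto
  also have "\<dots> \<le> max 1 (c\<^sup>2) * phi x" by (intro mult_right_mono) auto
  finally show ?thesis .
qed

lemma good_tree_block: "good_block (tree_block m)"
proof -
  have a: "tmod m (x + y) \<le> 2 * tmod m x + 2 * tmod m y" for x y
  proof -
    have "phi (sqrt (tsq m (x + y) n)) \<le> 2 * phi (sqrt (tsq m x n)) + 2 * phi (sqrt (tsq m y n))" for n
    proof -
      have "sqrt (tsq m (x + y) n) \<le> L2_set (\<lambda>j. cmod (x j (anc m j n)) + cmod (y j (anc m j n))) {..m}"
        unfolding sqrt_tsq by (rule L2_set_mono) (auto simp: norm_triangle_ineq)
      also have "\<dots> \<le> sqrt (tsq m x n) + sqrt (tsq m y n)"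
        unfolding sqrt_tsq by (rule L2_set_triangle_ineq)
      finally have "phi (sqrt (tsq m (x + y) n)) \<le> phi (sqrt (tsq m x n) + sqrt (tsq m y n))" by (intro phi_mono) auto
      also have "\<dots> \<le> 2 * phi (sqrt (tsq m x n)) + 2 * phi (sqrt (tsq m y n))" by (intro phi_add_le) auto
      finally show ?thesis .
    qed
    then have "(\<Sum>n<2^m. phi (sqrt (tsq m (x + y) n))) / 2^m \<le> (\<Sum>n<2^m. 2 * phi (sqrt (tsq m x n)) + 2 * phi (sqrt (tsq m y n))) / 2^m"
      by (intro divide_right_mono sum_mono) auto
    also have "\<dots> = 2 * ((\<Sum>n<2^m. phi (sqrt (tsq m x n))) / 2^m) + 2 * ((\<Sum>n<2^m. phi (sqrt (tsq m y n))) / 2^m)"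
      by (simp add: sum.distrib sum_distrib_left add_divide_distrib)
    finally have "tmod m (x + y) \<le> ennreal (2 * ((\<Sum>n<2^m. phi (sqrt (tsq m x n))) / 2^m) + 2 * ((\<Sum>n<2^m. phi (sqrt (tsq m y n))) / 2^m))"
      unfolding tmod_def by (rule ennreal_leI)
    also have "\<dots> = 2 * tmod m x + 2 * tmod m y"
      unfolding tmod_def by (subst ennreal_plus) (auto simp: ennreal_mult sum_nonneg simp del: times_divide_eq_right)
    finally show ?thesis .
  qed
  have s: "tmod m (vsc c x) \<le> ennreal (max 1 ((cmod c)\<^sup>2)) * tmod m x" for c x
  proof -
    have "sqrt (tsq m (vsc c x) n) = cmod c * sqrt (tsq m x n)" for n
      by (simp add: tsq_def vsc_def norm_mult power_mult_distrib real_sqrt_mult flip: sum_distrib_left)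
    then have "(\<Sum>n<2^m. phi (sqrt (tsq m (vsc c x) n))) / 2^m \<le> (\<Sum>n<2^m. max 1 ((cmod c)\<^sup>2) * phi (sqrt (tsq m x n))) / 2^m"
      by (intro divide_right_mono sum_mono) (auto simp: phi_scale_max)
    also have "\<dots> = max 1 ((cmod c)\<^sup>2) * ((\<Sum>n<2^m. phi (sqrt (tsq m x n))) / 2^m)" by (simp add: sum_distrib_left)
    finally show ?thesis unfolding tmod_def
      by (subst ennreal_mult[symmetric]) (auto intro!: ennreal_leI divide_nonneg_nonneg sum_nonneg)
  qed
  show ?thesis unfolding good_block_def tree_block_def using a s
    by (auto simp: vsc_def tmod_def tsq_def)
qed

lemma tpoly_cont: "continuous_on A (tpoly a v)"
  unfolding tpoly_def[abs_def] by (intro continuous_intros)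

lemma tpoly_measurable [measurable]: "tpoly a v \<in> borel_measurable borel"
  by (intro borel_measurable_continuous_onI tpoly_cont)

lemma tpoly_bound: "cmod (tpoly a v t) \<le> (\<Sum>p\<le>a. cmod (v 0 p))"
  unfolding tpoly_def by (rule order_trans[OF norm_sum]) (simp add: norm_mult)

lemma good_trig_block: "good_block (trig_block a)"
proof -
  have m: "(\<lambda>t. phi (cmod (tpoly a x t))) \<in> borel_measurable tor" for x unfolding phi_def by measurable
  have add: "pmod a (x + y) \<le> 2 * pmod a x + 2 * pmod a y" for x y
  proof -
    have "pmod a (x + y) \<le> (\<integral>\<^sup>+ t. 2 * ennreal (phi (cmod (tpoly a x t))) + 2 * ennreal (phi (cmod (tpoly a y t))) \<partial>tor)"
      unfolding pmod_def
    proof (rule nn_integral_mono)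
      fix t
      have "tpoly a (x + y) t = tpoly a x t + tpoly a y t" by (simp add: tpoly_def sum.distrib distrib_right)
      then have "ennreal (phi (cmod (tpoly a (x + y) t))) \<le> ennreal (2 * phi (cmod (tpoly a x t)) + 2 * phi (cmod (tpoly a y t)))"
        by (intro ennreal_leI) (simp add: phi_cmod_add)
      also have "\<dots> = 2 * ennreal (phi (cmod (tpoly a x t))) + 2 * ennreal (phi (cmod (tpoly a y t)))"
        by (subst ennreal_plus) (auto simp: ennreal_mult)
      finally show "ennreal (phi (cmod (tpoly a (x + y) t))) \<le> 2 * ennreal (phi (cmod (tpoly a x t))) + 2 * ennreal (phi (cmod (tpoly a y t)))" .
    qed
    also have "\<dots> = 2 * pmod a x + 2 * pmod a y"
      unfolding pmod_def using m by (simp add: nn_integral_add nn_integral_cmult)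
    finally show ?thesis .
  qed
  have sc: "pmod a (vsc c x) \<le> ennreal (max 1 ((cmod c)\<^sup>2)) * pmod a x" for c x
  proof -
    have "tpoly a (vsc c x) t = c * tpoly a x t" for t by (simp add: tpoly_def vsc_def sum_distrib_left mult.assoc)
    then have "pmod a (vsc c x) \<le> (\<integral>\<^sup>+ t. ennreal (max 1 ((cmod c)\<^sup>2)) * ennreal (phi (cmod (tpoly a x t))) \<partial>tor)"
      unfolding pmod_def
      by (intro nn_integral_mono) (auto simp: norm_mult phi_scale_max intro!: ennreal_leI simp flip: ennreal_mult)
    also have "\<dots> = ennreal (max 1 ((cmod c)\<^sup>2)) * pmod a x" unfolding pmod_def using m by (simp add: nn_integral_cmult)
    finally show ?thesis .
  qed
  have z: "pmod a 0 = 0" by (simp add: pmod_def tpoly_def)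
  show ?thesis unfolding good_block_def trig_block_def using add sc z by (auto simp: vsc_def)
qed

section \<open>Fejer kernels\<close>

definition fej :: "nat \<Rightarrow> real \<Rightarrow> real" where
  "fej R t = 1 + (\<Sum>n=1..<R. 2 * (1 - real n / real R) * cos (real n * t))"

text \<open>The squared modulus of a geometric sum of exponentials, expanded by induction on
  \<open>R\<close>; this is the source of positivity.\<close>

lemma fej_sq: "R > 0 \<Longrightarrow> real R * fej R t = (cmod (\<Sum>j<R. cis (real j * t)))\<^sup>2"
proof -
  have "real R + (\<Sum>n=1..<R. 2 * (real R - real n) * cos (real n * t)) = (cmod (\<Sum>j<R. cis (real j * t)))\<^sup>2" for R
  proof (induction R)
    case (Suc R)
    let ?S = "\<Sum>j<R. cis (real j * t)"
    have "cnj ?S * cis (real R * t) = (\<Sum>j<R. cis (real (R - j) * t))"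
      unfolding cnj_sum sum_distrib_right
      by (rule sum.cong) (auto simp: cis_cnj cis_mult of_nat_diff algebra_simps)
    also have "\<dots> = (\<Sum>n=1..R. cis (real n * t))"
      by (rule sum.reindex_bij_witness[where i="\<lambda>n. R - n" and j="\<lambda>j. R - j"]) auto
    finally have "Re (cnj ?S * cis (real R * t)) = (\<Sum>n=1..R. cos (real n * t))" by (simp only: Re_sum) simp
    then have "(cmod (\<Sum>j<Suc R. cis (real j * t)))\<^sup>2 = (cmod ?S)\<^sup>2 + 1 + 2 * (\<Sum>n=1..R. cos (real n * t))"
      using cmod_add_sq[of ?S "cis (real R * t)"] by simp
    also have "(cmod ?S)\<^sup>2 = real R + (\<Sum>n=1..R. 2 * (real R - real n) * cos (real n * t))"
    proof -
      have "(\<Sum>n=1..R. 2 * (real R - real n) * cos (real n * t)) = (\<Sum>n=1..<R. 2 * (real R - real n) * cos (real n * t))"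
        by (rule sum.mono_neutral_right) auto
      then show ?thesis using Suc by simp
    qed
    also have "real R + (\<Sum>n=1..R. 2 * (real R - real n) * cos (real n * t)) + 1 + 2 * (\<Sum>n=1..R. cos (real n * t))
       = real (Suc R) + (\<Sum>n=1..<Suc R. 2 * (real (Suc R) - real n) * cos (real n * t))"
      by (simp add: sum_distrib_left sum.distrib[symmetric] atLeastLessThanSuc_atLeastAtMost algebra_simps)
    finally show ?case by simp
  qed simp
  from this[of R] show "R > 0 \<Longrightarrow> real R * fej R t = (cmod (\<Sum>j<R. cis (real j * t)))\<^sup>2"
    unfolding fej_def by (simp add: distrib_left sum_distrib_left right_diff_distrib mult.assoc[symmetric] left_diff_distrib mult.commute[of "real R" 2])
qed

lemma fej_nonneg: "R > 0 \<Longrightarrow> 0 \<le> fej R t"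
  using fej_sq[of R t] by (metis of_nat_0_less_iff zero_le_mult_iff zero_le_power2 less_le_not_le)

lemma fej_cont: "continuous_on A (fej R)"
  unfolding fej_def[abs_def] by (intro continuous_intros)

lemma fej_cis: "cplx (fej R (s - x)) = 1 + (\<Sum>n=1..<R. (1 - real n / real R) *
    (cis (real n * s) * cis (- real n * x) + cis (- real n * s) * cis (real n * x)))"
proof -
  have "cplx (2 * cos (real n * (s - x))) = cis (real n * s) * cis (- real n * x) + cis (- real n * s) * cis (real n * x)" for n
    unfolding cis_mult by (simp add: complex_eq_iff right_diff_distrib) (metis add.commute cos_minus minus_diff_eq sin_minus uminus_add_conv_diff add.right_inverse)
  then have "cplx (2 * (1 - real n / real R) * cos (real n * (s - x))) = (1 - real n / real R) *
    (cis (real n * s) * cis (- real n * x) + cis (- real n * s) * cis (real n * x))" for n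
    by (metis (no_types, lifting) mult.assoc mult.left_commute of_real_mult)
  then show ?thesis unfolding fej_def of_real_add of_real_sum by simp
qed

section \<open>Binary addresses, Riesz products and the embedding of trees into the circle\<close>

lemma sum_pairs: "(\<Sum>n<2^(Suc m). f n) = (\<Sum>p<2^m. f (2 * p) + f (2 * p + 1 :: nat))"
proof -
  have "(\<Sum>n<2 * k. f n) = (\<Sum>p<k. f (2 * p) + f (2 * p + 1))" for k by (induction k) (auto simp: add.assoc)
  then show ?thesis by simp
qed

text \<open>The \<open>i\<close>-th Rademacher sign of cell \<open>p\<close> of level
  \<open>j\<close>: binary digit \<open>i\<close>, counted from the most significant one.\<close>

definition sgnb :: "nat \<Rightarrow> nat \<Rightarrow> nat \<Rightarrow> real" where
  "sgnb j i p = (if even (p div 2 ^ (j - 1 - i)) then 1 else - 1)"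

lemma sgnb_top: "sgnb (Suc j) j p = (if even p then 1 else - 1)"
  by (simp add: sgnb_def)

lemma sgnb_Suc: "i < j \<Longrightarrow> sgnb (Suc j) i p = sgnb j i (p div 2)"
proof -
  assume "i < j"
  then have "Suc j - 1 - i = Suc (j - 1 - i)" by simp
  then have "p div 2 ^ (Suc j - 1 - i) = p div 2 div 2 ^ (j - 1 - i)" by (simp add: div_mult2_eq)
  then show ?thesis unfolding sgnb_def by simp
qed

lemma sgnb_anc: "i < j \<Longrightarrow> j \<le> b \<Longrightarrow> sgnb j i (n div 2 ^ (b - j)) = sgnb b i n"
proof -
  assume "i < j" "j \<le> b"
  then have "b - 1 - i = (b - j) + (j - 1 - i)" by simp
  then have "n div 2 ^ (b - 1 - i) = n div 2 ^ (b - j) div 2 ^ (j - 1 - i)" by (simp add: power_add div_mult2_eq)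
  then show ?thesis unfolding sgnb_def by simp
qed

lemma sgnb_abs [simp]: "\<bar>sgnb j i p\<bar> = 1" by (simp add: sgnb_def)

text \<open>\<open>tau\<close> plays the role of a Rademacher function and \<open>taut\<close>, its Fejer mean, that of the biorthogonal
  one; \<open>rho\<close> close to \<open>1\<close> keeps \<open>b\<close>-fold products of the normalised kernels bounded.\<close>

locale dt =
  fixes b l R Lam :: nat and tau taut :: "real \<Rightarrow> real" and rho :: real
  assumes tau_tp: "tp (- int l) (int l) (\<lambda>t. cplx (tau t))"
    and tau_le: "\<And>t. \<bar>tau t\<bar> \<le> 1"
    and tau_mean: "(LINT t|tor. cplx (tau t)) = 0"
    and tau_cis: "(LINT t|tor. cplx (tau t) * cis t) = 0"
    and R2: "R \<ge> 2" and LamR: "Lam \<ge> R" and Laml: "Lam \<ge> 2 * l + 3"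
    and taut: "\<And>x. taut x = (LINT s|tor. fej R (s - x) * tau s)"
    and taut_tp: "tp (- int l) (int l) (\<lambda>t. cplx (taut t))"
    and taut_mean: "(LINT t|tor. cplx (taut t)) = 0"
    and rho: "(LINT t|tor. cplx (tau t) * cplx (taut t)) = cplx rho"
    and rho01: "0 < rho" "rho \<le> 1" and rhob: "((2 - rho) / rho) ^ b \<le> 2"
begin

text \<open>A Riesz product in place of the indicator of a cell; it would be an indicator if
  \<open>tau\<close> took only the values 1 and -1.\<close>

definition kap :: "nat \<Rightarrow> real \<Rightarrow> nat \<Rightarrow> real" where
  "kap j t p = (\<Prod>i<j. (1 + sgnb j i p * tau (real (Lam ^ i) * t)) / 2)"

text \<open>The dual weights. \<open>taut\<close> appears because the phases are later averaged
  against Fejer kernels, and \<open>rho\<close>, the pairing of \<open>tau\<close> with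
  \<open>taut\<close>, normalises each factor.\<close>

definition wt :: "nat \<Rightarrow> real \<Rightarrow> nat \<Rightarrow> real" where
  "wt j t p = (\<Prod>i<j. 1 + sgnb j i p * taut (real (Lam ^ i) * t) / rho)"

lemma kap_Suc: "kap (Suc j) t p = kap j t (p div 2) * ((1 + (if even p then 1 else - 1) * tau (real (Lam ^ j) * t)) / 2)"
proof -
  have "(\<Prod>i<j. (1 + sgnb (Suc j) i p * tau (real (Lam ^ i) * t)) / 2) = kap j t (p div 2)"
    unfolding kap_def by (rule prod.cong) (auto simp: sgnb_Suc)
  then show ?thesis by (simp only: kap_def[of "Suc j"] prod.lessThan_Suc sgnb_top)
qed

lemma wt_Suc: "wt (Suc j) t p = wt j t (p div 2) * (1 + (if even p then 1 else - 1) * taut (real (Lam ^ j) * t) / rho)"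
proof -
  have "(\<Prod>i<j. 1 + sgnb (Suc j) i p * taut (real (Lam ^ i) * t) / rho) = wt j t (p div 2)"
    unfolding wt_def by (rule prod.cong) (auto simp: sgnb_Suc)
  then show ?thesis by (simp only: wt_def[of "Suc j"] prod.lessThan_Suc sgnb_top)
qed

lemma kap_0 [simp]: "kap 0 t p = 1" and wt_0 [simp]: "wt 0 t p = 1"
  by (auto simp: kap_def wt_def)

lemma kap_nonneg: "0 \<le> kap j t p"
  unfolding kap_def
proof (rule prod_nonneg)
  fix i assume "i \<in> {..<j}"
  have "\<bar>sgnb j i p * tau (real (Lam ^ i) * t)\<bar> \<le> 1" using tau_le by (simp add: abs_mult)
  then show "0 \<le> (1 + sgnb j i p * tau (real (Lam ^ i) * t)) / 2" by (simp add: abs_le_iff)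
qed

text \<open>The total of all scales below level \<open>j\<close>; the spectral windows of level
  \<open>j\<close> objects are multiples of it.\<close>

definition DD :: "nat \<Rightarrow> int" where "DD j = (\<Sum>i<j. int Lam ^ i)"

lemma DD_Suc: "DD (Suc j) = DD j + int Lam ^ j" and DD_0: "DD 0 = 0" by (auto simp: DD_def)

lemma DD_nonneg: "0 \<le> DD j" by (simp add: DD_def sum_nonneg)

lemma DD_mono: "i \<le> j \<Longrightarrow> DD i \<le> DD j" unfolding DD_def by (rule sum_mono2) auto

lemma DD_ge: "i < j \<Longrightarrow> int Lam ^ i \<le> DD j" using DD_mono[of "Suc i" j] DD_nonneg[of i] by (simp add: DD_Suc)

text \<open>Geometric sum: fewer than \<open>Lam\<close> copies of all earlier scales together stay
  below the next scale.\<close>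

lemma DD_lt:
  assumes "0 \<le> k" "k \<le> int Lam - 1"
  shows "k * DD j \<le> int Lam ^ j - 1"
proof -
  have "(int Lam - 1) * DD j = int Lam ^ j - 1"
    by (induction j) (auto simp: DD_Suc DD_0 algebra_simps)
  moreover have "k * DD j \<le> (int Lam - 1) * DD j" using assms DD_nonneg by (intro mult_right_mono)
  ultimately show ?thesis by linarith
qed

lemma Lam_pos: "0 < int Lam ^ j" using Laml by simp

lemma tp_top_factor:
  assumes "tp (- int l) (int l) (\<lambda>t. cplx (f t))"
  shows "tp (- (int l * int Lam ^ j)) (int l * int Lam ^ j) (\<lambda>t. cplx (c + d * f (real (Lam ^ j) * t)))"
proof -
  have "tp (int Lam ^ j * - int l) (int Lam ^ j * int l) (\<lambda>t. cplx (f (of_int (int Lam ^ j) * t)))"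
    by (rule tp_dilate[OF assms]) simp
  from tp_scale[OF this, of "cplx d"] tp_const[of "int Lam ^ j * - int l" "int Lam ^ j * int l" "cplx c"]
  show ?thesis by (auto simp: mult.commute intro!: tp_add)
qed

lemma kap_tp: "tp (- (int l * DD j)) (int l * DD j) (\<lambda>t. cplx (kap j t p))"
proof (induction j arbitrary: p)
  case 0 show ?case by (simp add: DD_0 tp_const)
next
  case (Suc j)
  have "cplx (kap (Suc j) t p) = cplx (kap j t (p div 2)) * cplx (1 / 2 + (if even p then 1 else - 1) / 2 * tau (real (Lam ^ j) * t))" for t
    unfolding kap_Suc of_real_mult[symmetric] by (simp add: add_divide_distrib)
  with tp_mult[OF Suc.IH[of "p div 2"] tp_top_factor[OF tau_tp, of j "1/2" "(if even p then 1 else - 1) / 2"]]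
  show ?case by (simp add: DD_Suc algebra_simps)
qed

lemma wt_tp: "tp (- (int l * DD j)) (int l * DD j) (\<lambda>t. cplx (wt j t p))"
proof (induction j arbitrary: p)
  case 0 show ?case by (simp add: DD_0 tp_const)
next
  case (Suc j)
  have "cplx (wt (Suc j) t p) = cplx (wt j t (p div 2)) * cplx (1 + (if even p then 1 else - 1) / rho * taut (real (Lam ^ j) * t))" for t
    unfolding wt_Suc of_real_mult[symmetric] by simp
  with tp_mult[OF Suc.IH[of "p div 2"] tp_top_factor[OF taut_tp, of j "1" "(if even p then 1 else - 1) / rho"]]
  show ?case by (simp add: DD_Suc algebra_simps)
qed

lemma lacunary:
  assumes "tp (- (k * DD j)) (k * DD j) h" "0 \<le> k" "k \<le> int Lam - 1" "tp lo hi g"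
  shows "(LINT t|tor. h t * g (real (Lam ^ j) * t)) = (LINT t|tor. h t) * (LINT t|tor. g t)"
proof -
  have "tp (- (int Lam ^ j - 1)) (int Lam ^ j - 1) h"
    by (rule tp_mono[OF assms(1)]) (use DD_lt[OF assms(2,3), of j] in auto)
  from tp_lacunary[OF this assms(4) Lam_pos] show ?thesis by simp
qed

lemma half_tp: "tp (- int l) (int l) (\<lambda>t. cplx ((1 + s * tau t) / 2))"
  using tp_add[OF tp_const[of "- int l" "int l" "1/2"] tp_scale[OF tau_tp, of "cplx s / 2"]]
  by (simp add: add_divide_distrib)

lemma tau_integrable: "integrable tor (\<lambda>t. cplx (tau t))" "integrable tor (\<lambda>t. cplx (tau t) * cis t)"
  using tp_integrable[OF tau_tp] tp_integrable[OF tp_mult[OF tau_tp tp_cis[of 1 1 1 1]]] by simp_all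

lemma half_int: "(LINT t|tor. cplx ((1 + s * tau t) / 2)) = 1 / 2"
proof -
  have "(LINT t|tor. cplx ((1 + s * tau t) / 2)) = (LINT t|tor. 1 / 2 + cplx (s / 2) * cplx (tau t))"
    by (simp add: add_divide_distrib)
  also have "\<dots> = 1 / 2" using tau_integrable(1) tau_mean torus.prob_space by simp
  finally show ?thesis .
qed

lemma half_cis_int: "(LINT t|tor. cplx ((1 + s * tau t) / 2) * cis t) = 0"
proof -
  have i: "integrable tor (\<lambda>t. cis t)" using tp_integrable[OF tp_cis[of 1 1 1 1]] by simp
  have "(LINT t|tor. cplx ((1 + s * tau t) / 2) * cis t) = (LINT t|tor. (1 / 2) * cis t + cplx (s / 2) * (cplx (tau t) * cis t))"
    by (simp add: add_divide_distrib algebra_simps)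
  also have "\<dots> = 0" using tau_integrable(2) tau_cis i torus_integral_cis[of 1] by simp
  finally show ?thesis .
qed

lemma half_cis_cnj_int: "(LINT t|tor. cplx ((1 + s * tau t) / 2) * cis (- t)) = 0"
proof -
  have "(LINT t|tor. cplx ((1 + s * tau t) / 2) * cis (- t)) = (LINT t|tor. cnj (cplx ((1 + s * tau t) / 2) * cis t))"
    by (simp add: cis_cnj)
  also have "\<dots> = cnj (LINT t|tor. cplx ((1 + s * tau t) / 2) * cis t)" by (rule Bochner_Integration.integral_cnj)
  finally show ?thesis using half_cis_int by simp
qed

lemma kap_mean: "(LINT t|tor. cplx (kap j t p)) = 1 / 2 ^ j"
proof (induction j arbitrary: p)
  case 0 then show ?case using torus.prob_space by simp
next
  case (Suc j)
  have "(LINT t|tor. cplx (kap (Suc j) t p)) =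
    (LINT t|tor. cplx (kap j t (p div 2)) * (\<lambda>t. cplx ((1 + (if even p then 1 else - 1) * tau t) / 2)) (real (Lam ^ j) * t))"
    unfolding kap_Suc of_real_mult[symmetric] by simp
  also have "\<dots> = (1 / 2 ^ j) * (1 / 2)"
    using lacunary[OF kap_tp[of j "p div 2"] _ _ half_tp[of "if even p then 1 else - 1"]] Laml
    unfolding half_int Suc.IH by simp
  finally show ?case by simp
qed

text \<open>The lacunary analytic polynomial attached to one branch of the tree, with
  \<open>cis (Lam^i t)\<close> in the role of the \<open>i\<close>-th Haar sign.\<close>

definition Yf :: "complex \<Rightarrow> (nat \<Rightarrow> complex) \<Rightarrow> nat \<Rightarrow> real \<Rightarrow> complex" where
  "Yf c \<eta> j t = c + (\<Sum>i<j. \<eta> i * cis (real (Lam ^ i) * t))"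

lemma Yf_tp: "tp 0 (DD j) (Yf c \<eta> j)"
  unfolding Yf_def[abs_def]
proof (intro tp_add tp_const tp_sum)
  show "0 \<le> DD j" by (rule DD_nonneg)
  fix i assume "i \<in> {..<j}"
  then show "tp 0 (DD j) (\<lambda>t. \<eta> i * cis (real (Lam ^ i) * t))"
    using tp_cis[of 0 "int (Lam ^ i)" "DD j" "\<eta> i"] DD_ge[of i j] by simp
qed simp

text \<open>Induction on the top level. The factor \<open>(1 + s * tau) / 2\<close> is orthogonal to
  \<open>cis t\<close> and \<open>cis (-t)\<close>, so the cross terms vanish and the lacunary
  exponentials are exactly orthogonal under the density \<open>kap\<close>.\<close>

lemma kap_second:
  "(LINT t|tor. cplx (kap j t p) * (Yf c \<eta> j t * cnj (Yf c \<eta> j t)))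
    = cplx (((cmod c)\<^sup>2 + (\<Sum>i<j. (cmod (\<eta> i))\<^sup>2)) / 2 ^ j)"
proof (induction j arbitrary: p)
  case 0 then show ?case using torus.prob_space by (simp add: Yf_def complex_norm_square[symmetric])
next
  case (Suc j)
  let ?s = "(if even p then 1 else - 1) :: real"
  let ?K = "\<lambda>t. cplx (kap j t (p div 2))"
  let ?g = "\<lambda>t. cplx ((1 + ?s * tau t) / 2)"
  let ?Y = "Yf c \<eta> j"
  have g2: "tp (- int l + 1) (int l + 1) (\<lambda>t. ?g t * cis t)" "tp (- int l - 1) (int l - 1) (\<lambda>t. ?g t * cis (- t))"
    using tp_mult[OF half_tp[of ?s] tp_cis[of 1 1 1 1]] tp_mult[OF half_tp[of ?s] tp_cis[of "-1" "-1" "-1" 1]] by auto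
  have K: "tp (- (int l * DD j)) (int l * DD j) ?K" by (rule kap_tp)
  have Y: "tp (- DD j) (DD j) ?Y" "tp (- DD j) (DD j) (\<lambda>t. cnj (?Y t))"
    using tp_mono[OF Yf_tp] tp_mono[OF tp_cnj[OF Yf_tp]] DD_nonneg by auto
  have D: "0 \<le> DD j" by (rule DD_nonneg)
  \<comment> \<open>The window must hold \<open>kap\<close>, which contributes \<open>l\<close>, and
    \<open>Yf\<close> and its conjugate, which contribute 1 each.\<close>
  have dist: "(int l + 2) * DD j = int l * DD j + (DD j + DD j)" by (simp add: algebra_simps)
  have KYY: "tp (- ((int l + 2) * DD j)) ((int l + 2) * DD j) (\<lambda>t. ?K t * (?Y t * cnj (?Y t)))"
    by (rule tp_mono[OF tp_mult[OF K tp_mult[OF Y]]]) (unfold dist, linarith+)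
  have KY: "tp (- ((int l + 2) * DD j)) ((int l + 2) * DD j) (\<lambda>t. ?K t * (cnj (\<eta> j) * ?Y t))"
    by (rule tp_mono[OF tp_mult[OF K tp_scale[OF Y(1)]]]) (use D in \<open>unfold dist, linarith+\<close>)
  have KYc: "tp (- ((int l + 2) * DD j)) ((int l + 2) * DD j) (\<lambda>t. ?K t * (\<eta> j * cnj (?Y t)))"
    by (rule tp_mono[OF tp_mult[OF K tp_scale[OF Y(2)]]]) (use D in \<open>unfold dist, linarith+\<close>)
  have K1: "tp (- ((int l + 2) * DD j)) ((int l + 2) * DD j) (\<lambda>t. (\<eta> j * cnj (\<eta> j)) * ?K t)"
    by (rule tp_mono[OF tp_scale[OF K]]) (use D in \<open>unfold dist, linarith+\<close>)
  have k: "0 \<le> int l + 2" "int l + 2 \<le> int Lam - 1" using Laml by auto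
  let ?x = "\<lambda>t. real (Lam ^ j) * t"
  have e: "cplx (kap (Suc j) t p) * (Yf c \<eta> (Suc j) t * cnj (Yf c \<eta> (Suc j) t)) =
     (?K t * (?Y t * cnj (?Y t))) * ?g (?x t) + (?K t * (\<eta> j * cnj (?Y t))) * (?g (?x t) * cis (?x t))
     + (?K t * (cnj (\<eta> j) * ?Y t)) * (?g (?x t) * cis (- ?x t)) + ((\<eta> j * cnj (\<eta> j)) * ?K t) * ?g (?x t)" for t
  proof -
    have "Yf c \<eta> (Suc j) t = ?Y t + \<eta> j * cis (?x t)" by (simp add: Yf_def)
    moreover have "cplx (kap (Suc j) t p) = ?K t * ?g (?x t)" unfolding kap_Suc of_real_mult ..
    moreover have "cis (?x t) * cis (- ?x t) = 1" by (simp add: cis_mult)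
    ultimately show ?thesis
      by (simp add: cis_cnj algebra_simps del: of_real_divide of_real_add of_real_mult of_nat_power)
  qed
  have dl: "tp (int Lam ^ j * lo) (int Lam ^ j * hi) (\<lambda>t. f (?x t))" if "tp lo hi f" for lo hi f
    using tp_dilate[OF that, of "int Lam ^ j"] by simp
  note I1 = tp_integrable[OF tp_mult[OF KYY dl[OF half_tp[of ?s]]]]
  note I2 = tp_integrable[OF tp_mult[OF KYc dl[OF g2(1)]]]
  note I3 = tp_integrable[OF tp_mult[OF KY dl[OF g2(2)]]]
  note I4 = tp_integrable[OF tp_mult[OF K1 dl[OF half_tp[of ?s]]]]
  have "(LINT t|tor. cplx (kap (Suc j) t p) * (Yf c \<eta> (Suc j) t * cnj (Yf c \<eta> (Suc j) t))) =
     (LINT t|tor. (?K t * (?Y t * cnj (?Y t))) * ?g (?x t)) + (LINT t|tor. (?K t * (\<eta> j * cnj (?Y t))) * (?g (?x t) * cis (?x t)))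
     + (LINT t|tor. (?K t * (cnj (\<eta> j) * ?Y t)) * (?g (?x t) * cis (- ?x t))) + (LINT t|tor. ((\<eta> j * cnj (\<eta> j)) * ?K t) * ?g (?x t))"
    unfolding e using I1 I2 I3 I4 by (simp add: del: of_real_divide of_real_add of_real_mult of_nat_power)
  also have "(LINT t|tor. (?K t * (?Y t * cnj (?Y t))) * ?g (?x t)) = cplx (((cmod c)\<^sup>2 + (\<Sum>i<j. (cmod (\<eta> i))\<^sup>2)) / 2 ^ j) * (1 / 2)"
    using lacunary[OF KYY k half_tp[of ?s]] unfolding half_int Suc.IH .
  also have "(LINT t|tor. (?K t * (\<eta> j * cnj (?Y t))) * (?g (?x t) * cis (?x t))) = 0"
    using lacunary[OF KYc k g2(1)] unfolding half_cis_int by simp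
  also have "(LINT t|tor. (?K t * (cnj (\<eta> j) * ?Y t)) * (?g (?x t) * cis (- ?x t))) = 0"
    using lacunary[OF KY k g2(2)] unfolding half_cis_cnj_int by simp
  also have "(LINT t|tor. ((\<eta> j * cnj (\<eta> j)) * ?K t) * ?g (?x t)) = (\<eta> j * cnj (\<eta> j)) * (1 / 2 ^ j) * (1 / 2)"
  proof -
    have "(LINT t|tor. (\<eta> j * cnj (\<eta> j)) * ?K t) = (\<eta> j * cnj (\<eta> j)) * (1 / 2 ^ j)"
      unfolding kap_mean[symmetric, of j "p div 2"] by (rule integral_mult_right_zero)
    then show ?thesis using lacunary[OF K1 k half_tp[of ?s]] unfolding half_int by (simp only: mult.assoc)
  qed
  finally show ?case by (simp add: complex_norm_square[symmetric] add_divide_distrib mult.commute[of 2])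
qed

text \<open>By the definition of \<open>rho\<close> each level contributes
  \<open>(1 + s * s') / 2\<close>, the Kronecker delta of the two signs; lacunarity multiplies the
  levels.\<close>

lemma kap_wt:
  assumes "p < 2 ^ j" "p' < 2 ^ j"
  shows "(LINT t|tor. cplx (kap j t p) * cplx (wt j t p')) = (if p = p' then 1 else 0)"
  using assms
proof (induction j arbitrary: p p')
  case 0 then show ?case using torus.prob_space by simp
next
  case (Suc j)
  let ?s = "(if even p then 1 else - 1) :: real" and ?s' = "(if even p' then 1 else - 1) :: real"
  let ?h = "\<lambda>t. cplx (kap j t (p div 2)) * cplx (wt j t (p' div 2))"
  let ?g = "\<lambda>t. cplx ((1 + ?s * tau t) / 2) * cplx (1 + ?s' * taut t / rho)"
  have wtp: "tp (- int l) (int l) (\<lambda>t. cplx (1 + ?s' * taut t / rho))"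
    using tp_add[OF tp_const[of "- int l" "int l" "1"] tp_scale[OF taut_tp, of "cplx (?s' / rho)"]] by simp
  have i: "integrable tor (\<lambda>t. cplx (taut t))" "integrable tor (\<lambda>t. cplx (tau t) * cplx (taut t))"
    using tp_integrable[OF taut_tp] tp_integrable[OF tp_mult[OF tau_tp taut_tp]] by auto
  have "?g t = 1 / 2 + cplx (?s / 2) * cplx (tau t) + cplx (?s' / (2 * rho)) * cplx (taut t)
     + cplx (?s * ?s' / (2 * rho)) * (cplx (tau t) * cplx (taut t))" for t
    using rho01 by (simp add: field_simps)
  then have "(LINT t|tor. ?g t) = (LINT t|tor. 1 / 2 + cplx (?s / 2) * cplx (tau t) + cplx (?s' / (2 * rho)) * cplx (taut t)
     + cplx (?s * ?s' / (2 * rho)) * (cplx (tau t) * cplx (taut t)))" by presburger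
  also have "\<dots> = 1 / 2 + cplx (?s * ?s' / (2 * rho)) * cplx rho"
    using i tau_integrable(1) tau_mean taut_mean rho torus.prob_space
    by (simp del: of_real_divide of_real_mult)
  also have "\<dots> = (if even p = even p' then 1 else 0)" using rho01 by simp
  finally have g: "(LINT t|tor. ?g t) = (if even p = even p' then 1 else 0)" .
  have hp: "tp (- ((2 * int l) * DD j)) ((2 * int l) * DD j) ?h"
    using tp_mult[OF kap_tp[of j "p div 2"] wt_tp[of j "p' div 2"]] by (simp add: algebra_simps)
  have "(LINT t|tor. cplx (kap (Suc j) t p) * cplx (wt (Suc j) t p')) = (LINT t|tor. ?h t * ?g (real (Lam ^ j) * t))"
    unfolding kap_Suc wt_Suc of_real_mult by (simp only: mult_ac)
  also have "\<dots> = (LINT t|tor. ?h t) * (LINT t|tor. ?g t)"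
    by (rule lacunary[OF hp _ _ tp_mult[OF half_tp wtp]]) (use Laml in auto)
  also have "(LINT t|tor. ?h t) = (if p div 2 = p' div 2 then 1 else 0)"
    using Suc.prems by (intro Suc.IH) auto
  also have "(if p div 2 = p' div 2 then 1 else 0) * (LINT t|tor. ?g t) = (if p = p' then 1 else (0::complex))"
  proof -
    have "p = p' \<longleftrightarrow> p div 2 = p' div 2 \<and> (even p \<longleftrightarrow> even p')"
      by (metis div_mult_mod_eq even_iff_mod_2_eq_zero not_mod_2_eq_1_eq_0)
    then show ?thesis unfolding g by simp
  qed
  finally show ?case .
qed

text \<open>The densities of two siblings add up to that of the parent because their
  \<open>tau\<close> terms cancel.\<close>

lemma kap_tower:
  assumes "j \<le> m"
  shows "(\<Sum>n<2^m. cplx (kap m t n) * h (n div 2 ^ (m - j))) = (\<Sum>p<2^j. cplx (kap j t p) * h p)"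
  using assms
proof (induction m)
  case (Suc m)
  show ?case
  proof (cases "j = Suc m")
    case False
    then have jm: "j \<le> m" using Suc by simp
    have d: "(2 * p) div 2 ^ (Suc m - j) = p div 2 ^ (m - j)" "(2 * p + 1) div 2 ^ (Suc m - j) = p div 2 ^ (m - j)" for p :: nat
      using jm by (simp_all add: Suc_diff_le div_mult2_eq)
    have "(\<Sum>n<2^Suc m. cplx (kap (Suc m) t n) * h (n div 2 ^ (Suc m - j))) =
      (\<Sum>p<2^m. cplx (kap m t p) * h (p div 2 ^ (m - j)))"
      unfolding sum_pairs kap_Suc d by (rule sum.cong) (auto simp: field_simps)
    then show ?thesis using Suc jm by simp
  qed simp
qed simp

lemma kap_sum: "(\<Sum>n<2^b. kap b t n) = 1"
proof -
  have "cplx (\<Sum>n<2^b. kap b t n) = 1" using kap_tower[of 0 b t "\<lambda>_. 1"] by simp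
  then show ?thesis using of_real_eq_1_iff by blast
qed

text \<open>A mixture of branch polynomials with weights \<open>kap\<close>. This redundant form
  suits Jensen's inequality; \<open>Jf_expand\<close> shows that each tree coefficient is really
  used once.\<close>

definition Jf :: "vec \<Rightarrow> real \<Rightarrow> complex" where
  "Jf y t = (\<Sum>n<2^b. cplx (kap b t n) * Yf (y 0 0) (\<lambda>i. y (Suc i) (n div 2 ^ (b - i))) b t)"

lemma Jf_expand:
  "Jf y t = y 0 0 + (\<Sum>i<b. \<Sum>p<2^i. y (Suc i) p * (cplx (kap i t p) * cis (real (Lam ^ i) * t)))"
proof -
  have "Jf y t = y 0 0 * cplx (\<Sum>n<2^b. kap b t n)
     + (\<Sum>i<b. (\<Sum>n<2^b. cplx (kap b t n) * (\<lambda>p. y (Suc i) p * cis (real (Lam ^ i) * t)) (n div 2 ^ (b - i))))"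
    unfolding Jf_def Yf_def
    by (simp add: distrib_left sum.distrib sum_distrib_left sum_distrib_right mult_ac) (subst sum.swap, simp)
  also have "(\<Sum>i<b. (\<Sum>n<2^b. cplx (kap b t n) * (\<lambda>p. y (Suc i) p * cis (real (Lam ^ i) * t)) (n div 2 ^ (b - i)))) =
     (\<Sum>i<b. \<Sum>p<2^i. y (Suc i) p * (cplx (kap i t p) * cis (real (Lam ^ i) * t)))"
  proof (rule sum.cong[OF refl])
    fix i assume i: "i \<in> {..<b}"
    have "(\<Sum>n<2^b. cplx (kap b t n) * (\<lambda>p. y (Suc i) p * cis (real (Lam ^ i) * t)) (n div 2 ^ (b - i))) = (\<Sum>p<2^i. cplx (kap i t p) * (\<lambda>p. y (Suc i) p * cis (real (Lam ^ i) * t)) p)"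
      using i by (intro kap_tower) simp
    then show "(\<Sum>n<2^b. cplx (kap b t n) * (\<lambda>p. y (Suc i) p * cis (real (Lam ^ i) * t)) (n div 2 ^ (b - i))) =
      (\<Sum>p<2^i. y (Suc i) p * (cplx (kap i t p) * cis (real (Lam ^ i) * t)))" by (simp add: mult_ac)
  qed
  finally show ?thesis by (simp add: kap_sum)
qed

lemma cis_Lam_tp: "tp (int Lam ^ i) (int Lam ^ i) (\<lambda>t. cis (real (Lam ^ i) * t))"
  "tp (- (int Lam ^ i)) (- (int Lam ^ i)) (\<lambda>t. cis (- real (Lam ^ i) * t))"
  using tp_cis[of "int Lam ^ i" "int Lam ^ i" "int Lam ^ i" 1] tp_cis[of "- (int Lam ^ i)" "- (int Lam ^ i)" "- (int Lam ^ i)" 1] by auto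

text \<open>The exponent \<open>Lam^i\<close> exceeds \<open>l * DD i\<close>, the reach of
  \<open>kap i\<close> into negative frequencies, so every summand is analytic.\<close>

lemma Jf_tp: "tp 0 ((int l + 1) * DD b) (Jf y)"
  unfolding Jf_expand[abs_def]
proof (intro tp_add tp_const tp_sum tp_scale)
  show "0 \<le> (int l + 1) * DD b" using DD_nonneg by simp
  fix i p assume i: "i \<in> {..<b}"
  have 1: "int l * DD i \<le> int Lam ^ i - 1" using Laml by (intro DD_lt) auto
  have 2: "int l * DD i \<le> int l * DD b" using DD_mono[of i b] i by (intro mult_left_mono) auto
  show "tp 0 ((int l + 1) * DD b) (\<lambda>t. cplx (kap i t p) * cis (real (Lam ^ i) * t))"
    by (rule tp_mono[OF tp_mult[OF kap_tp cis_Lam_tp(1)]]) (use 1 2 DD_ge[of i b] i in \<open>auto simp: algebra_simps\<close>)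
qed simp

lemma tsq_eq: "n < 2^b \<Longrightarrow> tsq b y n = (cmod (y 0 0))\<^sup>2 + (\<Sum>i<b. (cmod (y (Suc i) (n div 2 ^ (b - i))))\<^sup>2)"
  unfolding tsq_def anc_def sum.atMost_shift by simp

lemma phi_sum_le:
  assumes "finite A" "\<And>n. n \<in> A \<Longrightarrow> 0 \<le> k n" "(\<Sum>n\<in>A. k n) = 1"
  shows "phi (\<Sum>n\<in>A. k n * x n) \<le> (\<Sum>n\<in>A. k n * phi (x n))"
proof -
  define X where "X = (\<Sum>n\<in>A. k n * x n)"
  define d where "d = X / sqrt (1 + X\<^sup>2)"
  have "phi X = phi X * (\<Sum>n\<in>A. k n) + d * ((\<Sum>n\<in>A. k n * x n) - X * (\<Sum>n\<in>A. k n))"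
    using assms(3) by (simp add: X_def)
  also have "\<dots> = (\<Sum>n\<in>A. k n * (phi X + d * (x n - X)))"
    by (simp add: sum_distrib_left sum.distrib sum_subtractf algebra_simps)
  also have "\<dots> \<le> (\<Sum>n\<in>A. k n * phi (x n))"
    using phi_tangent[of X] assms(2) unfolding d_def by (intro sum_mono mult_left_mono) auto
  finally show ?thesis unfolding X_def .
qed

lemma kap_cont: "continuous_on A (\<lambda>t. kap j t p)"
  using continuous_on_Re[OF tp_continuous[OF kap_tp]] by simp

lemma kap_le1: "kap j t p \<le> 1"
  unfolding kap_def
proof (rule prod_le_1)
  fix i assume "i \<in> {..<j}"
  have "\<bar>sgnb j i p * tau (real (Lam ^ i) * t)\<bar> \<le> 1" using tau_le by (simp add: abs_mult)
  then show "0 \<le> (1 + sgnb j i p * tau (real (Lam ^ i) * t)) / 2 \<and> (1 + sgnb j i p * tau (real (Lam ^ i) * t)) / 2 \<le> 1" by (simp add: abs_le_iff)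
qed

text \<open>\<open>sqrt (1 + x)\<close> lies below its tangent at \<open>A\<close>, the mean of
  \<open>|Yf|^2\<close> under the normalised density \<open>kap\<close>. Hence only the mass and the
  second moment enter.\<close>

lemma kap_phi_le:
  "(LINT t|tor. kap b t n * phi (cmod (Yf c \<eta> b t))) \<le> phi (sqrt ((cmod c)\<^sup>2 + (\<Sum>i<b. (cmod (\<eta> i))\<^sup>2))) / 2^b"
proof -
  define A where "A = (cmod c)\<^sup>2 + (\<Sum>i<b. (cmod (\<eta> i))\<^sup>2)"
  have A: "0 \<le> A" unfolding A_def by (simp add: sum_nonneg)
  define Y where "Y = Yf c \<eta> b"
  obtain B where B: "\<And>t. cmod (Y t) \<le> B" using tp_bounded[OF Yf_tp] unfolding Y_def by blast
  have Yc: "continuous_on UNIV Y" unfolding Y_def by (rule tp_continuous[OF Yf_tp])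
  have i1: "integrable tor (\<lambda>t. kap b t n * phi (cmod (Y t)))"
  proof (rule torus_integrable[where B="phi B"])
    show "(\<lambda>t. kap b t n * phi (cmod (Y t))) \<in> borel_measurable borel"
      unfolding phi_def by (intro borel_measurable_continuous_onI continuous_intros kap_cont Yc)
    show "norm (kap b t n * phi (cmod (Y t))) \<le> phi B" for t
      using mult_mono[OF kap_le1 phi_mono[OF _ B[of t]]] kap_nonneg by (simp add: abs_mult)
  qed
  have i2: "integrable tor (\<lambda>t. kap b t n)"
    using kap_le1 kap_nonneg by (intro torus_integrable[where B=1] borel_measurable_continuous_onI kap_cont) auto
  have i3: "integrable tor (\<lambda>t. kap b t n * (cmod (Y t))\<^sup>2)"
  proof (rule torus_integrable[where B="B\<^sup>2"])
    show "(\<lambda>t. kap b t n * (cmod (Y t))\<^sup>2) \<in> borel_measurable borel"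
      by (intro borel_measurable_continuous_onI continuous_intros kap_cont Yc)
    show "norm (kap b t n * (cmod (Y t))\<^sup>2) \<le> B\<^sup>2" for t
      using mult_mono[OF kap_le1 power_mono[OF B[of t], of 2]] kap_nonneg by (simp add: abs_mult)
  qed
  have e2: "(LINT t|tor. kap b t n) = 1 / 2^b"
  proof -
    have "cplx (LINT t|tor. kap b t n) = cplx (1 / 2^b)"
      using kap_mean[of b n] by simp
    then show ?thesis by (simp only: of_real_eq_iff)
  qed
  have e3: "(LINT t|tor. kap b t n * (cmod (Y t))\<^sup>2) = A / 2^b"
  proof -
    have "cplx (LINT t|tor. kap b t n * (cmod (Y t))\<^sup>2) = (LINT t|tor. cplx (kap b t n * (cmod (Y t))\<^sup>2))"
      by (rule integral_complex_of_real[symmetric])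
    also have "\<dots> = (LINT t|tor. cplx (kap b t n) * (Y t * cnj (Y t)))"
      by (simp add: complex_norm_square[symmetric])
    also have "\<dots> = cplx (A / 2^b)" unfolding Y_def A_def by (rule kap_second)
    finally show ?thesis by (simp only: of_real_eq_iff)
  qed
  let ?r = "sqrt (1 + A)"
  have r: "?r > 0" using A by simp
  have pt: "kap b t n * phi (cmod (Y t)) \<le> (?r - 1 - A / (2 * ?r)) * kap b t n + 1 / (2 * ?r) * (kap b t n * (cmod (Y t))\<^sup>2)" for t
  proof -
    have "sqrt (1 + x) \<le> ?r + (x - A) / (2 * ?r)" if "x \<ge> 0" for x
    proof -
      have "2 * sqrt (1 + x) * ?r \<le> (1 + x) + (1 + A)"
        using sum_squares_bound[of "sqrt (1 + x)" ?r] that A by simp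
      then have "sqrt (1 + x) \<le> ((1 + x) + (1 + A)) / (2 * ?r)" using r by (simp add: pos_le_divide_eq mult_ac)
      also have "\<dots> = ?r + (x - A) / (2 * ?r)"
      proof -
        have "?r = (1 + A) / ?r" using A r by (simp add: eq_divide_eq)
        then have "?r + (x - A) / (2 * ?r) = (1 + A) / ?r + (x - A) / (2 * ?r)" by simp
        also have "\<dots> = ((1 + x) + (1 + A)) / (2 * ?r)" using r by (simp add: field_simps)
        finally show ?thesis by simp
      qed
      finally show ?thesis .
    qed
    from this[of "(cmod (Y t))\<^sup>2"] have "phi (cmod (Y t)) \<le> (?r - 1 - A / (2 * ?r)) + 1 / (2 * ?r) * (cmod (Y t))\<^sup>2"
      by (simp add: phi_def diff_divide_distrib)
    from mult_left_mono[OF this kap_nonneg, of b t n] show ?thesis by (simp add: algebra_simps)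
  qed
  have "(LINT t|tor. kap b t n * phi (cmod (Y t))) \<le> (LINT t|tor. (?r - 1 - A / (2 * ?r)) * kap b t n + 1 / (2 * ?r) * (kap b t n * (cmod (Y t))\<^sup>2))"
    by (intro integral_mono i1 pt Bochner_Integration.integrable_add integrable_mult_right i2 i3)
  also have "\<dots> = (?r - 1 - A / (2 * ?r)) * (1 / 2^b) + 1 / (2 * ?r) * (A / 2^b)"
    by (subst Bochner_Integration.integral_add) (simp_all add: i2 i3 e2 e3)
  also have "\<dots> = phi (sqrt A) / 2^b" using A by (simp add: phi_def diff_divide_distrib)
  finally show ?thesis unfolding Y_def A_def .
qed

lemma Jf_bound: "(\<integral>\<^sup>+ t. ennreal (phi (cmod (Jf y t))) \<partial>tor) \<le> tmod b y"
proof -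
  let ?Y = "\<lambda>n. Yf (y 0 0) (\<lambda>i. y (Suc i) (n div 2 ^ (b - i))) b"
  have m: "(\<lambda>t. kap b t n * phi (cmod (?Y n t))) \<in> borel_measurable tor" for n
  proof -
    have "(\<lambda>t. kap b t n * phi (cmod (?Y n t))) \<in> borel_measurable borel"
      unfolding phi_def by (intro borel_measurable_continuous_onI continuous_intros kap_cont tp_continuous[OF Yf_tp])
    then show ?thesis by (simp cong: measurable_cong_sets)
  qed
  have bd: "\<exists>B. \<forall>t. \<bar>kap b t n * phi (cmod (?Y n t))\<bar> \<le> B" for n
  proof -
    obtain B where B: "\<And>t. cmod (?Y n t) \<le> B" using tp_bounded[OF Yf_tp] by blast
    have "\<bar>kap b t n * phi (cmod (?Y n t))\<bar> \<le> phi B" for t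
      using mult_mono[OF kap_le1 phi_mono[OF _ B[of t]]] kap_nonneg by (simp add: abs_mult)
    then show ?thesis by blast
  qed
  have int: "integrable tor (\<lambda>t. kap b t n * phi (cmod (?Y n t)))" for n
    using bd[of n] m[of n] by (auto intro!: torus.integrable_const_bound AE_I2)
  have "(\<integral>\<^sup>+ t. ennreal (phi (cmod (Jf y t))) \<partial>tor) \<le> (\<integral>\<^sup>+ t. (\<Sum>n<2^b. ennreal (kap b t n * phi (cmod (?Y n t)))) \<partial>tor)"
  proof (rule nn_integral_mono)
    fix t
    have "cmod (Jf y t) \<le> (\<Sum>n<2^b. kap b t n * cmod (?Y n t))"
      unfolding Jf_def by (rule order_trans[OF norm_sum]) (simp add: norm_mult kap_nonneg)
    then have "phi (cmod (Jf y t)) \<le> phi (\<Sum>n<2^b. kap b t n * cmod (?Y n t))" by (intro phi_mono) auto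
    also have "\<dots> \<le> (\<Sum>n<2^b. kap b t n * phi (cmod (?Y n t)))"
      by (rule phi_sum_le) (auto simp: kap_nonneg kap_sum)
    finally have "ennreal (phi (cmod (Jf y t))) \<le> ennreal (\<Sum>n<2^b. kap b t n * phi (cmod (?Y n t)))" by (rule ennreal_leI)
    then show "ennreal (phi (cmod (Jf y t))) \<le> (\<Sum>n<2^b. ennreal (kap b t n * phi (cmod (?Y n t))))"
      by (simp add: sum_ennreal kap_nonneg)
  qed
  also have "\<dots> = (\<Sum>n<2^b. \<integral>\<^sup>+ t. ennreal (kap b t n * phi (cmod (?Y n t))) \<partial>tor)"
    using m by (intro nn_integral_sum) auto
  also have "\<dots> = (\<Sum>n<2^b. ennreal (LINT t|tor. kap b t n * phi (cmod (?Y n t))))"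
    by (intro sum.cong refl nn_integral_eq_integral int) (simp add: kap_nonneg)
  also have "\<dots> \<le> (\<Sum>n<2^b. ennreal (phi (sqrt (tsq b y n)) / 2^b))"
    by (intro sum_mono ennreal_leI) (simp add: tsq_eq kap_phi_le)
  also have "\<dots> = tmod b y" unfolding tmod_def by (simp add: sum_ennreal sum_divide_distrib)
  finally show ?thesis .
qed

text \<open>The dual functionals: remove the exponential of the level, then pair with the dual
  weight of the cell.\<close>

definition Qf :: "(real \<Rightarrow> complex) \<Rightarrow> vec" where
  "Qf F j p = (case j of 0 \<Rightarrow> if p = 0 then (LINT t|tor. F t) else 0
     | Suc i \<Rightarrow> if i < b \<and> p < 2^i then (LINT t|tor. F t * (cis (- real (Lam ^ i) * t) * cplx (wt i t p))) else 0)"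

text \<open>On different levels the larger exponential lies beyond the reach of all other factors,
  so the product has no zero frequency.\<close>

lemma kap_wt_cross:
  assumes "p < 2 ^ i" "p' < 2 ^ j"
  shows "(LINT t|tor. (cplx (kap i t p) * cis (real (Lam ^ i) * t)) * (cis (- real (Lam ^ j) * t) * cplx (wt j t p')))
     = (if i = j \<and> p = p' then 1 else 0)"
proof (cases "i = j")
  case True
  have "(cplx (kap i t p) * cis (real (Lam ^ i) * t)) * (cis (- real (Lam ^ j) * t) * cplx (wt j t p')) = cplx (kap j t p) * cplx (wt j t p')" for t
  proof -
    have "cis (real (Lam ^ i) * t) * cis (- real (Lam ^ j) * t) = 1" using True by (simp add: cis_mult)
    then show ?thesis using True by (simp add: mult_ac)
  qed
  note e = this
  show ?thesis unfolding e using kap_wt[of p j p'] True assms by simp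
next
  case False
  note t = tp_mult[OF tp_mult[OF kap_tp[of i p] cis_Lam_tp(1)[of i]] tp_mult[OF cis_Lam_tp(2)[of j] wt_tp[of j p']]]
  have k: "(2 * int l + 1) * DD m \<le> int Lam ^ m - 1" for m using Laml by (intro DD_lt) auto
  have "0 < (- (int l * DD i) + int Lam ^ i) + (- (int Lam ^ j) + - (int l * DD j)) \<or> (int l * DD i + int Lam ^ i) + (- (int Lam ^ j) + int l * DD j) < 0"
  proof (cases "i < j")
    case True
    have "int l * DD i \<le> int l * DD j" using DD_mono[of i j] True by (intro mult_left_mono) auto
    then have "(int l * DD i + int Lam ^ i) + (- (int Lam ^ j) + int l * DD j) < 0"
      using k[of j] DD_ge[OF True] by (simp add: algebra_simps)
    then show ?thesis by simp
  next
    case f: False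
    then have "j < i" using False by simp
    moreover have "int l * DD j \<le> int l * DD i" using DD_mono[of j i] \<open>j < i\<close> by (intro mult_left_mono) auto
    ultimately have "0 < (- (int l * DD i) + int Lam ^ i) + (- (int Lam ^ j) + - (int l * DD j))"
      using k[of i] DD_ge[of j i] by (simp add: algebra_simps)
    then show ?thesis by simp
  qed
  from tp_integral_zero[OF t this] show ?thesis using False by simp
qed

lemma Qf_Jf:
  assumes "y \<in> fst (tree_block b)"
  shows "Qf (Jf y) = y"
proof (intro ext)
  fix j p
  let ?T = "\<lambda>i p t. cplx (kap i t p) * cis (real (Lam ^ i) * t)"
  have k: "int l * DD m \<le> int Lam ^ m - 1" for m using Laml by (intro DD_lt) auto
  have Tt: "tp (- (int l * DD i) + int Lam ^ i) (int l * DD i + int Lam ^ i) (?T i p)" for i p by (rule tp_mult[OF kap_tp cis_Lam_tp(1)])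
  show "Qf (Jf y) j p = y j p"
  proof (cases j)
    case 0
    have z: "(LINT t|tor. ?T i p t) = 0" for i p
      by (rule tp_integral_zero[OF Tt]) (use k[of i] in auto)
    have "(LINT t|tor. Jf y t) = y 0 0"
      unfolding Jf_expand using tp_integrable[OF Tt] z torus.prob_space
      by (simp add: Bochner_Integration.integral_sum)
    moreover have "p \<noteq> 0 \<Longrightarrow> y 0 p = 0" using assms by (auto simp: tree_block_def)
    ultimately show ?thesis using 0 by (auto simp: Qf_def)
  next
    case (Suc i)
    show ?thesis
    proof (cases "i < b \<and> p < 2^i")
      case True
      let ?W = "\<lambda>t. cis (- real (Lam ^ i) * t) * cplx (wt i t p)"
      have Wt: "tp (- (int Lam ^ i) + - (int l * DD i)) (- (int Lam ^ i) + int l * DD i) ?W" by (rule tp_mult[OF cis_Lam_tp(2) wt_tp])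
      have W0: "(LINT t|tor. ?W t) = 0" by (rule tp_integral_zero[OF Wt]) (use k[of i] in auto)
      have "Qf (Jf y) j p = (LINT t|tor. Jf y t * ?W t)" using Suc True by (simp add: Qf_def)
      also have "\<dots> = (LINT t|tor. y 0 0 * ?W t + (\<Sum>i'<b. \<Sum>p'<2^i'. y (Suc i') p' * (?T i' p' t * ?W t)))"
        unfolding Jf_expand by (simp add: distrib_right sum_distrib_right mult.assoc)
      also have "\<dots> = (\<Sum>i'<b. \<Sum>p'<2^i'. y (Suc i') p' * (LINT t|tor. ?T i' p' t * ?W t))"
        using tp_integrable[OF tp_mult[OF Tt Wt]] tp_integrable[OF Wt] W0
        by (simp add: Bochner_Integration.integral_sum del: of_nat_power)
      also have "\<dots> = (\<Sum>i'<b. \<Sum>p'<2^i'. if i' = i \<and> p' = p then y (Suc i') p' else 0)"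
        by (intro sum.cong refl, subst kap_wt_cross) (use True in auto)
      also have "\<dots> = (\<Sum>i'<b. if i' = i then (\<Sum>p'<2^i'. if p' = p then y (Suc i') p' else 0) else 0)"
        by (intro sum.cong refl) auto
      also have "\<dots> = y (Suc i) p" using True by simp
      finally show ?thesis using Suc by simp
    next
      case False
      then have "y (Suc i) p = 0" using assms by (auto simp: tree_block_def)
      then show ?thesis using False Suc by (auto simp: Qf_def)
    qed
  qed
qed

end

text \<open>Testing with the unit vector \<open>u\<close> at which the l2 norm is attained reduces
  the vector-valued estimate to a scalar kernel bound.\<close>

lemma minkowski_kernel:
  fixes a :: "'i \<Rightarrow> 'a \<Rightarrow> complex" and w :: "'a \<Rightarrow> complex"
  assumes I: "finite I" and i: "\<And>i. i \<in> I \<Longrightarrow> integrable M (\<lambda>x. a i x * w x)" and w: "\<And>x. cmod (w x) \<le> k x"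
  shows "ennreal (L2_set (\<lambda>i. cmod (LINT x|M. a i x * w x)) I) \<le> (\<integral>\<^sup>+ x. ennreal (k x) * ennreal (L2_set (\<lambda>i. cmod (a i x)) I) \<partial>M)"
proof -
  define v where "v i = (LINT x|M. a i x * w x)" for i
  define V where "V = L2_set (\<lambda>i. cmod (v i)) I"
  have k: "0 \<le> k x" for x using w[of x] norm_ge_zero order_trans by blast
  show ?thesis
  proof (cases "V = 0")
    case True then show ?thesis unfolding V_def v_def by simp
  next
    case False
    then have V: "V > 0" unfolding V_def using L2_set_nonneg[of _ I] by (simp add: order_less_le)
    have V2: "(\<Sum>i\<in>I. (cmod (v i))\<^sup>2) = V\<^sup>2" unfolding V_def L2_set_def by (simp add: sum_nonneg)
    define u where "u i = cnj (v i) / of_real V" for i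
    have "cplx V = (\<Sum>i\<in>I. u i * v i)"
    proof -
      have "(\<Sum>i\<in>I. u i * v i) = (\<Sum>i\<in>I. cplx ((cmod (v i))\<^sup>2)) / of_real V"
        unfolding u_def complex_norm_square by (simp add: sum_divide_distrib mult.commute)
      also have "\<dots> = cplx (V\<^sup>2 / V)" unfolding V2[symmetric] by simp
      finally show ?thesis using V by (simp add: power2_eq_square)
    qed
    also have "\<dots> = (LINT x|M. (\<Sum>i\<in>I. u i * a i x) * w x)"
      unfolding v_def sum_distrib_right mult.assoc using i by (simp add: Bochner_Integration.integral_sum)
    finally have Ve: "cplx V = (LINT x|M. (\<Sum>i\<in>I. u i * a i x) * w x)" .
    have "integrable M (\<lambda>x. (\<Sum>i\<in>I. u i * a i x) * w x)"
      unfolding sum_distrib_right mult.assoc using i by (intro Bochner_Integration.integrable_sum integrable_mult_right)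
    from norm_lint_le_kernel[OF this w] have "ennreal V \<le> (\<integral>\<^sup>+ x. ennreal (k x) * ennreal (cmod (\<Sum>i\<in>I. u i * a i x)) \<partial>M)"
      unfolding Ve[symmetric] using V by simp
    also have "\<dots> \<le> (\<integral>\<^sup>+ x. ennreal (k x) * ennreal (L2_set (\<lambda>i. cmod (a i x)) I) \<partial>M)"
    proof (intro nn_integral_mono mult_left_mono ennreal_leI)
      fix x
      have "cmod (\<Sum>i\<in>I. u i * a i x) \<le> (\<Sum>i\<in>I. \<bar>cmod (u i)\<bar> * \<bar>cmod (a i x)\<bar>)"
        by (rule order_trans[OF norm_sum]) (simp add: norm_mult)
      also have "\<dots> \<le> L2_set (\<lambda>i. cmod (u i)) I * L2_set (\<lambda>i. cmod (a i x)) I" by (rule L2_set_mult_ineq)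
      also have "L2_set (\<lambda>i. cmod (u i)) I = 1"
        using V unfolding L2_set_def u_def by (simp add: norm_divide power_divide V2 flip: sum_divide_distrib)
      finally show "cmod (\<Sum>i\<in>I. u i * a i x) \<le> L2_set (\<lambda>i. cmod (a i x)) I" by simp
    qed auto
    finally show ?thesis unfolding V_def v_def .
  qed
qed

lemma fej_measurable [measurable]: "fej R \<in> borel_measurable borel"
  by (intro borel_measurable_continuous_onI fej_cont)

definition fejb :: "nat \<Rightarrow> real" where "fejb R = 1 + (\<Sum>n=1..<R. 2 * \<bar>1 - real n / real R\<bar>)"

lemma fej_le: "\<bar>fej R t\<bar> \<le> fejb R"
proof -
  have "\<bar>fej R t\<bar> \<le> 1 + (\<Sum>n=1..<R. \<bar>2 * (1 - real n / real R) * cos (real n * t)\<bar>)"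
    unfolding fej_def by (rule order_trans[OF abs_triangle_ineq]) (simp add: order_trans[OF sum_abs])
  also have "\<dots> \<le> fejb R" unfolding fejb_def
  proof (intro add_left_mono sum_mono)
    fix n
    have "\<bar>2 * (1 - real n / real R) * cos (real n * t)\<bar> = (2 * \<bar>1 - real n / real R\<bar>) * \<bar>cos (real n * t)\<bar>"
      by (simp only: abs_mult abs_numeral)
    also have "\<dots> \<le> (2 * \<bar>1 - real n / real R\<bar>) * 1" by (intro mult_left_mono) auto
    finally show "\<bar>2 * (1 - real n / real R) * cos (real n * t)\<bar> \<le> 2 * \<bar>1 - real n / real R\<bar>" by simp
  qed
  finally show ?thesis .
qed

lemma fej_tp: "R > 0 \<Longrightarrow> tp (- (int R - 1)) (int R - 1) (\<lambda>x. cplx (fej R (s - x)))"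
  unfolding fej_cis
proof (intro tp_add tp_const tp_sum tp_scale)
  fix n assume n: "n \<in> {1..<R}"
  show "tp (- (int R - 1)) (int R - 1) (\<lambda>x. cis (- real n * x))"
    using tp_cis[of "- (int R - 1)" "- int n" "int R - 1" 1] n by simp
  show "tp (- (int R - 1)) (int R - 1) (\<lambda>x. cis (real n * x))"
    using tp_cis[of "- (int R - 1)" "int n" "int R - 1" 1] n by simp
qed auto

lemma fej_mean: "(LINT x|tor. cplx (fej R (s - x))) = 1"
proof -
  have z: "(LINT x|tor. cis (- real n * x)) = 0" "(LINT x|tor. cis (real n * x)) = 0"
     "integrable tor (\<lambda>x. cis (- real n * x))" "integrable tor (\<lambda>x. cis (real n * x))" if "n \<ge> 1" for n
    using torus_integral_cis[of "- int n"] torus_integral_cis[of "int n"] that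
      tp_integrable[OF tp_cis[of "- int n" "- int n" "- int n" 1]] tp_integrable[OF tp_cis[of "int n" "int n" "int n" 1]] by auto
  show ?thesis unfolding fej_cis using z torus.prob_space
    by (subst Bochner_Integration.integral_add) (auto simp: Bochner_Integration.integral_sum)
qed

lemma fej_sym: "fej R (s - x) = fej R (x - s)"
proof -
  have "cos (real n * (s - x)) = cos (real n * (x - s))" for n
    using cos_minus[of "real n * (x - s)"] by (simp add: algebra_simps)
  then show ?thesis by (simp add: fej_def)
qed

lemma fej_nn_mean: "R > 0 \<Longrightarrow> (\<integral>\<^sup>+ x. ennreal (fej R (s - x)) \<partial>tor) = 1"
proof -
  assume R: "R > 0"
  have "cplx (LINT x|tor. fej R (s - x)) = cplx 1" using fej_mean[of R s] by simp
  then have "(LINT x|tor. fej R (s - x)) = 1" by (simp only: of_real_eq_iff)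
  then show ?thesis
    by (subst torus_nn_integral[where B="fejb R"]) (use fej_le[of R] fej_nonneg[OF R] in \<open>auto simp: abs_le_iff\<close>)
qed

section \<open>Independent phases, Fejer products and the Bellman induction\<close>

abbreviation TT :: "nat \<Rightarrow> (nat \<Rightarrow> real) measure" where "TT j \<equiv> PiM {..<j} (\<lambda>_. tor)"

interpretation TP: product_sigma_finite "\<lambda>_ :: nat. tor"
  by (simp add: product_sigma_finite_def prob_space_imp_sigma_finite prob_space_torus)

lemma prob_TT: "prob_space (TT j)" by (rule prob_space_PiM) (rule prob_space_torus)

lemma TT_integrable:
  fixes h :: "(nat \<Rightarrow> real) \<Rightarrow> 'b::{banach, second_countable_topology}"
  assumes "h \<in> borel_measurable (TT j)" "\<And>\<theta>. norm (h \<theta>) \<le> B"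
  shows "integrable (TT j) h"
  by (rule finite_measure.integrable_const_bound[where B=B]) (use assms prob_TT prob_space.axioms(1) in auto)

lemma TT_Suc:
  fixes h :: "(nat \<Rightarrow> real) \<Rightarrow> real"
  assumes "h \<in> borel_measurable (TT (Suc j))" "\<And>\<theta>. norm (h \<theta>) \<le> B"
  shows "(LINT \<theta>|TT (Suc j). h \<theta>) = (LINT \<theta>|TT j. LINT s|tor. h (\<theta>(j := s)))"
  using TP.product_integral_insert[of "{..<j}" j h] TT_integrable[OF assms] by (simp add: lessThan_Suc)

context dt
begin

text \<open>A kernel coupling a point \<open>t\<close> of the circle with independent phases: phase
  \<open>i\<close> is a Fejer perturbation of \<open>Lam^i * t\<close>.\<close>

definition Pk :: "nat \<Rightarrow> (nat \<Rightarrow> real) \<Rightarrow> real \<Rightarrow> real" where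
  "Pk j \<theta> t = (\<Prod>i<j. fej R (\<theta> i - real (Lam ^ i) * t))"

lemma Rpos: "R > 0" using R2 by simp

lemma Pk_nonneg: "0 \<le> Pk j \<theta> t" unfolding Pk_def by (intro prod_nonneg) (simp add: fej_nonneg Rpos)

lemma Pk_le: "\<bar>Pk j \<theta> t\<bar> \<le> fejb R ^ j"
  unfolding Pk_def abs_prod using prod_mono[of "{..<j}" "\<lambda>i. \<bar>fej R (\<theta> i - real (Lam ^ i) * t)\<bar>" "\<lambda>_. fejb R"] fej_le by simp

lemma Pk_measurable [measurable]: "j \<le> m \<Longrightarrow> (\<lambda>x. Pk j (fst x) (snd x)) \<in> borel_measurable (TT m \<Otimes>\<^sub>M tor)"
proof -
  assume jm: "j \<le> m"
  show ?thesis unfolding Pk_def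
  proof (rule borel_measurable_prod)
    fix i assume i: "i \<in> {..<j}"
    have c: "(\<lambda>\<theta>. \<theta> i) \<in> borel_measurable (TT m)"
      using measurable_component_singleton[of i "{..<m}" "\<lambda>_. tor"] i jm by (simp cong: measurable_cong_sets)
    have s: "snd \<in> borel_measurable (TT m \<Otimes>\<^sub>M tor)"
      using measurable_snd[of "TT m" tor] by (simp cong: measurable_cong_sets)
    show "(\<lambda>x. fej R (fst x i - real (Lam ^ i) * snd x)) \<in> borel_measurable (TT m \<Otimes>\<^sub>M tor)"
      by (intro measurable_compose[OF _ fej_measurable] borel_measurable_diff borel_measurable_times borel_measurable_const s
          measurable_compose[OF measurable_fst c])
  qed
qed

lemma Pk_tp: "tp (- ((int R - 1) * DD j)) ((int R - 1) * DD j) (\<lambda>t. cplx (Pk j \<theta> t))"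
proof (induction j)
  case 0 then show ?case by (simp add: Pk_def DD_0 tp_const)
next
  case (Suc j)
  have "tp (int Lam ^ j * - (int R - 1)) (int Lam ^ j * (int R - 1)) (\<lambda>t. cplx (fej R (\<theta> j - real (Lam ^ j) * t)))"
    using tp_dilate[OF fej_tp[OF Rpos, of "\<theta> j"], of "int Lam ^ j"] by simp
  from tp_mult[OF Suc this] show ?case by (simp add: Pk_def DD_Suc algebra_simps)
qed

lemma Pk_mean: "(LINT t|tor. cplx (Pk j \<theta> t)) = 1"
proof (induction j)
  case 0 then show ?case using torus.prob_space by (simp add: Pk_def)
next
  case (Suc j)
  have "(LINT t|tor. cplx (Pk (Suc j) \<theta> t)) = (LINT t|tor. cplx (Pk j \<theta> t) * (\<lambda>x. cplx (fej R (\<theta> j - x))) (real (Lam ^ j) * t))"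
    by (simp add: Pk_def)
  also have "\<dots> = 1"
    using lacunary[OF Pk_tp[of j \<theta>] _ _ fej_tp[OF Rpos, of "\<theta> j"]] Rpos LamR Suc fej_mean[of R "\<theta> j"] by simp
  finally show ?case .
qed

lemma Pk_upd: "Pk (Suc j) (\<theta>(j := s)) t = Pk j \<theta> t * fej R (s - real (Lam ^ j) * t)"
  and Pk_upd': "i \<le> j \<Longrightarrow> Pk i (\<theta>(j := s)) t = Pk i \<theta> t"
  unfolding Pk_def by (auto intro!: prod.cong)

end

locale dtF = dt +
  fixes F :: "real \<Rightarrow> complex" and a :: int and BF :: real
  assumes Ftp: "tp 0 a F" and BF: "\<And>t. cmod (F t) \<le> BF"
begin

lemma F_measurable [measurable]: "F \<in> borel_measurable tor"
  using tp_measurable[OF Ftp] by (simp cong: measurable_cong_sets)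

text \<open>The averages of \<open>F\<close> seen by the first \<open>j\<close> phases, demodulated
  at frequency \<open>n * Lam^j\<close>. They are the coefficients of the next average as a function
  of phase \<open>j\<close>.\<close>

definition Af :: "nat \<Rightarrow> nat \<Rightarrow> (nat \<Rightarrow> real) \<Rightarrow> complex" where
  "Af j n \<theta> = (LINT t|tor. F t * (cplx (Pk j \<theta> t) * cis (- real (n * Lam ^ j) * t)))"

lemma FP_tp: "tp (- ((int R - 1) * DD j)) (a + (int R - 1) * DD j) (\<lambda>t. F t * cplx (Pk j \<theta> t))"
  using tp_mult[OF Ftp Pk_tp] by simp

lemma FPc_tp: "tp (- ((int R - 1) * DD j) + n) (a + (int R - 1) * DD j + n) (\<lambda>t. F t * (cplx (Pk j \<theta> t) * cis (of_int n * t)))"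
  using tp_mult[OF FP_tp[of j \<theta>] tp_cis[of n n n 1]] by (simp add: mult.assoc)

lemma Af_bound: "cmod (Af j n \<theta>) \<le> BF * fejb R ^ j"
proof -
  have i: "integrable tor (\<lambda>t. F t * (cplx (Pk j \<theta> t) * cis (- real (n * Lam ^ j) * t)))"
    using tp_integrable[OF FPc_tp[of j "- int (n * Lam ^ j)" \<theta>]] by simp
  have "cmod (Af j n \<theta>) \<le> (LINT t|tor. cmod (F t * (cplx (Pk j \<theta> t) * cis (- real (n * Lam ^ j) * t))))"
    unfolding Af_def by (rule integral_norm_bound)
  also have "\<dots> \<le> (LINT t|tor. BF * fejb R ^ j)"
  proof (intro integral_mono integrable_norm i)
    have "0 \<le> BF" using BF[of 0] norm_ge_zero order_trans by blast
    then show "cmod (F t * (cplx (Pk j \<theta> t) * cis (- real (n * Lam ^ j) * t))) \<le> BF * fejb R ^ j" for t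
      unfolding norm_mult using BF[of t] Pk_le[of j \<theta> t] by (auto intro!: mult_mono)
  qed auto
  finally show ?thesis using torus.prob_space by simp
qed

lemma Af_measurable: "j \<le> m \<Longrightarrow> Af j n \<in> borel_measurable (TT m)"
proof -
  assume [simp]: "j \<le> m"
  have [measurable]: "(\<lambda>t. cis (- real (n * Lam ^ j) * t)) \<in> borel_measurable borel" by (intro borel_measurable_continuous_onI continuous_intros)
  have "(\<lambda>(\<theta>, t). F t * (cplx (Pk j \<theta> t) * cis (- real (n * Lam ^ j) * t))) \<in> borel_measurable (TT m \<Otimes>\<^sub>M tor)"
    unfolding split_beta' by measurable
  then show ?thesis unfolding Af_def[abs_def] by (rule torus.borel_measurable_lebesgue_integral)
qed

text \<open>Half of the Fejer expansion disappears: \<open>F\<close> is analytic and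
  \<open>Pk j\<close> reaches less than \<open>Lam^j\<close> below zero. Thus each conditional step
  is an analytic polynomial in the new phase, which is what the one-step estimate needs.\<close>

lemma Af_step:
  "Af (Suc j) 0 (\<theta>(j := s)) = (\<Sum>n<R. (cplx (1 - real n / real R) * Af j n \<theta>) * cis (real n * s))"
proof -
  let ?H = "\<lambda>t. F t * cplx (Pk j \<theta> t)"
  have k: "(int R - 1) * DD j \<le> int Lam ^ j - 1" using LamR Rpos by (intro DD_lt) auto
  have neg: "(LINT t|tor. ?H t * cis (real n * (real (Lam ^ j) * t))) = 0" if n: "n \<ge> 1" for n
  proof -
    have "int Lam ^ j * 1 \<le> int Lam ^ j * int n" using n by (intro mult_left_mono) auto
    then have "0 < - ((int R - 1) * DD j) + int (n * Lam ^ j)" using k by (simp add: mult.commute)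
    from tp_integral_zero[OF FPc_tp[of j "int (n * Lam ^ j)" \<theta>] disjI1[OF this]] show ?thesis by (simp add: mult_ac)
  qed
  have i1: "integrable tor (\<lambda>t. ?H t * cis (- real n * (real (Lam ^ j) * t)))" for n
    using tp_integrable[OF FPc_tp[of j "- int (n * Lam ^ j)" \<theta>]] by (simp add: mult_ac)
  have i2: "integrable tor (\<lambda>t. ?H t * cis (real n * (real (Lam ^ j) * t)))" for n
    using tp_integrable[OF FPc_tp[of j "int (n * Lam ^ j)" \<theta>]] by (simp add: mult_ac)
  have i0: "integrable tor ?H" by (rule tp_integrable[OF FP_tp])
  have A: "Af j n \<theta> = (LINT t|tor. ?H t * cis (- real n * (real (Lam ^ j) * t)))" for n
    unfolding Af_def by (simp add: mult_ac)
  have "F t * (cplx (Pk (Suc j) (\<theta>(j := s)) t) * cis (- real (0 * Lam ^ Suc j) * t)) =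
     ?H t + (\<Sum>n=1..<R. cplx (1 - real n / real R) * (cis (real n * s) * (?H t * cis (- real n * (real (Lam ^ j) * t)))
       + cis (- real n * s) * (?H t * cis (real n * (real (Lam ^ j) * t)))))" for t
    unfolding Pk_upd of_real_mult fej_cis
    by (simp add: distrib_left sum_distrib_left mult_ac del: of_nat_power)
  then have "Af (Suc j) 0 (\<theta>(j := s)) = (LINT t|tor. ?H t + (\<Sum>n=1..<R. cplx (1 - real n / real R) * (cis (real n * s) * (?H t * cis (- real n * (real (Lam ^ j) * t)))
       + cis (- real n * s) * (?H t * cis (real n * (real (Lam ^ j) * t))))))"
    unfolding Af_def by presburger
  also have "\<dots> = (LINT t|tor. ?H t) + (\<Sum>n=1..<R. cplx (1 - real n / real R) * (cis (real n * s) * Af j n \<theta>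
       + cis (- real n * s) * (LINT t|tor. ?H t * cis (real n * (real (Lam ^ j) * t)))))"
    unfolding A using i0 i1 i2
    by (subst Bochner_Integration.integral_add) (auto simp: Bochner_Integration.integral_sum simp del: of_nat_power of_real_diff of_real_divide)
  also have "\<dots> = Af j 0 \<theta> + (\<Sum>n=1..<R. cplx (1 - real n / real R) * (cis (real n * s) * Af j n \<theta>))"
    using neg by (simp add: Af_def del: of_nat_power of_real_diff of_real_divide)
  also have "\<dots> = (\<Sum>n<R. (cplx (1 - real n / real R) * Af j n \<theta>) * cis (real n * s))"
  proof -
    have "{..<R} = insert 0 {1..<R}" using Rpos by auto
    then show ?thesis by (simp add: mult_ac del: of_real_diff of_real_divide)
  qed
  finally show ?thesis .
qed

lemma Af_upd: "i \<le> j \<Longrightarrow> Af i n (\<theta>(j := s)) = Af i n \<theta>"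
  unfolding Af_def by (simp add: Pk_upd')

definition g0 :: complex where "g0 = (LINT t|tor. F t)"

text \<open>Only the first coefficient of each step enters, with its Fejer weight
  \<open>1 - 1 / R\<close>; this is the part that \<open>analytic_step\<close> controls.\<close>

definition Sc :: "nat \<Rightarrow> (nat \<Rightarrow> real) \<Rightarrow> real" where
  "Sc j \<theta> = (cmod g0)\<^sup>2 + (\<Sum>i<j. (cmod (cplx (1 - 1 / real R) * Af i 1 \<theta>))\<^sup>2)"

lemma Sc_nonneg: "0 \<le> Sc j \<theta>" unfolding Sc_def by (simp add: sum_nonneg)

lemma Sc_measurable: "j \<le> Suc m \<Longrightarrow> Sc j \<in> borel_measurable (TT m)"
  unfolding Sc_def[abs_def] using Af_measurable[of _ m 1]
  by (intro borel_measurable_add borel_measurable_sum borel_measurable_power borel_measurable_norm borel_measurable_times borel_measurable_const) auto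

lemma Sc_bound: "\<exists>B. \<forall>\<theta>. Sc j \<theta> \<le> B"
proof -
  have "Sc j \<theta> \<le> (cmod g0)\<^sup>2 + (\<Sum>i<j. (\<bar>1 - 1 / real R\<bar> * (BF * fejb R ^ i))\<^sup>2)" for \<theta>
    unfolding Sc_def
    by (intro add_left_mono sum_mono power_mono) (auto simp: norm_mult simp del: of_real_diff of_real_divide intro!: mult_left_mono Af_bound)
  then show ?thesis by blast
qed

lemma sqrt_TT:
  assumes "q = 0 \<or> q = 1"
  shows "(\<lambda>\<theta>. sqrt (1 + q * Sc j \<theta> + (cmod (Af j 0 \<theta>))\<^sup>2)) \<in> borel_measurable (TT j)"
    "\<exists>B. \<forall>\<theta>. norm (sqrt (1 + q * Sc j \<theta> + (cmod (Af j 0 \<theta>))\<^sup>2)) \<le> B"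
proof -
  note [measurable] = Sc_measurable[of j j] Af_measurable[of j j 0]
  show "(\<lambda>\<theta>. sqrt (1 + q * Sc j \<theta> + (cmod (Af j 0 \<theta>))\<^sup>2)) \<in> borel_measurable (TT j)" by measurable
  obtain B where B: "\<And>\<theta>. Sc j \<theta> \<le> B" using Sc_bound by blast
  have "norm (sqrt (1 + q * Sc j \<theta> + (cmod (Af j 0 \<theta>))\<^sup>2)) \<le> sqrt (1 + B + (BF * fejb R ^ j)\<^sup>2)" for \<theta>
  proof -
    have "q * Sc j \<theta> \<le> B" using assms B[of \<theta>] Sc_nonneg[of j \<theta>] by auto
    moreover have "(cmod (Af j 0 \<theta>))\<^sup>2 \<le> (BF * fejb R ^ j)\<^sup>2" by (intro power_mono Af_bound) auto
    moreover have "0 \<le> q * Sc j \<theta>" using assms Sc_nonneg[of j \<theta>] by auto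
    ultimately show ?thesis by (auto intro!: add_mono)
  qed
  then show "\<exists>B. \<forall>\<theta>. norm (sqrt (1 + q * Sc j \<theta> + (cmod (Af j 0 \<theta>))\<^sup>2)) \<le> B" by blast
qed

text \<open>\<open>analytic_step\<close> is applied in the newest phase with the others frozen. The
  term \<open>2 * |g0|^2\<close> appears because \<open>Sc\<close> starts at
  \<open>|g0|^2\<close>.\<close>

lemma bellman:
  "(LINT \<theta>|TT j. sqrt (1 + 1 * Sc j \<theta> + (cmod (Af j 0 \<theta>))\<^sup>2)) + 18 * sqrt (1 + (cmod g0)\<^sup>2)
    \<le> sqrt (1 + 2 * (cmod g0)\<^sup>2) + 18 * (LINT \<theta>|TT j. sqrt (1 + 0 * Sc j \<theta> + (cmod (Af j 0 \<theta>))\<^sup>2))"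
proof (induction j)
  case 0
  interpret prob_space "TT 0" by (rule prob_TT)
  have "Af 0 0 \<theta> = g0" for \<theta> by (simp add: Af_def Pk_def g0_def)
  then show ?case using prob_space by (simp add: Sc_def)
next
  case (Suc j)
  let ?X = "\<lambda>j \<theta>. sqrt (1 + 1 * Sc j \<theta> + (cmod (Af j 0 \<theta>))\<^sup>2)" and ?Y = "\<lambda>j \<theta>. sqrt (1 + 0 * Sc j \<theta> + (cmod (Af j 0 \<theta>))\<^sup>2)"
  obtain B1 where B1: "\<And>\<theta>. norm (?X (Suc j) \<theta>) \<le> B1" using sqrt_TT(2)[of 1 "Suc j"] by auto
  obtain B2 where B2: "\<And>\<theta>. norm (?Y (Suc j) \<theta>) \<le> B2" using sqrt_TT(2)[of 0 "Suc j"] by auto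
  obtain B3 where B3: "\<And>\<theta>. norm (?X j \<theta>) \<le> B3" using sqrt_TT(2)[of 1 j] by auto
  obtain B4 where B4: "\<And>\<theta>. norm (?Y j \<theta>) \<le> B4" using sqrt_TT(2)[of 0 j] by auto
  have iX: "integrable (TT j) (?X j)" by (rule TT_integrable[OF _ B3]) (use sqrt_TT(1)[of 1 j] in auto)
  have iY: "integrable (TT j) (?Y j)" by (rule TT_integrable[OF _ B4]) (use sqrt_TT(1)[of 0 j] in auto)
  have eX: "(LINT \<theta>|TT (Suc j). ?X (Suc j) \<theta>) = (LINT \<theta>|TT j. LINT s|tor. ?X (Suc j) (\<theta>(j := s)))"
    by (rule TT_Suc[OF _ B1]) (use sqrt_TT(1)[of 1 "Suc j"] in auto)
  have eY: "(LINT \<theta>|TT (Suc j). ?Y (Suc j) \<theta>) = (LINT \<theta>|TT j. LINT s|tor. ?Y (Suc j) (\<theta>(j := s)))"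
    by (rule TT_Suc[OF _ B2]) (use sqrt_TT(1)[of 0 "Suc j"] in auto)
  have step: "(LINT s|tor. ?X (Suc j) (\<theta>(j := s))) + 18 * ?Y j \<theta> \<le> ?X j \<theta> + 18 * (LINT s|tor. ?Y (Suc j) (\<theta>(j := s)))" for \<theta>
  proof -
    define av where "av n = cplx (1 - real n / real R) * Af j n \<theta>" for n
    have s0: "Sc (Suc j) (\<theta>(j := s)) = Sc j \<theta> + (cmod (av 1))\<^sup>2" for s
      unfolding Sc_def av_def by (simp add: Af_upd del: of_real_diff of_real_divide)
    have a0: "av 0 = Af j 0 \<theta>" by (simp add: av_def)
    from analytic_step[OF R2 Sc_nonneg[of j \<theta>], of av] show ?thesis
      unfolding s0 Af_step a0 av_def[symmetric] by (simp add: add.assoc)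
  qed
  have mX: "(\<lambda>\<theta>. LINT s|tor. ?X (Suc j) (\<theta>(j := s))) \<in> borel_measurable (TT j)"
    and mY: "(\<lambda>\<theta>. LINT s|tor. ?Y (Suc j) (\<theta>(j := s))) \<in> borel_measurable (TT j)"
  proof -
    have u: "(\<lambda>(\<theta>, s). \<theta>(j := s)) \<in> measurable (TT j \<Otimes>\<^sub>M tor) (TT (Suc j))"
      using measurable_add_dim[of j "{..<j}" "\<lambda>_. tor"] by (simp add: lessThan_Suc)
    have "(\<lambda>x. ?X (Suc j) ((\<lambda>(\<theta>, s). \<theta>(j := s)) x)) \<in> borel_measurable (TT j \<Otimes>\<^sub>M tor)"
      by (rule measurable_compose[OF u]) (use sqrt_TT(1)[of 1 "Suc j"] in auto)
    then show "(\<lambda>\<theta>. LINT s|tor. ?X (Suc j) (\<theta>(j := s))) \<in> borel_measurable (TT j)"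
      by (intro torus.borel_measurable_lebesgue_integral) (simp add: split_beta')
    have "(\<lambda>x. ?Y (Suc j) ((\<lambda>(\<theta>, s). \<theta>(j := s)) x)) \<in> borel_measurable (TT j \<Otimes>\<^sub>M tor)"
      by (rule measurable_compose[OF u]) (use sqrt_TT(1)[of 0 "Suc j"] in auto)
    then show "(\<lambda>\<theta>. LINT s|tor. ?Y (Suc j) (\<theta>(j := s))) \<in> borel_measurable (TT j)"
      by (intro torus.borel_measurable_lebesgue_integral) (simp add: split_beta')
  qed
  \<comment> \<open>Without integrability the Bochner integral is 0, so the bound persists.\<close>
  have bint: "norm (LINT s|tor. h s) \<le> B" if "\<And>s. norm (h s) \<le> B" for h :: "real \<Rightarrow> real" and B
  proof (cases "integrable tor h")
    case True
    have "norm (LINT s|tor. h s) \<le> (LINT s|tor. norm (h s))" by (rule integral_norm_bound)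
    also have "\<dots> \<le> (LINT s|tor. B)" using True that by (intro integral_mono integrable_norm) auto
    finally show ?thesis using torus.prob_space by simp
  next
    case False
    then show ?thesis using that[of 0] by (simp add: not_integrable_integral_eq)
  qed
  have iX': "integrable (TT j) (\<lambda>\<theta>. LINT s|tor. ?X (Suc j) (\<theta>(j := s)))"
    by (rule TT_integrable[OF mX, of B1]) (rule bint, rule B1)
  have iY': "integrable (TT j) (\<lambda>\<theta>. LINT s|tor. ?Y (Suc j) (\<theta>(j := s)))"
    by (rule TT_integrable[OF mY, of B2]) (rule bint, rule B2)
  have "(LINT \<theta>|TT j. (LINT s|tor. ?X (Suc j) (\<theta>(j := s))) + 18 * ?Y j \<theta>) \<le> (LINT \<theta>|TT j. ?X j \<theta> + 18 * (LINT s|tor. ?Y (Suc j) (\<theta>(j := s))))"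
    by (intro integral_mono Bochner_Integration.integrable_add integrable_mult_right iX iY iX' iY' step)
  then have "(LINT \<theta>|TT (Suc j). ?X (Suc j) \<theta>) + 18 * (LINT \<theta>|TT j. ?Y j \<theta>) \<le> (LINT \<theta>|TT j. ?X j \<theta>) + 18 * (LINT \<theta>|TT (Suc j). ?Y (Suc j) \<theta>)"
    unfolding eX eY using iX iY iX' iY' by (simp only: Bochner_Integration.integral_add integrable_mult_right integral_mult_right_zero)
  then show ?case using Suc by linarith
qed

end

abbreviation UC :: "nat \<Rightarrow> nat measure" where "UC N \<equiv> uniform_count_measure {..<N}"

lemma sets_UC: "sets (UC N) = sets (count_space {..<N})"
  by (simp add: sets_uniform_count_measure)

lemma nn_integral_UC:
  assumes "N > 0" "\<And>n. n < N \<Longrightarrow> 0 \<le> f n"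
  shows "(\<integral>\<^sup>+ n. ennreal (f n) \<partial>UC N) = ennreal ((\<Sum>n<N. f n) / real N)"
proof -
  have "(\<integral>\<^sup>+ n. ennreal (f n) \<partial>UC N) = (\<Sum>n<N. ennreal (1 / real N) * ennreal (f n))"
    unfolding uniform_count_measure_def by (subst nn_integral_point_measure_finite) (auto simp: mult.commute)
  also have "\<dots> = (\<Sum>n<N. ennreal (f n / real N))"
    using assms by (intro sum.cong) (auto simp flip: ennreal_mult)
  also have "\<dots> = ennreal (\<Sum>n<N. f n / real N)" using assms by (intro sum_ennreal) auto
  finally show ?thesis by (simp add: sum_divide_distrib)
qed

lemma sigma_finite_UC: "N > 0 \<Longrightarrow> sigma_finite_measure (UC N)"
  by (intro prob_space_imp_sigma_finite prob_space_uniform_count_measure) auto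

lemma meas_UC_pair:
  assumes "\<And>n. n < N \<Longrightarrow> (\<lambda>x. k x n) \<in> borel_measurable M"
  shows "(\<lambda>(x, n). k x n :: real) \<in> borel_measurable (M \<Otimes>\<^sub>M UC N)" "(\<lambda>(n, x). k x n) \<in> borel_measurable (UC N \<Otimes>\<^sub>M M)"
proof -
  have "(\<lambda>(n, x). k x n) \<in> borel_measurable (count_space {..<N} \<Otimes>\<^sub>M M)"
    by (rule measurable_pair_measure_countable1) (use assms in auto)
  then show 2: "(\<lambda>(n, x). k x n) \<in> borel_measurable (UC N \<Otimes>\<^sub>M M)"
    by (subst measurable_cong_sets[OF sets_pair_measure_cong[OF sets_UC refl] refl])
  from measurable_comp[OF measurable_pair_swap' 2]
  show "(\<lambda>(x, n). k x n :: real) \<in> borel_measurable (M \<Otimes>\<^sub>M UC N)" by (simp add: comp_def split_beta')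
qed

lemma phi_kernel_to_fin:
  assumes "sigma_finite_measure M" "N > 0" "f \<in> borel_measurable M" and k: "\<And>n. n < N \<Longrightarrow> (\<lambda>x. k x n) \<in> borel_measurable M"
    and k0: "\<And>x n. 0 \<le> k x n" and f: "\<And>x. 0 \<le> f x" and g: "\<And>n. 0 \<le> g n" and A: "1 \<le> A"
    and w1: "\<And>n. n < N \<Longrightarrow> (\<integral>\<^sup>+ x. ennreal (k x n) \<partial>M) \<le> ennreal A"
    and w2: "\<And>x. x \<in> space M \<Longrightarrow> (\<Sum>n<N. k x n) / real N \<le> A"
    and le: "\<And>n. n < N \<Longrightarrow> ennreal (g n) \<le> (\<integral>\<^sup>+ x. ennreal (k x n) * ennreal (f x) \<partial>M)"
  shows "ennreal ((\<Sum>n<N. phi (g n)) / real N) \<le> ennreal (A\<^sup>2) * (\<integral>\<^sup>+ x. ennreal (phi (f x)) \<partial>M)"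
proof -
  have "(\<integral>\<^sup>+ n. ennreal (phi (g n)) \<partial>UC N) \<le> ennreal (A\<^sup>2) * (\<integral>\<^sup>+ x. ennreal (phi (f x)) \<partial>M)"
  proof (rule phi_kernel[where k=k])
    show "case_prod k \<in> borel_measurable (M \<Otimes>\<^sub>M UC N)" using meas_UC_pair(1)[OF k] by simp
    show "(\<integral>\<^sup>+ n. ennreal (k x n) \<partial>UC N) \<le> ennreal A" if "x \<in> space M" for x
      using w2[OF that] by (subst nn_integral_UC) (auto simp: k0 assms(2) ennreal_leI)
  qed (use assms sigma_finite_UC in \<open>auto simp: space_uniform_count_measure\<close>)
  then show ?thesis using assms(2) by (simp add: nn_integral_UC)
qed

lemma phi_kernel_from_fin:
  assumes "sigma_finite_measure M" "N > 0" and k: "\<And>n. n < N \<Longrightarrow> (\<lambda>y. k n y) \<in> borel_measurable M"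
    and k0: "\<And>x n. 0 \<le> k n x" and f: "\<And>n. 0 \<le> f n" and g: "\<And>y. 0 \<le> g y" and A: "1 \<le> A"
    and w1: "\<And>n. n < N \<Longrightarrow> (\<integral>\<^sup>+ y. ennreal (k n y) \<partial>M) \<le> ennreal A"
    and w2: "\<And>y. y \<in> space M \<Longrightarrow> (\<Sum>n<N. k n y) / real N \<le> A"
    and le: "\<And>y. y \<in> space M \<Longrightarrow> g y \<le> (\<Sum>n<N. k n y * f n) / real N"
  shows "(\<integral>\<^sup>+ y. ennreal (phi (g y)) \<partial>M) \<le> ennreal (A\<^sup>2) * ennreal ((\<Sum>n<N. phi (f n)) / real N)"
proof -
  have "(\<integral>\<^sup>+ y. ennreal (phi (g y)) \<partial>M) \<le> ennreal (A\<^sup>2) * (\<integral>\<^sup>+ n. ennreal (phi (f n)) \<partial>UC N)"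
  proof (rule phi_kernel[where k=k])
    show "case_prod k \<in> borel_measurable (UC N \<Otimes>\<^sub>M M)" using meas_UC_pair(2)[OF k] by simp
    show "f \<in> borel_measurable (UC N)" by (simp add: measurable_cong_sets[OF sets_UC refl])
    show "(\<integral>\<^sup>+ n. ennreal (k n y) \<partial>UC N) \<le> ennreal A" if "y \<in> space M" for y
      using w2[OF that] by (subst nn_integral_UC) (auto simp: k0 assms(2) ennreal_leI)
    show "ennreal (g y) \<le> (\<integral>\<^sup>+ n. ennreal (k n y) * ennreal (f n) \<partial>UC N)" if "y \<in> space M" for y
      using ennreal_leI[OF le[OF that]] nn_integral_UC[of N "\<lambda>n. k n y * f n"] assms(2) k0 f
      by (simp add: ennreal_mult)
  qed (use assms sigma_finite_UC in \<open>auto simp: space_uniform_count_measure\<close>)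
  then show ?thesis using assms(2) by (simp add: nn_integral_UC)
qed

section \<open>Recovery of the tree coefficients with a positive majorant\<close>

context dt
begin

text \<open>A positive majorant of \<open>wb\<close>. Its factors have mean
  \<open>(2 - rho) / rho\<close>, so the total mass is a \<open>b\<close>-th power that
  \<open>rhob\<close> keeps below 2.\<close>

definition kbar :: "nat \<Rightarrow> (nat \<Rightarrow> real) \<Rightarrow> nat \<Rightarrow> real" where
  "kbar j \<theta> n = (\<Prod>i<j. (2 - rho + sgnb j i n * tau (\<theta> i)) / rho)"

text \<open>The dual weight in phase coordinates. It uses \<open>tau\<close>; integrating a phase
  against its Fejer kernel replaces \<open>tau\<close> by \<open>taut\<close>.\<close>

definition wb :: "nat \<Rightarrow> (nat \<Rightarrow> real) \<Rightarrow> nat \<Rightarrow> real" where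
  "wb j \<theta> n = (\<Prod>i<j. 1 + sgnb j i n * tau (\<theta> i) / rho)"

lemma tau_measurable [measurable]: "tau \<in> borel_measurable borel"
proof -
  have "(\<lambda>t. Re (cplx (tau t))) \<in> borel_measurable borel" using tp_measurable[OF tau_tp] by measurable
  then show ?thesis by simp
qed

lemma sgn_tau_le: "\<bar>sgnb j i n * tau x\<bar> \<le> 1" using tau_le[of x] by (simp add: abs_mult)

lemma kfac_nonneg: "0 \<le> (2 - rho + sgnb j i n * tau x) / rho"
  using sgn_tau_le[of j i n x] rho01 by (simp add: abs_le_iff)

lemma kbar_nonneg: "0 \<le> kbar j \<theta> n"
  unfolding kbar_def by (intro prod_nonneg kfac_nonneg)

text \<open>For \<open>x >= -1\<close> and \<open>rho <= 1\<close> one has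
  \<open>|rho + x| <= 2 - rho + x\<close>. This inequality dictates the factors of
  \<open>kbar\<close>.\<close>

lemma wb_le_kbar: "\<bar>wb j \<theta> n\<bar> \<le> kbar j \<theta> n"
  unfolding wb_def kbar_def abs_prod
proof (rule prod_mono)
  fix i
  let ?x = "sgnb j i n * tau (\<theta> i)"
  have x: "-1 \<le> ?x" "?x \<le> 1" using sgn_tau_le[of j i n "\<theta> i"] by auto
  have "\<bar>rho + ?x\<bar> \<le> 2 - rho + ?x" using x rho01 by linarith
  moreover have "1 + ?x / rho = (rho + ?x) / rho" using rho01 by (simp add: field_simps)
  ultimately show "0 \<le> \<bar>1 + ?x / rho\<bar> \<and> \<bar>1 + ?x / rho\<bar> \<le> (2 - rho + ?x) / rho"
    using rho01 by (simp add: abs_divide divide_right_mono)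
qed

lemma kbar_bound: "kbar j \<theta> n \<le> ((3 - rho) / rho) ^ j"
proof -
  have "(2 - rho + sgnb j i n * tau (\<theta> i)) / rho \<le> (3 - rho) / rho" for i
    using sgn_tau_le[of j i n "\<theta> i"] rho01 by (intro divide_right_mono) auto
  then show ?thesis unfolding kbar_def using prod_mono[of "{..<j}" "\<lambda>i. (2 - rho + sgnb j i n * tau (\<theta> i)) / rho" "\<lambda>_. (3 - rho) / rho"] kfac_nonneg by simp
qed

lemma kbar_measurable: "(\<lambda>\<theta>. kbar j \<theta> n) \<in> borel_measurable (TT j)" "(\<lambda>\<theta>. wb j \<theta> n) \<in> borel_measurable (TT j)"
proof -
  have c: "(\<lambda>\<theta>. tau (\<theta> i)) \<in> borel_measurable (TT j)" if "i \<in> {..<j}" for i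
    using measurable_component_singleton[of i "{..<j}" "\<lambda>_. tor"] that
    by (intro measurable_compose[OF _ tau_measurable]) (simp cong: measurable_cong_sets)
  show "(\<lambda>\<theta>. kbar j \<theta> n) \<in> borel_measurable (TT j)" unfolding kbar_def
    by (intro borel_measurable_prod borel_measurable_divide borel_measurable_add borel_measurable_times borel_measurable_const c)
  show "(\<lambda>\<theta>. wb j \<theta> n) \<in> borel_measurable (TT j)" unfolding wb_def
    by (intro borel_measurable_prod borel_measurable_divide borel_measurable_add borel_measurable_times borel_measurable_const c)
qed

lemma tau_mean_real: "(LINT t|tor. tau t) = 0" "integrable tor tau"
proof -
  have "cplx (LINT t|tor. tau t) = 0" using tau_mean by simp
  then show "(LINT t|tor. tau t) = 0" by simp
  show "integrable tor tau" by (rule torus_integrable[where B=1]) (use tau_le in auto)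
qed

lemma kbar_nn: "(\<integral>\<^sup>+ \<theta>. ennreal (kbar b \<theta> n) \<partial>TT b) \<le> ennreal 2"
proof -
  have "(\<integral>\<^sup>+ \<theta>. ennreal (kbar b \<theta> n) \<partial>TT b) = (\<integral>\<^sup>+ \<theta>. (\<Prod>i<b. ennreal ((2 - rho + sgnb b i n * tau (\<theta> i)) / rho)) \<partial>TT b)"
    unfolding kbar_def by (intro nn_integral_cong prod_ennreal[symmetric] kfac_nonneg)
  also have "\<dots> = (\<Prod>i<b. \<integral>\<^sup>+ s. ennreal ((2 - rho + sgnb b i n * tau s) / rho) \<partial>tor)"
    by (rule TP.product_nn_integral_prod) (auto cong: measurable_cong_sets)
  also have "\<dots> = (\<Prod>i<b. ennreal ((2 - rho) / rho))"
  proof (rule prod.cong[OF refl])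
    fix i
    have "(\<integral>\<^sup>+ s. ennreal ((2 - rho + sgnb b i n * tau s) / rho) \<partial>tor) = ennreal (LINT s|tor. (2 - rho + sgnb b i n * tau s) / rho)"
    proof (rule torus_nn_integral[where B="(3 - rho) / rho"])
      show "(2 - rho + sgnb b i n * tau t) / rho \<le> (3 - rho) / rho" for t
        using sgn_tau_le[of b i n t] rho01 by (intro divide_right_mono) auto
    qed (auto simp: kfac_nonneg)
    also have "(LINT s|tor. (2 - rho + sgnb b i n * tau s) / rho) = (2 - rho) / rho"
      using tau_mean_real torus.prob_space by simp
    finally show "(\<integral>\<^sup>+ s. ennreal ((2 - rho + sgnb b i n * tau s) / rho) \<partial>tor) = ennreal ((2 - rho) / rho)" .
  qed
  also have "\<dots> = ennreal (((2 - rho) / rho) ^ b)" using rho01 by (simp add: ennreal_power)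
  also have "\<dots> \<le> ennreal 2" by (rule ennreal_leI[OF rhob])
  finally show ?thesis .
qed

lemma kbar_Suc: "kbar (Suc j) \<theta> p = kbar j \<theta> (p div 2) * ((2 - rho + (if even p then 1 else - 1) * tau (\<theta> j)) / rho)"
proof -
  have "(\<Prod>i<j. (2 - rho + sgnb (Suc j) i p * tau (\<theta> i)) / rho) = kbar j \<theta> (p div 2)"
    unfolding kbar_def by (rule prod.cong) (auto simp: sgnb_Suc)
  then show ?thesis by (simp only: kbar_def[of "Suc j"] prod.lessThan_Suc sgnb_top)
qed

lemma kbar_sum: "(\<Sum>n<2^j. kbar j \<theta> n) / 2^j = ((2 - rho) / rho) ^ j"
proof (induction j)
  case 0 then show ?case by (simp add: kbar_def)
next
  case (Suc j)
  have "(\<Sum>n<2^Suc j. kbar (Suc j) \<theta> n) = (\<Sum>p<2^j. kbar j \<theta> p * (2 * ((2 - rho) / rho)))"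
    unfolding sum_pairs kbar_Suc using rho01 by (intro sum.cong) (auto simp: field_simps)
  also have "\<dots> = (\<Sum>p<2^j. kbar j \<theta> p) * (2 * ((2 - rho) / rho))" by (rule sum_distrib_right[symmetric])
  also have "\<dots> / 2^Suc j = ((\<Sum>p<2^j. kbar j \<theta> p) / 2^j) * ((2 - rho) / rho)"
  proof -
    have "S * (2 * q) / 2^Suc j = (S / 2^j) * q" for S q :: real by simp
    then show ?thesis .
  qed
  finally show ?case by (simp only: Suc power_Suc2)
qed

end

context dtF
begin

text \<open>The Bellman inequality after subtracting 1. The initial values are harmless since
  \<open>sqrt (1 + 2 x) - 1 <= 2 * (sqrt (1 + x) - 1)\<close> and 2 is below 18.\<close>

lemma phi_Sc: "(\<integral>\<^sup>+ \<theta>. ennreal (phi (sqrt (Sc b \<theta>))) \<partial>TT b) \<le> ennreal 18 * (\<integral>\<^sup>+ \<theta>. ennreal (phi (cmod (Af b 0 \<theta>))) \<partial>TT b)"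
proof -
  interpret P: prob_space "TT b" by (rule prob_TT)
  note [measurable] = Sc_measurable[of b b] Af_measurable[of b b 0]
  let ?X = "\<lambda>\<theta>. sqrt (1 + 1 * Sc b \<theta> + (cmod (Af b 0 \<theta>))\<^sup>2)" and ?Y = "\<lambda>\<theta>. sqrt (1 + 0 * Sc b \<theta> + (cmod (Af b 0 \<theta>))\<^sup>2)"
  obtain B1 where B1: "\<And>\<theta>. norm (?X \<theta>) \<le> B1" using sqrt_TT(2)[of 1 b] by auto
  obtain B2 where B2: "\<And>\<theta>. norm (?Y \<theta>) \<le> B2" using sqrt_TT(2)[of 0 b] by auto
  have iX: "integrable (TT b) ?X" by (rule TT_integrable[OF _ B1]) measurable
  have iY: "integrable (TT b) ?Y" by (rule TT_integrable[OF _ B2]) measurable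
  have "(\<integral>\<^sup>+ \<theta>. ennreal (phi (sqrt (Sc b \<theta>))) \<partial>TT b) \<le> (\<integral>\<^sup>+ \<theta>. ennreal (?X \<theta> - 1) \<partial>TT b)"
    using Sc_nonneg by (intro nn_integral_mono ennreal_leI) (simp add: phi_def)
  also have "\<dots> = ennreal (LINT \<theta>|TT b. ?X \<theta> - 1)"
    using iX Sc_nonneg by (intro nn_integral_eq_integral) auto
  also have "(LINT \<theta>|TT b. ?X \<theta> - 1) = (LINT \<theta>|TT b. ?X \<theta>) - 1" using iX P.prob_space by simp
  also have "ennreal ((LINT \<theta>|TT b. ?X \<theta>) - 1) \<le> ennreal (18 * (LINT \<theta>|TT b. ?Y \<theta> - 1))"
  proof (rule ennreal_leI)
    have "sqrt (1 + 2 * (cmod g0)\<^sup>2) - 1 \<le> 2 * (sqrt (1 + (cmod g0)\<^sup>2) - 1)"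
      using sqrt_scale_le[of 1 "(cmod g0)\<^sup>2" 2] by simp
    moreover have "1 \<le> sqrt (1 + (cmod g0)\<^sup>2)" by simp
    moreover have "(LINT \<theta>|TT b. ?Y \<theta> - 1) = (LINT \<theta>|TT b. ?Y \<theta>) - 1" using iY P.prob_space by simp
    moreover have "x - 1 \<le> 18 * y'" if "s2 - 1 \<le> 2 * (s1 - 1)" "1 \<le> s1" "y' = y - 1" "x + 18 * s1 \<le> s2 + 18 * y" for x y y' s1 s2 :: real
      using that by argo
    ultimately show "(LINT \<theta>|TT b. ?X \<theta>) - 1 \<le> 18 * (LINT \<theta>|TT b. ?Y \<theta> - 1)" using bellman[of b] by blast
  qed
  also have "\<dots> = ennreal 18 * ennreal (LINT \<theta>|TT b. ?Y \<theta> - 1)"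
    by (intro ennreal_mult Bochner_Integration.integral_nonneg) auto
  also have "ennreal (LINT \<theta>|TT b. ?Y \<theta> - 1) = (\<integral>\<^sup>+ \<theta>. ennreal (?Y \<theta> - 1) \<partial>TT b)"
    using iY by (intro nn_integral_eq_integral[symmetric]) auto
  also have "\<dots> = (\<integral>\<^sup>+ \<theta>. ennreal (phi (cmod (Af b 0 \<theta>))) \<partial>TT b)" by (simp add: phi_def)
  finally show ?thesis .
qed

text \<open>Both marginals of \<open>Pk\<close> equal 1: in \<open>t\<close> by lacunarity, in the
  phases because it is a product of Fejer kernels.\<close>

lemma phi_Af: "(\<integral>\<^sup>+ \<theta>. ennreal (phi (cmod (Af b 0 \<theta>))) \<partial>TT b) \<le> (\<integral>\<^sup>+ t. ennreal (phi (cmod (F t))) \<partial>tor)"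
proof -
  have "(\<integral>\<^sup>+ \<theta>. ennreal (phi (cmod (Af b 0 \<theta>))) \<partial>TT b) \<le> ennreal (1\<^sup>2) * (\<integral>\<^sup>+ t. ennreal (phi (cmod (F t))) \<partial>tor)"
  proof (rule phi_kernel[where k="\<lambda>t \<theta>. Pk b \<theta> t"])
    show "sigma_finite_measure tor" "sigma_finite_measure (TT b)"
      using prob_space_torus prob_TT prob_space_imp_sigma_finite by auto
    have "(\<lambda>x. Pk b (fst x) (snd x)) \<circ> (\<lambda>(t, \<theta>). (\<theta>, t)) \<in> borel_measurable (tor \<Otimes>\<^sub>M TT b)"
      by (rule measurable_comp[OF measurable_pair_swap' Pk_measurable]) simp
    then show "(\<lambda>(t, \<theta>). Pk b \<theta> t) \<in> borel_measurable (tor \<Otimes>\<^sub>M TT b)" by (simp add: comp_def split_beta')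
    show "(\<integral>\<^sup>+ t. ennreal (Pk b \<theta> t) \<partial>tor) \<le> ennreal 1" for \<theta>
    proof -
      have "cplx (LINT t|tor. Pk b \<theta> t) = cplx 1" using Pk_mean[of b \<theta>] by simp
      then have "(LINT t|tor. Pk b \<theta> t) = 1" by (simp only: of_real_eq_iff)
      moreover have "(\<lambda>t. Re (cplx (Pk b \<theta> t))) \<in> borel_measurable borel" using tp_measurable[OF Pk_tp] by measurable
      ultimately show ?thesis
        by (subst torus_nn_integral[where B="fejb R ^ b"]) (use Pk_nonneg Pk_le[of b] in \<open>auto simp: abs_le_iff\<close>)
    qed
    show "(\<integral>\<^sup>+ \<theta>. ennreal (Pk b \<theta> t) \<partial>TT b) \<le> ennreal 1" for t
    proof -
      have "(\<integral>\<^sup>+ \<theta>. ennreal (Pk b \<theta> t) \<partial>TT b) = (\<integral>\<^sup>+ \<theta>. (\<Prod>i<b. ennreal (fej R (\<theta> i - real (Lam ^ i) * t))) \<partial>TT b)"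
        unfolding Pk_def by (intro nn_integral_cong prod_ennreal[symmetric] fej_nonneg Rpos)
      also have "\<dots> = (\<Prod>i<b. \<integral>\<^sup>+ s. ennreal (fej R (s - real (Lam ^ i) * t)) \<partial>tor)"
        by (rule TP.product_nn_integral_prod) (auto cong: measurable_cong_sets)
      also have "\<dots> = 1" unfolding fej_sym[of R _ "real (Lam ^ _) * t"] using fej_nn_mean[OF Rpos] by simp
      finally show ?thesis by simp
    qed
    show "ennreal (cmod (Af b 0 \<theta>)) \<le> (\<integral>\<^sup>+ t. ennreal (Pk b \<theta> t) * ennreal (cmod (F t)) \<partial>tor)" for \<theta>
    proof -
      have "Af b 0 \<theta> = (LINT t|tor. F t * cplx (Pk b \<theta> t))" by (simp add: Af_def)
      then show ?thesis using norm_lint_le_kernel[OF tp_integrable[OF FP_tp[of b \<theta>]], of "Pk b \<theta>"] Pk_nonneg by simp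
    qed
  qed (auto simp: Pk_nonneg)
  then show ?thesis by simp
qed

text \<open>The phases are integrated out first. A phase \<open>m < i\<close> meets a Fejer kernel
  and turns \<open>tau\<close> into \<open>taut\<close>; a later phase contributes mean 1; together
  they give \<open>wt i\<close>. So \<open>Qf F\<close> is an average of the process
  \<open>Af\<close> with a weight dominated by \<open>kbar\<close>.\<close>

lemma Qf_Af:
  assumes n: "n < 2^b" and i: "i < b"
  shows "Qf F (Suc i) (n div 2 ^ (b - i)) = (LINT \<theta>|TT b. Af i 1 \<theta> * cplx (wb b \<theta> n))"
proof -
  interpret P: pair_prob_space "TT b" tor
    by (intro pair_prob_space.intro pair_sigma_finite.intro prob_space_imp_sigma_finite prob_TT prob_space_torus)
  let ?c = "\<lambda>t. cis (- real (Lam ^ i) * t)"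
  let ?f = "\<lambda>\<theta> t. (F t * ?c t) * cplx (Pk i \<theta> t * wb b \<theta> n)"
  have pn: "n div 2 ^ (b - i) < 2 ^ i"
    using n i by (simp add: less_mult_imp_div_less flip: power_add)
  have [measurable]: "?c \<in> borel_measurable borel" by (intro borel_measurable_continuous_onI continuous_intros)
  note [measurable] = Pk_measurable[of i b, OF less_imp_le[OF i]] kbar_measurable(2)[of b n]
  have m: "(\<lambda>(\<theta>, t). ?f \<theta> t) \<in> borel_measurable (TT b \<Otimes>\<^sub>M tor)" unfolding split_beta' by measurable
  have bd: "cmod (?f \<theta> t) \<le> BF * (fejb R ^ i * ((3 - rho) / rho) ^ b)" for \<theta> t
  proof -
    have "0 \<le> BF" using BF[of 0] norm_ge_zero order_trans by blast
    moreover have "\<bar>wb b \<theta> n\<bar> \<le> ((3 - rho) / rho) ^ b" using wb_le_kbar[of b \<theta> n] kbar_bound[of b \<theta> n] by linarith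
    ultimately show ?thesis using BF[of t] Pk_le[of i \<theta> t]
      by (auto simp: norm_mult abs_mult intro!: mult_mono)
  qed
  have int: "integrable (TT b \<Otimes>\<^sub>M tor) (\<lambda>(\<theta>, t). ?f \<theta> t)"
    by (rule P.integrable_const_bound[of _ "BF * (fejb R ^ i * ((3 - rho) / rho) ^ b)"]) (use m bd in auto)
  have "(LINT \<theta>|TT b. Af i 1 \<theta> * cplx (wb b \<theta> n)) = (LINT \<theta>|TT b. LINT t|tor. ?f \<theta> t)"
  proof (rule Bochner_Integration.integral_cong[OF refl])
    fix \<theta>
    have "Af i 1 \<theta> * cplx (wb b \<theta> n) = (LINT t|tor. (F t * (cplx (Pk i \<theta> t) * ?c t)) * cplx (wb b \<theta> n))"
      unfolding Af_def by simp
    also have "\<dots> = (LINT t|tor. ?f \<theta> t)" by (simp add: mult_ac)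
    finally show "Af i 1 \<theta> * cplx (wb b \<theta> n) = (LINT t|tor. ?f \<theta> t)" .
  qed
  also have "\<dots> = (LINT t|tor. LINT \<theta>|TT b. ?f \<theta> t)" using P.Fubini_integral[OF int] by simp
  also have "\<dots> = (LINT t|tor. (F t * ?c t) * cplx (wt i t (n div 2 ^ (b - i))))"
  proof (rule Bochner_Integration.integral_cong[OF refl])
    fix t
    let ?g = "\<lambda>m s. (if m < i then fej R (s - real (Lam ^ m) * t) else 1) * (1 + sgnb b m n * tau s / rho)"
    have gi: "integrable tor (?g m)" for m
    proof (rule torus_integrable[where B="max (fejb R) 1 * (1 + 1 / rho)"])
      fix s
      have "\<bar>1 + sgnb b m n * tau s / rho\<bar> \<le> 1 + 1 / rho"
        using sgn_tau_le[of b m n s] rho01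
        by (intro order_trans[OF abs_triangle_ineq]) (simp add: abs_divide divide_right_mono)
      then show "norm (?g m s) \<le> max (fejb R) 1 * (1 + 1 / rho)"
        using fej_le[of R] unfolding real_norm_def abs_mult by (intro mult_mono) (auto simp: le_max_iff_disj)
    qed (cases "m < i", auto)
    have "Pk i \<theta> t * wb b \<theta> n = (\<Prod>m<b. ?g m (\<theta> m))" for \<theta>
    proof -
      have "(\<Prod>m<b. if m < i then fej R (\<theta> m - real (Lam ^ m) * t) else 1) = (\<Prod>m\<in>{..<b} \<inter> {m. m < i}. fej R (\<theta> m - real (Lam ^ m) * t))"
        by (subst prod.inter_restrict) (auto intro!: prod.cong)
      also have "{..<b} \<inter> {m. m < i} = {..<i}" using i by auto
      finally have "Pk i \<theta> t = (\<Prod>m<b. if m < i then fej R (\<theta> m - real (Lam ^ m) * t) else 1)" by (simp add: Pk_def)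
      then show ?thesis by (simp only: wb_def prod.distrib)
    qed
    then have "(LINT \<theta>|TT b. Pk i \<theta> t * wb b \<theta> n) = (LINT \<theta>|TT b. (\<Prod>m<b. ?g m (\<theta> m)))" by presburger
    also have "\<dots> = (\<Prod>m<b. LINT s|tor. ?g m s)"
      by (rule TP.product_integral_prod) (auto intro: gi)
    also have "\<dots> = (\<Prod>m<b. if m < i then 1 + sgnb b m n * taut (real (Lam ^ m) * t) / rho else 1)"
    proof (rule prod.cong[OF refl])
      fix m
      show "(LINT s|tor. ?g m s) = (if m < i then 1 + sgnb b m n * taut (real (Lam ^ m) * t) / rho else 1)"
      proof (cases "m < i")
        case True
        have f1: "integrable tor (\<lambda>s. fej R (s - real (Lam ^ m) * t))"
          by (rule torus_integrable[where B="fejb R"]) (use fej_le in auto)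
        have f2: "integrable tor (\<lambda>s. fej R (s - real (Lam ^ m) * t) * tau s)"
          by (rule torus_integrable[where B="fejb R * 1"])
            (use fej_le tau_le in \<open>auto simp: abs_mult intro!: mult_mono simp del: mult_1_right\<close>, metis abs_ge_zero order_trans fej_le)
        have "cplx (LINT s|tor. fej R (s - real (Lam ^ m) * t)) = cplx 1"
          using fej_mean[of R "real (Lam ^ m) * t"] unfolding fej_sym[of R "real (Lam ^ m) * t"] by simp
        then have "(LINT s|tor. fej R (s - real (Lam ^ m) * t)) = 1" by (simp only: of_real_eq_iff)
        moreover have "(LINT s|tor. ?g m s) = (LINT s|tor. fej R (s - real (Lam ^ m) * t) + (sgnb b m n / rho) * (fej R (s - real (Lam ^ m) * t) * tau s))"
          using True by (intro Bochner_Integration.integral_cong) (auto simp: algebra_simps)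
        ultimately show ?thesis using True f1 f2 taut[of "real (Lam ^ m) * t"] by simp
      next
        case False
        then show ?thesis using tau_mean_real torus.prob_space by simp
      qed
    qed
    also have "\<dots> = (\<Prod>m\<in>{..<b} \<inter> {m. m < i}. 1 + sgnb b m n * taut (real (Lam ^ m) * t) / rho)"
      by (subst prod.inter_restrict) (auto intro!: prod.cong)
    also have "{..<b} \<inter> {m. m < i} = {..<i}" using i by auto
    also have "(\<Prod>m<i. 1 + sgnb b m n * taut (real (Lam ^ m) * t) / rho) = wt i t (n div 2 ^ (b - i))"
      unfolding wt_def using i by (intro prod.cong) (auto simp: sgnb_anc)
    finally have e: "(LINT \<theta>|TT b. Pk i \<theta> t * wb b \<theta> n) = wt i t (n div 2 ^ (b - i))" .
    have "(LINT \<theta>|TT b. ?f \<theta> t) = (F t * ?c t) * (LINT \<theta>|TT b. cplx (Pk i \<theta> t * wb b \<theta> n))"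
      by (rule integral_mult_right_zero)
    also have "(LINT \<theta>|TT b. cplx (Pk i \<theta> t * wb b \<theta> n)) = cplx (wt i t (n div 2 ^ (b - i)))"
      unfolding e[symmetric] by (rule integral_complex_of_real)
    finally show "(LINT \<theta>|TT b. ?f \<theta> t) = (F t * ?c t) * cplx (wt i t (n div 2 ^ (b - i)))" .
  qed
  also have "\<dots> = Qf F (Suc i) (n div 2 ^ (b - i))" using i pn by (simp add: Qf_def mult.assoc)
  finally show ?thesis by simp
qed

text \<open>\<open>288 = 2^2 * 4 * 18\<close>: the Schur test with mass 2, the loss from
  \<open>1 - 1 / R >= 1 / 2\<close>, and the Bellman constant.\<close>

lemma Qf_bound: "tmod b (Qf F) \<le> ennreal 288 * (\<integral>\<^sup>+ t. ennreal (phi (cmod (F t))) \<partial>tor)"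
proof -
  interpret P: prob_space "TT b" by (rule prob_TT)
  define av where "av j \<theta> = (if j = 0 then g0 else Af (j - 1) 1 \<theta>)" for j \<theta>
  define f where "f \<theta> = L2_set (\<lambda>j. cmod (av j \<theta>)) {..b}" for \<theta>
  have avm: "av j \<in> borel_measurable (TT b)" if "j \<le> b" for j
    using that Af_measurable[of "j - 1" b 1] by (cases j) (auto simp: av_def[abs_def])
  have avb: "\<exists>B. \<forall>\<theta>. cmod (av j \<theta>) \<le> B" for j using Af_bound by (cases j) (auto simp: av_def)
  have fm: "f \<in> borel_measurable (TT b)"
    unfolding f_def[abs_def] L2_set_def
    by (intro borel_measurable_sqrt borel_measurable_sum borel_measurable_power measurable_compose[OF avm borel_measurable_norm]
        measurable_compose[OF _ borel_measurable_sqrt]) auto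
  have wi: "integrable (TT b) (\<lambda>\<theta>. av j \<theta> * cplx (wb b \<theta> n))" if "j \<le> b" for j n
  proof -
    obtain B where B: "\<And>\<theta>. cmod (av j \<theta>) \<le> B" using avb by blast
    show ?thesis
    proof (rule TT_integrable[where B="B * ((3 - rho) / rho) ^ b"])
      show "(\<lambda>\<theta>. av j \<theta> * cplx (wb b \<theta> n)) \<in> borel_measurable (TT b)"
        using avm[OF that] kbar_measurable(2)[of b n] by measurable
      fix \<theta>
      have "\<bar>wb b \<theta> n\<bar> \<le> ((3 - rho) / rho) ^ b" using wb_le_kbar[of b \<theta> n] kbar_bound[of b \<theta> n] by linarith
      moreover have "0 \<le> B" using B[of \<theta>] norm_ge_zero order_trans by blast
      ultimately show "norm (av j \<theta> * cplx (wb b \<theta> n)) \<le> B * ((3 - rho) / rho) ^ b"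
        using B[of \<theta>] by (auto simp: norm_mult intro!: mult_mono)
    qed
  qed
  have wmean: "(LINT \<theta>|TT b. cplx (wb b \<theta> n)) = 1" for n
  proof -
    have ti: "integrable tor (\<lambda>s. 1 + sgnb b m n * tau s / rho)" for m using tau_mean_real by simp
    have "(LINT \<theta>|TT b. wb b \<theta> n) = (\<Prod>m<b. LINT s|tor. 1 + sgnb b m n * tau s / rho)"
      unfolding wb_def by (rule TP.product_integral_prod[of "{..<b}" "\<lambda>m s. 1 + sgnb b m n * tau s / rho"]) (auto intro: ti)
    also have "\<dots> = 1" using tau_mean_real torus.prob_space by simp
    finally show ?thesis using integral_complex_of_real[of "TT b" "\<lambda>\<theta>. wb b \<theta> n"] by simp
  qed
  have "tmod b (Qf F) = ennreal ((\<Sum>n<2^b. phi (sqrt (tsq b (Qf F) n))) / real (2^b))" by (simp add: tmod_def)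
  also have "\<dots> \<le> ennreal (2\<^sup>2) * (\<integral>\<^sup>+ \<theta>. ennreal (phi (f \<theta>)) \<partial>TT b)"
  proof (rule phi_kernel_to_fin[where k="\<lambda>\<theta> n. kbar b \<theta> n"])
    show "sigma_finite_measure (TT b)" by (rule prob_space_imp_sigma_finite[OF prob_TT])
    show "(\<Sum>n<2^b. kbar b \<theta> n) / real (2^b) \<le> 2" for \<theta> using kbar_sum[of b \<theta>] rhob by simp
    fix n :: nat assume n: "n < 2^b"
    have "cmod (Qf F j (anc b j n)) = cmod (LINT \<theta>|TT b. av j \<theta> * cplx (wb b \<theta> n))" if "j \<le> b" for j
    proof (cases j)
      case 0
      have "(LINT \<theta>|TT b. av 0 \<theta> * cplx (wb b \<theta> n)) = g0" using wmean[of n] by (simp add: av_def)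
      then show ?thesis using 0 n by (simp add: Qf_def anc_def g0_def)
    next
      case (Suc i)
      then show ?thesis using Qf_Af[OF n, of i] that by (simp add: av_def anc_def)
    qed
    then have "sqrt (tsq b (Qf F) n) = L2_set (\<lambda>j. cmod (LINT \<theta>|TT b. av j \<theta> * cplx (wb b \<theta> n))) {..b}"
      unfolding sqrt_tsq by (intro L2_set_cong) auto
    then show "ennreal (sqrt (tsq b (Qf F) n)) \<le> (\<integral>\<^sup>+ \<theta>. ennreal (kbar b \<theta> n) * ennreal (f \<theta>) \<partial>TT b)"
      unfolding f_def using minkowski_kernel[of "{..b}" "TT b" av "\<lambda>\<theta>. cplx (wb b \<theta> n)" "\<lambda>\<theta>. kbar b \<theta> n"] wi wb_le_kbar by simp
    show "(\<integral>\<^sup>+ \<theta>. ennreal (kbar b \<theta> n) \<partial>TT b) \<le> ennreal 2" by (rule kbar_nn)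
    show "(\<lambda>\<theta>. kbar b \<theta> n) \<in> borel_measurable (TT b)" by (rule kbar_measurable)
  next
    show "0 \<le> f \<theta>" for \<theta> by (simp add: f_def)
  qed (simp_all add: fm kbar_nonneg)
  also have "(\<integral>\<^sup>+ \<theta>. ennreal (phi (f \<theta>)) \<partial>TT b) \<le> (\<integral>\<^sup>+ \<theta>. ennreal 4 * ennreal (phi (sqrt (Sc b \<theta>))) \<partial>TT b)"
  proof (rule nn_integral_mono)
    fix \<theta>
    have "(f \<theta>)\<^sup>2 = (\<Sum>j\<le>b. (cmod (av j \<theta>))\<^sup>2)" unfolding f_def L2_set_def by (simp add: sum_nonneg)
    also have "\<dots> = (cmod g0)\<^sup>2 + (\<Sum>i<b. (cmod (Af i 1 \<theta>))\<^sup>2)" unfolding sum.atMost_shift by (simp add: av_def)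
    also have "\<dots> \<le> 4 * Sc b \<theta>"
    proof -
      have R: "1 / 2 \<le> 1 - 1 / real R" using R2 by (simp add: field_simps)
      have "(cmod (Af i 1 \<theta>))\<^sup>2 \<le> 4 * (cmod (cplx (1 - 1 / real R) * Af i 1 \<theta>))\<^sup>2" for i
      proof -
        have "cmod (cplx (1 - 1 / real R) * Af i 1 \<theta>) = (1 - 1 / real R) * cmod (Af i 1 \<theta>)"
          using R by (simp only: norm_mult norm_of_real)
        moreover have "(1 / 2) * cmod (Af i 1 \<theta>) \<le> (1 - 1 / real R) * cmod (Af i 1 \<theta>)" using R by (intro mult_right_mono) auto
        ultimately have "cmod (Af i 1 \<theta>) \<le> 2 * cmod (cplx (1 - 1 / real R) * Af i 1 \<theta>)" by argo
        then have "(cmod (Af i 1 \<theta>))\<^sup>2 \<le> (2 * cmod (cplx (1 - 1 / real R) * Af i 1 \<theta>))\<^sup>2" by (intro power_mono) auto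
        then show ?thesis by (simp add: power_mult_distrib)
      qed
      then have "(\<Sum>i<b. (cmod (Af i 1 \<theta>))\<^sup>2) \<le> 4 * (\<Sum>i<b. (cmod (cplx (1 - 1 / real R) * Af i 1 \<theta>))\<^sup>2)"
        unfolding sum_distrib_left by (rule sum_mono)
      then show ?thesis unfolding Sc_def by (simp add: add_increasing del: of_real_diff of_real_divide)
    qed
    finally have "(f \<theta>)\<^sup>2 \<le> (2 * sqrt (Sc b \<theta>))\<^sup>2" using Sc_nonneg by (simp add: power_mult_distrib)
    then have "f \<theta> \<le> 2 * sqrt (Sc b \<theta>)" by (rule power2_le_imp_le) (simp add: Sc_nonneg)
    then have "phi (f \<theta>) \<le> phi (2 * sqrt (Sc b \<theta>))" by (intro phi_mono) (auto simp: f_def)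
    also have "\<dots> \<le> 2\<^sup>2 * phi (sqrt (Sc b \<theta>))" by (rule phi_scale_le) simp
    finally show "ennreal (phi (f \<theta>)) \<le> ennreal 4 * ennreal (phi (sqrt (Sc b \<theta>)))"
      by (subst ennreal_mult[symmetric]) (auto intro: ennreal_leI)
  qed
  also have "\<dots> = ennreal 4 * (\<integral>\<^sup>+ \<theta>. ennreal (phi (sqrt (Sc b \<theta>))) \<partial>TT b)"
    using Sc_measurable[of b b] by (intro nn_integral_cmult) (simp add: phi_def)
  also have "\<dots> \<le> ennreal 4 * (ennreal 18 * (\<integral>\<^sup>+ t. ennreal (phi (cmod (F t))) \<partial>tor))"
    using phi_Sc phi_Af by (meson mult_left_mono order_trans zero_le)
  also have "ennreal (2\<^sup>2) * (ennreal 4 * (ennreal 18 * (\<integral>\<^sup>+ t. ennreal (phi (cmod (F t))) \<partial>tor))) = ennreal (2\<^sup>2 * (4 * 18)) * (\<integral>\<^sup>+ t. ennreal (phi (cmod (F t))) \<partial>tor)"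
    by (subst ennreal_mult, simp, simp, subst ennreal_mult, simp, simp, simp only: mult.assoc)
  finally show ?thesis by (simp add: mult_left_mono)
qed

end

section \<open>Trees as uniformly complemented pieces of polynomial blocks\<close>

lemma tp_coeffs:
  assumes "tp 0 (int a) f"
  shows "f t = (\<Sum>p\<le>a. (LINT s|tor. f s * cis (- real p * s)) * cis (real p * t))"
proof -
  obtain c where c: "f = (\<lambda>t. \<Sum>n\<in>{0..int a}. c n * cis (of_int n * t))" using assms unfolding tp_def by blast
  have f: "f t = (\<Sum>p<Suc a. c (int p) * cis (real p * t))" for t
    unfolding c by (rule sum.reindex_bij_witness[where i="int" and j="nat"]) auto
  have "(LINT s|tor. f s * cis (- real p * s)) = c (int p)" if "p \<le> a" for p
    using torus_coeff[where R="Suc a" and a="\<lambda>p. c (int p)" and m="int p"] that unfolding f by simp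
  then show ?thesis unfolding f[of t] lessThan_Suc_atMost by (intro sum.cong) auto
qed

lemma tpoly_tp: "tp 0 (int a) (tpoly a v)"
  unfolding tpoly_def[abs_def]
proof (rule tp_sum)
  fix p assume "p \<in> {..a}"
  then show "tp 0 (int a) (\<lambda>t. v 0 p * cis (real p * t))" using tp_cis[of 0 "int p" "int a" "v 0 p"] by simp
qed

lemma tpoly_coeff:
  assumes "p \<le> a"
  shows "(LINT s|tor. tpoly a v s * cis (- real p * s)) = v 0 p"
  using torus_coeff[where R="Suc a" and a="v 0" and m="int p"] assms by (simp add: tpoly_def lessThan_Suc_atMost)

definition coefs :: "nat \<Rightarrow> (real \<Rightarrow> complex) \<Rightarrow> vec" where
  "coefs a f j p = (if j = 0 \<and> p \<le> a then (LINT s|tor. f s * cis (- real p * s)) else 0)"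

lemma tpoly_coefs: "tp 0 (int a) f \<Longrightarrow> tpoly a (coefs a f) t = f t"
  using tp_coeffs[of a f t] by (simp add: tpoly_def coefs_def)

lemma coefs_in: "coefs a f \<in> fst (trig_block a)"
  by (auto simp: trig_block_def coefs_def)

lemma coefs_lin:
  assumes "tp 0 (int a) f" "tp 0 (int a) g"
  shows "coefs a (\<lambda>t. f t + g t) = coefs a f + coefs a g" "coefs a (\<lambda>t. c * f t) = vsc c (coefs a f)"
proof -
  have i: "integrable tor (\<lambda>s. f s * cis (- real p * s))" "integrable tor (\<lambda>s. g s * cis (- real p * s))" for p
    using tp_integrable[OF tp_mult[OF assms(1) tp_cis[of "- int p" "- int p" "- int p" 1]]]
      tp_integrable[OF tp_mult[OF assms(2) tp_cis[of "- int p" "- int p" "- int p" 1]]] by simp_all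
  show "coefs a (\<lambda>t. f t + g t) = coefs a f + coefs a g"
    using i by (intro ext) (auto simp: coefs_def distrib_right)
  show "coefs a (\<lambda>t. c * f t) = vsc c (coefs a f)"
    using i by (intro ext) (auto simp: coefs_def vsc_def mult.assoc)
qed

context dt
begin

lemma Jf_lin: "Jf (x + y) t = Jf x t + Jf y t" "Jf (vsc c x) t = c * Jf x t"
  unfolding Jf_def Yf_def vsc_def
  by (simp_all add: algebra_simps sum.distrib sum_distrib_left)

lemma Qf_lin:
  assumes "tp lo hi f" "tp lo hi g"
  shows "Qf (\<lambda>t. f t + g t) = Qf f + Qf g" "Qf (\<lambda>t. c * f t) = vsc c (Qf f)"
proof -
  have W: "tp (- (int Lam ^ i) + - (int l * DD i)) (- (int Lam ^ i) + int l * DD i) (\<lambda>t. cis (- real (Lam ^ i) * t) * cplx (wt i t p))" for i p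
    by (rule tp_mult[OF cis_Lam_tp(2) wt_tp])
  note i = tp_integrable[OF assms(1)] tp_integrable[OF assms(2)] tp_integrable[OF tp_mult[OF assms(1) W]] tp_integrable[OF tp_mult[OF assms(2) W]]
  show "Qf (\<lambda>t. f t + g t) = Qf f + Qf g"
  proof (intro ext)
    fix j p show "Qf (\<lambda>t. f t + g t) j p = (Qf f + Qf g) j p"
      using i by (cases j) (auto simp: Qf_def distrib_right)
  qed
  show "Qf (\<lambda>t. c * f t) = vsc c (Qf f)"
  proof (intro ext)
    fix j p show "Qf (\<lambda>t. c * f t) j p = vsc c (Qf f) j p"
      by (cases j) (auto simp: Qf_def vsc_def mult.assoc)
  qed
qed

lemma dt_fac:
  assumes a: "(int l + 1) * DD b \<le> int a"
  shows "fac 288 (tree_block b) (trig_block a)"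
  unfolding fac_def
proof (rule exI[of _ "\<lambda>y. coefs a (Jf y)"], rule exI[of _ "\<lambda>v. Qf (tpoly a v)"], intro conjI ballI)
  have J: "tp 0 (int a) (Jf y)" for y by (rule tp_mono[OF Jf_tp]) (use a in auto)
  show "lin_on (fst (tree_block b)) (\<lambda>y. coefs a (Jf y))"
  proof -
    have "Jf (x + y) = (\<lambda>t. Jf x t + Jf y t)" "Jf (vsc c x) = (\<lambda>t. c * Jf x t)" for x y c using Jf_lin by blast+
    then show ?thesis unfolding lin_on_def using coefs_lin[OF J J] by simp
  qed
  have T: "tpoly a (x + y) = (\<lambda>t. tpoly a x t + tpoly a y t)" "tpoly a (vsc c x) = (\<lambda>t. c * tpoly a x t)" for x y c
    by (auto simp: tpoly_def vsc_def sum.distrib distrib_right sum_distrib_left mult.assoc)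
  show "lin_on (fst (trig_block a)) (\<lambda>v. Qf (tpoly a v))"
    unfolding lin_on_def T using Qf_lin[OF tpoly_tp tpoly_tp] by blast
  fix y assume y: "y \<in> fst (tree_block b)"
  show "coefs a (Jf y) \<in> fst (trig_block a)" by (rule coefs_in)
  have e: "tpoly a (coefs a (Jf y)) = Jf y" using tpoly_coefs[OF J] by blast
  show "Qf (tpoly a (coefs a (Jf y))) = y" unfolding e by (rule Qf_Jf[OF y])
  have "pmod a (coefs a (Jf y)) \<le> tmod b y" unfolding pmod_def e by (rule Jf_bound)
  also have "\<dots> = 1 * tmod b y" by simp
  also have "\<dots> \<le> ennreal 288 * tmod b y" by (intro mult_right_mono) auto
  finally show "snd (trig_block a) (coefs a (Jf y)) \<le> ennreal 288 * snd (tree_block b) y"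
    by (simp add: trig_block_def tree_block_def)
next
  fix v
  have "Qf f j p = 0" if "\<not> (j \<le> b \<and> p < 2 ^ (j - 1))" for f j p
    using that by (cases j) (auto simp: Qf_def)
  then show "Qf (tpoly a v) \<in> fst (tree_block b)" by (auto simp: tree_block_def)
  interpret dtF b l R Lam tau taut rho "tpoly a v" "int a" "\<Sum>p\<le>a. cmod (v 0 p)"
    by unfold_locales (auto intro: tpoly_tp tpoly_bound)
  show "snd (tree_block b) (Qf (tpoly a v)) \<le> ennreal 288 * snd (trig_block a) v"
    using Qf_bound by (simp add: trig_block_def tree_block_def pmod_def)
qed

end

section \<open>Trigonometric polynomials close to a sign function, and the choice of
  parameters\<close>

fun sgs :: "nat \<Rightarrow> real \<Rightarrow> real" where
  "sgs 0 t = sin t" | "sgs (Suc k) t = (3 * sgs k t - (sgs k t) ^ 3) / 2"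

text \<open>The map \<open>x -> (3 x - x^3) / 2\<close> fixes 1 and -1 and squares the defect
  \<open>1 - x^2\<close> up to a factor at most 1. Being a cubic polynomial, it only triples the
  degree.\<close>

lemma sgs_step: "1 - (sgs (Suc k) t)\<^sup>2 = (1 - (sgs k t)\<^sup>2)\<^sup>2 * (4 - (sgs k t)\<^sup>2) / 4"
  by (simp add: power2_eq_square power3_eq_cube field_simps)

lemma sgs_bounds: "0 \<le> 1 - (sgs k t)\<^sup>2 \<and> 1 - (sgs k t)\<^sup>2 \<le> (cos t) ^ (2 ^ Suc k)"
proof (induction k)
  case 0
  have "1 - (sin t)\<^sup>2 = (cos t)\<^sup>2" by (simp add: cos_squared_eq)
  then show ?case by simp
next
  case (Suc k)
  let ?x = "1 - (sgs k t)\<^sup>2"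
  have f: "0 \<le> (4 - (sgs k t)\<^sup>2) / 4" "(4 - (sgs k t)\<^sup>2) / 4 \<le> 1" using Suc zero_le_power2[of "sgs k t"] by auto
  have "1 - (sgs (Suc k) t)\<^sup>2 = ?x\<^sup>2 * ((4 - (sgs k t)\<^sup>2) / 4)" unfolding sgs_step by simp
  moreover have "0 \<le> ?x\<^sup>2 * ((4 - (sgs k t)\<^sup>2) / 4)" using f by (intro mult_nonneg_nonneg) auto
  moreover have "?x\<^sup>2 * ((4 - (sgs k t)\<^sup>2) / 4) \<le> ?x\<^sup>2 * 1" using f by (intro mult_left_mono) auto
  moreover have "?x\<^sup>2 \<le> ((cos t) ^ (2 ^ Suc k))\<^sup>2" using Suc by (intro power_mono) auto
  moreover have "((cos t) ^ (2 ^ Suc k))\<^sup>2 = (cos t) ^ (2 ^ Suc (Suc k))" by (simp add: power_mult[symmetric] mult.commute)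
  ultimately show ?case by simp
qed

lemma sgs_abs: "\<bar>sgs k t\<bar> \<le> 1"
proof -
  have "(sgs k t)\<^sup>2 \<le> 1\<^sup>2" using sgs_bounds[of k t] by simp
  then show ?thesis by (metis abs_le_square_iff abs_one)
qed

lemma sgs_tp: "tp (- (3 ^ k)) (3 ^ k) (\<lambda>t. cplx (sgs k t))"
proof (induction k)
  case 0
  have "cplx (sin t) = (- \<i> / 2) * cis (of_int 1 * t) + (\<i> / 2) * cis (of_int (-1) * t)" for t
    by (simp add: complex_eq_iff)
  then have e: "(\<lambda>t. cplx (sgs 0 t)) = (\<lambda>t. (- \<i> / 2) * cis (of_int 1 * t) + (\<i> / 2) * cis (of_int (-1) * t))" by simp
  show ?case unfolding e by (intro tp_add tp_cis) auto
next
  case (Suc k)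
  have p: "cplx (sgs (Suc k) t) = (3 / 2) * cplx (sgs k t) + (- 1 / 2) * (cplx (sgs k t) * (cplx (sgs k t) * cplx (sgs k t)))" for t
    by (simp add: power3_eq_cube field_simps)
  have "tp (- (3 ^ Suc k)) (3 ^ Suc k) (\<lambda>t. cplx (sgs k t))" by (rule tp_mono[OF Suc]) auto
  moreover have "tp (- (3 ^ Suc k)) (3 ^ Suc k) (\<lambda>t. cplx (sgs k t) * (cplx (sgs k t) * cplx (sgs k t)))"
    by (rule tp_mono[OF tp_mult[OF Suc tp_mult[OF Suc Suc]]]) auto
  ultimately show ?case unfolding p by (intro tp_add tp_scale)
qed

lemma sgs_cont: "continuous_on A (sgs k)"
proof -
  have "continuous_on A (\<lambda>t. Re (cplx (sgs k t)))" by (intro continuous_intros tp_continuous[OF sgs_tp])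
  then show ?thesis by simp
qed

lemma sgs_measurable [measurable]: "sgs k \<in> borel_measurable borel"
  by (intro borel_measurable_continuous_onI sgs_cont)

lemma sgs_mean: "(LINT t|tor. sgs k t) = 0"
proof -
  have s: "sgs k (t + pi) = - sgs k t" for t by (induction k) (auto simp: power3_eq_cube field_simps)
  have p: "sgs k (t + 2 * pi) = sgs k t" for t using s[of "t + pi"] s[of t] by (simp add: algebra_simps)
  have "(LINT t|tor. sgs k (t + pi)) = (LINT t|tor. sgs k t)"
    by (rule torus_shift[OF sgs_cont p]) auto
  then show ?thesis unfolding s by simp
qed

text \<open>Where \<open>sin t\<close> is nonzero one has \<open>|cos t| < 1\<close>, so the defect
  tends to 0; the exceptional set is countable and dominated convergence applies.\<close>

lemma sgs_square_lim: "(\<lambda>k. LINT t|tor. (sgs k t)\<^sup>2) \<longlonglongrightarrow> 1"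
proof -
  have "AE t in tor. sin t \<noteq> 0"
  proof -
    have "{t. sin t = 0} = range (\<lambda>i::int. of_int i * pi)" by (auto simp: sin_zero_iff_int2)
    then have "countable {t::real. sin t = 0}" by simp
    then have "AE t in lborel. sin t \<noteq> (0::real)"
      by (intro AE_I'[of "{t. sin t = 0}"] countable_imp_null_set_lborel) auto
    then show ?thesis unfolding torus_measure_def by (intro AE_uniform_measureI) auto
  qed
  then have ae: "AE t in tor. (\<lambda>k. (sgs k t)\<^sup>2) \<longlonglongrightarrow> 1"
  proof eventually_elim
    case (elim t)
    have c: "\<bar>cos t\<bar> < 1"
    proof -
      have "0 < (sin t)\<^sup>2" using elim by simp
      then have "(cos t)\<^sup>2 < 1" using sin_cos_squared_add[of t] by argo
      then have "(cos t)\<^sup>2 < 1\<^sup>2" by simp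
      then show ?thesis using abs_le_square_iff[of 1 "cos t"] by simp
    qed
    have fl: "filterlim (\<lambda>k::nat. (2::nat) ^ Suc k) at_top sequentially"
      by (rule filterlim_at_top_mono[OF filterlim_ident]) (auto intro!: eventually_sequentiallyI[of 0], metis less_exp le_less_trans less_imp_le lessI power_Suc2 mult.commute n_less_m_mult_n less_or_eq_imp_le trans_less_add1 mult_2 power_Suc)
    have "(\<lambda>k. (cos t) ^ (2 ^ Suc k)) \<longlonglongrightarrow> 0"
      by (rule filterlim_compose[OF LIMSEQ_power_zero fl]) (use c in auto)
    then have "(\<lambda>k. 1 - (sgs k t)\<^sup>2) \<longlonglongrightarrow> 0"
      by (rule tendsto_sandwich[OF _ _ tendsto_const, rotated 2]) (use sgs_bounds in auto)
    from tendsto_diff[OF tendsto_const[of 1] this] show ?case by simp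
  qed
  have "(\<lambda>k. LINT t|tor. (sgs k t)\<^sup>2) \<longlonglongrightarrow> (LINT t|tor. 1)"
  proof (rule integral_dominated_convergence[where w="\<lambda>_. 1", OF _ _ _ ae])
    show "AE t in tor. norm ((sgs k t)\<^sup>2) \<le> 1" for k using sgs_bounds[of k] by (intro AE_I2) auto
  qed auto
  then show ?thesis using torus.prob_space by simp
qed

lemma fej_conv_cis:
  assumes n: "\<bar>n\<bar> < int R"
  shows "(LINT s|tor. cplx (fej R (s - x)) * cis (of_int n * s)) = cplx (1 - of_int \<bar>n\<bar> / real R) * cis (of_int n * x)"
proof -
  let ?c = "\<lambda>m. cplx (1 - real m / real R)"
  have i: "integrable tor (\<lambda>s. cis (of_int m * s))" for m using tp_integrable[OF tp_cis[of m m m 1]] by simp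
  have e: "cplx (fej R (s - x)) * cis (of_int n * s) = cis (of_int n * s) +
     (\<Sum>m=1..<R. ?c m * (cis (- real m * x) * cis (of_int (int m + n) * s) + cis (real m * x) * cis (of_int (n - int m) * s)))" for s
  proof -
    have "cis (of_int (int m + n) * s) = cis (real m * s) * cis (of_int n * s)" "cis (of_int (n - int m) * s) = cis (- real m * s) * cis (of_int n * s)" for m
      by (simp_all add: cis_mult algebra_simps)
    note cm = this
    show ?thesis unfolding fej_cis distrib_right[of 1] mult_1_left sum_distrib_right
      by (intro arg_cong2[where f="(+)"] refl sum.cong) (simp only: cm, simp only: distrib_left distrib_right mult_ac)
  qed
  have "(LINT s|tor. cplx (fej R (s - x)) * cis (of_int n * s)) = (LINT s|tor. cis (of_int n * s)) +
     (\<Sum>m=1..<R. ?c m * (cis (- real m * x) * (LINT s|tor. cis (of_int (int m + n) * s)) + cis (real m * x) * (LINT s|tor. cis (of_int (n - int m) * s))))"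
    unfolding e using i by (subst Bochner_Integration.integral_add) (auto simp: Bochner_Integration.integral_sum simp del: of_int_add of_int_diff of_real_diff of_real_divide)
  also have "\<dots> = (if n = 0 then 1 else 0) + (\<Sum>m=1..<R. if m = nat \<bar>n\<bar> then ?c m * cis (of_int n * x) else 0)"
    unfolding torus_integral_cis by (intro arg_cong2[where f="(+)"] sum.cong) auto
  also have "\<dots> = cplx (1 - of_int \<bar>n\<bar> / real R) * cis (of_int n * x)"
    using n by (cases "n = 0") auto
  finally show ?thesis .
qed

lemma fej_conv_tp:
  assumes f: "tp (- int l) (int l) (\<lambda>t. cplx (f t))" and R: "l < R"
  obtains c where "\<And>t. cplx (f t) = (\<Sum>n\<in>{- int l..int l}. c n * cis (of_int n * t))"
    "\<And>x. cplx (LINT s|tor. fej R (s - x) * f s) = (\<Sum>n\<in>{- int l..int l}. (cplx (1 - of_int \<bar>n\<bar> / real R) * c n) * cis (of_int n * x))"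
proof -
  obtain c where "(\<lambda>t. cplx (f t)) = (\<lambda>t. \<Sum>n\<in>{- int l..int l}. c n * cis (of_int n * t))" using f unfolding tp_def by blast
  then have c: "cplx (f t) = (\<Sum>n\<in>{- int l..int l}. c n * cis (of_int n * t))" for t by meson
  have i: "integrable tor (\<lambda>s. cplx (fej R (s - x)) * cis (of_int n * s))" for n x
    by (rule torus_integrable[where B="fejb R"]) (auto simp: norm_mult fej_le intro!: borel_measurable_continuous_onI continuous_intros continuous_on_compose2[OF fej_cont])
  have "cplx (LINT s|tor. fej R (s - x) * f s) = (\<Sum>n\<in>{- int l..int l}. (cplx (1 - of_int \<bar>n\<bar> / real R) * c n) * cis (of_int n * x))" for x
  proof -
    have "cplx (LINT s|tor. fej R (s - x) * f s) = (LINT s|tor. cplx (fej R (s - x) * f s))"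
      by (rule integral_complex_of_real[symmetric])
    also have "\<dots> = (LINT s|tor. (\<Sum>n\<in>{- int l..int l}. c n * (cplx (fej R (s - x)) * cis (of_int n * s))))"
      unfolding of_real_mult c sum_distrib_left by (simp add: mult_ac)
    also have "\<dots> = (\<Sum>n\<in>{- int l..int l}. c n * (LINT s|tor. cplx (fej R (s - x)) * cis (of_int n * s)))"
      using i by (simp add: Bochner_Integration.integral_sum)
    also have "\<dots> = (\<Sum>n\<in>{- int l..int l}. (cplx (1 - of_int \<bar>n\<bar> / real R) * c n) * cis (of_int n * x))"
    proof (rule sum.cong[OF refl])
      fix n assume "n \<in> {- int l..int l}"
      then have "\<bar>n\<bar> < int R" using R by auto
      from fej_conv_cis[OF this, of x] show "c n * (LINT s|tor. cplx (fej R (s - x)) * cis (of_int n * s)) =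
         (cplx (1 - of_int \<bar>n\<bar> / real R) * c n) * cis (of_int n * x)" by (simp only: mult_ac)
    qed
    finally show ?thesis .
  qed
  with c that show ?thesis by blast
qed

text \<open>Order of the choices: \<open>b\<close> fixes \<open>\<delta>\<close>, this fixes the
  number \<open>k\<close> of iterations and so \<open>tau\<close> with its coefficients, and
  \<open>R\<close> is then so large that the Fejer mean of \<open>tau\<close> is uniformly within
  \<open>\<delta> / 2\<close> of \<open>tau\<close>.\<close>

lemma dt_exists: "\<exists>l R Lam tau taut rho. dt b l R Lam tau taut rho"
proof -
  \<comment> \<open>Small enough for
    \<open>(1 + 4 * \<delta>) ^ b <= exp (1 / 2) <= 2\<close>.\<close>
  define \<delta> where "\<delta> = 1 / (8 * (real b + 1))"
  have \<delta>: "0 < \<delta>" "\<delta> \<le> 1 / 8" "4 * \<delta> * real b \<le> 1 / 2" by (auto simp: \<delta>_def field_simps)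
  have "\<forall>\<^sub>F k in sequentially. 1 - \<delta> / 2 < (LINT t|tor. (sgs k t)\<^sup>2)"
    using order_tendstoD(1)[OF sgs_square_lim, of "1 - \<delta> / 2"] \<delta> by simp
  then obtain k where k: "1 - \<delta> / 2 < (LINT t|tor. (sgs k t)\<^sup>2)" by (auto dest: eventually_happens)
  define l where "l = (2 * 3 ^ k :: nat)"
  \<comment> \<open>The argument \<open>2 * t\<close> leaves even frequencies only, so
    \<open>tau\<close> is orthogonal to \<open>cis t\<close>.\<close>
  define tau where "tau t = sgs k (2 * t)" for t
  have s2: "tp (- (2 - 1)) (2 - 1) (\<lambda>t. 1 :: complex)" "tp (- (2 - 1)) (2 - 1) (\<lambda>t. cis t)"
    using tp_const[of "-1" 1 1] tp_cis[of "-1" 1 1 1] by simp_all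
  have tau_tp: "tp (- int l) (int l) (\<lambda>t. cplx (tau t))"
    using tp_dilate[OF sgs_tp[of k], of 2] by (simp add: l_def tau_def)
  have tau_le: "\<bar>tau t\<bar> \<le> 1" for t unfolding tau_def by (rule sgs_abs)
  have smean: "(LINT t|tor. cplx (sgs k t)) = 0" using sgs_mean[of k] integral_complex_of_real[of tor "sgs k"] by simp
  have tau_mean: "(LINT t|tor. cplx (tau t)) = 0"
    using tp_lacunary[OF s2(1) sgs_tp[of k]] smean by (simp add: tau_def)
  have tau_cis: "(LINT t|tor. cplx (tau t) * cis t) = 0"
    using tp_lacunary[OF s2(2) sgs_tp[of k]] smean by (simp add: tau_def mult.commute)
  have tau_sq: "(LINT t|tor. (tau t)\<^sup>2) = (LINT t|tor. (sgs k t)\<^sup>2)"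
  proof -
    have "(LINT t|tor. 1 * (\<lambda>t. cplx (sgs k t) * cplx (sgs k t)) (of_int 2 * t)) = (LINT t|tor. 1) * (LINT t|tor. cplx (sgs k t) * cplx (sgs k t))"
      by (rule tp_lacunary[OF s2(1) tp_mult[OF sgs_tp sgs_tp]]) simp
    then have "(LINT t|tor. cplx ((tau t)\<^sup>2)) = (LINT t|tor. cplx ((sgs k t)\<^sup>2))"
      using torus.prob_space by (simp add: tau_def power2_eq_square)
    then show ?thesis unfolding integral_complex_of_real by simp
  qed
  have tau_cont: "continuous_on UNIV tau" unfolding tau_def by (intro continuous_on_compose2[OF sgs_cont] continuous_intros) auto
  have tm [measurable]: "tau \<in> borel_measurable borel" by (intro borel_measurable_continuous_onI tau_cont)
  obtain c0 where c0: "\<And>t. cplx (tau t) = (\<Sum>n\<in>{- int l..int l}. c0 n * cis (of_int n * t))"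
    using tau_tp unfolding tp_def by meson
  define S where "S = (\<Sum>n\<in>{- int l..int l}. cmod (c0 n))"
  have S: "0 \<le> S" unfolding S_def by (simp add: sum_nonneg)
  obtain R where R: "R > l + 2" "real R > 2 * (real l * S) / \<delta>"
    by (meson reals_Archimedean2 less_le_trans le_less_trans max.cobounded1 max.cobounded2 of_nat_less_iff
        exists_least_lemma gt_ex max_less_iff_conj)
  define taut where "taut x = (LINT s|tor. fej R (s - x) * tau s)" for x
  have R0: "R > 0" "l < R" using R by auto
  obtain c where c: "\<And>t. cplx (tau t) = (\<Sum>n\<in>{- int l..int l}. c n * cis (of_int n * t))"
    "\<And>x. cplx (taut x) = (\<Sum>n\<in>{- int l..int l}. (cplx (1 - of_int \<bar>n\<bar> / real R) * c n) * cis (of_int n * x))"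
    using fej_conv_tp[OF tau_tp R0(2)] unfolding taut_def by blast
  \<comment> \<open>\<open>R\<close> was chosen from the coefficients \<open>c0\<close>, while the
    convolution formula supplies \<open>c\<close>; uniqueness of Fourier coefficients identifies
    them.\<close>
  have cc0: "c n = c0 n" if n: "n \<in> {- int l..int l}" for n
  proof -
    have co: "(LINT t|tor. (\<Sum>m\<in>{- int l..int l}. d m * cis (of_int m * t)) * cis (of_int (- n) * t)) = d n" for d
    proof -
      have i: "integrable tor (\<lambda>t. d m * cis (of_int (m - n) * t))" for m using tp_integrable[OF tp_cis[of "m - n" "m - n" "m - n" "d m"]] by simp
      have "(LINT t|tor. (\<Sum>m\<in>{- int l..int l}. d m * cis (of_int m * t)) * cis (of_int (- n) * t)) = (LINT t|tor. (\<Sum>m\<in>{- int l..int l}. d m * cis (of_int (m - n) * t)))"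
        unfolding sum_distrib_right by (intro Bochner_Integration.integral_cong sum.cong refl) (simp add: cis_mult algebra_simps)
      also have "\<dots> = (\<Sum>m\<in>{- int l..int l}. d m * (if m - n = 0 then 1 else 0))"
        unfolding torus_integral_cis[symmetric] using i by (subst Bochner_Integration.integral_sum) auto
      also have "\<dots> = (\<Sum>m\<in>{- int l..int l}. if m = n then d m else 0)" by (rule sum.cong) auto
      also have "\<dots> = d n" using n by simp
      finally show ?thesis .
    qed
    show ?thesis using co[of c] co[of c0] unfolding c(1)[symmetric] c0[symmetric] by simp
  qed
  have taut_tp: "tp (- int l) (int l) (\<lambda>t. cplx (taut t))" unfolding c(2) by (intro tp_sum tp_cis) auto
  have c00: "c 0 = 0" using tau_mean unfolding c(1) tp_integral by simp
  have taut_mean: "(LINT t|tor. cplx (taut t)) = 0" unfolding c(2) tp_integral using c00 by simp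
  define rho where "rho = (LINT t|tor. tau t * taut t)"
  have rho: "(LINT t|tor. cplx (tau t) * cplx (taut t)) = cplx rho"
    unfolding rho_def of_real_mult[symmetric] by (rule integral_complex_of_real)
  have tautm [measurable]: "taut \<in> borel_measurable borel"
  proof -
    have "(\<lambda>t. Re (cplx (taut t))) \<in> borel_measurable borel" using tp_measurable[OF taut_tp] by measurable
    then show ?thesis by simp
  qed
  have close: "\<bar>taut x - tau x\<bar> \<le> \<delta> / 2" for x
  proof -
    have "\<bar>taut x - tau x\<bar> = cmod (cplx (taut x) - cplx (tau x))" by (metis norm_of_real of_real_diff)
    also have "\<dots> = cmod (\<Sum>n\<in>{- int l..int l}. - (cplx (of_int \<bar>n\<bar> / real R) * c n * cis (of_int n * x)))"
      unfolding c sum_subtractf[symmetric] by (intro arg_cong[where f=cmod] sum.cong refl) (simp add: algebra_simps)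
    also have "\<dots> \<le> (\<Sum>n\<in>{- int l..int l}. (real l / real R) * cmod (c0 n))"
    proof (rule order_trans[OF norm_sum], rule sum_mono)
      fix n assume n: "n \<in> {- int l..int l}"
      then have "real_of_int \<bar>n\<bar> / real R \<le> real l / real R" using R0 by (intro divide_right_mono) auto
      moreover have "cmod (- (cplx (of_int \<bar>n\<bar> / real R) * c n * cis (of_int n * x))) = (of_int \<bar>n\<bar> / real R) * cmod (c0 n)"
        using cc0[OF n] R0 by (simp add: norm_mult norm_divide)
      ultimately show "cmod (- (cplx (of_int \<bar>n\<bar> / real R) * c n * cis (of_int n * x))) \<le> (real l / real R) * cmod (c0 n)"
        by (simp only: mult_right_mono norm_ge_zero)
    qed
    also have "\<dots> = real l * S / real R" by (simp add: S_def sum_distrib_left sum_divide_distrib)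
    also have "\<dots> \<le> \<delta> / 2" using R(2) R0 \<delta>(1) by (simp add: field_simps)
    finally show ?thesis .
  qed
  have taut_le: "\<bar>taut x\<bar> \<le> 1" for x
  proof -
    have fi: "integrable tor (\<lambda>s. fej R (s - x))" by (rule torus_integrable[where B="fejb R"]) (use fej_le in auto)
    have "cplx (LINT s|tor. fej R (s - x)) = cplx 1" using fej_mean[of R x] unfolding fej_sym[of R x] by simp
    then have f1: "(LINT s|tor. fej R (s - x)) = 1" by (simp only: of_real_eq_iff)
    have le: "\<bar>fej R (s - x) * tau s\<bar> \<le> fej R (s - x)" for s
      using mult_left_mono[OF tau_le[of s] fej_nonneg[OF R0(1), of "s - x"]] fej_nonneg[OF R0(1), of "s - x"] by (simp add: abs_mult)
    have ti: "integrable tor (\<lambda>s. fej R (s - x) * tau s)"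
      by (rule torus_integrable[where B="fejb R"]) (use order_trans[OF le order_trans[OF abs_ge_self fej_le]] in auto)
    have "\<bar>taut x\<bar> \<le> (LINT s|tor. \<bar>fej R (s - x) * tau s\<bar>)" unfolding taut_def by (rule integral_abs_bound)
    also have "\<dots> \<le> (LINT s|tor. fej R (s - x))" using ti fi le by (intro integral_mono) auto
    finally show ?thesis using f1 by simp
  qed
  have ti2: "integrable tor (\<lambda>t. tau t * taut t)" "integrable tor (\<lambda>t. (tau t)\<^sup>2)"
    using tau_le taut_le by (auto intro!: torus_integrable[where B=1] simp: abs_mult mult_le_one power_le_one_iff abs_square_le_1)
  have "rho \<le> (LINT t|tor. 1)" unfolding rho_def
  proof (intro integral_mono ti2)
    fix t
    have "tau t * taut t \<le> \<bar>tau t * taut t\<bar>" by simp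
    also have "\<dots> \<le> 1" unfolding abs_mult using tau_le[of t] taut_le[of t] by (intro mult_le_one) auto
    finally show "tau t * taut t \<le> 1" .
  qed auto
  then have rho1: "rho \<le> 1" using torus.prob_space by simp
  have "(LINT t|tor. (tau t)\<^sup>2 - \<delta> / 2) \<le> rho" unfolding rho_def
  proof (intro integral_mono ti2 Bochner_Integration.integrable_diff)
    fix t
    have "\<bar>tau t * (taut t - tau t)\<bar> \<le> 1 * (\<delta> / 2)" unfolding abs_mult using tau_le[of t] close[of t] by (intro mult_mono) auto
    then have "- (tau t * (taut t - tau t)) \<le> \<delta> / 2" by (simp only: mult_1 abs_le_iff)
    then show "(tau t)\<^sup>2 - \<delta> / 2 \<le> tau t * taut t" by (simp add: power2_eq_square algebra_simps)
  qed auto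
  then have "(LINT t|tor. (tau t)\<^sup>2) - \<delta> / 2 \<le> rho" using ti2 torus.prob_space by simp
  then have rhod: "1 - \<delta> \<le> rho" using k tau_sq by simp
  have rho0: "1 / 2 \<le> rho" using rhod \<delta> by simp
  have "((2 - rho) / rho) ^ b \<le> (1 + 4 * \<delta>) ^ b"
  proof (rule power_mono)
    have "2 * (1 - rho) \<le> 2 * \<delta>" using rhod by simp
    also have "\<dots> \<le> 4 * \<delta> * rho" using rho0 \<delta> mult_left_mono[OF rho0, of "4 * \<delta>"] by simp
    finally show "(2 - rho) / rho \<le> 1 + 4 * \<delta>" using rho0 by (simp add: divide_le_eq algebra_simps)
    show "0 \<le> (2 - rho) / rho" using rho0 rho1 by simp
  qed
  also have "\<dots> \<le> exp (4 * \<delta>) ^ b" using \<delta> by (intro power_mono) auto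
  also have "\<dots> = exp (4 * \<delta> * real b)" by (simp add: exp_of_nat_mult[symmetric] mult.commute)
  also have "\<dots> \<le> exp (1 / 2)" using \<delta>(3) by simp
  also have "\<dots> \<le> 2" by (rule exp_half_le2)
  finally have rhob: "((2 - rho) / rho) ^ b \<le> 2" .
  have "dt b l R (max R (2 * l + 3)) tau taut rho"
    by unfold_locales (use tau_tp tau_le tau_mean tau_cis R taut_tp taut_mean rho rho0 rho1 rhob in \<open>auto simp: taut_def\<close>)
  then show ?thesis by blast
qed

theorem tree_fac_trig: "\<exists>a0. \<forall>a\<ge>a0. fac 288 (tree_block b) (trig_block a)"
proof -
  obtain l R Lam tau taut rho where "dt b l R Lam tau taut rho" using dt_exists by blast
  then interpret dt b l R Lam tau taut rho .
  show ?thesis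
  proof (intro exI[of _ "nat ((int l + 1) * DD b)"] allI impI)
    fix a assume "nat ((int l + 1) * DD b) \<le> a"
    then have "(int l + 1) * DD b \<le> int a" by simp
    then show "fac 288 (tree_block b) (trig_block a)" by (rule dt_fac)
  qed
qed

subsection \<open>Stopped random walks in the disc\<close>

text \<open>Harmonic extension of \<open>R\<close> times the Fejer kernel, evaluated at the point \<open>M\<close> of the disc.\<close>

definition hu :: "nat \<Rightarrow> real \<Rightarrow> complex \<Rightarrow> real" where
  "hu R \<theta> M = real R + (\<Sum>n=1..R. 2 * real (R - n) * Re (M ^ n * cis (- real n * \<theta>)))"

text \<open>On the circle this is a nonnegative multiple of the Fejer kernel. The maximum principle
  for \<open>exp (- G)\<close>, whose modulus is \<open>exp (- Re G)\<close>, carries the sign into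
  the disc.\<close>

lemma hu_nonneg:
  assumes "cmod M \<le> 1"
  shows "0 \<le> hu R \<theta> M"
proof (cases "R = 0")
  case False
  define G where "G w = of_nat R + (\<Sum>n=1..R. 2 * of_nat (R - n) * w ^ n)" for w :: complex
  have ReG: "Re (G w) = real R + (\<Sum>n=1..R. 2 * real (R - n) * Re (w ^ n))" for w
  proof -
    have "Re (2 * of_nat (R - n) * w ^ n) = 2 * real (R - n) * Re (w ^ n)" for n
    proof -
      have "2 * of_nat (R - n) * w ^ n = cplx (2 * real (R - n)) * w ^ n" by simp
      then show ?thesis by (simp only: Re_complex_of_real Im_complex_of_real times_complex.sel)
    qed
    then show ?thesis unfolding G_def plus_complex.sel Re_sum by simp
  qed
  have circ: "0 \<le> Re (G w)" if "cmod w = 1" for w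
  proof -
    define t where "t = Arg w"
    have t: "w = cis t" unfolding t_def using rcis_cmod_Arg[of w] unfolding rcis_def that by simp
    have "Re (G w) = real R * fej R t"
    proof -
      have "(\<Sum>n=1..R. 2 * real (R - n) * Re (w ^ n)) = (\<Sum>n=1..R. real R * (2 * (1 - real n / real R) * cos (real n * t)))"
        using False by (intro sum.cong) (auto simp: t Complex.DeMoivre of_nat_diff field_simps)
      also have "\<dots> = (\<Sum>n=1..<R. real R * (2 * (1 - real n / real R) * cos (real n * t)))"
        using False by (intro sum.mono_neutral_right) auto
      finally show ?thesis unfolding ReG fej_def by (simp add: distrib_left sum_distrib_left)
    qed
    then show ?thesis using fej_nonneg[of R t] False by simp
  qed
  let ?w = "M * cis (- \<theta>)"
  have "cmod (exp (- G ?w)) \<le> 1"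
  proof (rule maximum_modulus_frontier[of "\<lambda>w. exp (- G w)" "cball 0 1"])
    show "(\<lambda>w. exp (- G w)) holomorphic_on interior (cball 0 1)" unfolding G_def by (intro holomorphic_intros)
    show "continuous_on (closure (cball 0 1)) (\<lambda>w. exp (- G w))" unfolding G_def by (intro continuous_intros)
    show "cmod (exp (- G z)) \<le> 1" if "z \<in> frontier (cball 0 1)" for z
      using circ[of z] that by (simp add: frontier_cball norm_exp_eq_Re)
    show "?w \<in> cball 0 1" using assms by (simp add: norm_mult)
  qed simp
  then have "0 \<le> Re (G ?w)" by (simp add: norm_exp_eq_Re)
  moreover have "hu R \<theta> M = Re (G ?w)"
    unfolding hu_def ReG power_mult_distrib Complex.DeMoivre by simp
  ultimately show ?thesis by simp
qed (simp add: hu_def)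

text \<open>The de la Vallee Poussin multiplier: the truncated subtractions make it 1 up to
  \<open>A\<close>, linear in between, and 0 from \<open>B\<close> on.\<close>

definition vm :: "nat \<Rightarrow> nat \<Rightarrow> nat \<Rightarrow> real" where
  "vm A B n = (real (B - n) - real (A - n)) / (real B - real A)"

text \<open>The harmonic kernel with multiplier \<open>vm A B\<close>, a difference of two positive
  kernels.\<close>

definition hk :: "nat \<Rightarrow> nat \<Rightarrow> real \<Rightarrow> complex \<Rightarrow> real" where
  "hk A B \<theta> M = (hu B \<theta> M - hu A \<theta> M) / (real B - real A)"

text \<open>Replacing the difference by a sum gives a positive majorant of mass
  \<open>(B + A) / (B - A)\<close>; this ratio is the whole price of the window.\<close>

definition hb :: "nat \<Rightarrow> nat \<Rightarrow> real \<Rightarrow> complex \<Rightarrow> real" where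
  "hb A B \<theta> M = (hu B \<theta> M + hu A \<theta> M) / (real B - real A)"

lemma vm_1: "A < B \<Longrightarrow> n \<le> A \<Longrightarrow> vm A B n = 1"
  by (simp add: vm_def of_nat_diff)

lemma vm_0: "A < B \<Longrightarrow> B \<le> n \<Longrightarrow> vm A B n = 0"
  by (simp add: vm_def)

lemma hu_ext: "R \<le> N \<Longrightarrow> hu R \<theta> M = real R + (\<Sum>n=1..N. 2 * real (R - n) * Re (M ^ n * cis (- real n * \<theta>)))"
  unfolding hu_def by (intro arg_cong2[where f="(+)"] refl sum.mono_neutral_left) auto

lemma hk_expand:
  assumes "A < B" "B \<le> Suc k"
  shows "cplx (hk A B \<theta> M) = 1 + (\<Sum>n=1..k. cplx (vm A B n) * (M ^ n * cis (- real n * \<theta>) + cnj M ^ n * cis (real n * \<theta>)))"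
proof -
  have AB: "real B - real A > 0" using assms by simp
  have r: "cplx (2 * Re (M ^ n * cis (- real n * \<theta>))) = M ^ n * cis (- real n * \<theta>) + cnj M ^ n * cis (real n * \<theta>)" for n
    using complex_add_cnj[of "M ^ n * cis (- real n * \<theta>)"] by (simp add: cis_cnj)
  have "hk A B \<theta> M = (real B - real A + (\<Sum>n=1..Suc k. (real (B - n) - real (A - n)) * (2 * Re (M ^ n * cis (- real n * \<theta>))))) / (real B - real A)"
    unfolding hk_def using assms by (subst (1 2) hu_ext[of _ "Suc k"]) (auto simp: sum_subtractf algebra_simps)
  also have "(\<Sum>n=1..Suc k. (real (B - n) - real (A - n)) * (2 * Re (M ^ n * cis (- real n * \<theta>)))) = (\<Sum>n=1..k. (real (B - n) - real (A - n)) * (2 * Re (M ^ n * cis (- real n * \<theta>))))"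
    using assms by simp
  finally have "hk A B \<theta> M = 1 + (\<Sum>n=1..k. vm A B n * (2 * Re (M ^ n * cis (- real n * \<theta>))))"
    using AB unfolding vm_def add_divide_distrib sum_divide_distrib by simp
  then have "cplx (hk A B \<theta> M) = 1 + (\<Sum>n=1..k. cplx (vm A B n) * cplx (2 * Re (M ^ n * cis (- real n * \<theta>))))"
    by (simp only: of_real_add of_real_sum of_real_mult of_real_1)
  then show ?thesis unfolding r .
qed

lemma hb_nonneg: "A < B \<Longrightarrow> cmod M \<le> 1 \<Longrightarrow> 0 \<le> hb A B \<theta> M"
  unfolding hb_def by (intro divide_nonneg_nonneg add_nonneg_nonneg hu_nonneg) auto

lemma hk_le_hb:
  assumes "A < B" "cmod M \<le> 1"
  shows "\<bar>hk A B \<theta> M\<bar> \<le> hb A B \<theta> M"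
proof -
  have "\<bar>hu B \<theta> M - hu A \<theta> M\<bar> \<le> hu B \<theta> M + hu A \<theta> M"
    using hu_nonneg[OF assms(2), of B \<theta>] hu_nonneg[OF assms(2), of A \<theta>] by (simp add: abs_le_iff)
  then show ?thesis unfolding hk_def hb_def using assms(1) by (simp add: abs_divide divide_right_mono)
qed

lemma hu_cont: "continuous_on S (\<lambda>\<theta>. hu R \<theta> M)"
  unfolding hu_def by (intro continuous_intros)

lemma hb_cont: "continuous_on S (\<lambda>\<theta>. hb A B \<theta> M)"
  unfolding hb_def divide_inverse by (intro continuous_intros hu_cont)

lemma hu_bound: "cmod M \<le> 1 \<Longrightarrow> hu R \<theta> M \<le> real R + (\<Sum>n=1..R. 2 * real (R - n))"
proof -
  assume M: "cmod M \<le> 1"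
  have "Re (M ^ n * cis (- real n * \<theta>)) \<le> 1" for n
    using complex_Re_le_cmod[of "M ^ n * cis (- real n * \<theta>)"] M power_le_one[of "cmod M" n] by (simp add: norm_mult norm_power)
  then show ?thesis unfolding hu_def by (intro add_left_mono sum_mono mult_left_le) auto
qed

lemma hu_mean: "(LINT \<theta>|tor. hu R \<theta> M) = real R"
proof -
  have i: "integrable tor (\<lambda>\<theta>. M ^ n * cis (- real n * \<theta>))" for n
    using tp_integrable[OF tp_cis[of "- int n" "- int n" "- int n" "M ^ n"]] by simp
  have z: "(LINT \<theta>|tor. Re (M ^ n * cis (- real n * \<theta>))) = 0" if "n \<ge> 1" for n
    using integral_Re[OF i[of n]] torus_integral_cis[of "- int n"] that by simp
  have ir: "integrable tor (\<lambda>\<theta>. Re (M ^ n * cis (- real n * \<theta>)))" for n by (rule integrable_Re[OF i])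
  have "(LINT \<theta>|tor. hu R \<theta> M) = real R + (\<Sum>n=1..R. 2 * real (R - n) * (LINT \<theta>|tor. Re (M ^ n * cis (- real n * \<theta>))))"
    unfolding hu_def using ir torus.prob_space
    by (subst Bochner_Integration.integral_add) (auto simp: Bochner_Integration.integral_sum simp del: times_complex.sel)
  then show ?thesis using z by (simp del: times_complex.sel)
qed

lemma hb_nn_mean:
  assumes "A < B" "cmod M \<le> 1"
  shows "(\<integral>\<^sup>+ \<theta>. ennreal (hb A B \<theta> M) \<partial>tor) = ennreal ((real B + real A) / (real B - real A))"
proof -
  have i: "integrable tor (\<lambda>\<theta>. hu R \<theta> M)" for R
    by (rule torus_integrable[where B="real R + (\<Sum>n=1..R. 2 * real (R - n))"])
      (use hu_bound[OF assms(2), of R] hu_nonneg[OF assms(2), of R] in \<open>auto intro!: borel_measurable_continuous_onI hu_cont\<close>)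
  have "(\<integral>\<^sup>+ \<theta>. ennreal (hb A B \<theta> M) \<partial>tor) = ennreal (LINT \<theta>|tor. hb A B \<theta> M)"
    using i hb_nonneg[OF assms] by (intro nn_integral_eq_integral) (auto simp: hb_def)
  also have "(LINT \<theta>|tor. hb A B \<theta> M) = (real B + real A) / (real B - real A)"
    unfolding hb_def using i by (simp add: hu_mean)
  finally show ?thesis .
qed

lemma sum_blocks:
  fixes f :: "nat \<Rightarrow> 'a::comm_monoid_add"
  shows "(\<Sum>n<a * b. f n) = (\<Sum>w<a. \<Sum>g<b. f (w * b + g))"
proof -
  have "(\<Sum>w<a. \<Sum>g<b. f (w * b + g)) = (\<Sum>w<a. sum f {w * b..<w * b + b})"
    using sum.shift_bounds_nat_ivl[of f 0 "_ * b" b] by (simp add: atLeast0LessThan add.commute)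
  then show ?thesis by (simp add: sum.nat_group)
qed

lemma mean_sqrt_le:
  assumes "0 < N" "\<And>i. i < N \<Longrightarrow> 0 \<le> x i"
  shows "(\<Sum>i<N. sqrt (x i)) / real N \<le> sqrt ((\<Sum>i<N. x i) / real N)"
proof -
  have "(\<Sum>i<N. sqrt (x i))\<^sup>2 \<le> real N * (\<Sum>i<N. (sqrt (x i))\<^sup>2)"
    using sum_squared_le_sum_of_squares[of "\<lambda>i. sqrt (x i)" "{..<N}"] by (simp add: mult.commute)
  also have "(\<Sum>i<N. (sqrt (x i))\<^sup>2) = (\<Sum>i<N. x i)" using assms by (intro sum.cong) auto
  finally have "((\<Sum>i<N. sqrt (x i)) / real N)\<^sup>2 \<le> (\<Sum>i<N. x i) / real N"
    using assms(1) by (simp add: power_divide divide_le_eq power2_eq_square mult.commute mult.assoc)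
  then show ?thesis by (rule real_le_rsqrt)
qed

text \<open>A step of the walk consumes a digit \<open>n mod H\<close>, which selects a root of unity, and two idle bits,
  which later leave room in the tree for the coefficients of two copies.\<close>

locale mg =
  fixes H :: nat and e :: real
  assumes H4: "4 dvd H" and H0: "0 < H" and e: "0 < e" "e \<le> 1"
begin

definition zz :: "nat \<Rightarrow> complex" where "zz g = cis (2 * pi * real g / real H)"

definition Ex :: "nat \<Rightarrow> (nat \<Rightarrow> 'a::real_normed_field) \<Rightarrow> 'a" where
  "Ex k f = (\<Sum>n<(4 * H) ^ k. f n) / of_nat ((4 * H) ^ k)"

text \<open>Averages at the moment when the two idle bits of the next step are drawn but its letter
  is not.\<close>

definition Ew :: "nat \<Rightarrow> (nat \<Rightarrow> 'a::real_normed_field) \<Rightarrow> 'a" where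
  "Ew k f = (\<Sum>w<(4 * H) ^ k * 4. f w) / of_nat ((4 * H) ^ k * 4)"

definition av :: "(complex \<Rightarrow> 'a::real_normed_field) \<Rightarrow> 'a" where
  "av f = (\<Sum>g<H. f (zz g)) / of_nat H"

text \<open>The newest letter is \<open>n mod H\<close>; the quotient \<open>n div H\<close> records
  the past followed by the two fresh idle bits.\<close>

lemma Ex_Suc: "Ex (Suc k) (\<lambda>n. F (n div H) (zz (n mod H))) = Ew k (\<lambda>w. av (F w))"
proof -
  have "(\<Sum>n<(4 * H) ^ k * 4 * H. F (n div H) (zz (n mod H))) = (\<Sum>w<(4 * H) ^ k * 4. \<Sum>g<H. F w (zz g))"
    unfolding sum_blocks[of _ "(4 * H) ^ k * 4" H] using H0 by (intro sum.cong) auto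
  then show ?thesis unfolding Ex_def Ew_def av_def by (simp add: sum_divide_distrib mult_ac)
qed

lemma Ew_div: "Ew k (\<lambda>w. f (w div 4)) = Ex k f"
proof -
  have "(\<Sum>w<(4 * H) ^ k * 4. f (w div 4)) = (\<Sum>p<(4 * H) ^ k. \<Sum>q<(4::nat). f p)"
    unfolding sum_blocks[of _ "(4 * H) ^ k" 4] by (intro sum.cong) auto
  then show ?thesis unfolding Ex_def Ew_def by (simp flip: sum_distrib_left)
qed

lemma Ex_lin: "Ex k (\<lambda>n. f n + g n) = Ex k f + Ex k g" "Ex k (\<lambda>n. f n - g n) = Ex k f - Ex k g"
  "Ex k (\<lambda>n. c * f n) = c * Ex k f" "Ex k (\<lambda>n. f n * c) = Ex k f * c" "Ex k (\<lambda>n. c) = c" "Ex 0 f = f 0"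
  "Ex k (\<lambda>n. \<Sum>i\<in>I. ff i n) = (\<Sum>i\<in>I. Ex k (ff i))"
  using H0 unfolding Ex_def by (simp_all add: sum.distrib sum_subtractf sum_distrib_left sum_distrib_right add_divide_distrib diff_divide_distrib sum.swap[of _ I] sum_divide_distrib)

lemma Ew_lin: "Ew k (\<lambda>n. f n + g n) = Ew k f + Ew k g" "Ew k (\<lambda>n. f n - g n) = Ew k f - Ew k g"
  "Ew k (\<lambda>n. c * f n) = c * Ew k f" "Ew k (\<lambda>n. f n * c) = Ew k f * c" "Ew k (\<lambda>n. c) = c"
  "Ew k (\<lambda>n. \<Sum>i\<in>I. ff i n) = (\<Sum>i\<in>I. Ew k (ff i))"
  using H0 unfolding Ew_def by (simp_all add: sum.distrib sum_subtractf sum_distrib_left sum_distrib_right add_divide_distrib diff_divide_distrib sum.swap[of _ I] sum_divide_distrib)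

lemma av_lin: "av (\<lambda>n. f n + g n) = av f + av g" "av (\<lambda>n. f n - g n) = av f - av g"
  "av (\<lambda>n. c * f n) = c * av f" "av (\<lambda>n. f n * c) = av f * c" "av (\<lambda>n. c) = c"
  "av (\<lambda>n. \<Sum>i\<in>I. ff i n) = (\<Sum>i\<in>I. av (ff i))"
  using H0 unfolding av_def by (simp_all add: sum.distrib sum_subtractf sum_distrib_left sum_distrib_right add_divide_distrib diff_divide_distrib sum.swap[of _ I] sum_divide_distrib)

lemma Ex_mono: "(\<And>n. f n \<le> g n) \<Longrightarrow> Ex k f \<le> (Ex k g :: real)"
  unfolding Ex_def by (intro divide_right_mono sum_mono) auto

lemma Ew_mono: "(\<And>n. f n \<le> g n) \<Longrightarrow> Ew k f \<le> (Ew k g :: real)"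
  unfolding Ew_def by (intro divide_right_mono sum_mono) auto

lemma av_mono: "(\<And>x. cmod x = 1 \<Longrightarrow> f x \<le> g x) \<Longrightarrow> av f \<le> (av g :: real)"
  unfolding av_def zz_def by (intro divide_right_mono sum_mono) auto

lemma av_cong: "(\<And>x. cmod x = 1 \<Longrightarrow> f x = g x) \<Longrightarrow> av f = av g"
  unfolding av_def zz_def by simp

lemma Ex_cmod: "cmod (Ex k f) \<le> Ex k (\<lambda>n. cmod (f n))"
  unfolding Ex_def by (simp add: norm_divide norm_power norm_mult divide_right_mono norm_sum)

lemma Ex_sqrt: "(\<And>n. 0 \<le> f n) \<Longrightarrow> Ex k (\<lambda>n. sqrt (f n)) \<le> sqrt (Ex k f)"
  unfolding Ex_def using mean_sqrt_le[of "(4 * H) ^ k" f] H0 by simp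

lemma av_sqrt: "(\<And>x. 0 \<le> f x) \<Longrightarrow> av (\<lambda>x. sqrt (f x)) \<le> sqrt (av f)"
  unfolding av_def using mean_sqrt_le[of H "\<lambda>g. f (zz g)"] H0 by simp

lemma av_Re: "av (\<lambda>x. Re (f x)) = Re (av f)"
  unfolding av_def by (simp add: Re_divide_of_nat)

lemma av_cnj: "av (\<lambda>x. cnj (f x)) = cnj (av f)"
  unfolding av_def by simp

lemma zz_add: "zz (a + b) = zz a * zz b"
  unfolding zz_def cis_mult by (simp add: add_divide_distrib distrib_left)

lemma zz_H: "zz H = 1"
  unfolding zz_def using H0 by simp

lemma av_rot: "av (\<lambda>x. f (zz r * x)) = av f"
proof (induction r)
  case 0 then show ?case by (simp add: zz_def)
next
  case (Suc r)
  have s: "(\<Sum>g<H. F (zz (Suc g))) = (\<Sum>g<H. F (zz g))" for F :: "complex \<Rightarrow> 'a"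
  proof -
    have "F (zz 0) + (\<Sum>g<H. F (zz (Suc g))) = (\<Sum>g<H. F (zz g)) + F (zz H)"
      using sum.lessThan_Suc_shift[of "\<lambda>g. F (zz g)" H] sum.lessThan_Suc[of "\<lambda>g. F (zz g)" H] by simp
    then show ?thesis using zz_H by (simp add: zz_def)
  qed
  have "av (\<lambda>x. f (zz (Suc r) * x)) = av (\<lambda>x. f (zz r * x))"
    unfolding av_def s[of "\<lambda>x. f (zz r * x)", symmetric] by (simp only: zz_add[symmetric] add_Suc add_Suc_right)
  then show ?case using Suc by simp
qed

lemma zz_neq_1: "0 < i \<Longrightarrow> i < H \<Longrightarrow> zz i \<noteq> 1"
proof
  assume i: "0 < i" "i < H" and "zz i = 1"
  then have "cos (2 * pi * real i / real H) = 1" by (simp add: zz_def complex_eq_iff)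
  then obtain n :: int where n: "2 * pi * real i / real H = of_int n * 2 * pi" by (auto simp: cos_one_2pi_int)
  then have "real i = of_int n * real H" using H0 by (simp add: field_simps)
  then have "of_int (int i) = (of_int (n * int H) :: real)" by simp
  then have "int i = n * int H" by (simp only: of_int_eq_iff)
  then show False using i by (metis dvd_triv_right int_dvd_int_iff nat_dvd_not_less)
qed

lemma zz_pow: "zz 1 ^ i = zz i"
  unfolding zz_def Complex.DeMoivre by (simp add: mult.commute)

lemma av_pow: assumes "0 < i" "i < H" shows "av (\<lambda>x. x ^ i) = (0 :: complex)"
proof -
  have "zz 1 ^ i * av (\<lambda>x. x ^ i) = av (\<lambda>x. x ^ i)"
    using av_rot[of "\<lambda>x. x ^ i" 1] by (simp add: power_mult_distrib av_lin)
  then show ?thesis using zz_neq_1[OF assms] unfolding zz_pow by simp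
qed

lemma av_id: "av (\<lambda>x. x) = (0 :: complex)"
  using av_pow[of 1] H4 H0 by (auto elim: dvdE)

text \<open>Mean value property: averages over the \<open>H\<close>-th roots of unity are exact for
  polynomials of degree below \<open>H\<close>.\<close>

lemma av_binom:
  assumes "j < H"
  shows "av (\<lambda>x. (m + a * x) ^ j) = (m ^ j :: complex)"
proof -
  have "av (\<lambda>x. (m + a * x) ^ j) = av (\<lambda>x. \<Sum>i\<le>j. of_nat (j choose i) * a ^ i * m ^ (j - i) * x ^ i)"
    unfolding add.commute[of m] binomial_ring
    by (intro av_cong sum.cong refl) (simp add: power_mult_distrib mult_ac)
  also have "\<dots> = (\<Sum>i\<le>j. of_nat (j choose i) * a ^ i * m ^ (j - i) * av (\<lambda>x. x ^ i))"
    unfolding av_lin ..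
  also have "\<dots> = (\<Sum>i\<in>{0}. of_nat (j choose i) * a ^ i * m ^ (j - i) * av (\<lambda>x. x ^ i))"
    using assms by (intro sum.mono_neutral_right) (auto simp: av_pow)
  finally show ?thesis by (simp add: av_lin)
qed

lemma av_binom_id:
  assumes "Suc j < H"
  shows "av (\<lambda>x. x * (m + a * x) ^ j) = (0 :: complex)"
proof -
  have "av (\<lambda>x. x * (m + a * x) ^ j) = av (\<lambda>x. \<Sum>i\<le>j. of_nat (j choose i) * a ^ i * m ^ (j - i) * x ^ Suc i)"
    unfolding add.commute[of m] binomial_ring sum_distrib_left
    by (intro av_cong sum.cong refl) (simp add: power_mult_distrib mult_ac)
  also have "\<dots> = (\<Sum>i\<le>j. of_nat (j choose i) * a ^ i * m ^ (j - i) * av (\<lambda>x. x ^ Suc i))"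
    unfolding av_lin ..
  also have "\<dots> = 0" using assms by (intro sum.neutral) (auto simp: av_pow simp del: power_Suc)
  finally show ?thesis .
qed

text \<open>Pairing with \<open>x\<close> selects the linear Taylor coefficient; all other powers
  average to zero as the degree is below \<open>H\<close>.\<close>

lemma av_binom_cnj:
  assumes "j < H"
  shows "av (\<lambda>x. x * cnj ((m + a * x) ^ j)) = cnj (of_nat j * a * m ^ (j - 1))"
proof -
  have "av (\<lambda>x. cnj x * (m + a * x) ^ j) = av (\<lambda>x. \<Sum>i\<le>j. of_nat (j choose i) * a ^ i * m ^ (j - i) * (cnj x * x ^ i))"
    unfolding add.commute[of m] binomial_ring sum_distrib_left
    by (intro av_cong sum.cong refl) (simp add: power_mult_distrib mult_ac)
  also have "\<dots> = (\<Sum>i\<le>j. of_nat (j choose i) * a ^ i * m ^ (j - i) * av (\<lambda>x. cnj x * x ^ i))"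
    unfolding av_lin ..
  also have "av (\<lambda>x. cnj x * x ^ i) = (if i = 1 then 1 else 0)" if "i \<le> j" for i
  proof (cases i)
    case 0 then show ?thesis using av_cnj[of "\<lambda>x. x"] av_id by simp
  next
    case (Suc i')
    have "cnj x * x = 1" if "cmod x = 1" for x using complex_norm_square[of x] that by (simp add: mult.commute)
    then have "av (\<lambda>x. cnj x * x ^ i) = av (\<lambda>x. x ^ i')" by (intro av_cong) (simp add: Suc flip: mult.assoc)
    then show ?thesis using av_pow[of i'] that assms Suc by (cases i') (auto simp: av_lin)
  qed
  then have "(\<Sum>i\<le>j. of_nat (j choose i) * a ^ i * m ^ (j - i) * av (\<lambda>x. cnj x * x ^ i)) = (\<Sum>i\<le>j. if i = 1 then of_nat (j choose i) * a ^ i * m ^ (j - i) else 0)"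
    by (intro sum.cong) auto
  also have "\<dots> = of_nat j * a * m ^ (j - 1)" by (cases j) (auto simp: sum.delta)
  finally show ?thesis using av_cnj[of "\<lambda>x. cnj x * (m + a * x) ^ j"] by simp
qed

end

section \<open>Martingales along the walk and their square functions\<close>

context mg
begin

text \<open>The coefficient of a step may depend on the past and on the idle bits of the step, but
  not on its letter; this makes the sum a martingale.\<close>

primrec NN :: "(nat \<Rightarrow> nat \<Rightarrow> complex) \<Rightarrow> complex \<Rightarrow> nat \<Rightarrow> nat \<Rightarrow> complex" where
  "NN c u 0 n = u"
| "NN c u (Suc k) n = NN c u k (n div H div 4) + c k (n div H) * zz (n mod H)"

primrec SS :: "(nat \<Rightarrow> nat \<Rightarrow> complex) \<Rightarrow> real \<Rightarrow> nat \<Rightarrow> nat \<Rightarrow> real" where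
  "SS c s 0 n = s"
| "SS c s (Suc k) n = SS c s k (n div H div 4) + (cmod (c k (n div H)))\<^sup>2"

lemma SS_nonneg: "0 \<le> s \<Longrightarrow> 0 \<le> SS c s k n"
  by (induction k arbitrary: n) auto

text \<open>A Bellman function whose one-step averages do not increase has a non-increasing
  expectation. Both square function estimates are instances with different
  \<open>\<Psi>\<close>.\<close>

lemma supermartingale:
  assumes st: "\<And>s u a. 0 \<le> s \<Longrightarrow> av (\<lambda>x. \<Psi> (s + (cmod a)\<^sup>2) (u + a * x)) \<le> (\<Psi> s u :: real)" and s: "0 \<le> s"
  shows "Ex k (\<lambda>n. \<Psi> (SS c s k n) (NN c u k n)) \<le> \<Psi> s u"
proof (induction k)
  case 0 then show ?case by (simp add: Ex_lin)
next
  case (Suc k)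
  have "Ex (Suc k) (\<lambda>n. \<Psi> (SS c s (Suc k) n) (NN c u (Suc k) n))
    = Ew k (\<lambda>w. av (\<lambda>x. \<Psi> (SS c s k (w div 4) + (cmod (c k w))\<^sup>2) (NN c u k (w div 4) + c k w * x)))"
    unfolding SS.simps NN.simps by (rule Ex_Suc)
  also have "\<dots> \<le> Ew k (\<lambda>w. \<Psi> (SS c s k (w div 4)) (NN c u k (w div 4)))"
    by (intro Ew_mono st SS_nonneg s)
  also have "\<dots> = Ex k (\<lambda>n. \<Psi> (SS c s k n) (NN c u k n))" by (rule Ew_div)
  finally show ?case using Suc by simp
qed

lemma av_cmod_sq: "av (\<lambda>x. (cmod (u + a * x))\<^sup>2) = (cmod u)\<^sup>2 + (cmod a)\<^sup>2"
proof -
  have "av (\<lambda>x. (cmod (u + a * x))\<^sup>2) = av (\<lambda>x. ((cmod u)\<^sup>2 + (cmod a)\<^sup>2) + 2 * Re (cnj u * a * x))"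
    by (intro av_cong) (simp add: cmod_add_sq norm_mult mult.assoc)
  also have "\<dots> = (cmod u)\<^sup>2 + (cmod a)\<^sup>2"
    unfolding av_lin(1,3,5) av_Re by (simp add: av_lin(3) av_id)
  finally show ?thesis .
qed

lemma av_jensen:
  assumes "0 \<le> s"
  shows "av (\<lambda>x. sqrt (1 + (s + (cmod a)\<^sup>2) + (cmod (u + a * x))\<^sup>2)) \<le> sqrt (1 + s + (cmod u)\<^sup>2 + 2 * (cmod a)\<^sup>2)"
proof -
  have "av (\<lambda>x. sqrt (1 + (s + (cmod a)\<^sup>2) + (cmod (u + a * x))\<^sup>2)) \<le> sqrt (av (\<lambda>x. 1 + (s + (cmod a)\<^sup>2) + (cmod (u + a * x))\<^sup>2))"
    using assms by (intro av_sqrt) auto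
  also have "av (\<lambda>x. 1 + (s + (cmod a)\<^sup>2) + (cmod (u + a * x))\<^sup>2) = 1 + s + (cmod u)\<^sup>2 + 2 * (cmod a)\<^sup>2"
    unfolding av_lin(1)[of "\<lambda>x. 1 + (s + (cmod a)\<^sup>2)"] av_lin(5) av_cmod_sq by simp
  finally show ?thesis .
qed

text \<open>As 4 divides \<open>H\<close>, the quarter turns are among the roots of unity and the
  four-point inequality can be averaged.\<close>

lemma av_four: "sqrt (1 + (cmod u)\<^sup>2) + sqrt (1 + (cmod u)\<^sup>2 + (cmod a)\<^sup>2 / 2) \<le> 2 * av (\<lambda>x. sqrt (1 + (cmod (u + a * x))\<^sup>2))"
proof -
  obtain q where q: "H = 4 * q" using H4 by (rule dvdE)
  have q0: "0 < q" using H0 q by simp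
  have i: "zz q = \<i>" "zz (2 * q) = -1" "zz (3 * q) = - \<i>"
  proof -
    have "2 * pi * real q / real H = pi / 2" unfolding q using q0 by simp
    then show i: "zz q = \<i>" unfolding zz_def by (simp only: cis_pi_half)
    show m: "zz (2 * q) = -1" using zz_add[of q q] by (simp add: i mult_2)
    show "zz (3 * q) = - \<i>" using zz_add[of "2 * q" q] by (simp add: i m)
  qed
  let ?f = "\<lambda>x. sqrt (1 + (cmod (u + a * x))\<^sup>2)"
  have "2 * sqrt (1 + (cmod u)\<^sup>2) + 2 * sqrt (1 + (cmod u)\<^sup>2 + (cmod a)\<^sup>2 / 2)
     = av (\<lambda>x. 2 * sqrt (1 + (cmod u)\<^sup>2) + 2 * sqrt (1 + (cmod u)\<^sup>2 + (cmod a)\<^sup>2 / 2))" unfolding av_lin(5) ..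
  also have "\<dots> \<le> av (\<lambda>x. ?f x + ?f (zz (2 * q) * x) + ?f (zz q * x) + ?f (zz (3 * q) * x))"
  proof (rule av_mono)
    fix x :: complex assume x: "cmod x = 1"
    show "2 * sqrt (1 + (cmod u)\<^sup>2) + 2 * sqrt (1 + (cmod u)\<^sup>2 + (cmod a)\<^sup>2 / 2) \<le> ?f x + ?f (zz (2 * q) * x) + ?f (zz q * x) + ?f (zz (3 * q) * x)"
      using four_point[of u "a * x"] x unfolding i by (simp add: norm_mult mult.left_commute[of a \<i>])
  qed
  also have "\<dots> = 4 * av ?f" unfolding av_lin(1) av_rot[of ?f] by simp
  finally show ?thesis by simp
qed

text \<open>\<open>8 = 4 * 2\<close>: a factor 4 rescales \<open>|a|^2 / 2\<close> to
  \<open>2 * |a|^2\<close>, and a factor 2 comes from \<open>av_four\<close>.\<close>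

lemma av_lower:
  assumes "0 \<le> s"
  shows "av (\<lambda>x. sqrt (1 + (s + (cmod a)\<^sup>2) + (cmod (u + a * x))\<^sup>2) - 8 * sqrt (1 + (cmod (u + a * x))\<^sup>2))
    \<le> sqrt (1 + s + (cmod u)\<^sup>2) - 8 * sqrt (1 + (cmod u)\<^sup>2)"
proof -
  have 1: "sqrt (1 + s + (cmod u)\<^sup>2 + 2 * (cmod a)\<^sup>2) - sqrt (1 + s + (cmod u)\<^sup>2) \<le> sqrt (1 + (cmod u)\<^sup>2 + 2 * (cmod a)\<^sup>2) - sqrt (1 + (cmod u)\<^sup>2)"
    using assms by (intro sqrt_diff_antimono) auto
  have 2: "sqrt (1 + (cmod u)\<^sup>2 + 2 * (cmod a)\<^sup>2) - sqrt (1 + (cmod u)\<^sup>2) \<le> 4 * (sqrt (1 + (cmod u)\<^sup>2 + (cmod a)\<^sup>2 / 2) - sqrt (1 + (cmod u)\<^sup>2))"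
    using sqrt_scale_le[of "1 + (cmod u)\<^sup>2" "(cmod a)\<^sup>2 / 2" 4] by simp
  have 3: "av (\<lambda>x. sqrt (1 + (s + (cmod a)\<^sup>2) + (cmod (u + a * x))\<^sup>2) - 8 * sqrt (1 + (cmod (u + a * x))\<^sup>2))
    = av (\<lambda>x. sqrt (1 + (s + (cmod a)\<^sup>2) + (cmod (u + a * x))\<^sup>2)) - 8 * av (\<lambda>x. sqrt (1 + (cmod (u + a * x))\<^sup>2))" unfolding av_lin(2,3) ..
  show ?thesis unfolding 3 using 1 2 av_jensen[OF assms, of a u] av_four[of u a] by argo
qed

text \<open>The increment of \<open>sqrt (1 + s + |u|^2)\<close> is largest for \<open>u = 0\<close>
  by concavity, and there the square function alone pays for it.\<close>

lemma av_upper: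
  assumes "0 \<le> s"
  shows "av (\<lambda>x. sqrt (1 + (s + (cmod a)\<^sup>2) + (cmod (u + a * x))\<^sup>2) - 2 * sqrt (1 + (s + (cmod a)\<^sup>2)))
    \<le> sqrt (1 + s + (cmod u)\<^sup>2) - 2 * sqrt (1 + s)"
proof -
  have 1: "sqrt (1 + s + (cmod u)\<^sup>2 + 2 * (cmod a)\<^sup>2) - sqrt (1 + s + (cmod u)\<^sup>2) \<le> sqrt (1 + s + 2 * (cmod a)\<^sup>2) - sqrt (1 + s)"
    using assms by (intro sqrt_diff_antimono) auto
  have 2: "sqrt (1 + s + 2 * (cmod a)\<^sup>2) - sqrt (1 + s) \<le> 2 * (sqrt (1 + (s + (cmod a)\<^sup>2)) - sqrt (1 + s))"
    using sqrt_scale_le[of "1 + s" "(cmod a)\<^sup>2" 2] assms by (simp add: add.assoc)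
  have 3: "av (\<lambda>x. sqrt (1 + (s + (cmod a)\<^sup>2) + (cmod (u + a * x))\<^sup>2) - 2 * sqrt (1 + (s + (cmod a)\<^sup>2)))
    = av (\<lambda>x. sqrt (1 + (s + (cmod a)\<^sup>2) + (cmod (u + a * x))\<^sup>2)) - 2 * sqrt (1 + (s + (cmod a)\<^sup>2))" unfolding av_lin(2,5) ..
  show ?thesis unfolding 3 using 1 2 av_jensen[OF assms, of a u] by argo
qed

lemma sqrt_start: "sqrt (1 + (cmod u)\<^sup>2 + (cmod u)\<^sup>2) + 1 \<le> 2 * sqrt (1 + (cmod u)\<^sup>2)"
  using sqrt_scale_le[of 1 "(cmod u)\<^sup>2" 2] by (simp add: add.assoc)

lemma Ex_phi: "Ex k (\<lambda>n. phi (f n)) = Ex k (\<lambda>n. sqrt (1 + (f n)\<^sup>2)) - 1"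
  unfolding phi_def Ex_lin(2,5) ..

lemma square_fun_le: "Ex k (\<lambda>n. phi (sqrt (SS c ((cmod u)\<^sup>2) k n))) \<le> 8 * Ex k (\<lambda>n. phi (cmod (NN c u k n)))"
proof -
  let ?S = "SS c ((cmod u)\<^sup>2) k" and ?N = "NN c u k"
  have S: "0 \<le> ?S n" for n by (rule SS_nonneg) simp
  have "Ex k (\<lambda>n. sqrt (1 + ?S n + (cmod (?N n))\<^sup>2) - 8 * sqrt (1 + (cmod (?N n))\<^sup>2))
     \<le> sqrt (1 + (cmod u)\<^sup>2 + (cmod u)\<^sup>2) - 8 * sqrt (1 + (cmod u)\<^sup>2)"
    by (rule supermartingale[where \<Psi>="\<lambda>s u. sqrt (1 + s + (cmod u)\<^sup>2) - 8 * sqrt (1 + (cmod u)\<^sup>2)", OF av_lower]) auto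
  then have "Ex k (\<lambda>n. sqrt (1 + ?S n + (cmod (?N n))\<^sup>2)) - 8 * Ex k (\<lambda>n. sqrt (1 + (cmod (?N n))\<^sup>2))
     \<le> sqrt (1 + (cmod u)\<^sup>2 + (cmod u)\<^sup>2) - 8 * sqrt (1 + (cmod u)\<^sup>2)" unfolding Ex_lin(2,3) .
  moreover have "Ex k (\<lambda>n. sqrt (1 + (sqrt (?S n))\<^sup>2)) \<le> Ex k (\<lambda>n. sqrt (1 + ?S n + (cmod (?N n))\<^sup>2))"
    using S by (intro Ex_mono) simp
  moreover have "1 \<le> sqrt (1 + (cmod u)\<^sup>2)" by simp
  ultimately show ?thesis unfolding Ex_phi using sqrt_start[of u] by argo
qed

text \<open>The converse estimate, controlling the final value of the martingale by its square
  function.\<close>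

lemma maximal_fun_le: "Ex k (\<lambda>n. phi (cmod (NN c u k n))) \<le> 2 * Ex k (\<lambda>n. phi (sqrt (SS c ((cmod u)\<^sup>2) k n)))"
proof -
  let ?S = "SS c ((cmod u)\<^sup>2) k" and ?N = "NN c u k"
  have S: "0 \<le> ?S n" for n by (rule SS_nonneg) simp
  have "Ex k (\<lambda>n. sqrt (1 + ?S n + (cmod (?N n))\<^sup>2) - 2 * sqrt (1 + ?S n))
     \<le> sqrt (1 + (cmod u)\<^sup>2 + (cmod u)\<^sup>2) - 2 * sqrt (1 + (cmod u)\<^sup>2)"
    by (rule supermartingale[where \<Psi>="\<lambda>s u. sqrt (1 + s + (cmod u)\<^sup>2) - 2 * sqrt (1 + s)", OF av_upper]) auto
  then have "Ex k (\<lambda>n. sqrt (1 + ?S n + (cmod (?N n))\<^sup>2)) - 2 * Ex k (\<lambda>n. sqrt (1 + ?S n))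
     \<le> sqrt (1 + (cmod u)\<^sup>2 + (cmod u)\<^sup>2) - 2 * sqrt (1 + (cmod u)\<^sup>2)" unfolding Ex_lin(2,3) .
  moreover have "Ex k (\<lambda>n. sqrt (1 + (cmod (?N n))\<^sup>2)) \<le> Ex k (\<lambda>n. sqrt (1 + ?S n + (cmod (?N n))\<^sup>2))"
    using S by (intro Ex_mono) simp
  moreover have "Ex k (\<lambda>n. sqrt (1 + (sqrt (?S n))\<^sup>2)) = Ex k (\<lambda>n. sqrt (1 + ?S n))" using S by simp
  ultimately show ?thesis unfolding Ex_phi using sqrt_start[of u] by argo
qed

section \<open>The stopped walk and its rotation invariance\<close>

definition stp :: "complex \<Rightarrow> complex \<Rightarrow> complex" where
  "stp m x = (if cmod m \<le> 1 - e then m + cplx e * x else m)"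

primrec MM :: "nat \<Rightarrow> nat \<Rightarrow> complex" where
  "MM 0 n = 0"
| "MM (Suc k) n = stp (MM k (n div H div 4)) (zz (n mod H))"

lemma stp_le: "cmod m \<le> 1 \<Longrightarrow> cmod x = 1 \<Longrightarrow> cmod (stp m x) \<le> 1"
  unfolding stp_def using norm_triangle_ineq[of m "cplx e * x"] e by (auto simp: norm_mult)

lemma MM_le: "cmod (MM k n) \<le> 1"
  by (induction k arbitrary: n) (auto intro!: stp_le simp: zz_def)

lemma Ex_MM_Suc: "Ex (Suc k) (\<lambda>n. f (MM (Suc k) n)) = Ex k (\<lambda>n. av (\<lambda>x. f (stp (MM k n) x)))"
  unfolding MM.simps Ex_Suc[of k "\<lambda>w x. f (stp (MM k (w div 4)) x)"] by (rule Ew_div)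

text \<open>Stopping depends only on the modulus, so rotating by a root of unity merely permutes the
  letters.\<close>

lemma Ex_rot: "Ex k (\<lambda>n. f (zz 1 * MM k n)) = Ex k (\<lambda>n. f (MM k n))"
proof (induction k arbitrary: f)
  case 0 then show ?case by simp
next
  case (Suc k)
  have "av (\<lambda>x. f (zz 1 * stp m x)) = av (\<lambda>x. f (stp (zz 1 * m) x))" for m
  proof -
    have "zz 1 * stp m x = stp (zz 1 * m) (zz 1 * x)" for x
      unfolding stp_def by (simp add: norm_mult zz_def algebra_simps)
    then show ?thesis using av_rot[of "\<lambda>x. f (stp (zz 1 * m) x)" 1] by simp
  qed
  then show ?case using Suc[of "\<lambda>m. av (\<lambda>x. f (stp m x))"]
    unfolding Ex_MM_Suc[of k f] Ex_MM_Suc[of k "\<lambda>m. f (zz 1 * m)"] by simp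
qed

lemma Ex_homog:
  assumes "\<And>m. f (zz 1 * m) = zz i * f m" "0 < i" "i < H"
  shows "Ex k (\<lambda>n. f (MM k n)) = (0 :: complex)"
  using Ex_rot[of k f] zz_neq_1[OF assms(2,3)] unfolding assms(1) Ex_lin(3) by simp

lemma Ex_MM_pow: "0 < i \<Longrightarrow> i < H \<Longrightarrow> Ex k (\<lambda>n. MM k n ^ i) = 0"
  by (rule Ex_homog[where f="\<lambda>m. m ^ i" and i=i]) (simp_all only: power_mult_distrib zz_pow)

lemma Ex_Re: "Ex k (\<lambda>n. Re (f n)) = Re (Ex k f)"
  unfolding Ex_def Re_divide_of_nat Re_sum ..

text \<open>The moments of order \<open>0 < i < H\<close> vanish by rotation invariance, and the
  term \<open>i = R\<close> has weight 0. This supplies the second marginal in the Schur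
  tests.\<close>

lemma Ex_hu:
  assumes "R \<le> H"
  shows "Ex k (\<lambda>n. hu R \<theta> (MM k n)) = real R"
proof -
  have z: "Ex k (\<lambda>n. Re (MM k n ^ i * cis (- real i * \<theta>))) = 0" if "0 < i" "i < H" for i
    unfolding Ex_Re Ex_lin(4) using Ex_MM_pow[OF that] by simp
  have "(\<Sum>i=1..R. 2 * real (R - i) * Ex k (\<lambda>n. Re (MM k n ^ i * cis (- real i * \<theta>)))) = 0"
  proof (intro sum.neutral ballI)
    fix i assume i: "i \<in> {1..R}"
    show "2 * real (R - i) * Ex k (\<lambda>n. Re (MM k n ^ i * cis (- real i * \<theta>))) = 0"
    proof (cases "i = R")
      case False
      then have "0 < i" "i < H" using i assms by auto
      then show ?thesis by (simp only: z mult_zero_right)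
    qed simp
  qed
  then show ?thesis unfolding hu_def Ex_lin(1) Ex_lin(7) Ex_lin(3) Ex_lin(5) by simp
qed

end

section \<open>Linearised powers of the walk\<close>

context mg
begin

text \<open>The increments of the linearisation of \<open>MM k ^ j\<close>.\<close>

definition cc :: "nat \<Rightarrow> nat \<Rightarrow> nat \<Rightarrow> complex" where
  "cc j k w = (if cmod (MM k (w div 4)) \<le> 1 - e then of_nat j * cplx e * MM k (w div 4) ^ (j - 1) else 0)"

lemma Ex_NN_MM_Suc:
  "Ex (Suc k) (\<lambda>n. f (NN c u (Suc k) n) (MM (Suc k) n)) = Ew k (\<lambda>w. av (\<lambda>x. f (NN c u k (w div 4) + c k w * x) (stp (MM k (w div 4)) x)))"
  unfolding MM.simps NN.simps by (rule Ex_Suc)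

text \<open>The powers \<open>MM^j\<close> are martingales, and their increments meet
  \<open>c * x\<close> only through the linear Taylor coefficient \<open>cc j\<close>. So the
  formula is exact although \<open>cc j\<close> comes from a linearisation.\<close>

lemma NN_MM_cnj:
  assumes "j < H"
  shows "Ex k (\<lambda>n. NN c u k n * cnj (MM k n ^ j)) = u * cnj (0 ^ j) + (\<Sum>i<k. Ew i (\<lambda>w. c i w * cnj (cc j i w)))"
proof (induction k)
  case 0 then show ?case by (simp add: Ex_lin)
next
  case (Suc k)
  have "av (\<lambda>x. (N + a * x) * cnj (stp (MM k (w div 4)) x ^ j)) = N * cnj (MM k (w div 4) ^ j) + a * cnj (cc j k w)" for N a w
  proof (cases "cmod (MM k (w div 4)) \<le> 1 - e")
    case True
    let ?m = "MM k (w div 4)"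
    have "av (\<lambda>x. (N + a * x) * cnj (stp ?m x ^ j)) = av (\<lambda>x. N * cnj ((?m + cplx e * x) ^ j) + a * (x * cnj ((?m + cplx e * x) ^ j)))"
      using True by (simp add: stp_def algebra_simps)
    also have "\<dots> = N * cnj (?m ^ j) + a * cnj (of_nat j * cplx e * ?m ^ (j - 1))"
      unfolding av_lin(1,3) av_cnj av_binom[OF assms] av_binom_cnj[OF assms] ..
    finally show ?thesis using True by (simp add: cc_def)
  next
    case False
    then have "av (\<lambda>x. (N + a * x) * cnj (stp (MM k (w div 4)) x ^ j)) = (N + a * av (\<lambda>x. x)) * cnj (MM k (w div 4) ^ j)"
      by (simp only: stp_def if_False av_lin)
    then show ?thesis using False av_id by (simp add: cc_def)
  qed
  then have "Ex (Suc k) (\<lambda>n. NN c u (Suc k) n * cnj (MM (Suc k) n ^ j)) = Ew k (\<lambda>w. NN c u k (w div 4) * cnj (MM k (w div 4) ^ j) + c k w * cnj (cc j k w))"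
    unfolding Ex_NN_MM_Suc[of k "\<lambda>N M. N * cnj (M ^ j)"] by simp
  also have "\<dots> = Ex k (\<lambda>n. NN c u k n * cnj (MM k n ^ j)) + Ew k (\<lambda>w. c k w * cnj (cc j k w))"
    unfolding Ew_lin(1) Ew_div[of k "\<lambda>n. NN c u k n * cnj (MM k n ^ j)"] ..
  finally show ?case using Suc by simp
qed

text \<open>Without the conjugation only positive powers of the letter occur, and they average to
  zero. Along the walk every such martingale is therefore free of negative frequencies.\<close>

lemma NN_MM_zero:
  assumes "Suc j < H" "0 < j"
  shows "Ex k (\<lambda>n. NN c u k n * MM k n ^ j) = 0"
proof (induction k)
  case 0 then show ?case using assms by (simp add: Ex_lin)
next
  case (Suc k)
  have j: "j < H" using assms by simp
  have "av (\<lambda>x. (N + a * x) * stp m x ^ j) = N * m ^ j" for N a m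
  proof (cases "cmod m \<le> 1 - e")
    case True
    have "av (\<lambda>x. (N + a * x) * stp m x ^ j) = av (\<lambda>x. N * (m + cplx e * x) ^ j + a * (x * (m + cplx e * x) ^ j))"
      using True by (simp add: stp_def algebra_simps)
    also have "\<dots> = N * m ^ j"
      unfolding av_lin(1,3) av_binom[OF j] av_binom_id[OF assms(1)] by simp
    finally show ?thesis .
  next
    case False
    then have "av (\<lambda>x. (N + a * x) * stp m x ^ j) = (N + a * av (\<lambda>x. x)) * m ^ j"
      by (simp only: stp_def if_False av_lin)
    then show ?thesis using av_id by simp
  qed
  then have "Ex (Suc k) (\<lambda>n. NN c u (Suc k) n * MM (Suc k) n ^ j) = Ew k (\<lambda>w. NN c u k (w div 4) * MM k (w div 4) ^ j)"
    unfolding Ex_NN_MM_Suc[of k "\<lambda>N M. N * M ^ j"] by simp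
  then show ?case using Suc unfolding Ew_div[of k "\<lambda>n. NN c u k n * MM k n ^ j"] by simp
qed

text \<open>The factor \<open>2 ^ j\<close> is crude; only the quadratic smallness in
  \<open>d\<close> matters, because the step size is chosen after the degree.\<close>

lemma taylor_bound:
  assumes "cmod (m + d) \<le> 1" "cmod m \<le> 1"
  shows "cmod ((m + d) ^ j - m ^ j - of_nat j * d * m ^ (j - 1)) \<le> (cmod d)\<^sup>2 * 2 ^ j"
proof (induction j)
  case 0 then show ?case by simp
next
  case (Suc j)
  let ?r = "(m + d) ^ j - m ^ j - of_nat j * d * m ^ (j - 1)"
  have eq: "(m + d) ^ Suc j - m ^ Suc j - of_nat (Suc j) * d * m ^ (Suc j - 1) = (m + d) * ?r + of_nat j * (d\<^sup>2 * m ^ (j - 1))"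
    by (cases j) (auto simp: algebra_simps power2_eq_square)
  have 1: "cmod ((m + d) * ?r) \<le> 1 * ((cmod d)\<^sup>2 * 2 ^ j)"
    unfolding norm_mult using assms Suc by (intro mult_mono) auto
  have 2: "cmod (of_nat j * (d\<^sup>2 * m ^ (j - 1))) \<le> 2 ^ j * ((cmod d)\<^sup>2 * 1)"
    unfolding norm_mult norm_power norm_of_nat using assms by (intro mult_mono power_le_one) (auto simp: less_imp_le[OF of_nat_less_two_power])
  have "1 * ((cmod d)\<^sup>2 * 2 ^ j) + 2 ^ j * ((cmod d)\<^sup>2 * 1) = (cmod d)\<^sup>2 * 2 ^ Suc j" by simp
  then show ?case unfolding eq using order_trans[OF norm_triangle_ineq add_mono[OF 1 2]] by (simp only:)
qed

lemma sq_pow2: "(e\<^sup>2 * 2 ^ j)\<^sup>2 = e ^ 4 * 4 ^ j"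
proof -
  have "((2::real) ^ j)\<^sup>2 = (2\<^sup>2) ^ j" by (simp only: power_mult[symmetric] mult.commute)
  then show ?thesis by (simp add: power_mult_distrib flip: power_mult)
qed

text \<open>The Taylor remainder of a step averages to zero over the letter, so the cross term
  vanishes and the squared errors of the steps simply add.\<close>

lemma taylor_error:
  assumes "j < H"
  shows "Ex k (\<lambda>n. (cmod (MM k n ^ j - NN (cc j) (0 ^ j) k n))\<^sup>2) \<le> real k * (e ^ 4 * 4 ^ j)"
proof (induction k)
  case 0 then show ?case by (simp add: Ex_lin)
next
  case (Suc k)
  have "av (\<lambda>x. (cmod (stp (MM k (w div 4)) x ^ j - (N + cc j k w * x)))\<^sup>2) \<le> (cmod (MM k (w div 4) ^ j - N))\<^sup>2 + e ^ 4 * 4 ^ j" for N w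
  proof (cases "cmod (MM k (w div 4)) \<le> 1 - e")
    case True
    define m where "m = MM k (w div 4)"
    define r where "r x = (m + cplx e * x) ^ j - m ^ j - (of_nat j * cplx e * m ^ (j - 1)) * x" for x
    have r0: "av r = 0" unfolding r_def av_lin(2,3,5) av_binom[OF assms] av_id by simp
    have rb: "(cmod (r x))\<^sup>2 \<le> e ^ 4 * 4 ^ j" if "cmod x = 1" for x
    proof -
      have "cmod (m + cplx e * x) \<le> 1" using stp_le[of m x] MM_le that True by (simp add: stp_def m_def)
      from taylor_bound[OF this, of j] have "cmod (r x) \<le> e\<^sup>2 * 2 ^ j"
        using that e MM_le[of k "w div 4"] unfolding r_def by (simp add: norm_mult mult_ac flip: m_def)
      then have "(cmod (r x))\<^sup>2 \<le> (e\<^sup>2 * 2 ^ j)\<^sup>2" by (intro power_mono) auto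
      then show ?thesis unfolding sq_pow2 .
    qed
    have "av (\<lambda>x. (cmod (stp (MM k (w div 4)) x ^ j - (N + cc j k w * x)))\<^sup>2) = av (\<lambda>x. (cmod ((m ^ j - N) + r x))\<^sup>2)"
      using True by (simp add: stp_def cc_def r_def m_def algebra_simps)
    also have "\<dots> = (cmod (m ^ j - N))\<^sup>2 + av (\<lambda>x. (cmod (r x))\<^sup>2) + 2 * Re (cnj (m ^ j - N) * av r)"
      unfolding cmod_add_sq av_lin(1) av_lin(3)[of 2] av_Re av_lin(3) av_lin(5) by simp
    also have "\<dots> \<le> (cmod (m ^ j - N))\<^sup>2 + av (\<lambda>x. e ^ 4 * 4 ^ j)" unfolding r0 using av_mono[OF rb] by simp
    finally show ?thesis unfolding av_lin m_def .
  next
    case False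
    then show ?thesis using e by (simp add: stp_def cc_def av_lin)
  qed
  then have "Ex (Suc k) (\<lambda>n. (cmod (MM (Suc k) n ^ j - NN (cc j) (0 ^ j) (Suc k) n))\<^sup>2)
      \<le> Ew k (\<lambda>w. (cmod (MM k (w div 4) ^ j - NN (cc j) (0 ^ j) k (w div 4)))\<^sup>2 + e ^ 4 * 4 ^ j)"
    unfolding Ex_NN_MM_Suc[of k "\<lambda>N M. (cmod (M ^ j - N))\<^sup>2"] by (intro Ew_mono)
  also have "\<dots> = Ex k (\<lambda>n. (cmod (MM k n ^ j - NN (cc j) (0 ^ j) k n))\<^sup>2) + e ^ 4 * 4 ^ j"
    unfolding Ew_lin(1,5) Ew_div[of k "\<lambda>n. (cmod (MM k n ^ j - NN (cc j) (0 ^ j) k n))\<^sup>2"] ..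
  finally show ?case using Suc by (simp add: algebra_simps)
qed

text \<open>The product is homogeneous of degree \<open>i - j\<close> under rotation, and a nonzero
  degree forces the mean to vanish.\<close>

lemma cc_orth:
  assumes "i \<noteq> j" "i < H" "j < H"
  shows "Ew k (\<lambda>w. cc i k w * cnj (cc j k w)) = 0"
proof -
  have *: "Ew k (\<lambda>w. cc i k w * cnj (cc j k w)) = 0" if ij: "j < i" "i < H" for i j
  proof (cases "j = 0")
    case False
    define f where "f m = (if cmod m \<le> 1 - e then of_nat i * cplx e * m ^ (i - 1) else 0)
       * cnj (if cmod m \<le> 1 - e then of_nat j * cplx e * m ^ (j - 1) else 0)" for m
    have z: "zz 1 ^ (i - 1) * cnj (zz 1) ^ (j - 1) = zz (i - j)"
    proof -
      have "zz 1 ^ (i - 1) = zz 1 ^ (j - 1) * zz 1 ^ (i - j)" using False ij by (simp flip: power_add)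
      moreover have "zz 1 ^ (j - 1) * cnj (zz 1) ^ (j - 1) = 1"
        unfolding zz_def complex_cnj_power[symmetric] Complex.DeMoivre cis_cnj cis_mult by simp
      ultimately show ?thesis by (simp add: mult.assoc mult.left_commute zz_pow[of "i - j"] flip: One_nat_def)
    qed
    have n: "cmod (zz 1 * m) = cmod m" for m by (simp add: norm_mult zz_def)
    have "Ex k (\<lambda>n. f (MM k n)) = 0"
    proof (rule Ex_homog[where i="i - j"])
      show "f (zz 1 * m) = zz (i - j) * f m" for m
        unfolding f_def n z[symmetric] by (simp add: power_mult_distrib mult_ac)
    qed (use ij in auto)
    then show ?thesis using Ew_div[of k "\<lambda>n. f (MM k n)"] by (simp add: f_def cc_def)
  next
    case True
    then have "cc j k w = 0" for w by (simp add: cc_def)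
    then show ?thesis by (simp add: Ew_lin)
  qed
  have "Ew k (\<lambda>w. cnj (f w)) = cnj (Ew k f)" for f unfolding Ew_def by simp
  from this[of "\<lambda>w. cc j k w * cnj (cc i k w)"] show ?thesis
    using *[of j i] *[of i j] assms by (cases "i < j") (auto simp: mult.commute)
qed

text \<open>The factor by which embedding and reading off multiply frequency \<open>j\<close>; the
  return map has to compensate for it.\<close>

definition lam :: "nat \<Rightarrow> nat \<Rightarrow> real" where
  "lam k j = (\<Sum>i<k. Ew i (\<lambda>w. (cmod (cc j i w))\<^sup>2))"

lemma Ew_cc_self: "Ew k (\<lambda>w. cc j k w * cnj (cc j k w)) = cplx (Ew k (\<lambda>w. (cmod (cc j k w))\<^sup>2))"
  unfolding Ew_def complex_norm_square[symmetric] by simp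

lemma lam_eq: "0 < j \<Longrightarrow> j < H \<Longrightarrow> Ex k (\<lambda>n. NN (cc j) (0 ^ j) k n * cnj (MM k n ^ j)) = cplx (lam k j)"
  unfolding NN_MM_cnj[of j] Ew_cc_self lam_def by simp

text \<open>The difference is the mean of the Taylor error against \<open>cnj (MM^j)\<close>,
  bounded in mean square by \<open>taylor_error\<close>.\<close>

lemma lam_close:
  assumes "0 < j" "j < H"
  shows "\<bar>lam k j - Ex k (\<lambda>n. cmod (MM k n) ^ (2 * j))\<bar> \<le> sqrt (real k) * e\<^sup>2 * 2 ^ j"
proof -
  let ?r = "\<lambda>n. MM k n ^ j - NN (cc j) (0 ^ j) k n"
  have c: "cplx (Ex k (\<lambda>n. cmod (MM k n) ^ (2 * j))) = Ex k (\<lambda>n. MM k n ^ j * cnj (MM k n ^ j))"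
    unfolding Ex_def complex_norm_square[symmetric] norm_power power_mult[symmetric] mult.commute[of j 2] by simp
  have d: "cplx (Ex k (\<lambda>n. cmod (MM k n) ^ (2 * j)) - lam k j) = Ex k (\<lambda>n. ?r n * cnj (MM k n ^ j))"
    unfolding of_real_diff c lam_eq[OF assms, symmetric] Ex_lin(2)[symmetric] by (simp add: algebra_simps)
  have "\<bar>Ex k (\<lambda>n. cmod (MM k n) ^ (2 * j)) - lam k j\<bar> = cmod (Ex k (\<lambda>n. ?r n * cnj (MM k n ^ j)))"
    by (simp only: norm_of_real flip: d)
  also have "\<dots> \<le> Ex k (\<lambda>n. cmod (?r n * cnj (MM k n ^ j)))" by (rule Ex_cmod)
  also have "\<dots> \<le> Ex k (\<lambda>n. sqrt ((cmod (?r n))\<^sup>2))"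
    unfolding norm_mult complex_mod_cnj norm_power using MM_le by (intro Ex_mono) (simp add: mult_left_le power_le_one)
  also have "\<dots> \<le> sqrt (Ex k (\<lambda>n. (cmod (?r n))\<^sup>2))" by (rule Ex_sqrt) simp
  also have "\<dots> \<le> sqrt (real k * (e ^ 4 * 4 ^ j))" using taylor_error[OF assms(2)] by (intro real_sqrt_le_mono)
  also have "\<dots> = sqrt (real k * (e\<^sup>2 * 2 ^ j)\<^sup>2)" unfolding sq_pow2 ..
  also have "\<dots> = sqrt (real k) * e\<^sup>2 * 2 ^ j" using e by (simp add: real_sqrt_mult)
  finally show ?thesis by (simp add: abs_minus_commute)
qed

text \<open>The probability that the walk is still moving at time \<open>k\<close>.\<close>

definition alv :: "nat \<Rightarrow> real" where
  "alv k = Ex k (\<lambda>n. if cmod (MM k n) \<le> 1 - e then 1 else 0)"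

lemma alv_antimono: "i \<le> k \<Longrightarrow> alv k \<le> alv i"
proof (induction k rule: dec_induct)
  case (step k)
  have "alv (Suc k) = Ex k (\<lambda>n. av (\<lambda>x. if cmod (stp (MM k n) x) \<le> 1 - e then 1 else 0))"
    unfolding alv_def by (rule Ex_MM_Suc)
  also have "\<dots> \<le> Ex k (\<lambda>n. av (\<lambda>x. if cmod (MM k n) \<le> 1 - e then 1 else 0))"
    by (intro Ex_mono av_mono) (auto simp: stp_def)
  finally show ?case using step unfolding av_lin alv_def by simp
qed simp

lemma MM_NN: "MM k n = NN (cc 1) (0 ^ 1) k n"
  by (induction k arbitrary: n) (auto simp: stp_def cc_def)

text \<open>The second moment of the walk is the sum of \<open>e^2 * alv i\<close> and cannot exceed
  1 in the disc; \<open>alv\<close> is decreasing.\<close>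

lemma alv_le:
  assumes "2 \<le> H"
  shows "real k * e\<^sup>2 * alv k \<le> 1"
proof -
  have "real k * e\<^sup>2 * alv k = (\<Sum>i<k. e\<^sup>2 * alv k)" by simp
  also have "\<dots> \<le> (\<Sum>i<k. e\<^sup>2 * alv i)" by (intro sum_mono mult_left_mono alv_antimono) auto
  also have "\<dots> = lam k 1"
  proof -
    have "e\<^sup>2 * alv i = Ew i (\<lambda>w. (cmod (cc 1 i w))\<^sup>2)" for i
    proof -
      have "e\<^sup>2 * alv i = Ex i (\<lambda>n. e\<^sup>2 * (if cmod (MM i n) \<le> 1 - e then 1 else 0))" unfolding alv_def Ex_lin ..
      also have "\<dots> = Ew i (\<lambda>w. e\<^sup>2 * (if cmod (MM i (w div 4)) \<le> 1 - e then 1 else 0))"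
        by (rule Ew_div[symmetric, where f="\<lambda>n. e\<^sup>2 * (if cmod (MM i n) \<le> 1 - e then 1 else 0)"])
      also have "\<dots> = Ew i (\<lambda>w. (cmod (cc 1 i w))\<^sup>2)" using e by (intro arg_cong[where f="Ew i"]) (auto simp: cc_def)
      finally show ?thesis .
    qed
    then show ?thesis unfolding lam_def by simp
  qed
  also have "lam k 1 = Ex k (\<lambda>n. (cmod (MM k n))\<^sup>2)"
  proof -
    have "cplx (lam k 1) = Ex k (\<lambda>n. MM k n * cnj (MM k n ^ 1))"
      unfolding MM_NN[abs_def, symmetric] using lam_eq[of 1 k] assms unfolding MM_NN[symmetric] by simp
    also have "\<dots> = cplx (Ex k (\<lambda>n. (cmod (MM k n))\<^sup>2))" unfolding Ex_def power_one_right complex_norm_square[symmetric] by simp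
    finally show ?thesis unfolding of_real_eq_iff .
  qed
  also have "\<dots> \<le> Ex k (\<lambda>n. 1)" using MM_le by (intro Ex_mono) (simp add: power_le_one)
  finally show ?thesis unfolding Ex_lin .
qed

lemma MM_moment:
  shows "1 - 2 * real j * e - alv k \<le> Ex k (\<lambda>n. cmod (MM k n) ^ (2 * j))" "Ex k (\<lambda>n. cmod (MM k n) ^ (2 * j)) \<le> 1"
proof -
  have "1 - 2 * real j * e - alv k = Ex k (\<lambda>n. 1 - 2 * real j * e - (if cmod (MM k n) \<le> 1 - e then 1 else 0))"
    unfolding alv_def Ex_lin ..
  also have "\<dots> \<le> Ex k (\<lambda>n. cmod (MM k n) ^ (2 * j))"
  proof (rule Ex_mono)
    fix n
    show "1 - 2 * real j * e - (if cmod (MM k n) \<le> 1 - e then 1 else 0) \<le> cmod (MM k n) ^ (2 * j)"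
    proof (cases "cmod (MM k n) \<le> 1 - e")
      case True
      have "- (2 * real j * e) \<le> 0" using e by simp
      also have "0 \<le> cmod (MM k n) ^ (2 * j)" by simp
      finally show ?thesis using True by simp
    next
      case False
      have "1 + real (2 * j) * (- e) \<le> (1 + (- e)) ^ (2 * j)" using e by (intro Bernoulli_inequality) simp
      also have "\<dots> \<le> cmod (MM k n) ^ (2 * j)" using False e by (intro power_mono) auto
      finally show ?thesis using False by simp
    qed
  qed
  finally show "1 - 2 * real j * e - alv k \<le> Ex k (\<lambda>n. cmod (MM k n) ^ (2 * j))" .
  have "Ex k (\<lambda>n. cmod (MM k n) ^ (2 * j)) \<le> Ex k (\<lambda>n. 1)" using MM_le by (intro Ex_mono) (simp add: power_le_one)
  then show "Ex k (\<lambda>n. cmod (MM k n) ^ (2 * j)) \<le> 1" unfolding Ex_lin .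
qed

text \<open>The choice balances two errors: \<open>k * e^2 = r^2\<close> makes survival unlikely,
  while \<open>sqrt k * e^2 = 1 / r\<close> keeps the accumulated Taylor error small.\<close>

lemma lam_near_1:
  assumes "0 < j" "j < H" "0 < r" "e = 1 / real r ^ 2" "k = r ^ 6"
  shows "\<bar>lam k j - 1\<bar> \<le> (2 * real j + 1 + 2 ^ j) / real r"
proof -
  have r: "1 \<le> real r" using assms by simp
  have H2: "2 \<le> H" using assms by simp
  have "real k * e\<^sup>2 = real r ^ 2" unfolding assms using assms(3) by (simp add: power_divide field_simps flip: power_mult power_add)
  then have "real r ^ 2 * alv k \<le> 1" using alv_le[OF H2, of k] by simp
  then have "alv k \<le> 1 / real r ^ 2" using r by (simp add: field_simps)
  moreover have rr: "1 / real r ^ 2 \<le> 1 / real r" using r by (simp add: field_simps power2_eq_square)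
  ultimately have a: "alv k \<le> 1 / real r" by simp
  have "e \<le> 1 / real r" using rr assms(4) by simp
  then have e1: "2 * real j * e \<le> 2 * real j * (1 / real r)" by (intro mult_left_mono) auto
  have "sqrt (real k) = real r ^ 3" unfolding assms(5) by (intro real_sqrt_unique) (auto simp flip: power_mult)
  then have s: "sqrt (real k) * e\<^sup>2 * 2 ^ j = 2 ^ j / real r"
    unfolding assms(4) using assms(3) by (simp add: power_divide field_simps flip: power_mult power_add) (simp add: power_numeral_reduce)
  show ?thesis using lam_close[OF assms(1,2), of k] MM_moment[where k=k and j=j] a e1 unfolding s add_divide_distrib by (simp add: abs_le_iff)
qed

end

section \<open>Reflection, frequency windows and the embedding of polynomials into walk
  martingales\<close>

lemma torus_reflect:
  fixes g :: "real \<Rightarrow> real"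
  assumes c: "continuous_on UNIV g" and p: "\<And>t. g (t + 2 * pi) = g t"
  shows "(LINT t|tor. g (- t)) = (LINT t|tor. g t)"
proof -
  have ci: "continuous_on A g" for A using c continuous_on_subset by blast
  have "continuous_on UNIV (\<lambda>t. g (- t))" by (intro continuous_intros continuous_on_compose2[OF c]) auto
  then have "(LINT t|tor. g (- t)) = integral {0..2*pi} (\<lambda>t. g (- t)) / (2 * pi)" by (rule torus_integral_cont)
  also have "integral {0..2*pi} (\<lambda>t. g (- t)) = integral {- (2*pi)..0} g"
    using Henstock_Kurzweil_Integration.integral_reflect_real[of 0 "- (2*pi)" g] by simp
  also have "\<dots> = integral {0..2*pi} g"
    using integral_shift[of "- (2*pi)" "2*pi" 0 g, OF ci] p by (simp add: comp_def)
  finally show ?thesis using torus_integral_cont[OF c] by simp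
qed

definition rv :: "nat \<Rightarrow> vec \<Rightarrow> vec" where
  "rv k v j p = (if j = 0 \<and> p \<le> k then v 0 (k - p) else 0)"

lemma pmod_LINT: "pmod a v = ennreal (LINT t|tor. phi (cmod (tpoly a v t)))"
  unfolding pmod_def
proof (rule torus_nn_integral)
  show "(\<lambda>t. phi (cmod (tpoly a v t))) \<in> borel_measurable borel" unfolding phi_def by measurable
  show "phi (cmod (tpoly a v t)) \<le> phi (\<Sum>p\<le>a. cmod (v 0 p))" for t by (intro phi_mono tpoly_bound) auto
qed simp

text \<open>Reversing the coefficients is the reflection \<open>t -> -t\<close> followed by
  multiplication with the unimodular factor \<open>cis (k t)\<close>.\<close>

lemma pmod_rv: "pmod k (rv k v) = pmod k v"
proof -
  have a: "tpoly k (rv k v) t = cis (real k * t) * tpoly k v (- t)" for t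
  proof -
    have "tpoly k (rv k v) t = (\<Sum>p\<le>k. v 0 (k - p) * cis (real p * t))"
      unfolding tpoly_def rv_def by (intro sum.cong) auto
    also have "\<dots> = (\<Sum>p\<le>k. v 0 p * cis (real (k - p) * t))"
      by (rule sum.reindex_bij_witness[of _ "\<lambda>p. k - p" "\<lambda>p. k - p"]) auto
    also have "\<dots> = cis (real k * t) * tpoly k v (- t)"
      unfolding tpoly_def sum_distrib_left
      by (intro sum.cong refl) (simp add: mult.left_commute cis_mult of_nat_diff algebra_simps)
    finally show ?thesis .
  qed
  have "(LINT t|tor. phi (cmod (tpoly k v (- t)))) = (LINT t|tor. phi (cmod (tpoly k v t)))"
  proof (rule torus_reflect)
    show "continuous_on UNIV (\<lambda>t. phi (cmod (tpoly k v t)))" unfolding phi_def by (intro continuous_intros tpoly_cont)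
    show "phi (cmod (tpoly k v (t + 2 * pi))) = phi (cmod (tpoly k v t))" for t
    proof -
      have "cis (real p * (t + 2 * pi)) = cis (real p * t)" for p
        using cis_mult[of "real p * t" "2 * pi * real p"] cis_multiple_2pi[of "real p"] by (simp add: algebra_simps)
      then show ?thesis unfolding tpoly_def by simp
    qed
  qed
  then show ?thesis unfolding pmod_LINT a by (simp add: norm_mult)
qed

lemma tpoly_coeff_neg: "0 < p \<Longrightarrow> (LINT s|tor. tpoly a v s * cis (real p * s)) = 0"
  using torus_coeff[where R="Suc a" and a="v 0" and m="- int p"] by (simp add: tpoly_def lessThan_Suc_atMost)

lemma sum_atMost_square_le: "(\<Sum>j\<le>k. f j)\<^sup>2 \<le> (real k + 1) * (\<Sum>j\<le>k. (f j :: real)\<^sup>2)"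
  using sum_squared_le_sum_of_squares[of f "{..k}"] by (simp add: mult.commute add.commute)

text \<open>The parameter \<open>r\<close> sets the quality of the walk; \<open>rb\<close> keeps the
  relative Taylor error and the total correction \<open>mu\<close> below 1 for degrees up to
  \<open>k\<close>.\<close>

locale td = mg +
  fixes k r :: nat
  assumes k1: "1 \<le> k" and kH: "Suc k < H" and er: "e = 1 / real r ^ 2" and r0: "0 < r"
    and rb: "2 * (real k + 1) * (2 * real k + 1 + 2 ^ k) \<le> real r"
begin

definition K :: nat where "K = r ^ 6"
text \<open>The window falls from 1 to 0 roughly between \<open>k / 3\<close> and
  \<open>2 k / 3\<close>; \<open>A + B = k\<close> makes it symmetric about
  \<open>k / 2\<close>.\<close>

definition A :: nat where "A = k div 3"
definition B :: nat where "B = k - A"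

lemma AB: "A < B" "B \<le> Suc k" "B - 1 < Suc k" "(real B + real A) / (real B - real A) \<le> 3"
  "(real (Suc k) + real (B - 1)) / (real (Suc k) - real (B - 1)) \<le> 6"
proof -
  have A: "3 * A \<le> k" "k \<le> 3 * A + 2" "A \<le> k" using k1 unfolding A_def by auto
  have B: "real B = real k - real A" unfolding B_def using A by (simp add: of_nat_diff)
  show AB: "A < B" using A k1 unfolding B_def by auto
  show "B \<le> Suc k" "B - 1 < Suc k" unfolding B_def using k1 by auto
  have "real (3 * A) \<le> real k" using A by (simp only: of_nat_le_iff)
  then have A3: "3 * real A \<le> real k" by simp
  have "0 < real k - 2 * real A" using A3 k1 by simp
  then show "(real B + real A) / (real B - real A) \<le> 3" unfolding B using A3 by (simp add: divide_le_eq)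
  have B1: "real (B - 1) = real k - real A - 1" using AB B by simp
  have "real k \<le> real (3 * A + 2)" using A by (simp only: of_nat_le_iff)
  then have k: "real k \<le> 3 * real A + 2" by simp
  show "(real (Suc k) + real (B - 1)) / (real (Suc k) - real (B - 1)) \<le> 6" unfolding B1 using k by (simp add: divide_le_eq)
qed

text \<open>By the symmetry of the window, the copy for the reversed polynomial supplies exactly
  what the first copy misses.\<close>

lemma vm_sum: "j \<le> k \<Longrightarrow> vm A B j + vm A B (k - j) = 1"
proof -
  assume j: "j \<le> k"
  have Ak: "A \<le> k" unfolding A_def by simp
  consider "j \<le> A" | "A < j" "j < B" | "B \<le> j" by linarith
  then show ?thesis
  proof cases
    case 1
    then show ?thesis using vm_1[OF AB(1), of j] vm_0[OF AB(1), of "k - j"] unfolding B_def by simp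
  next
    case 2
    have "vm A B j + vm A B (k - j) = (real (B - j) + real (B - (k - j))) / (real B - real A)"
    proof -
      have z: "A - j = 0" "A - (k - j) = 0" using 2 by (auto simp: B_def)
      show ?thesis unfolding vm_def z by (simp only: add_divide_distrib of_nat_0 diff_zero)
    qed
    also have "real (B - j) + real (B - (k - j)) = real B - real A"
      using 2 j Ak unfolding B_def by (simp add: of_nat_diff)
    finally show ?thesis using AB(1) by simp
  next
    case 3
    then show ?thesis using vm_0[OF AB(1), of j] vm_1[OF AB(1), of "k - j"] j Ak unfolding B_def by simp
  qed
qed

lemma vm_range: "0 \<le> vm A B j" "vm A B j \<le> 1"
proof -
  show "0 \<le> vm A B j" unfolding vm_def using AB(1) by simp
  have "real (B - j) - real (A - j) \<le> real B - real A" using AB(1) by (cases "j \<le> A") (auto simp: of_nat_diff)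
  then show "vm A B j \<le> 1" unfolding vm_def using AB(1) by simp
qed

definition bb :: "vec \<Rightarrow> nat \<Rightarrow> complex" where "bb v j = cplx (vm A B j) * v 0 j"

definition ci :: "vec \<Rightarrow> nat \<Rightarrow> nat \<Rightarrow> complex" where "ci v i w = (\<Sum>j\<le>k. bb v j * cc j i w)"

lemma NN_ci: "NN (ci v) (bb v 0) i n = (\<Sum>j\<le>k. bb v j * NN (cc j) (0 ^ j) i n)"
proof (induction i arbitrary: n)
  case 0
  have "(\<Sum>j\<le>k. bb v j * 0 ^ j) = (\<Sum>j\<in>{0}. bb v j * 0 ^ j)" by (intro sum.mono_neutral_right) auto
  then show ?case by simp
next
  case (Suc i)
  then show ?case by (simp add: ci_def sum_distrib_right sum.distrib distrib_left mult.assoc)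
qed

lemma Ex_nn: "Ex K (\<lambda>n. f n :: real) = (\<Sum>n<(4 * H) ^ K. f n) / real ((4 * H) ^ K)"
  unfolding Ex_def ..

lemma hb_mean: "A' < B' \<Longrightarrow> B' \<le> H \<Longrightarrow> Ex K (\<lambda>n. hb A' B' \<theta> (MM K n)) = (real B' + real A') / (real B' - real A')"
  unfolding hb_def divide_inverse Ex_lin(4) Ex_lin(1) using Ex_hu[of A' K \<theta>] Ex_hu[of B' K \<theta>] by simp

lemma hk_cont: "continuous_on S (\<lambda>\<theta>. hk A' B' \<theta> M)"
  unfolding hk_def divide_inverse by (intro continuous_intros hu_cont)

lemma hk_le: "A' < B' \<Longrightarrow> cmod M \<le> 1 \<Longrightarrow> \<bar>hk A' B' \<theta> M\<bar> \<le> ((real B' + (\<Sum>n=1..B'. 2 * real (B' - n))) + (real A' + (\<Sum>n=1..A'. 2 * real (A' - n)))) / (real B' - real A')"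
  by (rule order_trans[OF hk_le_hb], assumption, assumption, unfold hb_def, intro divide_right_mono add_mono hu_bound) auto

text \<open>The windowed polynomial at a point of the disc is an integral against the harmonic
  kernel; its antiholomorphic part does not meet the analytic polynomial.\<close>

lemma poly_MM:
  assumes "cmod M \<le> 1"
  shows "(\<Sum>j\<le>k. bb v j * M ^ j) = (LINT \<theta>|tor. tpoly k v \<theta> * cplx (hk A B \<theta> M))"
proof -
  have i: "integrable tor (\<lambda>\<theta>. tpoly k v \<theta> * cis (of_int n * \<theta>))" for n :: int
    by (rule torus_integrable[where B="\<Sum>p\<le>k. cmod (v 0 p)"]) (auto simp: norm_mult tpoly_bound intro!: borel_measurable_continuous_onI continuous_intros tpoly_cont)
  have im: "integrable tor (\<lambda>\<theta>. tpoly k v \<theta> * cis (- real n * \<theta>))" and ip: "integrable tor (\<lambda>\<theta>. tpoly k v \<theta> * cis (real n * \<theta>))" for n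
    using i[of "- int n"] i[of "int n"] by simp_all
  have i0: "integrable tor (\<lambda>\<theta>. tpoly k v \<theta>)" using i[of 0] by simp
  have "(LINT \<theta>|tor. tpoly k v \<theta> * cplx (hk A B \<theta> M)) = (LINT \<theta>|tor. tpoly k v \<theta> + (\<Sum>n=1..k. (cplx (vm A B n) * M ^ n) * (tpoly k v \<theta> * cis (- real n * \<theta>)) + (cplx (vm A B n) * cnj M ^ n) * (tpoly k v \<theta> * cis (real n * \<theta>))))"
    unfolding hk_expand[OF AB(1,2)] distrib_left sum_distrib_left by (simp only: mult_1_right mult_1_left mult_ac)
  also have "\<dots> = (LINT \<theta>|tor. tpoly k v \<theta>) + (\<Sum>n=1..k. (cplx (vm A B n) * M ^ n) * (LINT \<theta>|tor. tpoly k v \<theta> * cis (- real n * \<theta>)) + (cplx (vm A B n) * cnj M ^ n) * (LINT \<theta>|tor. tpoly k v \<theta> * cis (real n * \<theta>)))"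
    using im ip i0 by (subst Bochner_Integration.integral_add, simp, simp, subst Bochner_Integration.integral_sum, simp, subst Bochner_Integration.integral_add) simp_all
  also have "\<dots> = v 0 0 + (\<Sum>n=1..k. bb v n * M ^ n)"
    using tpoly_coeff[of 0 k v] tpoly_coeff[of _ k v] tpoly_coeff_neg[of _ k v] by (simp add: bb_def mult_ac)
  also have "\<dots> = (\<Sum>j\<le>k. bb v j * M ^ j)"
    using vm_1[OF AB(1), of 0] sum.atLeast_Suc_atMost[of 0 k "\<lambda>j. bb v j * M ^ j"] by (simp add: bb_def atMost_atLeast0)
  finally show ?thesis by simp
qed

text \<open>Schur test between the circle and the end points of the walk. The majorant has mass at
  most 3 in the angle and, by harmonicity, the same mean along the walk.\<close>

lemma poly_MM_bound: "ennreal (Ex K (\<lambda>n. phi (cmod (\<Sum>j\<le>k. bb v j * MM K n ^ j)))) \<le> ennreal (3\<^sup>2) * pmod k v"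
  unfolding Ex_nn pmod_def
proof (rule phi_kernel_to_fin[where k="\<lambda>\<theta> n. hb A B \<theta> (MM K n)"])
  show "sigma_finite_measure tor" by (rule prob_space_imp_sigma_finite) (rule prob_space_torus)
  show "0 < (4 * H) ^ K" using H0 by simp
  show "(\<lambda>t. cmod (tpoly k v t)) \<in> borel_measurable tor"
    by (simp add: measurable_cong_sets[OF sets_torus refl])
  show "(\<lambda>\<theta>. hb A B \<theta> (MM K n)) \<in> borel_measurable tor" for n
    by (simp add: measurable_cong_sets[OF sets_torus refl] borel_measurable_continuous_onI hb_cont)
  show "0 \<le> hb A B \<theta> (MM K n)" for \<theta> n using hb_nonneg AB(1) MM_le by simp
  show "(\<integral>\<^sup>+ \<theta>. ennreal (hb A B \<theta> (MM K n)) \<partial>tor) \<le> ennreal 3" for n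
    unfolding hb_nn_mean[OF AB(1) MM_le] using AB(4) by (rule ennreal_leI)
  show "(\<Sum>n<(4 * H) ^ K. hb A B \<theta> (MM K n)) / real ((4 * H) ^ K) \<le> 3" for \<theta>
    unfolding Ex_nn[symmetric] using hb_mean[OF AB(1), of \<theta>] AB(2,4) kH by simp
  fix n
  show "ennreal (cmod (\<Sum>j\<le>k. bb v j * MM K n ^ j)) \<le> (\<integral>\<^sup>+ \<theta>. ennreal (hb A B \<theta> (MM K n)) * ennreal (cmod (tpoly k v \<theta>)) \<partial>tor)"
    unfolding poly_MM[OF MM_le]
  proof (rule norm_lint_le_kernel)
    show "cmod (cplx (hk A B \<theta> (MM K n))) \<le> hb A B \<theta> (MM K n)" for \<theta>
      using hk_le_hb[OF AB(1) MM_le] by simp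
    show "integrable tor (\<lambda>\<theta>. tpoly k v \<theta> * cplx (hk A B \<theta> (MM K n)))"
      by (rule torus_integrable) (auto simp: norm_mult intro!: mult_mono tpoly_bound hk_le[OF AB(1) MM_le] borel_measurable_continuous_onI continuous_intros tpoly_cont hk_cont sum_nonneg)
  qed
qed auto

lemma coeff_bound:
  assumes "j \<le> k"
  shows "cmod (bb v j) \<le> (LINT t|tor. cmod (tpoly k v t))"
proof -
  have "cmod (bb v j) \<le> cmod (v 0 j)" unfolding bb_def using vm_range[of j] by (simp add: norm_mult mult_left_le_one_le)
  also have "v 0 j = (LINT s|tor. tpoly k v s * cis (- real j * s))" using tpoly_coeff[OF assms] by simp
  also have "cmod \<dots> \<le> (LINT s|tor. cmod (tpoly k v s * cis (- real j * s)))" by (rule integral_norm_bound)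
  finally show ?thesis by (simp add: norm_mult)
qed

lemma phi_L1: "ennreal (phi (LINT t|tor. cmod (tpoly k v t))) \<le> pmod k v"
proof -
  have m: "(\<lambda>t. cmod (tpoly k v t)) \<in> borel_measurable borel" by measurable
  have "ennreal (phi (LINT t|tor. cmod (tpoly k v t))) \<le> (\<integral>\<^sup>+ t. ennreal 1 * ennreal (phi (cmod (tpoly k v t))) \<partial>tor)"
  proof (rule phi_jensen_kernel)
    show "ennreal (LINT t|tor. cmod (tpoly k v t)) \<le> (\<integral>\<^sup>+ t. ennreal 1 * ennreal (cmod (tpoly k v t)) \<partial>tor)"
      using torus_nn_integral[OF m _ tpoly_bound] by simp
  qed (auto simp: measurable_cong_sets[OF sets_torus refl] torus.emeasure_space_1[unfolded space_torus])
  then show ?thesis unfolding pmod_def by simp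
qed

text \<open>Each coefficient is at most the L1 norm \<open>F\<close> of the polynomial, and the
  summed Taylor errors are small enough that the mean square of the error is at most
  \<open>F^2\<close>. Concavity gives \<open>phi F\<close>, which Jensen bounds by the
  modular.\<close>

lemma error_bound: "ennreal (Ex K (\<lambda>n. phi (cmod ((\<Sum>j\<le>k. bb v j * MM K n ^ j) - NN (ci v) (bb v 0) K n)))) \<le> pmod k v"
proof -
  define F where "F = (LINT t|tor. cmod (tpoly k v t))"
  let ?d = "\<lambda>j n. MM K n ^ j - NN (cc j) (0 ^ j) K n"
  let ?E = "\<lambda>n. (\<Sum>j\<le>k. bb v j * MM K n ^ j) - NN (ci v) (bb v 0) K n"
  have F0: "0 \<le> F" unfolding F_def by simp
  have "(cmod (?E n))\<^sup>2 \<le> F\<^sup>2 * ((real k + 1) * (\<Sum>j\<le>k. (cmod (?d j n))\<^sup>2))" for n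
  proof -
    have eq: "?E n = (\<Sum>j\<le>k. bb v j * ?d j n)" unfolding NN_ci by (simp add: sum_subtractf right_diff_distrib)
    have "cmod (?E n) \<le> F * (\<Sum>j\<le>k. cmod (?d j n))" unfolding eq sum_distrib_left
      using coeff_bound by (intro order_trans[OF norm_sum] sum_mono) (auto simp: norm_mult F_def intro!: mult_right_mono)
    then have "(cmod (?E n))\<^sup>2 \<le> (F * (\<Sum>j\<le>k. cmod (?d j n)))\<^sup>2" by (rule power_mono) (rule norm_ge_zero)
    also have "\<dots> \<le> F\<^sup>2 * ((real k + 1) * (\<Sum>j\<le>k. (cmod (?d j n))\<^sup>2))"
      unfolding power_mult_distrib by (intro mult_left_mono sum_atMost_square_le zero_le_power2)
    finally show ?thesis .
  qed
  then have "Ex K (\<lambda>n. (cmod (?E n))\<^sup>2) \<le> Ex K (\<lambda>n. F\<^sup>2 * ((real k + 1) * (\<Sum>j\<le>k. (cmod (?d j n))\<^sup>2)))" by (rule Ex_mono)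
  also have "\<dots> = F\<^sup>2 * ((real k + 1) * (\<Sum>j\<le>k. Ex K (\<lambda>n. (cmod (?d j n))\<^sup>2)))" unfolding Ex_lin(3) Ex_lin(7) ..
  also have "\<dots> \<le> F\<^sup>2 * ((real k + 1) * (\<Sum>j\<le>k. real K * (e ^ 4 * 4 ^ k)))"
  proof (intro mult_left_mono sum_mono)
    fix j assume j: "j \<in> {..k}"
    have "Ex K (\<lambda>n. (cmod (?d j n))\<^sup>2) \<le> real K * (e ^ 4 * 4 ^ j)" using j kH by (intro taylor_error) auto
    also have "\<dots> \<le> real K * (e ^ 4 * 4 ^ k)" using j e by (intro mult_left_mono power_increasing) auto
    finally show "Ex K (\<lambda>n. (cmod (?d j n))\<^sup>2) \<le> real K * (e ^ 4 * 4 ^ k)" .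
  qed auto
  also have "\<dots> \<le> F\<^sup>2 * 1"
  proof (rule mult_left_mono)
    have "(real k + 1) * 2 ^ k \<le> (2 * (real k + 1)) * (2 * real k + 1 + 2 ^ k)" by (intro mult_mono) auto
    then have "(real k + 1) * 2 ^ k \<le> real r" using rb by simp
    then have "((real k + 1) * 2 ^ k)\<^sup>2 \<le> (real r)\<^sup>2" by (intro power_mono) auto
    moreover have "((real k + 1) * 2 ^ k)\<^sup>2 = (real k + 1)\<^sup>2 * 4 ^ k"
    proof -
      have "((2::real) ^ k)\<^sup>2 = (2\<^sup>2) ^ k" by (simp only: power_mult[symmetric] mult.commute)
      then show ?thesis by (simp add: power_mult_distrib)
    qed
    moreover have "real K * e ^ 4 = 1 / (real r)\<^sup>2" unfolding K_def er using r0 by (simp add: field_simps flip: power_mult power_add)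
    moreover have "(real k + 1) * (\<Sum>j\<le>k. real K * (e ^ 4 * 4 ^ k)) = ((real k + 1)\<^sup>2 * 4 ^ k) * (real K * e ^ 4)" by (simp add: power2_eq_square mult_ac)
    ultimately show "(real k + 1) * (\<Sum>j\<le>k. real K * (e ^ 4 * 4 ^ k)) \<le> 1" using r0 by simp
  qed simp
  finally have E: "Ex K (\<lambda>n. (cmod (?E n))\<^sup>2) \<le> F\<^sup>2" by simp
  have "Ex K (\<lambda>n. phi (cmod (?E n))) = Ex K (\<lambda>n. sqrt (1 + (cmod (?E n))\<^sup>2)) - 1" by (rule Ex_phi)
  also have "\<dots> \<le> sqrt (Ex K (\<lambda>n. 1 + (cmod (?E n))\<^sup>2)) - 1" by (intro diff_right_mono Ex_sqrt) simp
  also have "\<dots> \<le> phi F" unfolding phi_def Ex_lin(1,5) using E by simp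
  finally show ?thesis using phi_L1[of v] unfolding F_def by (meson ennreal_leI order_trans)
qed

text \<open>\<open>160 = 8 * (2 * 9 + 2 * 1)\<close>: the square function constant times the
  quasi-triangle inequality for the windowed polynomial and the linearisation error.\<close>

lemma embed_bound: "ennreal (Ex K (\<lambda>n. phi (sqrt (SS (ci v) ((cmod (bb v 0))\<^sup>2) K n)))) \<le> ennreal 160 * pmod k v"
proof -
  define P where "P = (LINT t|tor. phi (cmod (tpoly k v t)))"
  have P: "0 \<le> P" "pmod k v = ennreal P" unfolding P_def pmod_LINT by simp_all
  let ?f = "\<lambda>n. \<Sum>j\<le>k. bb v j * MM K n ^ j"
  have 1: "Ex K (\<lambda>n. phi (cmod (?f n))) \<le> 9 * P" using poly_MM_bound[of v] P(1) unfolding P(2) by (simp only: ennreal_mult[symmetric] zero_le_power2 ennreal_le_iff mult_nonneg_nonneg) simp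
  have 2: "Ex K (\<lambda>n. phi (cmod (?f n - NN (ci v) (bb v 0) K n))) \<le> P" using error_bound[of v] P by simp
  have "Ex K (\<lambda>n. phi (cmod (NN (ci v) (bb v 0) K n))) \<le> Ex K (\<lambda>n. 2 * phi (cmod (?f n)) + 2 * phi (cmod (?f n - NN (ci v) (bb v 0) K n)))"
  proof (rule Ex_mono)
    fix n show "phi (cmod (NN (ci v) (bb v 0) K n)) \<le> 2 * phi (cmod (?f n)) + 2 * phi (cmod (?f n - NN (ci v) (bb v 0) K n))"
      using phi_cmod_add[of "?f n" "- (?f n - NN (ci v) (bb v 0) K n)"] by (simp only: norm_minus_cancel) simp
  qed
  then have "Ex K (\<lambda>n. phi (cmod (NN (ci v) (bb v 0) K n))) \<le> 2 * (9 * P) + 2 * P" unfolding Ex_lin(1,3) using 1 2 by simp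
  then have "Ex K (\<lambda>n. phi (sqrt (SS (ci v) ((cmod (bb v 0))\<^sup>2) K n))) \<le> 160 * P"
    using square_fun_le[of K "ci v" "bb v 0"] by simp
  then show ?thesis using P(1) unfolding P(2) by (subst ennreal_mult[symmetric]) (auto intro: ennreal_leI)
qed

end

section \<open>The way back from walk martingales to polynomials\<close>

context td
begin

text \<open>Corrects \<open>lam\<close> to 1 on the frequencies that the analysis window reaches;
  frequency 0 is carried by the starting value and needs no correction.\<close>

definition mu :: "nat \<Rightarrow> real" where
  "mu j = (if 1 \<le> j \<and> j < B then 1 / lam K j - 1 else 0)"

lemma lam_half:
  assumes "1 \<le> j" "j \<le> k"
  shows "\<bar>lam K j - 1\<bar> \<le> 1 / (2 * (real k + 1))" "1 / 2 \<le> lam K j"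
proof -
  have r: "0 < real r" using r0 by simp
  have "(2 * real j + 1 + 2 ^ j) \<le> 2 * real k + 1 + 2 ^ k" using assms by (intro add_mono power_increasing) auto
  then have "\<bar>lam K j - 1\<bar> \<le> (2 * real k + 1 + 2 ^ k) / real r"
    using lam_near_1[of j r K] assms kH r0 er K_def r divide_right_mono[of "2 * real j + 1 + 2 ^ j" "2 * real k + 1 + 2 ^ k" "real r"] by simp
  also have "\<dots> \<le> 1 / (2 * (real k + 1))" using rb r by (simp add: field_simps)
  finally show 1: "\<bar>lam K j - 1\<bar> \<le> 1 / (2 * (real k + 1))" .
  have "1 / (2 * (real k + 1)) \<le> 1 / 2" by (simp add: field_simps)
  moreover have "1 - lam K j \<le> 1 / (2 * (real k + 1))" using abs_le_D2[OF 1] by (simp only: minus_diff_eq)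
  ultimately show "1 / 2 \<le> lam K j" by argo
qed

lemma mu_sum: "(\<Sum>j\<le>k. \<bar>mu j\<bar>) \<le> 1"
proof -
  have "\<bar>mu j\<bar> \<le> 1 / (real k + 1)" if "j \<le> k" for j
  proof (cases "1 \<le> j \<and> j < B")
    case True
    note l = lam_half[of j] that True
    have "\<bar>mu j\<bar> = \<bar>lam K j - 1\<bar> / lam K j"
    proof -
      have "1 / lam K j - 1 = (1 - lam K j) / lam K j" using l by (simp add: diff_divide_distrib)
      then show ?thesis using l True by (simp add: mu_def abs_divide abs_minus_commute)
    qed
    also have "\<dots> \<le> (1 / (2 * (real k + 1))) / (1 / 2)" using l by (intro frac_le) auto
    also have "\<dots> = 1 / (real k + 1)" by (simp add: field_simps)
    finally show ?thesis .
  next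
    case False
    then have "mu j = 0" unfolding mu_def by (rule if_not_P)
    then show ?thesis by simp
  qed
  then have "(\<Sum>j\<le>k. \<bar>mu j\<bar>) \<le> (\<Sum>j\<le>k. 1 / (real k + 1))" by (intro sum_mono) auto
  also have "\<dots> = 1" by (simp add: add.commute)
  finally show ?thesis .
qed

definition qq :: "(nat \<Rightarrow> nat \<Rightarrow> complex) \<Rightarrow> complex \<Rightarrow> nat \<Rightarrow> complex" where
  "qq c u j = Ex K (\<lambda>n. NN c u K n * cnj (MM K n ^ j))"

text \<open>The synthesis window is 1 up to \<open>B - 1\<close>, where the analysis window
  \<open>vm A B\<close> is supported, and reaches 0 at \<open>Suc k\<close>, so the degree stays at
  most \<open>k\<close>.\<close>

definition pj :: "(nat \<Rightarrow> nat \<Rightarrow> complex) \<Rightarrow> complex \<Rightarrow> vec" where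
  "pj c u i j = (if i = 0 \<and> j \<le> k then cplx (vm (B - 1) (Suc k) j + mu j) * qq c u j else 0)"

lemma NN_lin: "NN (\<lambda>i w. c i w + c' i w) (u + u') i n = NN c u i n + NN c' u' i n"
  "NN (\<lambda>i w. a * c i w) (a * u) i n = a * NN c u i n"
  by (induction i arbitrary: n) (auto simp: algebra_simps)

lemma pj_lin: "pj (\<lambda>i w. c i w + c' i w) (u + u') = pj c u + pj c' u'"
  "pj (\<lambda>i w. a * c i w) (a * u) = vsc a (pj c u)"
proof -
  have "qq (\<lambda>i w. c i w + c' i w) (u + u') j = qq c u j + qq c' u' j" for j
    unfolding qq_def NN_lin distrib_right Ex_lin ..
  then show "pj (\<lambda>i w. c i w + c' i w) (u + u') = pj c u + pj c' u'"
    unfolding pj_def[abs_def] fun_eq_iff plus_fun_apply by (auto simp: distrib_left)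
  have "qq (\<lambda>i w. a * c i w) (a * u) j = a * qq c u j" for j
    unfolding qq_def NN_lin mult.assoc Ex_lin ..
  then show "pj (\<lambda>i w. a * c i w) (a * u) = vsc a (pj c u)"
    unfolding pj_def[abs_def] fun_eq_iff vsc_def by auto
qed

text \<open>Orthogonality of the increments isolates \<open>bb v j * lam K j\<close>, and the factor
  \<open>1 + mu j\<close> cancels \<open>lam\<close>.\<close>

lemma pj_ci:
  assumes "j \<le> k"
  shows "pj (ci v) (bb v 0) 0 j = bb v j"
proof -
  have "Ew i (\<lambda>w. ci v i w * cnj (cc j i w)) = bb v j * cplx (Ew i (\<lambda>w. (cmod (cc j i w))\<^sup>2))" for i
  proof -
    have "Ew i (\<lambda>w. ci v i w * cnj (cc j i w)) = (\<Sum>l\<le>k. bb v l * Ew i (\<lambda>w. cc l i w * cnj (cc j i w)))"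
      unfolding ci_def sum_distrib_right mult.assoc Ew_lin ..
    also have "\<dots> = (\<Sum>l\<in>{j}. bb v l * Ew i (\<lambda>w. cc l i w * cnj (cc j i w)))"
    proof (intro sum.mono_neutral_right ballI)
      fix l assume "l \<in> {..k} - {j}"
      then show "bb v l * Ew i (\<lambda>w. cc l i w * cnj (cc j i w)) = 0" using cc_orth[of l j i] assms kH by simp
    qed (use assms in auto)
    finally show ?thesis unfolding Ew_cc_self[symmetric] by simp
  qed
  then have q: "qq (ci v) (bb v 0) j = bb v 0 * cnj (0 ^ j) + bb v j * cplx (lam K j)"
    unfolding qq_def using NN_MM_cnj[of j K "ci v" "bb v 0"] assms kH unfolding lam_def of_real_sum sum_distrib_left by simp
  \<comment> \<open>The starting value, the frequencies inside the analysis window, and those beyond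
    it, where \<open>bb\<close> vanishes.\<close>
  consider "j = 0" | "1 \<le> j" "j < B" | "1 \<le> j" "B \<le> j" by linarith
  then show ?thesis
  proof cases
    case 1
    then have "cc j i w = 0" for i w by (simp add: cc_def)
    then have "lam K j = 0" by (simp add: lam_def Ew_lin)
    then show ?thesis using q 1 vm_1[OF AB(3), of 0] by (simp add: pj_def mu_def)
  next
    case 2
    have "vm (B - 1) (Suc k) j = 1" using 2 by (intro vm_1 AB(3)) simp
    moreover have "lam K j \<noteq> 0" using lam_half(2)[OF 2(1) assms] by auto
    ultimately show ?thesis using q 2 assms by (simp add: pj_def mu_def power_0_left)
  next
    case 3
    then show ?thesis using q vm_0[OF AB(1), of j] by (simp add: pj_def bb_def)
  qed
qed

text \<open>Only the conjugate powers of the walk are wanted, but \<open>NN_MM_zero\<close> lets the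
  holomorphic half be added for free. This produces the real kernel \<open>hk\<close>, which has the
  positive majorant \<open>hb\<close>.\<close>

lemma pj_kernel:
  "tpoly k (pj c u) \<theta> = Ex K (\<lambda>n. NN c u K n * (cplx (hk (B - 1) (Suc k) \<theta> (MM K n)) + (\<Sum>j\<le>k. cplx (mu j) * cnj (MM K n ^ j) * cis (real j * \<theta>))))"
proof -
  let ?N = "NN c u K" and ?v = "\<lambda>j. cplx (vm (B - 1) (Suc k) j)"
  have "Ex K (\<lambda>n. ?N n * cplx (hk (B - 1) (Suc k) \<theta> (MM K n)))
      = Ex K (\<lambda>n. ?N n + (\<Sum>j=1..k. (?v j * cis (- real j * \<theta>)) * (?N n * MM K n ^ j) + (?v j * cis (real j * \<theta>)) * (?N n * cnj (MM K n ^ j))))"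
    unfolding hk_expand[OF AB(3) order_refl] distrib_left sum_distrib_left complex_cnj_power[symmetric] by (simp only: mult_1_right mult_1_left mult_ac)
  also have "\<dots> = qq c u 0 + (\<Sum>j=1..k. (?v j * cis (- real j * \<theta>)) * Ex K (\<lambda>n. ?N n * MM K n ^ j) + (?v j * cis (real j * \<theta>)) * qq c u j)"
    unfolding Ex_lin(1) Ex_lin(7) Ex_lin(3) qq_def by simp
  also have "\<dots> = qq c u 0 + (\<Sum>j=1..k. ?v j * cis (real j * \<theta>) * qq c u j)"
    using NN_MM_zero[of _ K c u] kH by simp
  also have "\<dots> = (\<Sum>j\<le>k. ?v j * cis (real j * \<theta>) * qq c u j)"
    using vm_1[OF AB(3), of 0] sum.atLeast_Suc_atMost[of 0 k "\<lambda>j. ?v j * cis (real j * \<theta>) * qq c u j"] by (simp add: atMost_atLeast0)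
  finally have 1: "Ex K (\<lambda>n. ?N n * cplx (hk (B - 1) (Suc k) \<theta> (MM K n))) = (\<Sum>j\<le>k. ?v j * cis (real j * \<theta>) * qq c u j)" .
  have "Ex K (\<lambda>n. ?N n * (\<Sum>j\<le>k. cplx (mu j) * cnj (MM K n ^ j) * cis (real j * \<theta>)))
      = Ex K (\<lambda>n. \<Sum>j\<le>k. (cplx (mu j) * cis (real j * \<theta>)) * (?N n * cnj (MM K n ^ j)))"
    unfolding sum_distrib_left by (simp only: mult_ac)
  also have "\<dots> = (\<Sum>j\<le>k. cplx (mu j) * cis (real j * \<theta>) * qq c u j)" unfolding Ex_lin(7) Ex_lin(3) qq_def ..
  finally have 2: "Ex K (\<lambda>n. ?N n * (\<Sum>j\<le>k. cplx (mu j) * cnj (MM K n ^ j) * cis (real j * \<theta>))) = (\<Sum>j\<le>k. cplx (mu j) * cis (real j * \<theta>) * qq c u j)" .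
  show ?thesis unfolding distrib_left Ex_lin(1) 1 2 tpoly_def pj_def sum.distrib[symmetric] by (intro sum.cong) (auto simp: algebra_simps)
qed

lemma pj_kernel_bound:
  "cmod (cplx (hk (B - 1) (Suc k) \<theta> (MM K n)) + (\<Sum>j\<le>k. cplx (mu j) * cnj (MM K n ^ j) * cis (real j * \<theta>))) \<le> hb (B - 1) (Suc k) \<theta> (MM K n) + 1"
proof -
  have "cmod (\<Sum>j\<le>k. cplx (mu j) * cnj (MM K n ^ j) * cis (real j * \<theta>)) \<le> (\<Sum>j\<le>k. \<bar>mu j\<bar>)"
    using MM_le[of K n] by (intro order_trans[OF norm_sum] sum_mono) (simp add: norm_mult norm_power mult_left_le power_le_one)
  then have "cmod (\<Sum>j\<le>k. cplx (mu j) * cnj (MM K n ^ j) * cis (real j * \<theta>)) \<le> 1" using mu_sum by simp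
  moreover have "cmod (cplx (hk (B - 1) (Suc k) \<theta> (MM K n))) \<le> hb (B - 1) (Suc k) \<theta> (MM K n)"
    using hk_le_hb[OF AB(3) MM_le] by simp
  ultimately show ?thesis by (intro order_trans[OF norm_triangle_ineq] add_mono)
qed

text \<open>The majorant has mass \<open>7 = 6 + 1\<close>, the 1 coming from the corrections
  \<open>mu\<close>; \<open>98 = 7^2 * 2\<close> includes the factor of
  \<open>maximal_fun_le\<close>.\<close>

lemma pj_bound: "pmod k (pj c u) \<le> ennreal 98 * ennreal (Ex K (\<lambda>n. phi (sqrt (SS c ((cmod u)\<^sup>2) K n))))"
proof -
  have "pmod k (pj c u) \<le> ennreal (7\<^sup>2) * ennreal (Ex K (\<lambda>n. phi (cmod (NN c u K n))))"
    unfolding pmod_def Ex_nn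
  proof (rule phi_kernel_from_fin[where k="\<lambda>n \<theta>. hb (B - 1) (Suc k) \<theta> (MM K n) + 1"])
    show "sigma_finite_measure tor" by (rule prob_space_imp_sigma_finite) (rule prob_space_torus)
    show "0 < (4 * H) ^ K" using H0 by simp
    have m: "(\<lambda>\<theta>. hb (B - 1) (Suc k) \<theta> (MM K n)) \<in> borel_measurable tor" for n
      by (simp add: measurable_cong_sets[OF sets_torus refl] borel_measurable_continuous_onI hb_cont)
    then show "(\<lambda>\<theta>. hb (B - 1) (Suc k) \<theta> (MM K n) + 1) \<in> borel_measurable tor" for n by simp
    have nn: "0 \<le> hb (B - 1) (Suc k) \<theta> (MM K n)" for \<theta> n by (rule hb_nonneg[OF AB(3) MM_le])
    then show "0 \<le> hb (B - 1) (Suc k) \<theta> (MM K n) + 1" for \<theta> n by (simp add: add_nonneg_nonneg)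
    show "(\<integral>\<^sup>+ \<theta>. ennreal (hb (B - 1) (Suc k) \<theta> (MM K n) + 1) \<partial>tor) \<le> ennreal 7" for n
    proof -
      have "(\<integral>\<^sup>+ \<theta>. ennreal (hb (B - 1) (Suc k) \<theta> (MM K n) + 1) \<partial>tor) = (\<integral>\<^sup>+ \<theta>. ennreal (hb (B - 1) (Suc k) \<theta> (MM K n)) \<partial>tor) + 1"
        using nn m by (simp add: ennreal_plus nn_integral_add torus.emeasure_space_1[unfolded space_torus])
      also have "\<dots> \<le> ennreal 6 + ennreal 1" unfolding hb_nn_mean[OF AB(3) MM_le] using ennreal_leI[OF AB(5)] by (intro add_mono) auto
      finally show ?thesis by (simp flip: ennreal_plus)
    qed
    show "(\<Sum>n<(4 * H) ^ K. hb (B - 1) (Suc k) \<theta> (MM K n) + 1) / real ((4 * H) ^ K) \<le> 7" for \<theta>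
      unfolding Ex_nn[symmetric] Ex_lin(1,5) using hb_mean[OF AB(3), of \<theta>] AB(5) kH by simp
    show "cmod (tpoly k (pj c u) \<theta>) \<le> (\<Sum>n<(4 * H) ^ K. (hb (B - 1) (Suc k) \<theta> (MM K n) + 1) * cmod (NN c u K n)) / real ((4 * H) ^ K)" for \<theta>
      unfolding Ex_nn[symmetric] pj_kernel
      by (intro order_trans[OF Ex_cmod] Ex_mono) (simp only: norm_mult mult.commute[of "cmod (NN _ _ _ _)"] mult_right_mono[OF pj_kernel_bound] norm_ge_zero)
  qed auto
  also have "\<dots> \<le> ennreal (7\<^sup>2) * ennreal (2 * Ex K (\<lambda>n. phi (sqrt (SS c ((cmod u)\<^sup>2) K n))))"
    by (intro mult_left_mono ennreal_leI maximal_fun_le) auto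
  also have "\<dots> = ennreal 98 * ennreal (Ex K (\<lambda>n. phi (sqrt (SS c ((cmod u)\<^sup>2) K n))))"
  proof -
    have "0 \<le> Ex K (\<lambda>n. phi (sqrt (SS c ((cmod u)\<^sup>2) K n)))" unfolding Ex_nn by (intro divide_nonneg_nonneg sum_nonneg) auto
    then show ?thesis by (subst (1 2) ennreal_mult[symmetric]) auto
  qed
  finally show ?thesis .
qed

end

section \<open>Placing two copies of the walk martingale in a dyadic tree\<close>

lemma phi_sqrt_add:
  assumes "0 \<le> a" "0 \<le> b"
  shows "phi (sqrt (a + b)) \<le> phi (sqrt a) + phi (sqrt b)"
  using sqrt_diff_antimono[of 1 "1 + a" b] assms by (simp add: phi_def add.assoc)

lemma sum_union_le:
  fixes f :: "'a \<Rightarrow> real"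
  assumes "finite X" "finite Y" "\<And>x. 0 \<le> f x"
  shows "sum f (X \<union> Y) \<le> sum f X + sum f Y"
  using sum.union_inter[OF assms(1,2), of f] sum_nonneg[of "X \<inter> Y" f] assms(3) by simp

text \<open>With \<open>H\<close> a power of two, one step of the walk is a group of
  \<open>h + 2\<close> binary digits: two idle bits, then the letter.\<close>

locale tdt = td +
  fixes h :: nat
  assumes Hh: "H = 2 ^ h" and h2: "2 \<le> h"
begin

definition L :: nat where "L = h + 2"
definition m :: nat where "m = L * K"

lemma G_L: "4 * H = 2 ^ L" "(4 * H) ^ K = 2 ^ m"
  unfolding m_def L_def Hh power_mult by (simp_all add: power_add)

lemma NN_cong:
  assumes "\<And>i w. i < K \<Longrightarrow> w < (4 * H) ^ i * 4 \<Longrightarrow> c i w = c' i w" "i \<le> K" "n < (4 * H) ^ i"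
  shows "NN c u i n = NN c' u i n"
  using assms(2,3)
proof (induction i arbitrary: n)
  case (Suc i)
  have "n div H < (4 * H) ^ i * 4" using Suc.prems H0 by (simp add: div_less_iff_less_mult mult_ac)
  moreover then have "n div H div 4 < (4 * H) ^ i" by (simp add: div_less_iff_less_mult)
  ultimately show ?case using Suc assms(1) by simp
qed simp

lemma pj_cong:
  assumes "\<And>i w. i < K \<Longrightarrow> w < (4 * H) ^ i * 4 \<Longrightarrow> c i w = c' i w"
  shows "pj c u = pj c' u"
proof -
  have "qq c u j = qq c' u j" for j
    unfolding qq_def Ex_def using NN_cong[of c c' K _ u] assms by simp
  then show ?thesis by (intro ext) (simp add: pj_def)
qed

lemma SS_eq: "SS c s i n = s + (\<Sum>j<i. (cmod (c j (n div 2 ^ (L * (i - j - 1) + h))))\<^sup>2)"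
proof (induction i arbitrary: n)
  case (Suc i)
  have "n div H div 4 div 2 ^ (L * (i - j - 1) + h) = n div 2 ^ (L * (Suc i - j - 1) + h)" if "j < i" for j
  proof -
    have "Suc i - j - 1 = Suc (i - j - 1)" using that by simp
    then have "(2::nat) ^ (L * (Suc i - j - 1) + h) = (H * 4) * 2 ^ (L * (i - j - 1) + h)"
      using G_L(1) by (simp add: power_add mult_ac)
    then show ?thesis by (simp only: div_mult2_eq)
  qed
  moreover have "n div H = n div 2 ^ h" by (simp only: Hh)
  ultimately show ?case using Suc by simp
qed simp

text \<open>Row \<open>L * i + 2\<close> is indexed by addresses containing one idle bit of step
  \<open>i\<close>, row \<open>L * i + 3\<close> by addresses containing both. The first copy
  forgets the last idle bit through \<open>w div 2\<close>, so the two copies occupy different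
  rows.\<close>

definition C1 :: "vec \<Rightarrow> nat \<Rightarrow> nat \<Rightarrow> complex" where "C1 y i w = y (L * i + 2) (w div 2)"
definition C2 :: "vec \<Rightarrow> nat \<Rightarrow> nat \<Rightarrow> complex" where "C2 y i w = y (L * i + 3) w"

lemma anc_eq:
  assumes "i < K"
  shows "anc m (L * i + 3) n = n div 2 ^ (L * (K - i - 1) + h)"
    "anc m (L * i + 2) n = n div 2 ^ (L * (K - i - 1) + h) div 2"
    "L * i + 3 \<le> m"
proof -
  obtain d where d: "K = i + Suc d" using less_imp_Suc_add[OF assms] by auto
  have m: "m = L * i + L * d + L" unfolding m_def d by (simp add: algebra_simps)
  have "m - (L * i + 2) = L * (K - i - 1) + h" unfolding m d by (simp add: L_def)
  then show "anc m (L * i + 3) n = n div 2 ^ (L * (K - i - 1) + h)" unfolding anc_def by simp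
  have a: "m - (L * i + 2 - 1) = Suc (L * (K - i - 1) + h)" unfolding m d by (simp add: L_def)
  show "anc m (L * i + 2) n = n div 2 ^ (L * (K - i - 1) + h) div 2"
    unfolding anc_def a by (simp only: power_Suc2 div_mult2_eq)
  show "L * i + 3 \<le> m" unfolding m using h2 by (simp add: L_def)
qed

lemma anc_0: "n < 2 ^ m \<Longrightarrow> anc m 0 n = 0" "n < 2 ^ m \<Longrightarrow> anc m 1 n = 0"
  by (simp_all add: anc_def)

lemma idx: "inj (\<lambda>i. L * i + 2)" "inj (\<lambda>i. L * i + 3)" "4 \<le> L"
proof -
  show L: "4 \<le> L" using h2 by (simp add: L_def)
  show "inj (\<lambda>i. L * i + 2)" "inj (\<lambda>i. L * i + 3)" using L by (auto simp: inj_def)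
qed

lemma I_le: "(\<lambda>i. L * i + 2) ` {..<K} \<subseteq> {..m}" "(\<lambda>i. L * i + 3) ` {..<K} \<subseteq> {..m}"
proof (intro image_subsetI)
  fix i assume "i \<in> {..<K}"
  then show "L * i + 2 \<in> {..m}" using anc_eq(3)[of i] by simp
next
  show "(\<lambda>i. L * i + 3) ` {..<K} \<subseteq> {..m}" using anc_eq(3) by auto
qed

lemma m_pos: "1 \<le> m"
  unfolding m_def L_def K_def using r0 by (cases "r ^ 6") auto

text \<open>Each copy sits in rows of its own, so its square function is a partial sum of that of
  the tree.\<close>

lemma SS_tsq:
  assumes "n < 2 ^ m"
  shows "SS (C1 y) ((cmod (y 0 0))\<^sup>2) K n \<le> tsq m y n" "SS (C2 y) ((cmod (y 1 0))\<^sup>2) K n \<le> tsq m y n"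
proof -
  let ?f = "\<lambda>j. (cmod (y j (anc m j n)))\<^sup>2"
  have "SS (C1 y) ((cmod (y 0 0))\<^sup>2) K n = ?f 0 + (\<Sum>i<K. ?f (L * i + 2))"
    unfolding SS_eq C1_def using anc_0[OF assms] anc_eq(2) by simp
  also have "\<dots> = sum ?f (insert 0 ((\<lambda>i. L * i + 2) ` {..<K}))"
    using idx by (subst sum.insert) (auto simp: sum.reindex inj_on_def)
  also have "\<dots> \<le> tsq m y n" unfolding tsq_def using I_le(1) by (intro sum_mono2) auto
  finally show "SS (C1 y) ((cmod (y 0 0))\<^sup>2) K n \<le> tsq m y n" .
  have "SS (C2 y) ((cmod (y 1 0))\<^sup>2) K n = ?f 1 + (\<Sum>i<K. ?f (L * i + 3))"
    unfolding SS_eq C2_def using anc_0[OF assms] anc_eq(1) by simp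
  also have "\<dots> = sum ?f (insert 1 ((\<lambda>i. L * i + 3) ` {..<K}))"
    using idx by (subst sum.insert) (auto simp: sum.reindex inj_on_def)
  also have "\<dots> \<le> tsq m y n" unfolding tsq_def using I_le(2) m_pos by (intro sum_mono2) auto
  finally show "SS (C2 y) ((cmod (y 1 0))\<^sup>2) K n \<le> tsq m y n" .
qed

text \<open>Rows 0 and 1 hold the two starting values, one row of each idle pair holds the
  increments of one copy, and all other rows vanish. The argument \<open>2 * p\<close> sets the
  forgotten idle bit to 0.\<close>

definition Jt :: "(nat \<Rightarrow> nat \<Rightarrow> complex) \<Rightarrow> complex \<Rightarrow> (nat \<Rightarrow> nat \<Rightarrow> complex) \<Rightarrow> complex \<Rightarrow> vec" where
  "Jt c1 u1 c2 u2 j p = (if \<not> (j \<le> m \<and> p < 2 ^ (j - 1)) then 0 else if j = 0 then u1 else if j = 1 then u2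
     else if (j - 2) mod L = 0 then c1 ((j - 2) div L) (2 * p) else if (j - 3) mod L = 0 then c2 ((j - 3) div L) p else 0)"

lemma Jt_val:
  assumes "i < K"
  shows "p < 2 ^ (L * i + 1) \<Longrightarrow> Jt c1 u1 c2 u2 (L * i + 2) p = c1 i (2 * p)"
    "p < 2 ^ (L * i + 2) \<Longrightarrow> Jt c1 u1 c2 u2 (L * i + 3) p = c2 i p"
proof -
  have m: "L * i + 3 \<le> m" by (rule anc_eq(3)[OF assms])
  then show "p < 2 ^ (L * i + 1) \<Longrightarrow> Jt c1 u1 c2 u2 (L * i + 2) p = c1 i (2 * p)"
    using idx(3) by (simp add: Jt_def)
  have "(L * i + 1) mod L = 1" using idx(3) mod_mult_self1[of 1 i L] by (simp add: mult.commute)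
  then show "p < 2 ^ (L * i + 2) \<Longrightarrow> Jt c1 u1 c2 u2 (L * i + 3) p = c2 i p"
    using idx(3) m by (simp add: Jt_def)
qed

lemma Jt_0: "Jt c1 u1 c2 u2 0 0 = u1" "Jt c1 u1 c2 u2 1 0 = u2"
  using m_pos by (simp_all add: Jt_def)

lemma anc_less: "n < 2 ^ m \<Longrightarrow> j \<le> m \<Longrightarrow> anc m j n < 2 ^ (j - 1)"
  unfolding anc_def by (simp add: div_less_iff_less_mult flip: power_add)

text \<open>The hypothesis says that the first copy ignores the last idle bit, so storing it under
  \<open>w div 2\<close> loses nothing.\<close>

lemma tsq_Jt:
  assumes n: "n < 2 ^ m" and c1: "\<And>i w. c1 i (2 * (w div 2)) = c1 i w"
  shows "tsq m (Jt c1 u1 c2 u2) n \<le> SS c1 ((cmod u1)\<^sup>2) K n + SS c2 ((cmod u2)\<^sup>2) K n"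
proof -
  let ?y = "Jt c1 u1 c2 u2"
  let ?f = "\<lambda>j. (cmod (?y j (anc m j n)))\<^sup>2"
  let ?I = "(\<lambda>i. L * i + 2) ` {..<K}" and ?I' = "(\<lambda>i. L * i + 3) ` {..<K}"
  have z: "?f j = 0" if j: "j \<le> m" "j \<notin> {0, 1} \<union> (?I \<union> ?I')" for j
  proof -
    have "(j - 2) mod L \<noteq> 0"
    proof
      assume "(j - 2) mod L = 0"
      then have "L * ((j - 2) div L) = j - 2" by (metis add_0_right mult_div_mod_eq)
      then have e: "j = L * ((j - 2) div L) + 2" using j by (cases "j < 2") (auto simp: less_2_cases_iff)
      then have "L * ((j - 2) div L) < L * K" using j(1) unfolding m_def by linarith
      then have "j \<in> ?I" using e by (intro image_eqI[of _ _ "(j - 2) div L"]) auto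
      then show False using j by simp
    qed
    moreover have "(j - 3) mod L \<noteq> 0"
    proof
      assume a: "(j - 3) mod L = 0"
      have "j \<noteq> 2" using calculation by auto
      moreover have "L * ((j - 3) div L) = j - 3" using a by (metis add_0_right mult_div_mod_eq)
      ultimately have e: "j = L * ((j - 3) div L) + 3" using j by (cases "j < 3") auto
      then have "L * ((j - 3) div L) < L * K" using j(1) unfolding m_def by linarith
      then have "j \<in> ?I'" using e by (intro image_eqI[of _ _ "(j - 3) div L"]) auto
      then show False using j by simp
    qed
    ultimately show ?thesis using j by (simp add: Jt_def)
  qed
  have a3: "L * i + 3 \<le> m" if "i < K" for i using anc_eq(3)[OF that] .
  have "tsq m ?y n = sum ?f ({0, 1} \<union> (?I \<union> ?I'))"
    unfolding tsq_def
  proof (intro sum.mono_neutral_right ballI)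
    show "{0, 1} \<union> (?I \<union> ?I') \<subseteq> {..m}" using m_pos I_le(1) I_le(2) by auto
    show "?f j = 0" if "j \<in> {..m} - ({0, 1} \<union> (?I \<union> ?I'))" for j using that by (intro z) auto
  qed auto
  also have "\<dots> \<le> sum ?f {0, 1} + (sum ?f ?I + sum ?f ?I')"
    by (rule order_trans[OF sum_union_le add_left_mono[OF sum_union_le]]) auto
  also have "sum ?f {0, 1} = (cmod u1)\<^sup>2 + (cmod u2)\<^sup>2" using anc_0[OF n] Jt_0 by simp
  also have "sum ?f ?I = (\<Sum>i<K. (cmod (c1 i (n div 2 ^ (L * (K - i - 1) + h))))\<^sup>2)"
  proof -
    have "?f (L * i + 2) = (cmod (c1 i (n div 2 ^ (L * (K - i - 1) + h))))\<^sup>2" if i: "i < K" for i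
    proof -
      have l: "anc m (L * i + 2) n < 2 ^ (L * i + 1)" using anc_less[OF n, of "L * i + 2"] a3[OF i] by simp
      show ?thesis unfolding Jt_val(1)[OF i l] by (simp only: anc_eq(2)[OF i] c1)
    qed
    then show ?thesis using idx by (subst sum.reindex) (auto simp: inj_on_def)
  qed
  also have "sum ?f ?I' = (\<Sum>i<K. (cmod (c2 i (n div 2 ^ (L * (K - i - 1) + h))))\<^sup>2)"
  proof -
    have "?f (L * i + 3) = (cmod (c2 i (n div 2 ^ (L * (K - i - 1) + h))))\<^sup>2" if i: "i < K" for i
    proof -
      have l: "anc m (L * i + 3) n < 2 ^ (L * i + 2)" using anc_less[OF n, of "L * i + 3"] a3[OF i] by simp
      show ?thesis unfolding Jt_val(2)[OF i l] by (simp only: anc_eq(1)[OF i])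
    qed
    then show ?thesis using idx by (subst sum.reindex) (auto simp: inj_on_def)
  qed
  finally show ?thesis unfolding SS_eq by simp
qed

lemma tmod_Ex: "tmod m y = ennreal (Ex K (\<lambda>n. phi (sqrt (tsq m y n))))"
  unfolding tmod_def Ex_nn G_L(2) by simp

lemma Ex_phi_mono: "(\<And>n. n < 2 ^ m \<Longrightarrow> f n \<le> g n) \<Longrightarrow> (\<And>n. 0 \<le> f n) \<Longrightarrow> Ex K (\<lambda>n. phi (f n)) \<le> Ex K (\<lambda>n. phi (g n))"
  unfolding Ex_nn G_L(2) by (intro divide_right_mono sum_mono phi_mono) auto

lemma ci_mod: "ci v i (2 * (w div 2)) = ci v i w"
proof -
  have e: "2 * (w div 2) div 4 = w div 4" by presburger
  show ?thesis unfolding ci_def cc_def e ..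
qed

definition Jv :: "vec \<Rightarrow> vec" where
  "Jv v = Jt (ci v) (bb v 0) (ci (rv k v)) (bb (rv k v) 0)"

text \<open>The second copy is reversed back before the two halves are added.\<close>

definition Pv :: "vec \<Rightarrow> vec" where
  "Pv y = pj (C1 y) (y 0 0) + rv k (pj (C2 y) (y 1 0))"

lemma Jv_bound: "tmod m (Jv v) \<le> ennreal 320 * pmod k v"
proof -
  let ?S = "\<lambda>v. SS (ci v) ((cmod (bb v 0))\<^sup>2) K"
  have nn: "0 \<le> Ex K (\<lambda>n. phi (f n))" for f unfolding Ex_nn by (intro divide_nonneg_nonneg sum_nonneg) auto
  have S: "0 \<le> ?S v n" for v n by (rule SS_nonneg) simp
  have "Ex K (\<lambda>n. phi (sqrt (tsq m (Jv v) n))) \<le> Ex K (\<lambda>n. phi (sqrt (?S v n + ?S (rv k v) n)))"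
    unfolding Jv_def by (rule Ex_phi_mono) (auto intro!: tsq_Jt ci_mod)
  also have "\<dots> \<le> Ex K (\<lambda>n. phi (sqrt (?S v n)) + phi (sqrt (?S (rv k v) n)))"
    by (intro Ex_mono phi_sqrt_add S)
  finally have "tmod m (Jv v) \<le> ennreal (Ex K (\<lambda>n. phi (sqrt (?S v n))) + Ex K (\<lambda>n. phi (sqrt (?S (rv k v) n))))"
    unfolding tmod_Ex Ex_lin(1) by (rule ennreal_leI)
  also have "\<dots> = ennreal (Ex K (\<lambda>n. phi (sqrt (?S v n)))) + ennreal (Ex K (\<lambda>n. phi (sqrt (?S (rv k v) n))))"
    using nn by (intro ennreal_plus)
  also have "\<dots> \<le> ennreal 160 * pmod k v + ennreal 160 * pmod k (rv k v)" by (intro add_mono embed_bound)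
  also have "\<dots> = ennreal 320 * pmod k v" unfolding pmod_rv by (simp flip: distrib_right)
  finally show ?thesis .
qed

lemma pj_C_bound: "pmod k (pj (C1 y) (y 0 0)) \<le> ennreal 98 * tmod m y" "pmod k (pj (C2 y) (y 1 0)) \<le> ennreal 98 * tmod m y"
  unfolding tmod_Ex
  by (intro order_trans[OF pj_bound] mult_left_mono ennreal_leI Ex_phi_mono real_sqrt_le_mono SS_tsq real_sqrt_ge_zero SS_nonneg; simp)+

lemma rv_in: "rv k v \<in> fst (trig_block k)" "pj c u \<in> fst (trig_block k)"
  by (auto simp: trig_block_def rv_def pj_def)

lemma Pv_bound: "pmod k (Pv y) \<le> ennreal 400 * tmod m y"
proof -
  have "pmod k (Pv y) \<le> 2 * pmod k (pj (C1 y) (y 0 0)) + 2 * pmod k (rv k (pj (C2 y) (y 1 0)))"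
    unfolding Pv_def using good_blockD(5)[OF good_trig_block rv_in(2) rv_in(1)] by (simp add: trig_block_def)
  also have "\<dots> \<le> 2 * (ennreal 98 * tmod m y) + 2 * (ennreal 98 * tmod m y)"
    unfolding pmod_rv by (intro add_mono mult_left_mono pj_C_bound) auto
  also have "\<dots> = ennreal 392 * tmod m y" by (simp add: mult.assoc[symmetric] flip: distrib_right)
  also have "\<dots> \<le> ennreal 400 * tmod m y" by (intro mult_right_mono ennreal_leI) auto
  finally show ?thesis .
qed

text \<open>Each copy returns its windowed coefficients, and \<open>vm_sum\<close> recombines the
  two windows.\<close>

lemma Pv_Jv:
  assumes "v \<in> fst (trig_block k)"
  shows "Pv (Jv v) = v"
proof -
  have le: "(4 * H) ^ i * 4 = 2 ^ (L * i + 2)" for i unfolding G_L(1) power_mult[symmetric] by (simp add: power_add)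
  have 1: "pj (C1 (Jv v)) (Jv v 0 0) = pj (ci v) (bb v 0)"
  proof -
    have "C1 (Jv v) i w = ci v i w" if "i < K" "w < (4 * H) ^ i * 4" for i w
      using Jt_val(1)[OF that(1), of "w div 2"] that(2) ci_mod unfolding le C1_def Jv_def by (simp add: div_less_iff_less_mult)
    from pj_cong[OF this] show ?thesis by (simp add: Jv_def Jt_0)
  qed
  have 2: "pj (C2 (Jv v)) (Jv v 1 0) = pj (ci (rv k v)) (bb (rv k v) 0)"
  proof -
    have "C2 (Jv v) i w = ci (rv k v) i w" if "i < K" "w < (4 * H) ^ i * 4" for i w
      using Jt_val(2)[OF that(1), of w] that(2) unfolding le C2_def Jv_def by simp
    from pj_cong[OF this] show ?thesis by (simp add: Jv_def Jt_0[unfolded One_nat_def])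
  qed
  have "Pv (Jv v) i j = v i j" for i j
  proof (cases "i = 0 \<and> j \<le> k")
    case True
    then have "Pv (Jv v) i j = bb v j + bb (rv k v) (k - j)"
      unfolding Pv_def 1 2 plus_fun_apply by (simp add: rv_def pj_ci)
    also have "\<dots> = cplx (vm A B j + vm A B (k - j)) * v 0 j"
      using True by (simp add: bb_def rv_def algebra_simps)
    finally show ?thesis using True vm_sum by simp
  next
    case False
    then have "v i j = 0" using assms by (auto simp: trig_block_def)
    then show ?thesis using False unfolding Pv_def plus_fun_apply by (auto simp: rv_def pj_def)
  qed
  then show ?thesis by blast
qed

lemma trig_fac: "fac 400 (trig_block k) (tree_block m)"
  unfolding fac_def
proof (rule exI[of _ Jv], rule exI[of _ Pv], intro conjI ballI)
  have rl: "rv k (x + y) = rv k x + rv k y" "rv k (vsc c x) = vsc c (rv k x)" for x y c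
    by (auto simp: fun_eq_iff rv_def vsc_def)
  have bl: "bb (x + y) j = bb x j + bb y j" "bb (vsc c x) j = c * bb x j" for x y c j
    by (simp_all add: bb_def vsc_def algebra_simps)
  have cl: "ci (x + y) i w = ci x i w + ci y i w" "ci (vsc c x) i w = c * ci x i w" for x y c i w
    by (simp_all add: ci_def bl distrib_right sum.distrib sum_distrib_left mult.assoc)
  show "lin_on (fst (trig_block k)) Jv"
  proof -
    have "Jv (x + y) j p = Jv x j p + Jv y j p" "Jv (vsc c x) j p = c * Jv x j p" for x y c j p
      unfolding Jv_def rl Jt_def bl cl by simp_all
    then show ?thesis unfolding lin_on_def fun_eq_iff plus_fun_apply vsc_def[of _ "Jv _"] by simp
  qed
  have p2: "pj (C2 (x + y)) ((x + y) 1 0) = pj (C2 x) (x 1 0) + pj (C2 y) (y 1 0)" "pj (C1 (x + y)) ((x + y) 0 0) = pj (C1 x) (x 0 0) + pj (C1 y) (y 0 0)" for x y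
    unfolding pj_lin[symmetric] by (simp_all add: C1_def[abs_def] C2_def[abs_def] plus_fun_def)
  have p3: "pj (C2 (vsc c x)) (vsc c x 1 0) = vsc c (pj (C2 x) (x 1 0))" "pj (C1 (vsc c x)) (vsc c x 0 0) = vsc c (pj (C1 x) (x 0 0))" for c x
    unfolding pj_lin[symmetric] by (simp_all add: C1_def[abs_def] C2_def[abs_def] vsc_def)
  show "lin_on (fst (tree_block m)) Pv"
    unfolding lin_on_def Pv_def p2 p3 rl by (auto simp: fun_eq_iff vsc_def algebra_simps)
  show "Jv v \<in> fst (tree_block m)" for v by (auto simp: tree_block_def Jv_def Jt_def)
  show "Pv (Jv v) = v" if "v \<in> fst (trig_block k)" for v by (rule Pv_Jv[OF that])
  show "snd (tree_block m) (Jv v) \<le> ennreal 400 * snd (trig_block k) v" for v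
  proof -
    have "tmod m (Jv v) \<le> ennreal 400 * pmod k v"
      by (rule order_trans[OF Jv_bound]) (intro mult_right_mono ennreal_leI; simp)
    then show ?thesis by (simp add: tree_block_def trig_block_def)
  qed
  show "Pv y \<in> fst (trig_block k)" for y
    unfolding Pv_def by (intro good_blockD(2)[OF good_trig_block] rv_in)
  show "snd (trig_block k) (Pv y) \<le> ennreal 400 * snd (tree_block m) y" for y
    using Pv_bound by (simp add: tree_block_def trig_block_def)
qed

end

theorem trig_fac_tree:
  assumes "1 \<le> k"
  shows "\<exists>m. fac 400 (trig_block k) (tree_block m)"
proof -
  \<comment> \<open>Equality in the constraint \<open>rb\<close>. The alphabet size
    \<open>2 ^ (k + 3)\<close> used below exceeds \<open>Suc k\<close> and is divisible by
    4.\<close>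
  define r where "r = 2 * (k + 1) * (2 * k + 1 + 2 ^ k)"
  have r0: "0 < r" unfolding r_def by simp
  have "Suc k < 2 ^ Suc k" by (rule less_exp)
  also have "(2::nat) ^ Suc k \<le> 2 ^ (k + 3)" by (rule power_increasing) auto
  finally have kH: "Suc k < 2 ^ (k + 3)" .
  have "(2::nat) ^ 2 dvd 2 ^ (k + 3)" by (rule le_imp_power_dvd) simp
  moreover have "2 * (real k + 1) * (2 * real k + 1 + 2 ^ k) = real r" unfolding r_def by (simp add: algebra_simps)
  ultimately interpret tdt "2 ^ (k + 3)" "1 / real r ^ 2" k r "k + 3"
    by unfold_locales (use assms r0 kH in auto)
  show ?thesis using trig_fac by blast
qed

section \<open>Trees inside larger trees, and the isomorphism of the modular sums\<close>

lemma tmod_extend: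
  assumes "k \<le> b"
  shows "tmod k y = ennreal ((\<Sum>n<2^b. phi (sqrt (\<Sum>j\<le>k. (cmod (y j (anc b j n)))\<^sup>2))) / 2^b)"
proof -
  let ?g = "\<lambda>n. phi (sqrt (\<Sum>j\<le>k. (cmod (y j (anc b j n)))\<^sup>2))"
  have "anc b j (p * 2 ^ (b - k) + q) = anc k j p" if "q < 2 ^ (b - k)" "j \<le> k" for j p q
  proof -
    have "b - (j - 1) = (b - k) + (k - (j - 1))" using assms that by simp
    then have "(2::nat) ^ (b - (j - 1)) = 2 ^ (b - k) * 2 ^ (k - (j - 1))" by (simp only: power_add)
    then show ?thesis using that by (simp add: anc_def div_mult2_eq)
  qed
  then have "(\<Sum>n<2^k * 2^(b - k). ?g n) = (\<Sum>p<2^k. \<Sum>q<(2::nat)^(b - k). phi (sqrt (tsq k y p)))"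
    unfolding sum_blocks tsq_def by (intro sum.cong refl) simp
  then have "(\<Sum>n<2^b. ?g n) = 2^(b - k) * (\<Sum>p<2^k. phi (sqrt (tsq k y p)))"
    using assms by (simp add: sum_distrib_left flip: power_add)
  moreover have "(2::real) ^ b = 2 ^ (b - k) * 2 ^ k" using assms by (simp flip: power_add)
  ultimately show ?thesis unfolding tmod_def by simp
qed

text \<open>Inclusion and truncation of rows; truncating only removes terms of the square function,
  so the constant is 1.\<close>

lemma tree_fac_tree:
  assumes "k \<le> b"
  shows "fac 1 (tree_block k) (tree_block b)"
  unfolding fac_def
proof (rule exI[of _ "\<lambda>y. y"], rule exI[of _ "\<lambda>y j p. if j \<le> k then y j p else 0"], intro conjI ballI)
  show "lin_on (fst (tree_block k)) (\<lambda>y. y)" by (simp add: lin_on_def)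
  show "lin_on (fst (tree_block b)) (\<lambda>y j p. if j \<le> k then y j p else 0)"
    by (auto simp: lin_on_def vsc_def fun_eq_iff)
next
  fix y assume y: "y \<in> fst (tree_block k)"
  then have z: "y j p = 0" if "\<not> j \<le> k" for j p using that by (auto simp: tree_block_def)
  show "y \<in> fst (tree_block b)" using y assms by (auto simp: tree_block_def)
  show "(\<lambda>j p. if j \<le> k then y j p else 0) = y" using z by (auto simp: fun_eq_iff)
  have "tsq b y n = (\<Sum>j\<le>k. (cmod (y j (anc b j n)))\<^sup>2)" for n
    unfolding tsq_def using assms z by (intro sum.mono_neutral_right) auto
  then show "snd (tree_block b) y \<le> ennreal 1 * snd (tree_block k) y"
    using tmod_extend[OF assms, of y] by (simp add: tree_block_def tmod_def[of b])
next
  fix y assume y: "y \<in> fst (tree_block b)"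
  show "(\<lambda>j p. if j \<le> k then y j p else 0) \<in> fst (tree_block k)" using y assms by (auto simp: tree_block_def)
  have "(\<Sum>j\<le>k. (cmod (y j (anc b j n)))\<^sup>2) \<le> tsq b y n" for n
    unfolding tsq_def using assms by (intro sum_mono2) auto
  then have "tmod k (\<lambda>j p. if j \<le> k then y j p else 0) \<le> tmod b y"
    unfolding tmod_extend[OF assms] tmod_def[of b]
    by (intro ennreal_leI divide_right_mono sum_mono phi_mono) (auto simp: sum_nonneg)
  then show "snd (tree_block k) (\<lambda>j p. if j \<le> k then y j p else 0) \<le> ennreal 1 * snd (tree_block b) y"
    by (simp add: tree_block_def)
qed

lemma limsup_infinite:
  assumes "limsup (\<lambda>n. ereal (real (a n))) = \<infinity>"
  shows "infinite {n. K \<le> a n}"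
proof
  assume "finite {n. K \<le> a n}"
  then have "eventually (\<lambda>n. \<not> K \<le> a n) sequentially"
    unfolding cofinite_eq_sequentially[symmetric] eventually_cofinite by simp
  then have "eventually (\<lambda>n. ereal (real (a n)) \<le> ereal (real K)) sequentially" by eventually_elim simp
  then have "limsup (\<lambda>n. ereal (real (a n))) \<le> ereal (real K)" by (rule Limsup_bounded)
  then show False using assms by simp
qed

text \<open>Both families are compared with the sum of all trees, each repeated infinitely often,
  and are never matched index by index.\<close>

theorem fiso_trig_tree:
  assumes a: "\<And>n. a n > 0" and "limsup (\<lambda>n. ereal (real (a n))) = \<infinity>" and "limsup (\<lambda>n. ereal (real (b n))) = \<infinity>"
  shows "fiso (\<lambda>n. trig_block (a n)) (\<lambda>n. tree_block (b n))"
proof -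
  have "fiso (\<lambda>n. trig_block (a n)) (\<lambda>(k, i :: nat). tree_block k)"
  proof (rule fiso_universal[where C=400])
    show "\<exists>m. fac 400 (trig_block (a n)) (tree_block m)" for n using a[of n] by (intro trig_fac_tree) simp
    fix k
    obtain a0 where a0: "\<And>a. a0 \<le> a \<Longrightarrow> fac 288 (tree_block k) (trig_block a)" using tree_fac_trig by blast
    have "{n. a0 \<le> a n} \<subseteq> {n. fac 400 (tree_block k) (trig_block (a n))}" using fac_mono[OF a0, of _ 400] by auto
    then show "infinite {n. fac 400 (tree_block k) (trig_block (a n))}" using limsup_infinite[OF assms(2)] infinite_super by blast
  qed (auto simp: good_trig_block good_tree_block)
  moreover have "fiso (\<lambda>n. tree_block (b n)) (\<lambda>(k, i :: nat). tree_block k)"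
  proof (rule fiso_universal[where C=1])
    show "\<exists>m. fac 1 (tree_block (b n)) (tree_block m)" for n using tree_fac_tree by blast
    fix k
    have "{n. k \<le> b n} \<subseteq> {n. fac 1 (tree_block k) (tree_block (b n))}" using tree_fac_tree by auto
    then show "infinite {n. fac 1 (tree_block k) (tree_block (b n))}" using limsup_infinite[OF assms(3)] infinite_super by blast
  qed (auto simp: good_tree_block)
  ultimately show ?thesis using fiso_trans fiso_sym[OF good_tree_block] by blast
qed

subsection \<open>Dyadic step functions\<close>

text \<open>The inverse Haar transform: the value of the \<open>n\<close>-th conditional expectation
  on cell \<open>K\<close>, with sign + on the left (even) child.\<close>

fun Wt :: "vec \<Rightarrow> nat \<Rightarrow> nat \<Rightarrow> complex" where
  "Wt y 0 K = y 0 K"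
| "Wt y (Suc n) K = Wt y n (K div 2) + (if even K then y (Suc n) (K div 2) else - y (Suc n) (K div 2))"

definition dcell :: "nat \<Rightarrow> real \<Rightarrow> nat" where "dcell n x = nat \<lfloor>2 ^ n * x\<rfloor>"

lemma dcell_div: "dcell (n + d) x div 2 ^ d = dcell n x"
proof (cases "x < 0")
  \<comment> \<open>Negative points fall into cell 0 on every level, since \<open>nat\<close>
    truncates.\<close>
  case True
  have "dcell i x = 0" for i
  proof -
    have "2 ^ i * x \<le> 0" using True by (simp add: mult_nonneg_nonpos)
    then have "\<lfloor>2 ^ i * x\<rfloor> \<le> 0" by (metis floor_mono floor_zero)
    then show ?thesis by (simp add: dcell_def)
  qed
  then show ?thesis by simp
next
  case False
  have "\<lfloor>2 ^ n * x\<rfloor> = \<lfloor>2 ^ (n + d) * x / real_of_int (2 ^ d)\<rfloor>" by (simp add: power_add)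
  also have "\<dots> = \<lfloor>2 ^ (n + d) * x\<rfloor> div 2 ^ d" by (rule floor_divide_real_eq_div) simp
  finally have "dcell n x = nat (\<lfloor>2 ^ (n + d) * x\<rfloor> div 2 ^ d)" by (simp add: dcell_def)
  also have "\<dots> = nat \<lfloor>2 ^ (n + d) * x\<rfloor> div nat (2 ^ d)" using False by (intro nat_div_distrib) simp
  finally show ?thesis by (simp add: dcell_def nat_power_eq)
qed

lemma dcell_Suc: "dcell (Suc n) x div 2 = dcell n x"
  using dcell_div[of n 1 x] by simp

lemma dcell_iff: "0 \<le> x \<Longrightarrow> x \<in> dyad_int n K \<longleftrightarrow> dcell n x = K"
proof -
  assume x: "0 \<le> x"
  have "x \<in> dyad_int n K \<longleftrightarrow> real K \<le> 2 ^ n * x \<and> 2 ^ n * x < real K + 1"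
    by (simp add: dyad_int_def field_simps)
  also have "\<dots> \<longleftrightarrow> \<lfloor>2 ^ n * x\<rfloor> = int K" by (simp add: floor_eq_iff)
  also have "\<dots> \<longleftrightarrow> dcell n x = K" using x by (auto simp: dcell_def)
  finally show ?thesis .
qed

lemma dyad_int_nonneg: "x \<in> dyad_int n K \<Longrightarrow> 0 \<le> x"
  unfolding dyad_int_def by (auto intro: order_trans[rotated])

text \<open>The case distinction is needed because \<open>dcell\<close> sends negative points to
  cell 0, whereas step functions vanish there.\<close>

definition fstep :: "nat \<Rightarrow> vec \<Rightarrow> real \<Rightarrow> complex" where
  "fstep b y x = (if x < 0 then 0 else Wt y b (dcell b x))"

lemma step_sum:
  fixes v :: "nat \<Rightarrow> complex"
  assumes "\<And>k. 2 ^ b \<le> k \<Longrightarrow> v k = 0"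
  shows "(\<Sum>k<2^b. v k * indicator (dyad_int b k) x) = (if x < 0 then 0 else v (dcell b x))"
proof (cases "x < 0")
  case True
  then have "x \<notin> dyad_int b k" for k using dyad_int_nonneg by force
  then show ?thesis using True by simp
next
  case False
  then have "(\<Sum>k<2^b. v k * indicator (dyad_int b k) x) = (\<Sum>k<2^b. if dcell b x = k then v k else 0)"
    using dcell_iff[of x b] by (intro sum.cong) (auto simp: indicator_def)
  then show ?thesis using False assms by (simp add: sum.delta not_less)
qed

lemma Wt_zero:
  assumes "y \<in> fst (tree_block b)" "2 ^ n \<le> K"
  shows "Wt y n K = 0"
  using assms(2)
proof (induction n arbitrary: K)
  case 0 then show ?case using assms(1) by (auto simp: tree_block_def)
next
  case (Suc n)
  have l: "2 ^ n \<le> K div 2" using Suc.prems by auto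
  then have "y (Suc n) (K div 2) = 0" using assms(1) by (auto simp: tree_block_def)
  then show ?case using Suc.IH[OF l] by simp
qed

lemma Wt_const:
  assumes "y \<in> fst (tree_block b)"
  shows "Wt y (b + d) K = Wt y b (K div 2 ^ d)"
proof (induction d arbitrary: K)
  case (Suc d)
  have "y (Suc (b + d)) p = 0" for p using assms by (auto simp: tree_block_def)
  then show ?case using Suc[of "K div 2"] by (simp flip: div_mult2_eq)
qed simp

lemma fstep_dyadic:
  assumes "y \<in> fst (tree_block b)"
  shows "dyadic_step b (fstep b y)"
  unfolding dyadic_step_def fstep_def[abs_def] using step_sum[of b "Wt y b"] Wt_zero[OF assms] by (intro exI[of _ "Wt y b"]) auto

lemma dyadic_fstep:
  assumes "dyadic_step b f"
  shows "\<exists>y\<in>fst (tree_block b). f = fstep b y"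
proof -
  obtain v0 where f: "f = (\<lambda>x. \<Sum>k<2^b. v0 k * indicator (dyad_int b k) x)" using assms unfolding dyadic_step_def by blast
  define v where "v k = (if k < 2 ^ b then v0 k else 0)" for k
  \<comment> \<open>\<open>U i\<close> holds the means over the cells of level \<open>b - i\<close>;
    the Haar coefficients are half differences of neighbouring means.\<close>
  define U where "U = rec_nat v (\<lambda>_ u K. (u (2 * K) + u (2 * K + 1)) / 2)"
  have U: "U 0 = v" "U (Suc i) K = (U i (2 * K) + U i (2 * K + 1)) / 2" for i K by (simp_all add: U_def)
  have Uz: "U i K = 0" if "2 ^ (b - i) \<le> K" "i \<le> b" for i K
    using that
  proof (induction i arbitrary: K)
    case 0 then show ?case by (simp add: U v_def)
  next
    case (Suc i)
    then have "b - i = Suc (b - Suc i)" by simp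
    then have "2 ^ (b - i) \<le> 2 * K" using Suc.prems(1) by simp
    then show ?case using Suc.IH[of "2 * K"] Suc.IH[of "2 * K + 1"] Suc.prems(2) by (simp add: U)
  qed
  define y where "y j p = (if j = 0 then U b p else if j \<le> b then (U (b - j) (2 * p) - U (b - j) (2 * p + 1)) / 2 else 0)" for j p
  have W: "Wt y n K = U (b - n) K" if "n \<le> b" for n K
    using that
  proof (induction n arbitrary: K)
    case 0 then show ?case by (simp add: y_def)
  next
    case (Suc n)
    have b: "b - n = Suc (b - Suc n)" using Suc.prems by simp
    have w1: "Wt y n (K div 2) = (U (b - Suc n) (2 * (K div 2)) + U (b - Suc n) (2 * (K div 2) + 1)) / 2"
      using Suc b by (simp add: U)
    have w2: "y (Suc n) (K div 2) = (U (b - Suc n) (2 * (K div 2)) - U (b - Suc n) (2 * (K div 2) + 1)) / 2"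
      using Suc.prems by (simp add: y_def)
    have h: "\<And>p q :: complex. (p + q) / 2 + (p - q) / 2 = p" "\<And>p q :: complex. (p + q) / 2 + - ((p - q) / 2) = q"
      by (simp_all add: field_simps)
    show ?case
    proof (cases "even K")
      case True
      then have k: "2 * (K div 2) = K" by simp
      show ?thesis by (simp only: Wt.simps True if_True w1 w2 h k)
    next
      case False
      then have k: "2 * (K div 2) + 1 = K" by (rule odd_two_times_div_two_succ)
      show ?thesis by (simp only: Wt.simps False if_False w1 w2 h k)
    qed
  qed
  have "y \<in> fst (tree_block b)"
  proof -
    have "y j p = 0" if "\<not> (j \<le> b \<and> p < 2 ^ (j - 1))" for j p
    proof (cases "j = 0 \<or> b < j")
      case True then show ?thesis using that Uz[of b p] by (auto simp: y_def)
    next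
      case False
      then obtain i where "j = Suc i" by (cases j) auto
      then have "2 ^ (b - (b - j)) \<le> 2 * p" using that False by simp
      then show ?thesis using Uz[of "b - j" "2 * p"] Uz[of "b - j" "2 * p + 1"] False by (simp add: y_def)
    qed
    then show ?thesis by (simp add: tree_block_def)
  qed
  moreover have "f = fstep b y"
  proof -
    have "f x = (\<Sum>k<2^b. v k * indicator (dyad_int b k) x)" for x unfolding f v_def by simp
    moreover have "Wt y b K = v K" for K using W[of b K] U(1) by simp
    moreover have "v k = 0" if "2 ^ b \<le> k" for k using that by (simp add: v_def)
    ultimately show ?thesis using step_sum[of b v] by (intro ext) (simp only: fstep_def)
  qed
  ultimately show ?thesis by blast
qed

lemma measure_dyad_int: "dyad_int n K \<in> sets lborel" "emeasure lborel (dyad_int n K) = ennreal (1 / 2 ^ n)" "measure lborel (dyad_int n K) = 1 / 2 ^ n"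
proof -
  have "(real K + 1) / 2 ^ n - real K / 2 ^ n = 1 / 2 ^ n" by (simp flip: diff_divide_distrib)
  moreover have "real K / 2 ^ n \<le> (real K + 1) / 2 ^ n" by (intro divide_right_mono) auto
  ultimately show "emeasure lborel (dyad_int n K) = ennreal (1 / 2 ^ n)" "measure lborel (dyad_int n K) = 1 / 2 ^ n"
    unfolding dyad_int_def by simp_all
qed (simp add: dyad_int_def)

text \<open>From level \<open>b\<close> on the function is constant on cells. Coarser levels follow
  downwards: a cell is the union of two children, and their Haar terms cancel.\<close>

lemma fstep_integral:
  assumes y: "y \<in> fst (tree_block b)"
  shows "set_integrable lborel (dyad_int n K) (fstep b y) \<and> (LINT x:dyad_int n K|lborel. fstep b y x) = Wt y n K / 2 ^ n"
proof -
  have big: "set_integrable lborel (dyad_int n K) (fstep b y) \<and> (LINT x:dyad_int n K|lborel. fstep b y x) = Wt y n K / 2 ^ n" if "b \<le> n" for n K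
  proof -
    define d where "d = n - b"
    have d: "n = b + d" using that by (simp add: d_def)
    have e: "indicator (dyad_int n K) x *\<^sub>R fstep b y x = indicator (dyad_int n K) x *\<^sub>R Wt y n K" for x
    proof (cases "x \<in> dyad_int n K")
      case True
      then have x: "0 \<le> x" "dcell n x = K" using dyad_int_nonneg dcell_iff by blast+
      have "dcell b x = K div 2 ^ d" using dcell_div[of b d x] x by (simp add: d)
      then show ?thesis using Wt_const[OF y, of d K] x by (simp add: d fstep_def)
    qed simp
    have "emeasure lborel (dyad_int n K) < \<infinity>" by (simp add: measure_dyad_int)
    then have ii: "integrable lborel (indicator (dyad_int n K) :: real \<Rightarrow> real)"
      by (rule integrable_real_indicator[OF measure_dyad_int(1)])
    have "(LINT x|lborel. indicator (dyad_int n K) x *\<^sub>R Wt y n K) = (LINT x|lborel. indicator (dyad_int n K) x) *\<^sub>R Wt y n K"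
      using ii by (rule integral_scaleR_left)
    also have "\<dots> = Wt y n K / 2 ^ n" using measure_dyad_int(3)[of n K] by (simp add: scaleR_conv_of_real)
    finally show ?thesis unfolding set_integrable_def set_lebesgue_integral_def e
      using integrable_scaleR_left[OF ii] by blast
  qed
  show ?thesis
  proof (cases "b \<le> n")
    case False
    then have "n \<le> b" by simp
    then show ?thesis
    proof (induction n arbitrary: K rule: inc_induct)
      case base then show ?case using big by simp
    next
      case (step n)
      have u: "dyad_int n K = dyad_int (Suc n) (2 * K) \<union> dyad_int (Suc n) (2 * K + 1)"
        by (auto simp: dyad_int_def field_simps)
      have i: "dyad_int (Suc n) (2 * K) \<inter> dyad_int (Suc n) (2 * K + 1) = {}"
        by (auto simp: dyad_int_def field_simps)
      note IH = step.IH[of "2 * K"] step.IH[of "2 * K + 1"]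
      have "set_integrable lborel (dyad_int n K) (fstep b y)"
        unfolding u using IH measure_dyad_int by (intro set_integrable_Un) auto
      moreover have "(LINT x:dyad_int n K|lborel. fstep b y x) = Wt y (Suc n) (2 * K) / 2 ^ Suc n + Wt y (Suc n) (2 * K + 1) / 2 ^ Suc n"
        unfolding u using IH i by (subst set_integral_Un) auto
      ultimately show ?case by (simp add: field_simps)
    qed
  qed (rule big)
qed

lemma dyad_E_fstep: "y \<in> fst (tree_block b) \<Longrightarrow> dyad_E n (fstep b y) x = Wt y n (dcell n x)"
  unfolding dyad_E_def dcell_def[symmetric] using fstep_integral[of y b n "dcell n x"] by simp

definition dtree :: "vec \<Rightarrow> real \<Rightarrow> nat \<Rightarrow> complex" where
  "dtree y x j = (if j \<noteq> 0 \<and> odd (dcell j x) then - y j (dcell (j - 1) x) else y j (dcell (j - 1) x))"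

lemma iota_fstep:
  assumes "y \<in> fst (tree_block b)"
  shows "iota (fstep b y) = dtree y"
proof -
  have "dyad_Delta j (fstep b y) x = dtree y x j" for x j
    by (cases j) (simp_all add: dyad_E_fstep[OF assms] dtree_def dcell_Suc)
  then show ?thesis by (simp add: fun_eq_iff iota_def)
qed

lemma dtree_inj:
  assumes "y \<in> fst (tree_block b)" "y' \<in> fst (tree_block b)" "dtree y = dtree y'"
  shows "y = y'"
proof (intro ext)
  fix j p
  show "y j p = y' j p"
  proof (cases "j = 0")
    case True
    then show ?thesis using fun_cong[OF fun_cong[OF assms(3), of "real p"], of 0] by (simp add: dtree_def dcell_def)
  next
    case False
    then obtain i where j: "j = Suc i" by (cases j) auto
    have "dcell i (real p / 2 ^ i) = p" "dcell (Suc i) (real p / 2 ^ i) = 2 * p"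
    proof -
      have "2 ^ Suc i * (real p / 2 ^ i) = of_int (int (2 * p))" by simp
      then show "dcell (Suc i) (real p / 2 ^ i) = 2 * p" unfolding dcell_def by (simp only: floor_of_int nat_int)
      show "dcell i (real p / 2 ^ i) = p" by (simp add: dcell_def)
    qed
    then show ?thesis using fun_cong[OF fun_cong[OF assms(3), of "real p / 2 ^ i"], of j] by (simp add: dtree_def j)
  qed
qed

lemma l2_sq_dtree:
  assumes "y \<in> fst (tree_block b)"
  shows "l2_sq (dtree y x) = ennreal ((sqrt (tsq b y (dcell b x)))\<^sup>2)"
proof -
  have a: "anc b j (dcell b x) = dcell (j - 1) x" if "j \<le> b" for j
    using dcell_div[of "j - 1" "b - (j - 1)" x] that by (simp add: anc_def)
  have "l2_sq (dtree y x) = (\<Sum>j. ennreal ((cmod (y j (dcell (j - 1) x)))\<^sup>2))"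
    unfolding l2_sq_def by (intro suminf_cong) (auto simp: dtree_def)
  also have "\<dots> = (\<Sum>j\<le>b. ennreal ((cmod (y j (dcell (j - 1) x)))\<^sup>2))"
    using assms by (intro suminf_finite) (auto simp: tree_block_def)
  also have "\<dots> = ennreal (tsq b y (dcell b x))" unfolding tsq_def using a by (simp add: sum_ennreal)
  finally show ?thesis by simp
qed

lemma prob_unit: "prob_space unit_measure"
  unfolding unit_measure_def by (rule prob_space_uniform_measure) auto

lemma sets_unit: "sets unit_measure = sets borel"
  by (simp add: unit_measure_def)

lemma dcell_measurable: "(\<lambda>x. g (dcell b x) :: real) \<in> borel_measurable borel"
proof -
  have "dcell b \<in> borel \<rightarrow>\<^sub>M count_space UNIV" unfolding dcell_def[abs_def] by measurable
  then show ?thesis by measurable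
qed

lemma unit_dyadic_mean:
  assumes g: "\<And>k. 0 \<le> g k"
  shows "(\<integral>\<^sup>+ x. ennreal (g (dcell b x)) \<partial>unit_measure) = ennreal ((\<Sum>k<2^b. g k) / 2^b)"
proof -
  have m: "(\<lambda>x. ennreal (g (dcell b x))) \<in> borel_measurable lborel" using dcell_measurable[of g b] by simp
  have "(\<integral>\<^sup>+ x. ennreal (g (dcell b x)) \<partial>unit_measure) = (\<integral>\<^sup>+ x. ennreal (g (dcell b x)) * indicator {0..1} x \<partial>lborel)"
    unfolding unit_measure_def by (subst nn_integral_uniform_measure[OF m]) (auto simp: divide_ennreal_def)
  also have "\<dots> = (\<integral>\<^sup>+ x. (\<Sum>k<2^b. ennreal (g k) * indicator (dyad_int b k) x) \<partial>lborel)"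
  proof (rule nn_integral_cong_AE)
    \<comment> \<open>The point 1 lies in the unit interval but in none of the half-open
      cells.\<close>
    have "AE x in lborel. x \<noteq> (1::real)" by (rule AE_lborel_singleton)
    then show "AE x in lborel. ennreal (g (dcell b x)) * indicator {0..1} x = (\<Sum>k<2^b. ennreal (g k) * indicator (dyad_int b k) x)"
    proof (eventually_elim)
      fix x :: real assume x1: "x \<noteq> 1"
      show "ennreal (g (dcell b x)) * indicator {0..1} x = (\<Sum>k<2^b. ennreal (g k) * indicator (dyad_int b k) x)"
      proof (cases "0 \<le> x")
        case True
        have "(\<Sum>k<2^b. ennreal (g k) * indicator (dyad_int b k) x) = (\<Sum>k<2^b. if dcell b x = k then ennreal (g k) else 0)"
          using dcell_iff[OF True, of b] by (intro sum.cong) (auto simp: indicator_def)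
        also have "\<dots> = (if dcell b x < 2 ^ b then ennreal (g (dcell b x)) else 0)" by (simp add: sum.delta)
        also have "dcell b x < 2 ^ b \<longleftrightarrow> x \<in> {0..1}"
        proof -
          have "dcell b x < 2 ^ b \<longleftrightarrow> \<lfloor>2 ^ b * x\<rfloor> < 2 ^ b" unfolding dcell_def using True by (simp add: nat_less_iff)
          also have "\<dots> \<longleftrightarrow> 2 ^ b * x < 2 ^ b" by (simp add: floor_less_iff)
          also have "\<dots> \<longleftrightarrow> x < 1" by simp
          finally show ?thesis using True x1 by auto
        qed
        finally show ?thesis by (simp add: indicator_def)
      next
        case False
        then have "x \<notin> dyad_int b k" for k using dyad_int_nonneg by blast
        then show ?thesis using False by simp
      qed
    qed
  qed
  also have "\<dots> = (\<Sum>k<2^b. ennreal (g k) * ennreal (1 / 2 ^ b))"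
    using measure_dyad_int(1)[of b] by (subst nn_integral_sum) (auto simp: nn_integral_cmult_indicator measure_dyad_int(2))
  also have "\<dots> = (\<Sum>k<2^b. ennreal (g k * (1 / 2 ^ b)))" using g by (intro sum.cong refl ennreal_mult[symmetric]) auto
  also have "\<dots> = ennreal ((\<Sum>k<2^b. g k) / 2^b)" using g by (simp add: sum_ennreal sum_divide_distrib)
  finally show ?thesis .
qed

section \<open>Identification of the modular sums with the spaces of the theorem\<close>

lemma tree_modular:
  assumes "\<And>n. y n \<in> fst (tree_block (b n))"
  shows "ind_mod unit_measure (\<lambda>n x. sqrt (tsq (b n) (y n) (dcell (b n) x))) = msum (\<lambda>n. tree_block (b n)) y"
    "norm_dyad (\<lambda>n. dtree (y n)) = ind_int unit_measure (\<lambda>n x. sqrt (tsq (b n) (y n) (dcell (b n) x)))"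
proof -
  show "ind_mod unit_measure (\<lambda>n x. sqrt (tsq (b n) (y n) (dcell (b n) x))) = msum (\<lambda>n. tree_block (b n)) y"
    unfolding ind_mod_def msum_def nn_integral_count_space_nat
    using unit_dyadic_mean[of "\<lambda>k. phi (sqrt (tsq (b _) (y _) k))"] by (simp add: tree_block_def tmod_def)
  show "norm_dyad (\<lambda>n. dtree (y n)) = ind_int unit_measure (\<lambda>n x. sqrt (tsq (b n) (y n) (dcell (b n) x)))"
    unfolding norm_dyad_def ind_norm_def ind_int_def l2_sq_dtree[OF assms] ..
qed

lemma tsq_vsc: "sqrt (tsq m (vsc (of_real r) y) n) = \<bar>r\<bar> * sqrt (tsq m y n)"
proof -
  have "tsq m (vsc (of_real r) y) n = r\<^sup>2 * tsq m y n"
    unfolding tsq_def vsc_def sum_distrib_left by (simp add: norm_mult power_mult_distrib)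
  then show ?thesis by (simp add: real_sqrt_mult)
qed

lemma tree_finite: "(\<integral>\<^sup>+ x. ennreal (phi (c * sqrt (tsq b y (dcell b x)))) \<partial>unit_measure) < \<infinity>"
  using unit_dyadic_mean[of "\<lambda>k. phi (c * sqrt (tsq b y k))" b] by simp

lemma trig_modular:
  "ind_mod tor (\<lambda>n t. cmod (tpoly (a n) (v n) t)) = msum (\<lambda>n. trig_block (a n)) v"
  "norm_trig (\<lambda>n. tpoly (a n) (v n)) = ind_int tor (\<lambda>n t. cmod (tpoly (a n) (v n) t))"
  unfolding ind_mod_def msum_def nn_integral_count_space_nat norm_trig_def ind_norm_def ind_int_def
  by (simp_all add: trig_block_def pmod_def)

lemma tpoly_lin: "tpoly a (v + w) t = tpoly a v t + tpoly a w t" "tpoly a (vsc c v) t = c * tpoly a v t"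
  by (simp_all add: tpoly_def vsc_def distrib_right sum.distrib sum_distrib_left mult.assoc)

lemma trig_finite: "(\<integral>\<^sup>+ t. ennreal (phi (c * cmod (tpoly a v t))) \<partial>tor) < \<infinity>"
proof -
  have "pmod a (vsc (of_real c) v) < \<infinity>" unfolding pmod_LINT by simp
  moreover have "phi (cmod (cplx c * z)) = phi (c * cmod z)" for z
    using phi_abs[of "c * cmod z"] by (simp add: norm_mult abs_mult)
  ultimately show ?thesis unfolding pmod_def tpoly_lin by simp
qed

lemma trig_poly_iff: "trig_poly a f \<longleftrightarrow> (\<exists>v\<in>fst (trig_block a). f = tpoly a v)"
proof -
  have e: "exp (\<i> * of_nat j * of_real t) = cis (real j * t)" for j t by (simp add: cis_conv_exp mult.assoc)
  show ?thesis
  proof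
    assume "trig_poly a f"
    then obtain c where c: "f = (\<lambda>t. \<Sum>j\<le>a. c j * cis (real j * t))" unfolding trig_poly_def e by blast
    define v where "v i j = (if i = (0::nat) \<and> j \<le> a then c j else 0)" for i j
    have "v \<in> fst (trig_block a)" by (simp add: v_def trig_block_def)
    moreover have "f = tpoly a v" unfolding c tpoly_def[abs_def] v_def by simp
    ultimately show "\<exists>v\<in>fst (trig_block a). f = tpoly a v" by blast
  next
    assume "\<exists>v\<in>fst (trig_block a). f = tpoly a v"
    then show "trig_poly a f" unfolding trig_poly_def e tpoly_def[abs_def] by blast
  qed
qed

lemma tpoly_inj:
  assumes "v \<in> fst (trig_block a)" "w \<in> fst (trig_block a)" "tpoly a v = tpoly a w"
  shows "v = w"
proof (intro ext)
  fix i j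
  show "v i j = w i j"
  proof (cases "i = 0 \<and> j \<le> a")
    case True then show ?thesis using tpoly_coeff[of j a v] tpoly_coeff[of j a w] assms(3) by simp
  next
    case False then show ?thesis using assms(1,2) by (auto simp: trig_block_def)
  qed
qed

text \<open>Norm and modular are finite for the same sequences by \<open>ind_int_finite_iff\<close>,
  so the coefficient map is onto the whole independent sum.\<close>

lemma trig_bij: "bij_betw (\<lambda>v n. tpoly (a n) (v n)) (msp (\<lambda>n. trig_block (a n))) (ind_trig a)"
proof (rule bij_betw_imageI)
  show "inj_on (\<lambda>v n. tpoly (a n) (v n)) (msp (\<lambda>n. trig_block (a n)))"
  proof (rule inj_onI)
    fix v w assume h: "v \<in> msp (\<lambda>n. trig_block (a n))" "w \<in> msp (\<lambda>n. trig_block (a n))" "(\<lambda>n. tpoly (a n) (v n)) = (\<lambda>n. tpoly (a n) (w n))"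
    have "v n = w n" for n using tpoly_inj[of "v n" "a n" "w n"] h(1,2) fun_cong[OF h(3), of n] by (simp add: msp_def)
    then show "v = w" by blast
  qed
  have fin: "norm_trig (\<lambda>n. tpoly (a n) (v n)) < \<infinity> \<longleftrightarrow> msum (\<lambda>n. trig_block (a n)) v < \<infinity>" for v
    unfolding trig_modular(1)[symmetric] trig_modular(2)
    by (rule torus.ind_int_finite_iff) (auto simp: trig_finite[simplified] measurable_cong_sets[OF sets_torus refl])
  show "(\<lambda>v n. tpoly (a n) (v n)) ` msp (\<lambda>n. trig_block (a n)) = ind_trig a"
  proof (intro equalityI subsetI)
    fix F assume "F \<in> (\<lambda>v n. tpoly (a n) (v n)) ` msp (\<lambda>n. trig_block (a n))"
    then obtain v where v: "v \<in> msp (\<lambda>n. trig_block (a n))" "F = (\<lambda>n. tpoly (a n) (v n))" by blast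
    then have "norm_trig F < \<infinity>" using fin[of v] by (simp add: msp_def)
    moreover have "trig_poly (a n) (F n)" for n unfolding trig_poly_iff using v by (auto simp: msp_def)
    ultimately show "F \<in> ind_trig a" by (simp add: ind_trig_def norm_trig_def)
  next
    fix F assume F: "F \<in> ind_trig a"
    then have "\<forall>n. \<exists>v. v \<in> fst (trig_block (a n)) \<and> F n = tpoly (a n) v" unfolding ind_trig_def trig_poly_iff by blast
    then obtain v where v: "\<And>n. v n \<in> fst (trig_block (a n))" "\<And>n. F n = tpoly (a n) (v n)" by metis
    then have Fv: "F = (\<lambda>n. tpoly (a n) (v n))" by blast
    have "norm_trig F < \<infinity>" using F by (simp add: ind_trig_def norm_trig_def)
    then have "v \<in> msp (\<lambda>n. trig_block (a n))" using fin[of v] v(1) Fv by (simp add: msp_def)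
    then show "F \<in> (\<lambda>v n. tpoly (a n) (v n)) ` msp (\<lambda>n. trig_block (a n))" using Fv by blast
  qed
qed

lemma dyad_bij: "bij_betw (\<lambda>y n. dtree (y n)) (msp (\<lambda>n. tree_block (b n))) (ind_dyad b)"
proof (rule bij_betw_imageI)
  interpret U: prob_space unit_measure by (rule prob_unit)
  show "inj_on (\<lambda>y n. dtree (y n)) (msp (\<lambda>n. tree_block (b n)))"
  proof (rule inj_onI)
    fix y z assume h: "y \<in> msp (\<lambda>n. tree_block (b n))" "z \<in> msp (\<lambda>n. tree_block (b n))" "(\<lambda>n. dtree (y n)) = (\<lambda>n. dtree (z n))"
    have "y n = z n" for n using dtree_inj[of "y n" "b n" "z n"] h(1,2) fun_cong[OF h(3), of n] by (simp add: msp_def)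
    then show "y = z" by blast
  qed
  have fin: "norm_dyad (\<lambda>n. dtree (y n)) < \<infinity> \<longleftrightarrow> msum (\<lambda>n. tree_block (b n)) y < \<infinity>" if "\<And>n. y n \<in> fst (tree_block (b n))" for y
    unfolding tree_modular(1)[OF that, symmetric] tree_modular(2)[OF that]
    by (rule U.ind_int_finite_iff) (auto simp: tree_finite[simplified] measurable_cong_sets[OF sets_unit refl] intro: dcell_measurable[of "\<lambda>k. sqrt (tsq _ _ k)"])
  show "(\<lambda>y n. dtree (y n)) ` msp (\<lambda>n. tree_block (b n)) = ind_dyad b"
  proof (intro equalityI subsetI)
    fix F assume "F \<in> (\<lambda>y n. dtree (y n)) ` msp (\<lambda>n. tree_block (b n))"
    then obtain y where y: "y \<in> msp (\<lambda>n. tree_block (b n))" "F = (\<lambda>n. dtree (y n))" by blast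
    then have yn: "y n \<in> fst (tree_block (b n))" for n by (simp add: msp_def)
    have "norm_dyad F < \<infinity>" using fin[OF yn] y by (simp add: msp_def)
    moreover have "\<exists>f. dyadic_step (b n) f \<and> F n = iota f" for n
      using fstep_dyadic[OF yn, of n] iota_fstep[OF yn, of n] y(2) by auto
    ultimately show "F \<in> ind_dyad b" by (simp add: ind_dyad_def norm_dyad_def)
  next
    fix F assume F: "F \<in> ind_dyad b"
    have "\<exists>y. y \<in> fst (tree_block (b n)) \<and> F n = dtree y" for n
    proof -
      obtain f where f: "dyadic_step (b n) f" "F n = iota f" using F unfolding ind_dyad_def by blast
      then show ?thesis using dyadic_fstep[OF f(1)] iota_fstep by auto
    qed
    then obtain y where y: "\<And>n. y n \<in> fst (tree_block (b n))" "\<And>n. F n = dtree (y n)" by metis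
    then have Fy: "F = (\<lambda>n. dtree (y n))" by blast
    have "norm_dyad F < \<infinity>" using F by (simp add: ind_dyad_def norm_dyad_def)
    then have "y \<in> msp (\<lambda>n. tree_block (b n))" using fin[OF y(1)] y(1) Fy by (simp add: msp_def)
    then show "F \<in> (\<lambda>y n. dtree (y n)) ` msp (\<lambda>n. tree_block (b n))" using Fy by blast
  qed
qed

lemma dtree_lin: "dtree (y + z) x j = dtree y x j + dtree z x j" "dtree (vsc c y) x j = c * dtree y x j"
  by (simp_all add: dtree_def vsc_def)

theorem theorem5p12:
  fixes a b :: "nat \<Rightarrow> nat"
  assumes "\<forall>n. a n > 0" and "\<forall>n. b n > 0"
    and "limsup (\<lambda>n. ereal (real (a n))) = \<infinity>"
    and "limsup (\<lambda>n. ereal (real (b n))) = \<infinity>"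
  shows "ind_isomorphic (ind_trig a) norm_trig (ind_dyad b) norm_dyad"
proof -
  let ?X = "\<lambda>n. trig_block (a n)" and ?Y = "\<lambda>n. tree_block (b n)"
  let ?P = "\<lambda>v n. tpoly (a n) (v n)" and ?Q = "\<lambda>y n. dtree (y n)"
  have "fiso ?X ?Y" using assms by (intro fiso_trig_tree) auto
  then obtain S C0 where bij: "bij_betw S (msp ?X) (msp ?Y)"
    and add: "\<And>F G. F \<in> msp ?X \<Longrightarrow> G \<in> msp ?X \<Longrightarrow> S (F + G) = S F + S G"
    and scale: "\<And>F c. F \<in> msp ?X \<Longrightarrow> S (\<lambda>i. vsc c (F i)) = (\<lambda>j. vsc c (S F j))"
    and bnd0: "C0 > 0" "\<And>F. F \<in> msp ?X \<Longrightarrow> msum ?Y (S F) \<le> ennreal C0 * msum ?X F \<and> msum ?X F \<le> ennreal C0 * msum ?Y (S F)"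
    unfolding fiso_def by blast
  \<comment> \<open>\<open>ind_int_transfer\<close> requires a constant of at least 1.\<close>
  define C where "C = max 1 C0"
  have C: "1 \<le> C" "C0 \<le> C" by (simp_all add: C_def)
  have bnd: "msum ?Y (S F) \<le> ennreal C * msum ?X F" "msum ?X F \<le> ennreal C * msum ?Y (S F)" if "F \<in> msp ?X" for F
    using bnd0(2)[OF that] mult_right_mono[OF ennreal_leI[OF C(2)], of "msum ?X F"] mult_right_mono[OF ennreal_leI[OF C(2)], of "msum ?Y (S F)"]
    by (auto intro: order_trans)
  define R where "R = inv_into (msp ?X) ?P"
  have RB: "bij_betw R (ind_trig a) (msp ?X)" unfolding R_def by (rule bij_betw_inv_into[OF trig_bij])
  have PR: "?P (R F) = F" if "F \<in> ind_trig a" for F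
    unfolding R_def using f_inv_into_f[of F ?P "msp ?X"] that trig_bij[of a] by (auto simp: bij_betw_def)
  have RP: "R (?P v) = v" if "v \<in> msp ?X" for v
    unfolding R_def using inv_into_f_f[of ?P "msp ?X" v] that trig_bij[of a] by (auto simp: bij_betw_def)
  have Rin: "R F \<in> msp ?X" if "F \<in> ind_trig a" for F using RB that by (auto simp: bij_betw_def)
  have Sin: "S v \<in> msp ?Y" if "v \<in> msp ?X" for v using bij that by (auto simp: bij_betw_def)
  define T where "T F = ?Q (S (R F))" for F
  have "bij_betw T (ind_trig a) (ind_dyad b)"
    using bij_betw_trans[OF bij_betw_trans[OF RB bij] dyad_bij] unfolding T_def comp_def by simp
  moreover have "T (\<lambda>n t. F n t + G n t) = (\<lambda>n x k. T F n x k + T G n x k)" if F: "F \<in> ind_trig a" and G: "G \<in> ind_trig a" for F G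
  proof -
    have "(\<lambda>n t. F n t + G n t) = ?P (R F + R G)"
      using fun_cong[OF fun_cong[OF PR[OF F]]] fun_cong[OF fun_cong[OF PR[OF G]]] by (simp add: fun_eq_iff tpoly_lin)
    then have "R (\<lambda>n t. F n t + G n t) = R F + R G"
      using RP[OF msp_add[of ?X "R F" "R G"]] Rin[OF F] Rin[OF G] good_trig_block by simp
    then have "S (R (\<lambda>n t. F n t + G n t)) = S (R F) + S (R G)" by (simp only: add[OF Rin[OF F] Rin[OF G]])
    then show ?thesis unfolding T_def by (intro ext) (simp only: plus_fun_apply[of "S (R F)"] dtree_lin)
  qed
  moreover have "T (\<lambda>n t. c * F n t) = (\<lambda>n x k. c * T F n x k)" if F: "F \<in> ind_trig a" for F c
  proof -
    have "(\<lambda>n t. c * F n t) = ?P (\<lambda>n. vsc c (R F n))"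
      using fun_cong[OF fun_cong[OF PR[OF F]]] by (simp add: fun_eq_iff tpoly_lin)
    then have "R (\<lambda>n t. c * F n t) = (\<lambda>n. vsc c (R F n))"
      using RP[OF msp_scale[of ?X "R F" c]] Rin[OF F] good_trig_block by simp
    then have "S (R (\<lambda>n t. c * F n t)) = (\<lambda>n. vsc c (S (R F) n))" by (simp only: scale[OF Rin[OF F]])
    then show ?thesis unfolding T_def by (intro ext) (simp only: dtree_lin)
  qed
  moreover have "norm_dyad (T F) \<le> ennreal (4 * C) * norm_trig F \<and> norm_trig F \<le> ennreal (4 * C) * norm_dyad (T F)" if F: "F \<in> ind_trig a" for F
  proof -
    define v where "v = R F"
    define y where "y = S v"
    have v: "v \<in> msp ?X" unfolding v_def by (rule Rin[OF F])
    have y: "y \<in> msp ?Y" unfolding y_def by (rule Sin[OF v])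
    have yn: "y n \<in> fst (tree_block (b n))" for n using y by (simp add: msp_def)
    let ?h = "\<lambda>n t. cmod (tpoly (a n) (v n) t)" and ?g = "\<lambda>n x. sqrt (tsq (b n) (y n) (dcell (b n) x))"
    \<comment> \<open>The comparison at scale \<open>r\<close> is the comparison at scale 1 for the
      scaled vector, because \<open>S\<close> is linear.\<close>
    have vr: "(\<lambda>n. vsc (of_real r) (v n)) \<in> msp ?X" for r by (rule msp_scale[OF good_trig_block v])
    have hr: "ind_mod tor (\<lambda>n t. r * ?h n t) = msum ?X (\<lambda>n. vsc (of_real r) (v n))"
      and gr: "ind_mod unit_measure (\<lambda>n x. r * ?g n x) = msum ?Y (S (\<lambda>n. vsc (of_real r) (v n)))" if r: "0 < r" for r
    proof -
      show "ind_mod tor (\<lambda>n t. r * ?h n t) = msum ?X (\<lambda>n. vsc (of_real r) (v n))"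
        unfolding trig_modular(1)[symmetric] tpoly_lin norm_mult using r by simp
      have "vsc (of_real r) (y n) \<in> fst (tree_block (b n))" for n by (rule good_blockD(3)[OF good_tree_block yn])
      then show "ind_mod unit_measure (\<lambda>n x. r * ?g n x) = msum ?Y (S (\<lambda>n. vsc (of_real r) (v n)))"
        unfolding scale[OF v] y_def[symmetric] using r by (subst tree_modular(1)[symmetric]) (simp_all add: tsq_vsc)
    qed
    have mh: "?h n \<in> borel_measurable tor" and mg: "?g n \<in> borel_measurable unit_measure" for n
      using dcell_measurable[of "\<lambda>k. sqrt (tsq (b n) (y n) k)" "b n"]
      by (simp_all add: measurable_cong_sets[OF sets_torus refl] measurable_cong_sets[OF sets_unit refl])
    have "ind_int unit_measure ?g \<le> ennreal (4 * C) * ind_int tor ?h"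
      using bnd(1)[OF vr] by (intro ind_int_transfer prob_unit prob_space_torus mh mg trig_finite C(1)) (simp add: hr gr)
    moreover have "ind_int tor ?h \<le> ennreal (4 * C) * ind_int unit_measure ?g"
      using bnd(2)[OF vr] by (intro ind_int_transfer prob_unit prob_space_torus mh mg tree_finite C(1)) (simp add: hr gr)
    moreover have "T F = ?Q y" "F = ?P v" unfolding T_def y_def v_def using PR[OF F] by simp_all
    ultimately show ?thesis using trig_modular(2)[of a v] tree_modular(2)[OF yn] by simp
  qed
  moreover have "0 < 4 * C" using C(1) by simp
  ultimately show ?thesis unfolding ind_isomorphic_def by blast
qed

end
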